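(* Let $z_j^{(2n)}\in\mathbb{C}$, $n>0$, $j=0,\ldots,2n$, be a family of (not necessarily distinct) interpolation points such that, for some constants $0<\alpha\le1$ and $c>0$ independent of $n$, $\max_{0\le j\le 2n}|z_j^{(2n)}|\le c\,n^{1-\alpha}$ for all $n\in\mathbb{N}$. For each $n$ let $p_n,q_n$ be polynomials, not both identically zero, with $\deg p_n\le n$, $\deg q_n\le n$ and $$p_n(z)e^{-z/2}+q_n(z)e^{z/2}=\mathcal{O}\Big(\prod_{i=0}^{2n}(z-z_i^{(2n)})\Big),\qquad z\to z_j^{(2n)},\quad j=0,\ldots,2n,$$ and let $P_n(z)=p_n(2nz)$, $Q_n(z)=q_n(2nz)$. Then, as $n\to\infty$, $$\nu_{P_n}\stackrel{*}{\to}\mu_P,\qquad \nu_{Q_n}\stackrel{*}{\to}\mu_Q,$$ where the convergence is in the sense of weak-$^*$ convergence of measures, $\nu_{P_n},\nu_{Q_n}$ are the normalized zero counting measures, and $\mu_P,\mu_Q$ are the measures on the curves $\gamma_1,\gamma_2$ defined in the context.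
   Context: The interpolation condition means that $p_n(z)e^{-z/2}+q_n(z)e^{z/2}$ vanishes at each interpolation point at least to the order with which that point occurs in the list. For a polynomial $p$ of degree $n$, $\nu_p=\frac1n\sum_{p(z)=0}\delta_z$, zeros counted with multiplicity. Curves. Consider critical trajectories of the quadratic differential $(z^2+1)z^{-2}dz^2$ emanating from $i$, defined by the condition $$\mathrm{Re}\int_i^z\frac{(\sqrt{s^2+1})_+}{s}\,ds=0,$$ where the integral is taken along the trajectory itself, the square root has a branch cut along the path of integration and behaves like $z$ at infinity, and $(\cdot)_+$ is the $+$ boundary value on the path. (Equivalently, $\mathrm{Re}\,\eta(z)=0$ with $\eta(z)=\sqrt{z^2+1}+\log\frac{z}{1+\sqrt{z^2+1}}$.) There are four such critical trajectories: $\gamma_1$ is the one connecting $i$ with $-i$ in the left half-plane; $\gamma_2$ is its mirror image with respect to the imaginary axis; the other two are the vertical half-lines $(i,i\infty)$ and $(-i,-i\infty)$. Measures. $\gamma_1$ is oriented from $i$ to $-i$, the $+$ side of an oriented curve is its left side, and $\sqrt{s^2+1}$ is analytic in $\mathbb{C}\setminus\gamma_1$ and behaves like $s$ at infinity. Then $$d\mu_P(s)=\frac{1}{i\pi}\frac{(\sqrt{s^2+1})_+}{s}\,ds\quad\text{on }\gamma_1,\qquad d\mu_Q(s)=\frac{1}{i\pi}\frac{(\sqrt{(-s)^2+1})_+}{s}\,ds\quad\text{on }\gamma_2,$$ where in the second formula the $+$ boundary value of the same square root is evaluated at the point $-s\in\gamma_1$, and $\gamma_2=-\gamma_1$ carries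 the orientation induced by $s\mapsto -s$ (so $\mu_Q$ is the image of $\mu_P$ under $s\mapsto -s$). Both are positive measures. *)

theory Defs
  imports "HOL-Complex_Analysis.Complex_Analysis" "HOL-Library.Landau_Symbols"
begin

text \<open>
  The branch of the square root of \<open>z\<^sup>2 + 1\<close> with cut \<open>\<Gamma>\<close>. If \<open>\<Gamma>\<close> is an arc joining
  \<open>\<i>\<close> and \<open>-\<i>\<close>, it exists and is unique outside \<open>\<Gamma>\<close>, whose complement is connected;
  its values on \<open>\<Gamma>\<close> are arbitrary and are never used.
\<close>
definition sqrt_branch :: "complex set \<Rightarrow> complex \<Rightarrow> complex" where
  "sqrt_branch \<Gamma> = (SOME R. R holomorphic_on (- \<Gamma>) \<and> (\<forall>z\<in>- \<Gamma>. (R z)\<^sup>2 = z\<^sup>2 + 1) \<and>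
     ((\<lambda>z. R z / z) \<longlongrightarrow> 1) at_infinity)"

text \<open>
  The boundary value at \<open>\<gamma> t\<close> from the left side of the oriented curve \<open>\<gamma>\<close>, taken along the
  left normal direction \<open>\<i> * \<gamma>' t\<close>.
\<close>
definition sqrt_plus :: "(real \<Rightarrow> complex) \<Rightarrow> real \<Rightarrow> complex" where
  "sqrt_plus \<gamma> t = Lim (at_right 0) (\<lambda>\<epsilon>::real.
     sqrt_branch (path_image \<gamma>) (\<gamma> t + of_real \<epsilon> * (\<i> * vector_derivative \<gamma> (at t))))"

text \<open>
  \<open>is_gamma1 \<gamma>\<close>: \<open>\<gamma>\<close> is a regular parametrization over \<open>[0,1]\<close> of the critical trajectory
  of \<open>(z\<^sup>2 + 1) z\<^sup>-\<^sup>2 dz\<^sup>2\<close> that runs from \<open>\<i>\<close> to \<open>-\<i>\<close> in the left half-plane.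
  Integrability is required explicitly because \<open>integral\<close> is \<open>0\<close> by convention otherwise.
\<close>
definition is_gamma1 :: "(real \<Rightarrow> complex) \<Rightarrow> bool" where
  "is_gamma1 \<gamma> \<longleftrightarrow>
     arc \<gamma> \<and> pathstart \<gamma> = \<i> \<and> pathfinish \<gamma> = - \<i> \<and>
     \<gamma> C1_differentiable_on {0<..<1} \<and>
     (\<forall>t\<in>{0<..<1}. vector_derivative \<gamma> (at t) \<noteq> 0 \<and> Re (\<gamma> t) < 0) \<and>
     (\<forall>t\<in>{0..1}.
        (\<lambda>u. sqrt_plus \<gamma> u / \<gamma> u * vector_derivative \<gamma> (at u)) integrable_on {0..t} \<and>
        Re (integral {0..t} (\<lambda>u. sqrt_plus \<gamma> u / \<gamma> u * vector_derivative \<gamma> (at u))) = 0)"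

text \<open>
  The measures on \<open>\<gamma>\<^sub>1\<close> and \<open>\<gamma>\<^sub>2 = -\<gamma>\<^sub>1\<close>, transported from the parameter interval. In the second
  one the boundary value is taken at \<open>-\<gamma>2 t = \<gamma> t\<close>.
  The differential is real and nonnegative along the curve, so \<open>Re\<close> and \<open>ennreal\<close> lose nothing.
\<close>
definition mu_P :: "(real \<Rightarrow> complex) \<Rightarrow> complex measure" where
  "mu_P \<gamma> = distr
     (density (restrict_space lborel {0<..<1})
        (\<lambda>t. ennreal (Re (1 / (\<i> * of_real pi) * (sqrt_plus \<gamma> t / \<gamma> t) * vector_derivative \<gamma> (at t)))))
     borel \<gamma>"

definition mu_Q :: "(real \<Rightarrow> complex) \<Rightarrow> complex measure" where
  "mu_Q \<gamma> = (let \<gamma>2 = (\<lambda>t. - \<gamma> t) in distr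
     (density (restrict_space lborel {0<..<1})
        (\<lambda>t. ennreal (Re (1 / (\<i> * of_real pi) * (sqrt_plus \<gamma> t / \<gamma>2 t) * vector_derivative \<gamma>2 (at t)))))
     borel \<gamma>2)"

text \<open>For constant polynomials, including \<open>0\<close>, this is the null measure.\<close>
definition zero_counting_measure :: "complex poly \<Rightarrow> complex measure" where
  "zero_counting_measure p = distr
     (point_measure {z. poly p z = 0} (\<lambda>z. ennreal (real (order z p) / real (degree p))))
     borel (\<lambda>z. z)"

text \<open>Finite measures on the plane as functionals on the continuous functions vanishing at infinity.\<close>
definition weak_star_conv :: "(nat \<Rightarrow> complex measure) \<Rightarrow> complex measure \<Rightarrow> bool" where
  "weak_star_conv M \<mu> \<longleftrightarrow>
     (\<forall>f :: complex \<Rightarrow> real. continuous_on UNIV f \<longrightarrow> (f \<longlongrightarrow> 0) at_infinity \<longrightarrow>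
        (\<lambda>n. integral\<^sup>L (M n) f) \<longlonglongrightarrow> integral\<^sup>L \<mu> f)"

end

theory Submission
  imports Defs "HOL-Real_Asymp.Real_Asymp" "HOL-Computational_Algebra.Fundamental_Theorem_Algebra"
begin

text \<open>
  After rescaling, \<open>w = z / (2 n)\<close>, the interpolation condition says that \<open>P w exp (- n w) / (\<Prod>j. w - a\<^sub>j)\<close>
  is, up to the same expression in \<open>Q\<close>, an entire function, and its Borel transform \<open>G\<close> is an entire function
  that vanishes to order \<open>n\<close> at \<open>\<plusminus>1\<close> and is annihilated by \<open>\<Prod>j. (D - n a\<^sub>j)\<close> with \<open>a\<^sub>j \<rightarrow> 0\<close>. Hence \<open>\<bar>G t\<bar>\<close> is at most
  \<open>N\<^sub>n \<bar>1 - t\<^sup>2\<bar>\<^sup>n\<close> up to subexponential factors, and this is attained near any large circle. Moving the Laplace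
  integral that recovers \<open>P\<close> from \<open>G\<close> through the critical points \<open>(1 \<plusminus> \<surd>(z\<^sup>2 + 1)) / z\<close> of \<open>(1 - t\<^sup>2) exp (- z t)\<close>
  gives an explicit upper bound for \<open>\<bar>P z\<bar> / N\<^sub>n\<close>, and the size of \<open>G\<close> on large circles shows that the bound is
  attained up to subexponential factors at some points near \<open>0\<close>.

  Off \<open>\<gamma>\<close> the \<open>n\<close>-th root of the upper bound is the modulus of the zero-free holomorphic function
  \<open>(1 + R) exp (z - R)\<close>, where \<open>R = \<surd>(z\<^sup>2 + 1)\<close> is cut along \<open>\<gamma>\<close>. A sequence that is subexponentially bounded on a
  connected open set and is not exponentially small near one point is not exponentially small near any point, so the
  upper bound is attained near every point. In the coordinate \<open>\<xi> = \<integral> \<surd>(z\<^sup>2 + 1) / z dz\<close>, which is univalent in the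
  left half-plane and maps \<open>\<gamma>\<close> to the segment from \<open>- \<i> \<pi> / 2\<close> to \<open>\<i> \<pi> / 2\<close> and \<open>\<mu>\<^sub>P\<close> to the length divided by
  \<open>\<pi>\<close>, the logarithm of the bound is \<open>n \<bar>Re \<xi>\<bar>\<close> plus a harmonic function. By Jensen's formula a disc of radius \<open>r\<close>
  centred on the segment then contains about \<open>2 r n / \<pi>\<close> zeros of \<open>P\<close>. Disjoint discs that nearly cover the segment
  contain nearly \<open>n\<close> zeros, which are all that \<open>P\<close> can have, and this gives the weak convergence. The statement on
  \<open>Q\<close> follows by the reflection \<open>z \<mapsto> - z\<close>.
\<close>

text \<open>The conditions fix neither a formula for \<open>P\<close> nor its size, so the size is
  read off from \<open>G\<close>: \<open>N n\<close> is the maximum modulus of G / (1 - t^2)^n on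
  the circle of radius \<open>\<rho> n\<close>. Being annihilated by 2n + 1 factors with small
  exponents, \<open>G\<close> grows at most like a polynomial of degree 2n, up to factors exp (n
  \<tau> \<bar>t\<bar>), and 2n is exactly the degree of (1 - t^2)^n. From a circle of radius r
  outwards the quotient therefore gains at most (1 + O(1 / r^2))^n, so that the upper and the lower
  bound for \<open>P\<close> refer to the same number \<open>N n\<close>. This asks for
  \<open>\<rho> n\<close> to tend to infinity while \<open>\<tau> n * \<rho> n\<close> tends to 0;
  with \<open>\<tau> n\<close> of order n^(-\<alpha>), the radius n^(\<alpha>/2) does both. Large
  circles control \<open>P\<close> from below only near 0, because there the critical point of
  larger modulus, about 2 / z, is far out. This is why the lower bound has to be propagated from 0.
  Zeros are counted from below only; the bound \<open>n\<close> on their total number supplies the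
  other half.\<close>

section \<open>Growth of solutions of linear differential equations\<close>

text \<open>\<open>d k j\<close> is the \<open>j\<close>-th Taylor coefficient (times \<open>j!\<close>) of \<open>(D - b\<^sub>0)\<dots>(D - b\<^sub>k\<^sub>-\<^sub>1) G\<close>, where \<open>G\<close> is
  annihilated by \<open>(D - b\<^sub>0)\<dots>(D - b\<^sub>m\<^sub>-\<^sub>1)\<close>.\<close>
locale annihilated_taylor =
  fixes d :: "nat \<Rightarrow> nat \<Rightarrow> complex" and b :: "nat \<Rightarrow> complex" and m :: nat and T :: real
  assumes rec: "\<And>k j. k < m \<Longrightarrow> d (Suc k) j = d k (Suc j) - b k * d k j"
    and dm: "\<And>j. d m j = 0"
    and b: "\<And>k. k < m \<Longrightarrow> norm (b k) \<le> T"
    and T: "0 \<le> T"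
begin

text \<open>On moduli each factor D - b is dominated by D + \<open>T\<close>, and the power (D +
  T)^k is expanded by the binomial theorem.\<close>

lemma norm_d_le_binomial:
  "k \<le> m \<Longrightarrow> norm (d k j) \<le> (\<Sum>i\<le>k. real (k choose i) * T ^ (k - i) * norm (d 0 (j + i)))"
proof (induction k arbitrary: j)
  case 0
  then show ?case by simp
next
  case (Suc k)
  define f where "f i = norm (d 0 (j + i))" for i
  have "norm (d (Suc k) j) \<le> norm (d k (Suc j)) + norm (b k) * norm (d k j)"
    using rec[of k j] Suc.prems by (simp add: norm_triangle_ineq4 flip: norm_mult)
  also have "\<dots> \<le> (\<Sum>i\<le>k. real (k choose i) * T ^ (k - i) * f (Suc i)) +
      T * (\<Sum>i\<le>k. real (k choose i) * T ^ (k - i) * f i)"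
    using Suc.IH[of "Suc j"] Suc.IH[of j] Suc.prems b[of k] T
    by (intro add_mono mult_mono) (auto simp: f_def)
  also have "T * (\<Sum>i\<le>k. real (k choose i) * T ^ (k - i) * f i)
       = (\<Sum>i\<le>k. real (k choose i) * T ^ (Suc k - i) * f i)"
    unfolding sum_distrib_left by (intro sum.cong) (auto simp: Suc_diff_le)
  also have "\<dots> = T ^ Suc k * f 0 + (\<Sum>i<k. real (k choose Suc i) * T ^ (k - i) * f (Suc i))"
    unfolding lessThan_Suc_atMost[symmetric] sum.lessThan_Suc_shift by simp
  also have "(\<Sum>i<k. real (k choose Suc i) * T ^ (k - i) * f (Suc i)) = (\<Sum>i\<le>k. real (k choose Suc i) * T ^ (k - i) * f (Suc i))"
    by (simp add: lessThan_Suc_atMost[symmetric])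
  also have "(\<Sum>i\<le>k. real (k choose i) * T ^ (k - i) * f (Suc i)) + (T ^ Suc k * f 0 + (\<Sum>i\<le>k. real (k choose Suc i) * T ^ (k - i) * f (Suc i)))
     = T ^ Suc k * f 0 + (\<Sum>i\<le>k. real (Suc k choose Suc i) * T ^ (k - i) * f (Suc i))"
    by (simp add: sum.distrib[symmetric] algebra_simps)
  also have "\<dots> = (\<Sum>i\<le>Suc k. real (Suc k choose i) * T ^ (Suc k - i) * f i)"
    unfolding sum.atMost_Suc_shift by simp
  finally show ?case by (simp add: f_def)
qed

text \<open>The recursion, read as \<open>d k (Suc j) = d (Suc k) j + b k * d k j\<close>, leads
  from \<open>d k j\<close> to second index 0 in \<open>j\<close> steps: \<open>l\<close> of them
  raise the first index, the others cost a factor of modulus at most \<open>T\<close>. Whatever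
  reaches first index \<open>m\<close> contributes 0, so \<open>m - k\<close> initial values
  determine everything.\<close>

lemma norm_d_le_initial:
  "k \<le> m \<Longrightarrow> norm (d k j) \<le> (\<Sum>l<m - k. norm (d (k + l) 0) * real (j choose l) * T ^ (j - l))"
proof (induction j arbitrary: k)
  case 0
  show ?case
  proof (cases "k = m")
    case False
    then obtain p where p: "m - k = Suc p" using 0 by (cases "m - k") auto
    have "0 \<le> (\<Sum>i<p. norm (d (Suc (k + i)) 0) * real (0 choose Suc i) * T ^ (0 - Suc i))"
      by (intro sum_nonneg) simp
    then show ?thesis unfolding p sum.lessThan_Suc_shift by simp
  qed (simp add: dm)
next
  case (Suc j)
  show ?case
  proof (cases "k = m")
    case False
    then have km: "k < m" using Suc by simp
    then obtain p where p: "m - k = Suc p" "m - Suc k = p" by (cases "m - k") auto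
    define f where "f l = norm (d (k + l) 0)" for l
    have "d k (Suc j) = d (Suc k) j + b k * d k j" using rec[OF km] by simp
    then have "norm (d k (Suc j)) \<le> norm (d (Suc k) j) + norm (b k) * norm (d k j)"
      by (metis norm_mult norm_triangle_ineq)
    also have "\<dots> \<le> (\<Sum>l<p. f (Suc l) * real (j choose l) * T ^ (j - l)) + T * (\<Sum>l<Suc p. f l * real (j choose l) * T ^ (j - l))"
      using Suc.IH[of "Suc k"] Suc.IH[of k] km p b[of k] T
      by (intro add_mono mult_mono) (auto simp: f_def)
    also have "\<dots> = (\<Sum>l<Suc p. f l * real (Suc j choose l) * T ^ (Suc j - l))"
    proof -
      \<comment> \<open>For \<open>j < Suc l\<close> the truncated exponents do not match, but then
        the binomial coefficient is 0.\<close>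
      have e: "T * (f (Suc l) * real (j choose Suc l) * T ^ (j - Suc l)) = f (Suc l) * real (j choose Suc l) * T ^ (j - l)" for l
      proof (cases "Suc l \<le> j")
        case True
        then have "j - l = Suc (j - Suc l)" by simp
        then show ?thesis by simp
      qed (simp add: binomial_eq_0)
      have "T * (\<Sum>l<Suc p. f l * real (j choose l) * T ^ (j - l)) = f 0 * T ^ Suc j + (\<Sum>l<p. f (Suc l) * real (j choose Suc l) * T ^ (j - l))"
        unfolding sum.lessThan_Suc_shift distrib_left sum_distrib_left e by simp
      then show ?thesis
        unfolding sum.lessThan_Suc_shift by (simp add: sum.distrib[symmetric] algebra_simps)
    qed
    finally show ?thesis by (simp add: f_def p)
  qed (simp add: dm)
qed

text \<open>Cauchy estimates on the circle of radius \<open>r\<close> bound the initial values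
  \<open>d k 0\<close> at the price exp (T r), and these bound the Taylor series at radius
  \<open>R\<close> at the price exp (T R). For \<open>T = 0\<close> this is the coefficient estimate
  for a polynomial of degree less than \<open>m\<close>.\<close>

lemma taylor_sum_le:
  assumes d0: "\<And>j. norm (d 0 j) \<le> fact j * M / r ^ j" and r: "0 < r" and R: "0 \<le> R"
  shows "summable (\<lambda>j. norm (d 0 j) * R ^ j / fact j)"
    and "(\<Sum>j. norm (d 0 j) * R ^ j / fact j) \<le> M * exp (T * (r + R)) * (\<Sum>k<m. (R / r) ^ k)"
proof -
  have M: "0 \<le> M" using order_trans[OF norm_ge_zero d0[of 0]] by simp
  have dk: "norm (d k 0) \<le> M * fact k / r ^ k * exp (T * r)" if "k < m" for k
  proof -
    have "norm (d k 0) \<le> (\<Sum>i\<le>k. real (k choose i) * T ^ (k - i) * norm (d 0 (0 + i)))"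
      using norm_d_le_binomial[of k 0] that by simp
    also have "\<dots> \<le> (\<Sum>i\<le>k. real (k choose i) * T ^ (k - i) * (fact i * M / r ^ i))"
      using d0 T by (intro sum_mono mult_left_mono) auto
    also have "\<dots> = (\<Sum>i\<le>k. M * fact k / r ^ k * ((T * r) ^ (k - i) / fact (k - i)))"
    proof (intro sum.cong refl)
      fix i assume "i \<in> {..k}"
      then have ik: "i \<le> k" by simp
      then have rk: "r ^ k = r ^ i * r ^ (k - i)" by (simp add: power_add[symmetric])
      have bk: "real (k choose i) * fact i * fact (k - i) = fact k"
        using binomial_fact_lemma[OF ik] by (metis (mono_tags, lifting) mult.commute mult.assoc of_nat_fact of_nat_mult)
      show "real (k choose i) * T ^ (k - i) * (fact i * M / r ^ i) = M * fact k / r ^ k * ((T * r) ^ (k - i) / fact (k - i))"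
        unfolding rk bk[symmetric] using r by (simp add: power_mult_distrib field_simps)
    qed
    also have "\<dots> = M * fact k / r ^ k * (\<Sum>i\<le>k. (T * r) ^ i / fact i)"
      unfolding sum_distrib_left[symmetric]
      by (subst sum.nat_diff_reindex[symmetric, of _ "Suc k", unfolded lessThan_Suc_atMost]) simp
    also have "\<dots> \<le> M * fact k / r ^ k * exp (T * r)"
    proof (intro mult_left_mono)
      show "(\<Sum>i\<le>k. (T * r) ^ i / fact i) \<le> exp (T * r)"
        using sum_le_suminf[OF summable_exp[of "T * r"], of "{..k}"] T r
        by (simp add: exp_def divide_inverse scaleR_conv_of_real mult.commute)
    qed (use M r in auto)
    finally show ?thesis .
  qed
  \<comment> \<open>\<open>e l\<close> is the exponential series of \<open>T * R\<close> delayed by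
    \<open>l\<close> places; it arises from
    \<open>(j choose l) / fact j = 1 / (fact l * fact (j - l))\<close>.\<close>
  define e where "e l j = (if l \<le> j then (T * R) ^ (j - l) / fact (j - l) else 0)" for l j :: nat
  have es: "e l sums exp (T * R)" for l
  proof -
    have "(\<lambda>j. e l (j + l)) sums exp (T * R)"
      using exp_converges[of "T * R"] by (simp add: e_def divide_inverse scaleR_conv_of_real mult.commute)
    moreover have "(\<Sum>i<l. e l i) = 0" by (simp add: e_def)
    ultimately show ?thesis using sums_iff_shift[of "e l" l "exp (T * R)"] by simp
  qed
  define h where "h j = (\<Sum>l<m. norm (d l 0) * (R ^ l / fact l) * e l j)" for j
  have hs: "h sums (\<Sum>l<m. norm (d l 0) * (R ^ l / fact l) * exp (T * R))"
    unfolding h_def by (intro sums_sum sums_mult es)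
  have le: "norm (d 0 j) * R ^ j / fact j \<le> h j" for j
  proof -
    have "norm (d 0 j) \<le> (\<Sum>l<m. norm (d l 0) * real (j choose l) * T ^ (j - l))"
      using norm_d_le_initial[of 0 j] by simp
    then have "norm (d 0 j) * R ^ j / fact j \<le> (\<Sum>l<m. norm (d l 0) * real (j choose l) * T ^ (j - l)) * (R ^ j / fact j)"
      using R mult_right_mono[of "norm (d 0 j)" _ "R ^ j / fact j"] by fastforce
    also have "\<dots> = h j"
      unfolding h_def sum_distrib_right
    proof (intro sum.cong refl)
      fix l
      show "norm (d l 0) * real (j choose l) * T ^ (j - l) * (R ^ j / fact j) = norm (d l 0) * (R ^ l / fact l) * e l j"
      proof (cases "l \<le> j")
        case True
        then have rk: "R ^ j = R ^ l * R ^ (j - l)" by (simp add: power_add[symmetric])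
        have bk: "fact j = real (j choose l) * fact l * fact (j - l)"
          using binomial_fact_lemma[OF True] by (metis (mono_tags, lifting) mult.commute mult.assoc of_nat_fact of_nat_mult)
        have "real (j choose l) \<noteq> 0" using True by simp
        then show ?thesis unfolding rk bk using True by (simp add: e_def power_mult_distrib field_simps)
      qed (simp add: e_def binomial_eq_0)
    qed
    finally show ?thesis .
  qed
  show s: "summable (\<lambda>j. norm (d 0 j) * R ^ j / fact j)"
    by (rule summable_comparison_test[OF _ sums_summable[OF hs]]) (use le R in \<open>auto simp: norm_mult\<close>)
  have "(\<Sum>j. norm (d 0 j) * R ^ j / fact j) \<le> (\<Sum>l<m. norm (d l 0) * (R ^ l / fact l) * exp (T * R))"
    using suminf_le[OF le s sums_summable[OF hs]] sums_unique[OF hs] by simp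
  also have "\<dots> \<le> (\<Sum>l<m. (M * fact l / r ^ l * exp (T * r)) * (R ^ l / fact l) * exp (T * R))"
    using dk R by (intro sum_mono mult_right_mono) auto
  also have "\<dots> = (\<Sum>l<m. M * exp (T * (r + R)) * (R / r) ^ l)"
    using r by (intro sum.cong) (auto simp: field_simps exp_add power_divide)
  finally show "(\<Sum>j. norm (d 0 j) * R ^ j / fact j) \<le> M * exp (T * (r + R)) * (\<Sum>k<m. (R / r) ^ k)"
    by (simp add: sum_distrib_left)
qed

end

section \<open>Means over circles\<close>

text \<open>This is the contour integral of F(\<zeta>) / (2 \<pi> \<i> \<zeta>). Dividing by \<zeta>
  lets modulus bounds pass to the mean without a length factor; the plain contour integral is the
  mean of \<zeta> F(\<zeta>).\<close>

definition circle_mean :: "real \<Rightarrow> (complex \<Rightarrow> complex) \<Rightarrow> complex" where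
  "circle_mean \<rho> F = integral {0..1} (\<lambda>s. F (of_real \<rho> * exp (2 * of_real pi * \<i> * of_real s)))"

lemma norm_circle_point [simp]: "norm (of_real \<rho> * exp (2 * of_real pi * \<i> * of_real s)) = \<bar>\<rho>\<bar>"
  by (simp add: norm_mult norm_exp_eq_Re)

lemma integrable_circle_mean:
  fixes F :: "complex \<Rightarrow> 'a::banach"
  assumes "continuous_on (sphere 0 \<rho>) F" "0 \<le> \<rho>"
  shows "(\<lambda>s. F (of_real \<rho> * exp (2 * of_real pi * \<i> * of_real s))) integrable_on {0..1}"
  by (intro integrable_continuous_interval continuous_on_compose2[OF assms(1)] continuous_intros)
     (use assms in auto)

lemma circle_mean_cong:
  assumes "\<And>\<zeta>. norm \<zeta> = \<rho> \<Longrightarrow> F \<zeta> = H \<zeta>" "0 \<le> \<rho>"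
  shows "circle_mean \<rho> F = circle_mean \<rho> H"
  unfolding circle_mean_def using assms by (intro integral_cong) auto

lemma circle_mean_diff:
  assumes "continuous_on (sphere 0 \<rho>) F" "continuous_on (sphere 0 \<rho>) H" "0 \<le> \<rho>"
  shows "circle_mean \<rho> (\<lambda>\<zeta>. F \<zeta> - H \<zeta>) = circle_mean \<rho> F - circle_mean \<rho> H"
  unfolding circle_mean_def by (intro integral_diff integrable_circle_mean assms)

lemma circle_mean_cmult: "circle_mean \<rho> (\<lambda>\<zeta>. c * F \<zeta>) = c * circle_mean \<rho> F"
  unfolding circle_mean_def by (rule integral_mult_right)

lemma circle_mean_const [simp]: "circle_mean \<rho> (\<lambda>_. c) = c"
  unfolding circle_mean_def by simp

lemma norm_circle_mean_le:
  assumes "continuous_on (sphere 0 \<rho>) F" "0 \<le> \<rho>" "\<And>\<zeta>. norm \<zeta> = \<rho> \<Longrightarrow> norm (F \<zeta>) \<le> B"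
  shows "norm (circle_mean \<rho> F) \<le> B"
proof -
  have "norm (circle_mean \<rho> F) \<le> integral {0..1::real} (\<lambda>_. B)"
    unfolding circle_mean_def
    by (intro integral_norm_bound_integral integrable_circle_mean assms) (use assms in auto)
  then show ?thesis by simp
qed

lemma contour_integral_circlepath_eq_mean:
  assumes "\<rho> \<noteq> 0"
  shows "contour_integral (circlepath 0 \<rho>) (\<lambda>\<zeta>. F \<zeta> / \<zeta>) = 2 * of_real pi * \<i> * circle_mean \<rho> F"
proof -
  have "contour_integral (circlepath 0 \<rho>) (\<lambda>\<zeta>. F \<zeta> / \<zeta>) =
    integral {0..1} (\<lambda>s. 2 * of_real pi * \<i> * F (of_real \<rho> * exp (2 * of_real pi * \<i> * of_real s)))"
    unfolding contour_integral_integral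
    using assms by (intro integral_cong, simp only: vector_derivative_circlepath) (simp add: circlepath)
  then show ?thesis by (simp add: circle_mean_def)
qed

text \<open>The circles are homotopic along radii inside the exterior domain. Later means can thus
  be taken on whichever circle is convenient.\<close>

lemma circle_mean_radius_cong:
  assumes F: "F holomorphic_on {\<zeta>. \<tau> < norm \<zeta>}" and "\<tau> < \<rho>\<^sub>1" "\<tau> < \<rho>\<^sub>2" "0 \<le> \<tau>"
  shows "circle_mean \<rho>\<^sub>1 F = circle_mean \<rho>\<^sub>2 F"
proof -
  let ?S = "{\<zeta>::complex. \<tau> < norm \<zeta>}"
  have op: "open ?S" by (intro open_Collect_less continuous_intros)
  have "contour_integral (circlepath 0 \<rho>\<^sub>1) (\<lambda>\<zeta>. F \<zeta> / \<zeta>) = contour_integral (circlepath 0 \<rho>\<^sub>2) (\<lambda>\<zeta>. F \<zeta> / \<zeta>)"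
  proof (rule Cauchy_theorem_homotopic_loops[OF _ op])
    show "(\<lambda>\<zeta>. F \<zeta> / \<zeta>) holomorphic_on ?S"
      using assms by (intro holomorphic_intros) auto
    show "homotopic_loops ?S (circlepath 0 \<rho>\<^sub>1) (circlepath 0 \<rho>\<^sub>2)"
    proof (rule homotopic_loops_linear)
      fix t x :: real assume "t \<in> {0..1}"
      show "closed_segment (circlepath 0 \<rho>\<^sub>1 t) (circlepath 0 \<rho>\<^sub>2 t) \<subseteq> ?S"
      proof
        fix w assume "w \<in> closed_segment (circlepath 0 \<rho>\<^sub>1 t) (circlepath 0 \<rho>\<^sub>2 t)"
        then obtain u where u: "0 \<le> u" "u \<le> 1" and w: "w = (1 - u) *\<^sub>R circlepath 0 \<rho>\<^sub>1 t + u *\<^sub>R circlepath 0 \<rho>\<^sub>2 t"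
          by (auto simp: closed_segment_def)
        have "w = of_real ((1 - u) * \<rho>\<^sub>1 + u * \<rho>\<^sub>2) * exp (2 * of_real pi * \<i> * of_real t)"
          unfolding w by (simp add: circlepath scaleR_conv_of_real algebra_simps)
        then have "norm w = \<bar>(1 - u) * \<rho>\<^sub>1 + u * \<rho>\<^sub>2\<bar>" by (simp only: norm_circle_point)
        also have "(1 - u) * \<tau> + u * \<tau> < (1 - u) * \<rho>\<^sub>1 + u * \<rho>\<^sub>2"
        proof (cases "u = 0")
          case False
          then show ?thesis using u assms by (intro add_le_less_mono mult_left_mono mult_strict_left_mono) auto
        qed (use assms in simp)
        then have "\<tau> < \<bar>(1 - u) * \<rho>\<^sub>1 + u * \<rho>\<^sub>2\<bar>" by (simp add: algebra_simps)
        finally show "w \<in> ?S" by simp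
      qed
    qed auto
  qed auto
  then show ?thesis
    using assms by (simp add: contour_integral_circlepath_eq_mean)
qed

lemma circle_mean_eq_center:
  assumes F: "F holomorphic_on ball 0 r" and "0 < \<rho>" "\<rho> < r"
  shows "circle_mean \<rho> F = F 0"
proof -
  have "((\<lambda>u. F u / (u - 0)) has_contour_integral 2 * of_real pi * \<i> * F 0) (circlepath 0 \<rho>)"
    using assms by (intro Cauchy_integral_circlepath_simple holomorphic_on_subset[OF F]) auto
  then have "contour_integral (circlepath 0 \<rho>) (\<lambda>u. F u / u) = 2 * of_real pi * \<i> * F 0"
    by (simp add: contour_integral_unique)
  then show ?thesis using assms by (simp add: contour_integral_circlepath_eq_mean)
qed

lemma continuous_on_sphere_if_holomorphic:
  assumes "F holomorphic_on {\<zeta>. \<tau> < norm \<zeta>}" "\<tau> < \<rho>"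
  shows "continuous_on (sphere 0 \<rho>) F"
  by (rule continuous_on_subset[OF holomorphic_on_imp_continuous_on[OF assms(1)]]) (use assms in auto)

text \<open>The mean does not depend on the radius, and on very large circles the integrand is
  uniformly close to \<open>l\<close>.\<close>

lemma circle_mean_eq_limit_at_infinity:
  assumes F: "F holomorphic_on {\<zeta>. \<tau> < norm \<zeta>}" and \<rho>: "\<tau> < \<rho>" "0 \<le> \<tau>"
    and lim: "(F \<longlongrightarrow> l) at_infinity"
  shows "circle_mean \<rho> F = l"
proof -
  have "norm (circle_mean \<rho> F - l) \<le> e" if e: "e > 0" for e
  proof -
    from lim e have "eventually (\<lambda>\<zeta>. dist (F \<zeta>) l < e) at_infinity" by (rule tendstoD)
    then obtain b where b: "\<And>\<zeta>. b \<le> norm \<zeta> \<Longrightarrow> dist (F \<zeta>) l < e" by (auto simp: eventually_at_infinity)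
    define r where "r = max b \<rho>"
    have r: "\<tau> < r" "0 \<le> r" using \<rho> by (auto simp: r_def)
    have c: "continuous_on (sphere 0 r) F" by (rule continuous_on_sphere_if_holomorphic[OF F r(1)])
    have "circle_mean \<rho> F - l = circle_mean r F - circle_mean r (\<lambda>_. l)"
      using circle_mean_radius_cong[OF F \<rho>(1) r(1) \<rho>(2)] by simp
    also have "\<dots> = circle_mean r (\<lambda>\<zeta>. F \<zeta> - l)"
      by (intro circle_mean_diff[symmetric] c r continuous_intros)
    finally have eq: "circle_mean \<rho> F - l = circle_mean r (\<lambda>\<zeta>. F \<zeta> - l)" .
    show ?thesis unfolding eq
    proof (rule norm_circle_mean_le)
      fix \<zeta> :: complex assume "norm \<zeta> = r"
      then show "norm (F \<zeta> - l) \<le> e" using b[of \<zeta>] by (simp add: r_def dist_norm less_imp_le)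
    qed (use c r in \<open>auto intro!: continuous_intros\<close>)
  qed
  then have "norm (circle_mean \<rho> F - l) \<le> 0" by (metis dense_ge)
  then show ?thesis by simp
qed

text \<open>The difference quotient \<open>\<psi>\<close> of \<open>F\<close> at \<open>z\<close> is
  holomorphic in the exterior domain, and \<zeta> \<psi>(\<zeta>) tends to - \<open>F z\<close> at
  infinity, which gives its mean. The remaining multiple of \<zeta> / (z - \<zeta>) is holomorphic
  inside the circle and vanishes at 0.\<close>

lemma exterior_Cauchy_formula:
  assumes F: "F holomorphic_on {\<zeta>. \<tau> < norm \<zeta>}" and \<rho>: "\<tau> < \<rho>" "0 \<le> \<tau>"
    and lim: "(F \<longlongrightarrow> 0) at_infinity" and z: "\<rho> < norm z"
  shows "circle_mean \<rho> (\<lambda>\<zeta>. \<zeta> * F \<zeta> / (z - \<zeta>)) = F z"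
proof -
  let ?S = "{\<zeta>::complex. \<tau> < norm \<zeta>}"
  have op: "open ?S" by (intro open_Collect_less continuous_intros)
  define \<psi> where "\<psi> \<zeta> = (if \<zeta> = z then deriv F z else (F \<zeta> - F z) / (\<zeta> - z))" for \<zeta>
  have \<psi>: "\<psi> holomorphic_on ?S" unfolding \<psi>_def by (rule pole_lemma_open[OF F op])
  have rat: "((\<lambda>\<zeta>. \<zeta> / (\<zeta> - z)) \<longlongrightarrow> 1) at_infinity"
  proof -
    have "((\<lambda>\<zeta>. 1 + z * inverse (\<zeta> - z)) \<longlongrightarrow> 1 + z * 0) at_infinity"
    proof (intro tendsto_intros tendsto_inverse_0[THEN filterlim_compose])
      show "filterlim (\<lambda>\<zeta>. \<zeta> - z) at_infinity at_infinity"
        using tendsto_add_filterlim_at_infinity'[OF filterlim_ident tendsto_const[of "-z"]] by simp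
    qed
    moreover have "eventually (\<lambda>\<zeta>. 1 + z * inverse (\<zeta> - z) = \<zeta> / (\<zeta> - z)) at_infinity"
      by (rule eventually_at_infinityI[of "norm z + 1"]) (auto simp: divide_simps)
    ultimately show ?thesis by (simp add: tendsto_cong)
  qed
  have "((\<lambda>\<zeta>. (F \<zeta> - F z) * (\<zeta> / (\<zeta> - z))) \<longlongrightarrow> (0 - F z) * 1) at_infinity"
    by (intro tendsto_intros lim rat)
  moreover have "eventually (\<lambda>\<zeta>. (F \<zeta> - F z) * (\<zeta> / (\<zeta> - z)) = \<zeta> * \<psi> \<zeta>) at_infinity"
    by (rule eventually_at_infinityI[of "norm z + 1"]) (auto simp: \<psi>_def)
  ultimately have "((\<lambda>\<zeta>. \<zeta> * \<psi> \<zeta>) \<longlongrightarrow> - F z) at_infinity" by (simp add: tendsto_cong)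
  then have 1: "circle_mean \<rho> (\<lambda>\<zeta>. \<zeta> * \<psi> \<zeta>) = - F z"
    by (intro circle_mean_eq_limit_at_infinity[OF _ \<rho>] holomorphic_intros \<psi>)
  have "\<rho> > 0" using \<rho> by simp
  then have "circle_mean \<rho> (\<lambda>\<zeta>. \<zeta> / (z - \<zeta>)) = 0 / (z - 0)"
    using z by (intro circle_mean_eq_center[of _ "norm z"] holomorphic_intros) auto
  then have 2: "circle_mean \<rho> (\<lambda>\<zeta>. F z * (\<zeta> / (z - \<zeta>))) = 0"
    by (simp only: circle_mean_cmult) simp
  have c: "continuous_on (sphere 0 \<rho>) F" by (rule continuous_on_sphere_if_holomorphic[OF F \<rho>(1)])
  have c\<psi>: "continuous_on (sphere 0 \<rho>) \<psi>" by (rule continuous_on_sphere_if_holomorphic[OF \<psi> \<rho>(1)])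
  have "circle_mean \<rho> (\<lambda>\<zeta>. \<zeta> * F \<zeta> / (z - \<zeta>)) = circle_mean \<rho> (\<lambda>\<zeta>. F z * (\<zeta> / (z - \<zeta>)) - \<zeta> * \<psi> \<zeta>)"
  proof (rule circle_mean_cong)
    fix \<zeta> :: complex assume "norm \<zeta> = \<rho>"
    then have "\<zeta> \<noteq> z" using z by auto
    then show "\<zeta> * F \<zeta> / (z - \<zeta>) = F z * (\<zeta> / (z - \<zeta>)) - \<zeta> * \<psi> \<zeta>"
      by (simp add: \<psi>_def field_simps)
  qed (use \<open>\<rho> > 0\<close> in simp)
  also have "\<dots> = circle_mean \<rho> (\<lambda>\<zeta>. F z * (\<zeta> / (z - \<zeta>))) - circle_mean \<rho> (\<lambda>\<zeta>. \<zeta> * \<psi> \<zeta>)"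
    using z \<open>\<rho> > 0\<close> by (intro circle_mean_diff continuous_intros c\<psi>) auto
  finally show ?thesis using 1 2 by simp
qed

lemma circle_mean_exp_has_derivative:
  assumes h: "continuous_on (sphere 0 \<rho>) h" "0 \<le> \<rho>" and u: "continuous_on (sphere 0 \<rho>) u"
  shows "((\<lambda>t. circle_mean \<rho> (\<lambda>\<zeta>. h \<zeta> * exp (u \<zeta> * t))) has_field_derivative
           circle_mean \<rho> (\<lambda>\<zeta>. h \<zeta> * u \<zeta> * exp (u \<zeta> * t))) (at t)"
proof -
  define c where "c s = of_real \<rho> * exp (2 * of_real pi * \<i> * complex_of_real s)" for s
  have cc: "continuous_on X (\<lambda>x. c (f x))" if "continuous_on X f" for X and f :: "'a::topological_space \<Rightarrow> real"
    unfolding c_def by (intro continuous_intros that)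
  have ch: "continuous_on X (\<lambda>x. h (c (f x)))" if "continuous_on X f" for X and f :: "'a::topological_space \<Rightarrow> real"
    by (rule continuous_on_compose2[OF h(1) cc[OF that]]) (use h in \<open>auto simp: c_def\<close>)
  have cu: "continuous_on X (\<lambda>x. u (c (f x)))" if "continuous_on X f" for X and f :: "'a::topological_space \<Rightarrow> real"
    by (rule continuous_on_compose2[OF u cc[OF that]]) (use h in \<open>auto simp: c_def\<close>)
  have "((\<lambda>t. integral (cbox 0 1) (\<lambda>s. h (c s) * exp (u (c s) * t))) has_field_derivative
     integral (cbox 0 1) (\<lambda>s. h (c s) * u (c s) * exp (u (c s) * t))) (at t within UNIV)"
  proof (rule leibniz_rule_field_derivative)
    show "continuous_on (UNIV \<times> cbox 0 1) (\<lambda>(x, t). h (c t) * u (c t) * exp (u (c t) * x))"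
      unfolding split_def by (intro continuous_intros ch cu)
    show "(\<lambda>s. h (c s) * exp (u (c s) * x)) integrable_on cbox 0 1" for x
      by (intro integrable_continuous continuous_intros ch cu)
  qed (auto intro!: derivative_eq_intros)
  then show ?thesis by (simp add: circle_mean_def c_def)
qed

section \<open>The Borel transform\<close>

lemma holomorphic_extension_finite:
  assumes "finite A" "F holomorphic_on - A" "\<And>a. a \<in> A \<Longrightarrow> \<exists>B. eventually (\<lambda>w. norm (F w) \<le> B) (at a)"
  shows "\<exists>g. g holomorphic_on UNIV \<and> (\<forall>w\<in>-A. g w = F w)"
  using assms
proof (induction A arbitrary: F rule: finite_induct)
  case empty
  then show ?case by auto
next
  case (insert a A)
  have op: "open (- A)" using insert by (simp add: finite_imp_closed open_Compl)
  have "\<exists>g. g holomorphic_on - A \<and> (\<forall>z \<in> - A - {a}. g z = F z)"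
    using insert.prems insert.hyps op
    by (subst holomorphic_on_extend_bounded) (auto simp: interior_open Compl_insert)
  then obtain g where g: "g holomorphic_on - A" "\<And>z. z \<in> - A - {a} \<Longrightarrow> g z = F z" by blast
  have "\<exists>B. eventually (\<lambda>w. norm (g w) \<le> B) (at b)" if b: "b \<in> A" for b
  proof -
    obtain B where B: "eventually (\<lambda>w. norm (F w) \<le> B) (at b)" using insert.prems(2) b by blast
    have "open (- (insert a A - {b}))" using insert.hyps by (intro open_Compl finite_imp_closed) auto
    then have "eventually (\<lambda>w. w \<in> - (insert a A - {b}) - {b}) (at b)"
      using b insert.hyps by (intro eventually_at_in_open) auto
    with B have "eventually (\<lambda>w. norm (g w) \<le> B) (at b)"
      by eventually_elim (use g(2) b in auto)
    then show ?thesis by blast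
  qed
  then obtain h where h: "h holomorphic_on UNIV" "\<forall>w\<in>-A. h w = g w" using insert.IH[OF g(1)] by blast
  then show ?case using g(2) by (intro exI[of _ h]) auto
qed

text \<open>The growth condition at each point is against the full product, so repeated points carry
  their multiplicity, and every singularity of the quotient is removable. At the points themselves,
  about which the condition is silent, the identity follows by continuity.\<close>

lemma entire_quotient:
  assumes f: "f holomorphic_on UNIV" and I: "finite I"
    and O: "\<And>i. i \<in> I \<Longrightarrow> f \<in> O[at (z i)](\<lambda>w. \<Prod>i\<in>I. w - z i)"
  obtains E where "E holomorphic_on UNIV" "\<And>w. f w = (\<Prod>i\<in>I. w - z i) * E w"
proof -
  define W where "W w = (\<Prod>i\<in>I. w - z i)" for w
  define A where "A = z ` I"
  have A: "finite A" using I by (simp add: A_def)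
  have W0: "W w \<noteq> 0" if "w \<in> - A" for w using that I by (auto simp: W_def A_def)
  have W: "W holomorphic_on S" for S unfolding W_def by (intro holomorphic_intros)
  have "\<exists>g. g holomorphic_on UNIV \<and> (\<forall>w\<in>-A. g w = f w / W w)"
  proof (rule holomorphic_extension_finite[OF A])
    show "(\<lambda>w. f w / W w) holomorphic_on - A"
      using W0 by (intro holomorphic_intros W holomorphic_on_subset[OF f]) auto
    fix a assume "a \<in> A"
    then have "f \<in> O[at a](W)" using O unfolding A_def W_def by blast
    then obtain c where c: "c > 0" "eventually (\<lambda>w. norm (f w) \<le> c * norm (W w)) (at a)" by (rule landau_o.bigE)
    from c(2) have "eventually (\<lambda>w. norm (f w / W w) \<le> c) (at a)"
      by eventually_elim (use c(1) in \<open>auto simp: norm_divide divide_simps\<close>)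
    then show "\<exists>B. eventually (\<lambda>w. norm (f w / W w) \<le> B) (at a)" by blast
  qed
  then obtain E where E: "E holomorphic_on UNIV" "\<And>w. w \<in> - A \<Longrightarrow> E w = f w / W w" by blast
  have "f w - W w * E w = 0" for w
  proof (rule continuous_constant_on_closure[of "- A" "\<lambda>w. f w - W w * E w"])
    show "continuous_on (closure (- A)) (\<lambda>w. f w - W w * E w)"
      by (intro continuous_intros holomorphic_on_imp_continuous_on W holomorphic_on_subset[OF f] holomorphic_on_subset[OF E(1)]) auto
    have "interior A = {}" using A by (simp add: empty_interior_finite)
    then show "w \<in> closure (- A)" by (simp add: closure_complement)
  qed (use W0 E(2) in auto)
  then show ?thesis using that[OF E(1)] by (simp add: W_def)
qed

lemma tendsto_poly_div_prod_at_infinity: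
  fixes p :: "complex poly"
  assumes "finite I" "degree p < card I"
  shows "((\<lambda>w. poly p w / (\<Prod>i\<in>I. w - z i)) \<longlongrightarrow> 0) at_infinity"
proof -
  define V where "V = (\<Prod>i\<in>I. [:- z i, 1:])"
  have dV: "degree V = card I" unfolding V_def by (subst degree_prod_eq_sum_degree) auto
  have lV: "lead_coeff V = 1" unfolding V_def by (simp add: lead_coeff_prod)
  have pV: "poly V w = (\<Prod>i\<in>I. w - z i)" for w by (simp add: V_def poly_prod)
  define k where "k = card I - degree p"
  have k: "k > 0" "card I = degree p + k" using assms by (auto simp: k_def)
  have inv: "((\<lambda>x::complex. inverse (x ^ k)) \<longlongrightarrow> 0) at_infinity"
    by (rule filterlim_compose[OF tendsto_inverse_0 filterlim_power_at_infinity]) (use k in simp)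
  have "((\<lambda>x. (poly p x / x ^ degree p) * inverse (poly V x / x ^ degree V) * inverse (x ^ k)) \<longlongrightarrow> lead_coeff p * inverse (lead_coeff V) * 0) at_infinity"
    by (intro tendsto_intros poly_divide_tendsto_aux inv) (simp add: lV)
  moreover have "eventually (\<lambda>x. (poly p x / x ^ degree p) * inverse (poly V x / x ^ degree V) * inverse (x ^ k) = poly p x / (\<Prod>i\<in>I. x - z i)) at_infinity"
    by (rule eventually_at_infinityI[of 1]) (auto simp: dV k(2) power_add pV field_simps)
  ultimately show ?thesis by (simp add: tendsto_cong)
qed

text \<open>The vanishing moments remove the Taylor polynomial of degree \<open>n - 1\<close> of the
  exponential, and the remainder is of order \<open>n\<close> in \<open>s\<close>. In this way
  degree conditions become zeros of order \<open>n\<close> of the transform.\<close>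

lemma norm_circle_mean_exp_le_if_moments_zero:
  assumes h: "continuous_on (sphere 0 \<rho>) h" and \<rho>: "0 \<le> \<rho>" and n: "0 < n"
    and mom: "\<And>i. i < n \<Longrightarrow> circle_mean \<rho> (\<lambda>\<zeta>. h \<zeta> * \<zeta> ^ i) = 0"
  obtains C where "\<And>s. norm s \<le> 1 \<Longrightarrow> norm (circle_mean \<rho> (\<lambda>\<zeta>. h \<zeta> * exp (c * \<zeta> * s))) \<le> C * norm s ^ n"
proof -
  obtain m where m: "n = Suc m" using n by (cases n) auto
  have "bounded (h ` sphere 0 \<rho>)" by (intro compact_imp_bounded compact_continuous_image h compact_sphere)
  then obtain B where "\<forall>x\<in>h ` sphere 0 \<rho>. norm x \<le> B" by (auto simp: bounded_iff)
  then have B: "norm (h \<zeta>) \<le> B" if "norm \<zeta> = \<rho>" for \<zeta> using that by auto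
  define T where "T s \<zeta> = (\<Sum>i\<le>m. (c * \<zeta> * s) ^ i / fact i)" for s \<zeta> :: complex
  define K where "K = norm c * \<rho>"
  have K0: "0 \<le> K" using \<rho> by (simp add: K_def)
  have "norm (circle_mean \<rho> (\<lambda>\<zeta>. h \<zeta> * exp (c * \<zeta> * s))) \<le> (\<bar>B\<bar> * exp K * K ^ n) * norm s ^ n" if s: "norm s \<le> 1" for s
  proof -
    have ct: "continuous_on (sphere 0 \<rho>) (\<lambda>\<zeta>. h \<zeta> * T s \<zeta>)" "continuous_on (sphere 0 \<rho>) (\<lambda>\<zeta>. h \<zeta> * exp (c * \<zeta> * s))"
      unfolding T_def by (intro continuous_intros h; simp)+
    have "circle_mean \<rho> (\<lambda>\<zeta>. h \<zeta> * T s \<zeta>) = circle_mean \<rho> (\<lambda>\<zeta>. \<Sum>i\<le>m. ((c * s) ^ i / fact i) * (h \<zeta> * \<zeta> ^ i))"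
      unfolding T_def by (intro circle_mean_cong \<rho>) (simp add: sum_distrib_left power_mult_distrib mult_ac)
    also have "\<dots> = (\<Sum>i\<le>m. circle_mean \<rho> (\<lambda>\<zeta>. ((c * s) ^ i / fact i) * (h \<zeta> * \<zeta> ^ i)))"
      unfolding circle_mean_def
      by (intro integral_sum integrable_circle_mean[of \<rho> "\<lambda>\<zeta>. ((c * s) ^ _ / fact _) * (h \<zeta> * \<zeta> ^ _)"] continuous_intros h \<rho>) auto
    also have "\<dots> = 0" by (simp only: circle_mean_cmult) (simp add: mom m)
    finally have "circle_mean \<rho> (\<lambda>\<zeta>. h \<zeta> * exp (c * \<zeta> * s)) =
        circle_mean \<rho> (\<lambda>\<zeta>. h \<zeta> * exp (c * \<zeta> * s)) - circle_mean \<rho> (\<lambda>\<zeta>. h \<zeta> * T s \<zeta>)" by simp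
    also have "\<dots> = circle_mean \<rho> (\<lambda>\<zeta>. h \<zeta> * exp (c * \<zeta> * s) - h \<zeta> * T s \<zeta>)"
      by (intro circle_mean_diff[symmetric] ct \<rho>)
    finally have eq: "circle_mean \<rho> (\<lambda>\<zeta>. h \<zeta> * exp (c * \<zeta> * s)) = circle_mean \<rho> (\<lambda>\<zeta>. h \<zeta> * exp (c * \<zeta> * s) - h \<zeta> * T s \<zeta>)" .
    show ?thesis unfolding eq
    proof (rule norm_circle_mean_le)
      fix \<zeta> :: complex assume z: "norm \<zeta> = \<rho>"
      define x where "x = c * \<zeta> * s"
      have nx: "norm x = K * norm s" by (simp add: x_def norm_mult K_def z)
      then have nK: "norm x \<le> K" using s K0 mult_left_le[of "norm s" K] by simp
      have "norm (h \<zeta> * exp x - h \<zeta> * T s \<zeta>) = norm (h \<zeta>) * norm (exp x - (\<Sum>i\<le>m. x ^ i / fact i))"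
        by (simp add: T_def x_def norm_mult[symmetric] right_diff_distrib)
      also have "\<dots> \<le> \<bar>B\<bar> * (exp K * (K * norm s) ^ n)"
      proof (rule mult_mono)
        have "norm (exp x - (\<Sum>i\<le>m. x ^ i / fact i)) \<le> exp (norm x) * norm x ^ Suc m / fact m" by (rule Taylor_exp_field)
        also have "\<dots> \<le> exp (norm x) * norm x ^ Suc m"
          using mult_left_le[of "1 / fact m" "exp (norm x) * norm x ^ Suc m"] fact_ge_1[of m, where 'a=real] by simp
        also have "\<dots> \<le> exp K * (K * norm s) ^ n" using nK by (intro mult_mono) (use K0 in \<open>auto simp: nx m\<close>)
        finally show "norm (exp x - (\<Sum>i\<le>m. x ^ i / fact i)) \<le> exp K * (K * norm s) ^ n" .
      qed (use B[OF z] in auto)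
      finally show "norm (h \<zeta> * exp (c * \<zeta> * s) - h \<zeta> * T s \<zeta>) \<le> \<bar>B\<bar> * exp K * K ^ n * norm s ^ n"
        by (simp add: x_def power_mult_distrib mult_ac)
    qed (use ct \<rho> in \<open>auto intro!: continuous_intros\<close>)
  qed
  then show ?thesis by (rule that)
qed

text \<open>The rescaled problem: \<open>a j\<close> is \<open>z\<^sub>j / (2 n)\<close>.\<close>

locale pade_pair =
  fixes n :: nat and a :: "nat \<Rightarrow> complex" and P Q :: "complex poly" and E :: "complex \<Rightarrow> complex" and \<tau> :: real
  assumes n: "0 < n" and a: "\<And>j. j \<le> 2 * n \<Longrightarrow> norm (a j) \<le> \<tau>"
    and degP: "degree P \<le> n" and degQ: "degree Q \<le> n" and PQ: "P \<noteq> 0 \<or> Q \<noteq> 0"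
    and E: "E holomorphic_on UNIV"
    and interp: "\<And>w. poly P w * exp (- (of_nat n * w)) + poly Q w * exp (of_nat n * w) = (\<Prod>j\<le>2*n. w - a j) * E w"
begin

definition W where "W w = (\<Prod>j\<le>2*n. w - a j)"
definition \<phi> where "\<phi> \<zeta> = poly P \<zeta> * exp (- (of_nat n * \<zeta>)) / W \<zeta>"
text \<open>The factor \<zeta> compensates the division by \<zeta> in \<open>circle_mean\<close>:
  this is the contour integral of \<phi>(\<zeta>) exp (n \<zeta> t) / (2 \<pi> \<i>), the Borel
  transform of \<open>\<phi>\<close> in a variable scaled by \<open>n\<close>.\<close>

definition G where "G t = circle_mean (\<tau> + 1) (\<lambda>\<zeta>. \<zeta> * \<phi> \<zeta> * exp (of_nat n * \<zeta> * t))"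

lemma \<tau>: "0 \<le> \<tau>" using order_trans[OF norm_ge_zero a[of 0]] by simp

lemma W_nz: "\<tau> < norm w \<Longrightarrow> W w \<noteq> 0"
  using a by (fastforce simp: W_def)

lemma holomorphic_W: "W holomorphic_on S"
  unfolding W_def by (intro holomorphic_intros)

lemma norm_W_ge: "\<tau> \<le> norm w \<Longrightarrow> (norm w - \<tau>) ^ (2 * n + 1) \<le> norm (W w)"
proof -
  assume w: "\<tau> \<le> norm w"
  have "(\<Prod>j\<le>2*n. norm w - \<tau>) \<le> (\<Prod>j\<le>2*n. norm (w - a j))"
  proof (rule prod_mono)
    fix j assume "j \<in> {..2*n}"
    then show "0 \<le> norm w - \<tau> \<and> norm w - \<tau> \<le> norm (w - a j)"
      using a[of j] norm_triangle_ineq2[of w "a j"] w by auto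
  qed
  then show ?thesis by (simp add: W_def prod_norm)
qed

lemma norm_W_le: "norm (W w) \<le> (norm w + \<tau>) ^ (2 * n + 1)"
proof -
  have "(\<Prod>j\<le>2*n. norm (w - a j)) \<le> (\<Prod>j\<le>2*n. norm w + \<tau>)"
  proof (rule prod_mono)
    fix j assume "j \<in> {..2*n}"
    then show "0 \<le> norm (w - a j) \<and> norm (w - a j) \<le> norm w + \<tau>"
      using a[of j] norm_triangle_ineq4[of w "a j"] by auto
  qed
  then show ?thesis by (simp add: W_def prod_norm)
qed

lemma holomorphic_\<phi>: "\<phi> holomorphic_on {\<zeta>. \<tau> < norm \<zeta>}"
  unfolding \<phi>_def using W_nz by (intro holomorphic_intros holomorphic_W) auto

lemma continuous_\<phi>: "\<tau> < \<rho> \<Longrightarrow> continuous_on (sphere 0 \<rho>) \<phi>"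
  by (rule continuous_on_sphere_if_holomorphic[OF holomorphic_\<phi>])

lemma G_eq: "\<tau> < \<rho> \<Longrightarrow> G t = circle_mean \<rho> (\<lambda>\<zeta>. \<zeta> * \<phi> \<zeta> * exp (of_nat n * \<zeta> * t))"
  unfolding G_def using \<tau> by (intro circle_mean_radius_cong[of _ \<tau>] holomorphic_intros holomorphic_\<phi>) auto

lemma higher_deriv_G:
  assumes "\<tau> < \<rho>"
  shows "(deriv ^^ j) G = (\<lambda>t. circle_mean \<rho> (\<lambda>\<zeta>. \<zeta> * \<phi> \<zeta> * (of_nat n * \<zeta>) ^ j * exp (of_nat n * \<zeta> * t)))"
proof (induction j)
  case 0
  show ?case using G_eq[OF assms] by auto
next
  case (Suc j)
  have "((deriv ^^ j) G has_field_derivative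
      circle_mean \<rho> (\<lambda>\<zeta>. \<zeta> * \<phi> \<zeta> * (of_nat n * \<zeta>) ^ j * (of_nat n * \<zeta>) * exp (of_nat n * \<zeta> * t))) (at t)" for t
    unfolding Suc using assms \<tau>
    by (intro circle_mean_exp_has_derivative continuous_intros continuous_\<phi>) auto
  then show ?case by (auto simp: fun_eq_iff mult_ac dest!: DERIV_imp_deriv)
qed

lemma holomorphic_G: "G holomorphic_on S"
proof -
  have "(G has_field_derivative circle_mean (\<tau> + 1) (\<lambda>\<zeta>. \<zeta> * \<phi> \<zeta> * (of_nat n * \<zeta>) * exp (of_nat n * \<zeta> * t))) (at t)" for t
    unfolding G_def using \<tau> by (intro circle_mean_exp_has_derivative continuous_intros continuous_\<phi>) auto
  then show ?thesis by (auto simp: holomorphic_on_def field_differentiable_def intro: has_field_derivative_at_within)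
qed

lemma circle_mean_poly_over_W:
  assumes "degree p < 2 * n + 1" "\<tau> < \<rho>"
  shows "circle_mean \<rho> (\<lambda>\<zeta>. poly p \<zeta> / W \<zeta>) = 0"
proof (rule circle_mean_eq_limit_at_infinity[OF _ assms(2) \<tau>])
  show "(\<lambda>\<zeta>. poly p \<zeta> / W \<zeta>) holomorphic_on {\<zeta>. \<tau> < norm \<zeta>}"
    using W_nz by (intro holomorphic_intros holomorphic_W) auto
  show "((\<lambda>\<zeta>. poly p \<zeta> / W \<zeta>) \<longlongrightarrow> 0) at_infinity"
    unfolding W_def using assms by (intro tendsto_poly_div_prod_at_infinity) auto
qed

text \<open>The numerator has degree at most \<open>n + i + 1 \<le> 2 * n\<close>, below the degree
  \<open>2 * n + 1\<close> of \<open>W\<close>. Here the number of interpolation points meets the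
  bound on the degrees.\<close>

lemma moment_le_degree:
  assumes "degree p \<le> n" "i < n" "\<tau> < \<rho>"
  shows "circle_mean \<rho> (\<lambda>\<zeta>. \<zeta> * (poly p \<zeta> / W \<zeta>) * \<zeta> ^ i) = 0"
proof -
  have "degree (monom 1 (Suc i) * p) \<le> Suc i + n"
    using degree_mult_le[of "monom 1 (Suc i)" p] degree_monom_le[of "1::complex" "Suc i"] assms(1) by linarith
  then have "circle_mean \<rho> (\<lambda>\<zeta>. poly (monom 1 (Suc i) * p) \<zeta> / W \<zeta>) = 0"
    using assms by (intro circle_mean_poly_over_W) auto
  then show ?thesis by (simp add: poly_monom mult_ac)
qed

text \<open>At \<open>t = 1\<close> the exponentials cancel and the rational function
  \<open>P / W\<close> is left, to which \<open>moment_le_degree\<close> applies.\<close>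

lemma norm_G_le_at_1: obtains C where "\<And>t. norm (t - 1) \<le> 1 \<Longrightarrow> norm (G t) \<le> C * norm (t - 1) ^ n"
proof -
  let ?\<rho> = "\<tau> + 1"
  let ?h = "\<lambda>\<zeta>. \<zeta> * \<phi> \<zeta> * exp (of_nat n * \<zeta>)"
  have h: "?h \<zeta> = \<zeta> * (poly P \<zeta> / W \<zeta>)" for \<zeta>
    by (simp add: \<phi>_def exp_minus field_simps)
  have c: "continuous_on (sphere 0 ?\<rho>) ?h"
    by (intro continuous_intros continuous_\<phi>) auto
  have mom: "circle_mean ?\<rho> (\<lambda>\<zeta>. ?h \<zeta> * \<zeta> ^ i) = 0" if "i < n" for i
    unfolding h using moment_le_degree[OF degP that, of ?\<rho>] by simp
  obtain C where C: "\<And>s. norm s \<le> 1 \<Longrightarrow> norm (circle_mean ?\<rho> (\<lambda>\<zeta>. ?h \<zeta> * exp (of_nat n * \<zeta> * s))) \<le> C * norm s ^ n"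
    using norm_circle_mean_exp_le_if_moments_zero[OF c _ n mom, of "of_nat n"] \<tau> by auto
  have "?h \<zeta> * exp (of_nat n * \<zeta> * (t - 1)) = \<zeta> * \<phi> \<zeta> * exp (of_nat n * \<zeta> * t)" for \<zeta> t
    by (simp add: exp_add[symmetric] mult.assoc) (simp add: algebra_simps)
  then show ?thesis using C[of "t - 1" for t] by (intro that[of C]) (simp only: G_def)
qed

text \<open>Outside the disc \<open>\<phi>\<close> equals E - Q exp (n \<zeta>) / W. The entire part
  contributes nothing to a mean with a factor \<zeta>, and at \<open>t = - 1\<close> the rest
  reduces to - Q / W, which is treated like P / W at \<open>t = 1\<close>.\<close>

lemma norm_G_le_at_minus_1: obtains C where "\<And>t. norm (t + 1) \<le> 1 \<Longrightarrow> norm (G t) \<le> C * norm (t + 1) ^ n"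
proof -
  let ?\<rho> = "\<tau> + 1"
  let ?h = "\<lambda>\<zeta>. \<zeta> * \<phi> \<zeta> * exp (- (of_nat n * \<zeta>))"
  have c: "continuous_on (sphere 0 ?\<rho>) ?h"
    by (intro continuous_intros continuous_\<phi>) auto
  have mom: "circle_mean ?\<rho> (\<lambda>\<zeta>. ?h \<zeta> * \<zeta> ^ i) = 0" if i: "i < n" for i
  proof -
    have eq: "?h \<zeta> * \<zeta> ^ i = \<zeta> * (E \<zeta> * exp (- (of_nat n * \<zeta>)) * \<zeta> ^ i) - \<zeta> * (poly Q \<zeta> / W \<zeta>) * \<zeta> ^ i"
      if z: "norm \<zeta> = ?\<rho>" for \<zeta>
    proof -
      have "W \<zeta> \<noteq> 0" using W_nz z by simp
      then have "poly P \<zeta> * exp (- (of_nat n * \<zeta>)) / W \<zeta> = E \<zeta> - poly Q \<zeta> * exp (of_nat n * \<zeta>) / W \<zeta>"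
        using interp[of \<zeta>] unfolding W_def[symmetric] by (simp add: field_simps)
      then have "\<phi> \<zeta> = E \<zeta> - poly Q \<zeta> * exp (of_nat n * \<zeta>) / W \<zeta>" by (simp add: \<phi>_def)
      moreover have "exp (of_nat n * \<zeta>) * exp (- (of_nat n * \<zeta>)) = 1" by (simp add: exp_add[symmetric])
      moreover have "\<zeta> * (E \<zeta> - poly Q \<zeta> * exp (of_nat n * \<zeta>) / W \<zeta>) * exp (- (of_nat n * \<zeta>)) * \<zeta> ^ i
          = \<zeta> * (E \<zeta> * exp (- (of_nat n * \<zeta>)) * \<zeta> ^ i) - \<zeta> * (poly Q \<zeta> / W \<zeta>) * (exp (of_nat n * \<zeta>) * exp (- (of_nat n * \<zeta>))) * \<zeta> ^ i"
        by (simp add: algebra_simps)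
      ultimately show ?thesis by simp
    qed
    have "circle_mean ?\<rho> (\<lambda>\<zeta>. \<zeta> * (E \<zeta> * exp (- (of_nat n * \<zeta>)) * \<zeta> ^ i)) = 0 * (E 0 * exp (- (of_nat n * 0)) * 0 ^ i)"
      using \<tau> by (intro circle_mean_eq_center[of _ "?\<rho> + 1"] holomorphic_intros holomorphic_on_subset[OF E]) auto
    moreover have "circle_mean ?\<rho> (\<lambda>\<zeta>. ?h \<zeta> * \<zeta> ^ i) =
       circle_mean ?\<rho> (\<lambda>\<zeta>. \<zeta> * (E \<zeta> * exp (- (of_nat n * \<zeta>)) * \<zeta> ^ i) - \<zeta> * (poly Q \<zeta> / W \<zeta>) * \<zeta> ^ i)"
      using \<tau> eq by (intro circle_mean_cong) auto
    moreover have "\<dots> = circle_mean ?\<rho> (\<lambda>\<zeta>. \<zeta> * (E \<zeta> * exp (- (of_nat n * \<zeta>)) * \<zeta> ^ i)) - circle_mean ?\<rho> (\<lambda>\<zeta>. \<zeta> * (poly Q \<zeta> / W \<zeta>) * \<zeta> ^ i)"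
      using \<tau> W_nz by (intro circle_mean_diff continuous_intros holomorphic_on_imp_continuous_on[OF holomorphic_W]
           holomorphic_on_imp_continuous_on[OF holomorphic_on_subset[OF E]]) auto
    ultimately show ?thesis using moment_le_degree[OF degQ i, of ?\<rho>] by simp
  qed
  obtain C where C: "\<And>s. norm s \<le> 1 \<Longrightarrow> norm (circle_mean ?\<rho> (\<lambda>\<zeta>. ?h \<zeta> * exp (of_nat n * \<zeta> * s))) \<le> C * norm s ^ n"
    using norm_circle_mean_exp_le_if_moments_zero[OF c _ n mom, of "of_nat n"] \<tau> by auto
  have "?h \<zeta> * exp (of_nat n * \<zeta> * (t + 1)) = \<zeta> * \<phi> \<zeta> * exp (of_nat n * \<zeta> * t)" for \<zeta> t
    by (simp add: exp_add[symmetric] mult.assoc) (simp add: algebra_simps)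
  then show ?thesis using C[of "t + 1" for t] by (intro that[of C]) (simp only: G_def)
qed

lemma G_factor: obtains g where "g holomorphic_on UNIV" "\<And>t. G t = (1 - t\<^sup>2) ^ n * g t"
proof -
  \<comment> \<open>The list contains 1 and - 1 with multiplicity \<open>n\<close> each, so that
    \<open>entire_quotient\<close> divides out both zeros at once.\<close>
  define z where "z i = (if i < n then 1 else - 1 :: complex)" for i :: nat
  have W2: "(\<Prod>i<2*n. t - z i) = (t - 1) ^ n * (t + 1) ^ n" for t
  proof -
    have "(\<Prod>i<2*n. t - z i) = (\<Prod>i=0..<n. t - z i) * (\<Prod>i=n..<2*n. t - z i)"
      by (simp only: lessThan_atLeast0) (rule prod.atLeastLessThan_concat[symmetric], simp_all)
    also have "(\<Prod>i=0..<n. t - z i) = (\<Prod>i=0..<n. t - 1)" by (rule prod.cong) (simp_all add: z_def)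
    also have "(\<Prod>i=n..<2*n. t - z i) = (\<Prod>i=n..<2*n. t + 1)" by (rule prod.cong) (simp_all add: z_def)
    finally show ?thesis by simp
  qed
  have O: "G \<in> O[at (z i)](\<lambda>t. (t - 1) ^ n * (t + 1) ^ n)" for i
  proof -
    have near: "eventually (\<lambda>t::complex. norm (t - z i) \<le> 1) (at (z i))"
      unfolding eventually_at by (rule exI[of _ 1]) (auto simp: dist_norm)
    have "\<exists>C. \<forall>t. norm (t - z i) \<le> 1 \<longrightarrow> norm (G t) \<le> C * norm (t - z i) ^ n"
    proof (cases "i < n")
      case True
      obtain C where "\<And>t. norm (t - 1) \<le> 1 \<Longrightarrow> norm (G t) \<le> C * norm (t - 1) ^ n" using norm_G_le_at_1 by blast
      then show ?thesis using True unfolding z_def by auto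
    next
      case False
      obtain C where "\<And>t. norm (t + 1) \<le> 1 \<Longrightarrow> norm (G t) \<le> C * norm (t + 1) ^ n" using norm_G_le_at_minus_1 by blast
      then show ?thesis using False unfolding z_def by auto
    qed
    then obtain C where C: "\<And>t. norm (t - z i) \<le> 1 \<Longrightarrow> norm (G t) \<le> C * norm (t - z i) ^ n" by blast
    from near have "eventually (\<lambda>t. norm (G t) \<le> (\<bar>C\<bar> + 1) * norm ((t - 1) ^ n * (t + 1) ^ n)) (at (z i))"
    proof eventually_elim
      case (elim t)
      have "norm (t - z i) ^ n \<le> norm ((t - 1) ^ n * (t + 1) ^ n)"
      proof -
        \<comment> \<open>Within distance 1 of one of the points \<plusminus>1, the other one is at
          distance at least 1.\<close>
        have "norm (t - z i) * 1 \<le> norm (t - 1) * norm (t + 1)"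
        proof (cases "i < n")
          case True
          then have "1 \<le> norm (t + 1)" using elim norm_triangle_ineq4[of "t + 1" "t - 1"] unfolding z_def by simp
          then show ?thesis using True by (intro mult_mono) (auto simp: z_def)
        next
          case False
          then have "1 \<le> norm (t - 1)" using elim norm_triangle_ineq4[of "t + 1" "t - 1"] unfolding z_def by simp
          then have "norm (t + 1) * 1 \<le> norm (t + 1) * norm (t - 1)" by (intro mult_mono) auto
          then show ?thesis using False by (simp add: z_def mult.commute)
        qed
        then have "norm (t - z i) ^ n \<le> (norm (t - 1) * norm (t + 1)) ^ n" by (intro power_mono) auto
        then show ?thesis by (simp only: norm_mult norm_power power_mult_distrib)
      qed
      then have "C * norm (t - z i) ^ n \<le> (\<bar>C\<bar> + 1) * norm ((t - 1) ^ n * (t + 1) ^ n)"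
        by (intro mult_mono) auto
      then show ?case using C[OF elim] by linarith
    qed
    then show ?thesis by (intro landau_o.bigI[of "\<bar>C\<bar> + 1"]) auto
  qed
  obtain g where g: "g holomorphic_on UNIV" "\<And>t. G t = (\<Prod>i<2*n. t - z i) * g t"
  proof (rule entire_quotient[OF holomorphic_G[of UNIV] finite_lessThan])
    show "G \<in> O[at (z i)](\<lambda>w. \<Prod>i<2 * n. w - z i)" for i unfolding W2 by (rule O)
  qed blast
  have "G t = (1 - t\<^sup>2) ^ n * ((-1) ^ n * g t)" for t
  proof -
    have "(1 - t\<^sup>2) ^ n * (-1) ^ n = ((1 - t\<^sup>2) * (-1)) ^ n" by (rule power_mult_distrib[symmetric])
    also have "(1 - t\<^sup>2) * (-1) = (t - 1) * (t + 1)" by (simp add: power2_eq_square algebra_simps)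
    finally have "(1 - t\<^sup>2) ^ n * (-1) ^ n = (t - 1) ^ n * (t + 1) ^ n" by (simp only: power_mult_distrib)
    then show ?thesis using g(2)[of t] unfolding W2 by (simp only: mult.assoc[symmetric])
  qed
  moreover have "(\<lambda>t. (-1) ^ n * g t) holomorphic_on UNIV" by (intro holomorphic_intros g)
  ultimately show ?thesis using that by blast
qed

text \<open>Applying \<open>D - n a\<^sub>j\<close> for all \<open>j\<close> multiplies the
  integrand by n^(2n+1) W, which cancels the denominator of \<open>\<phi>\<close>; the remaining
  integrand is entire and vanishes at 0, so its mean is 0. Hence \<open>annihilated_taylor\<close>
  applies with \<open>m = 2 * n + 1\<close> and \<open>T = n * \<tau>\<close>.\<close>

lemma norm_G_le_ratio:
  assumes r: "0 < r" and R: "0 \<le> R" and M: "\<And>t. norm t = r \<Longrightarrow> norm (G t) \<le> M" and t: "norm t \<le> R"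
  shows "norm (G t) \<le> M * exp (n * \<tau> * (r + R)) * (\<Sum>k<2*n+1. (R / r) ^ k)"
proof -
  let ?\<rho> = "\<tau> + 1"
  define b where "b k = of_nat n * a k" for k
  define h where "h k j \<zeta> = \<zeta> * \<phi> \<zeta> * ((of_nat n * \<zeta>) ^ j * (\<Prod>i<k. of_nat n * \<zeta> - b i))" for k j \<zeta>
  define d where "d k j = circle_mean ?\<rho> (h k j)" for k j
  have ch: "continuous_on (sphere 0 ?\<rho>) (h k j)" for k j
    unfolding h_def by (intro continuous_intros continuous_\<phi>) simp
  interpret annihilated_taylor d b "2 * n + 1" "n * \<tau>"
  proof
    fix k j
    show "d (Suc k) j = d k (Suc j) - b k * d k j"
    proof -
      have "d k (Suc j) - b k * d k j = d k (Suc j) - circle_mean ?\<rho> (\<lambda>\<zeta>. b k * h k j \<zeta>)"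
        by (simp add: d_def circle_mean_cmult)
      also have "\<dots> = circle_mean ?\<rho> (\<lambda>\<zeta>. h k (Suc j) \<zeta> - b k * h k j \<zeta>)"
        unfolding d_def using \<tau> by (intro circle_mean_diff[symmetric] continuous_intros ch) auto
      also have "\<dots> = d (Suc k) j" unfolding d_def h_def by (simp add: algebra_simps)
      finally show ?thesis by simp
    qed
    show "d (2 * n + 1) j = 0"
    proof -
      have W': "(\<Prod>i<2 * n + 1. of_nat n * \<zeta> - b i) = of_nat n ^ (2 * n + 1) * W \<zeta>" for \<zeta>
        by (simp add: W_def b_def right_diff_distrib[symmetric] prod.distrib lessThan_Suc_atMost)
      have "d (2 * n + 1) j = circle_mean ?\<rho> (\<lambda>\<zeta>. \<zeta> * (poly P \<zeta> * exp (- (of_nat n * \<zeta>)) * (of_nat n * \<zeta>) ^ j * of_nat n ^ (2 * n + 1)))"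
        unfolding d_def h_def W'
      proof (rule circle_mean_cong)
        fix \<zeta> :: complex assume "norm \<zeta> = ?\<rho>"
        then have "W \<zeta> \<noteq> 0" using W_nz by simp
        then show "\<zeta> * \<phi> \<zeta> * ((of_nat n * \<zeta>) ^ j * (of_nat n ^ (2 * n + 1) * W \<zeta>)) =
           \<zeta> * (poly P \<zeta> * exp (- (of_nat n * \<zeta>)) * (of_nat n * \<zeta>) ^ j * of_nat n ^ (2 * n + 1))"
          by (simp add: \<phi>_def)
      qed (use \<tau> in simp)
      also have "\<dots> = 0 * (poly P 0 * exp (- (of_nat n * 0)) * (of_nat n * 0) ^ j * of_nat n ^ (2 * n + 1))"
        using \<tau> by (intro circle_mean_eq_center[of _ "?\<rho> + 1"] holomorphic_intros) auto
      finally show ?thesis by simp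
    qed
  next
    fix k assume "k < 2 * n + 1"
    then show "norm (b k) \<le> n * \<tau>" using a[of k] by (simp add: b_def norm_mult mult_left_mono)
  qed (use \<tau> in simp)
  have d0: "d 0 j = (deriv ^^ j) G 0" for j
    by (subst higher_deriv_G[of ?\<rho>]) (simp_all add: d_def h_def[abs_def])
  have dle: "norm (d 0 j) \<le> fact j * M / r ^ j" for j
    unfolding d0
    by (rule Cauchy_inequality) (use r M in \<open>auto intro!: holomorphic_G holomorphic_on_imp_continuous_on\<close>)
  have S: "(\<lambda>j. (deriv ^^ j) G 0 / fact j * (t - 0) ^ j) sums G t"
    by (rule holomorphic_power_series[OF holomorphic_G, where r = "norm t + 1"]) (simp add: dist_norm)
  have nle: "norm ((deriv ^^ j) G 0 / fact j * (t - 0) ^ j) \<le> norm (d 0 j) * R ^ j / fact j" for j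
    unfolding d0 norm_mult norm_divide using t
    by (auto simp: norm_power intro!: divide_right_mono mult_left_mono power_mono)
  have "norm (G t) \<le> (\<Sum>j. norm (d 0 j) * R ^ j / fact j)"
    unfolding sums_unique[OF S]
    by (rule norm_suminf_le[OF nle taylor_sum_le(1)[OF dle r R]])
  also have "\<dots> \<le> M * exp (n * \<tau> * (r + R)) * (\<Sum>k<2*n+1. (R / r) ^ k)"
    by (rule taylor_sum_le(2)[OF dle r R])
  finally show ?thesis .
qed

text \<open>\<open>K 1\<close> is \<open>n\<close> times the Laplace integral of \<open>G\<close>
  from 1 to infinity. Producing an entire primitive instead of the integral makes every path
  available for its estimate, without deforming contours. The direction \<open>cnj z\<close> is the
  one in which exp (- n z t) decays fastest.\<close>

lemma Laplace_representation:
  assumes z: "\<tau> < norm z"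
  obtains K where "\<And>t. (K has_field_derivative (- of_nat n * G t * exp (- (of_nat n * z * t)))) (at t)"
    "K 1 = exp (- (of_nat n * z)) * poly P z / W z"
    "\<And>T. ((\<lambda>r. K (T + of_real r * cnj z)) \<longlongrightarrow> 0) at_top"
proof -
  \<comment> \<open>Any radius strictly between \<open>\<tau>\<close> and \<open>norm z\<close>
    would do: the zeros of \<open>W\<close> are inside the circle and \<open>z\<close> is
    outside.\<close>
  define \<rho> where "\<rho> = (\<tau> + norm z) / 2"
  have \<rho>: "\<tau> < \<rho>" "\<rho> < norm z" "0 < \<rho>" using z \<tau> by (auto simp: \<rho>_def)
  have nz: "z - \<zeta> \<noteq> 0" if "\<zeta> \<in> sphere 0 \<rho>" for \<zeta> using that \<rho> by auto
  define h where "h \<zeta> = \<zeta> * \<phi> \<zeta> / (z - \<zeta>)" for \<zeta>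
  define u where "u \<zeta> = of_nat n * (\<zeta> - z)" for \<zeta>
  have ch: "continuous_on (sphere 0 \<rho>) h" unfolding h_def
    using nz \<rho> by (intro continuous_intros continuous_\<phi>) auto
  have cu: "continuous_on (sphere 0 \<rho>) u" unfolding u_def by (intro continuous_intros)
  define K where "K t = circle_mean \<rho> (\<lambda>\<zeta>. h \<zeta> * exp (u \<zeta> * t))" for t
  have "(K has_field_derivative circle_mean \<rho> (\<lambda>\<zeta>. h \<zeta> * u \<zeta> * exp (u \<zeta> * t))) (at t)" for t
    unfolding K_def using \<rho> by (intro circle_mean_exp_has_derivative ch cu) auto
  moreover have "circle_mean \<rho> (\<lambda>\<zeta>. h \<zeta> * u \<zeta> * exp (u \<zeta> * t)) = - of_nat n * G t * exp (- (of_nat n * z * t))" for t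
  proof -
    have "circle_mean \<rho> (\<lambda>\<zeta>. h \<zeta> * u \<zeta> * exp (u \<zeta> * t)) =
      circle_mean \<rho> (\<lambda>\<zeta>. (- of_nat n * exp (- (of_nat n * z * t))) * (\<zeta> * \<phi> \<zeta> * exp (of_nat n * \<zeta> * t)))"
    proof (rule circle_mean_cong)
      fix \<zeta> :: complex assume "norm \<zeta> = \<rho>"
      then have 1: "h \<zeta> * u \<zeta> = - of_nat n * (\<zeta> * \<phi> \<zeta>)" using nz[of \<zeta>] by (simp add: h_def u_def field_simps)
      have 2: "exp (u \<zeta> * t) = exp (of_nat n * \<zeta> * t) * exp (- (of_nat n * z * t))"
        by (simp add: u_def exp_add[symmetric] algebra_simps)
      show "h \<zeta> * u \<zeta> * exp (u \<zeta> * t) = (- of_nat n * exp (- (of_nat n * z * t))) * (\<zeta> * \<phi> \<zeta> * exp (of_nat n * \<zeta> * t))"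
        unfolding 1 2 by simp
    qed (use \<rho> in simp)
    also have "\<dots> = (- of_nat n * exp (- (of_nat n * z * t))) * G t"
      by (simp only: circle_mean_cmult G_eq[OF \<rho>(1)])
    finally show ?thesis by simp
  qed
  ultimately have 1: "(K has_field_derivative (- of_nat n * G t * exp (- (of_nat n * z * t)))) (at t)" for t by simp
  have F: "(\<lambda>\<zeta>. poly P \<zeta> / W \<zeta>) holomorphic_on {\<zeta>. \<tau> < norm \<zeta>}"
    using W_nz by (intro holomorphic_intros holomorphic_W) auto
  have lim: "((\<lambda>\<zeta>. poly P \<zeta> / W \<zeta>) \<longlongrightarrow> 0) at_infinity"
    unfolding W_def using degP by (intro tendsto_poly_div_prod_at_infinity) auto
  have "K 1 = circle_mean \<rho> (\<lambda>\<zeta>. exp (- (of_nat n * z)) * (\<zeta> * (poly P \<zeta> / W \<zeta>) / (z - \<zeta>)))"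
    unfolding K_def
  proof (rule circle_mean_cong)
    fix \<zeta> :: complex assume "norm \<zeta> = \<rho>"
    have "exp (u \<zeta> * 1) = exp (of_nat n * \<zeta>) * exp (- (of_nat n * z))"
      by (simp add: u_def exp_add[symmetric] algebra_simps)
    moreover have "exp (- (of_nat n * \<zeta>)) * exp (of_nat n * \<zeta>) = 1" by (simp add: exp_add[symmetric])
    ultimately have "\<phi> \<zeta> * exp (u \<zeta> * 1) = poly P \<zeta> / W \<zeta> * exp (- (of_nat n * z))"
      by (simp add: \<phi>_def mult_ac)
    then show "h \<zeta> * exp (u \<zeta> * 1) = exp (- (of_nat n * z)) * (\<zeta> * (poly P \<zeta> / W \<zeta>) / (z - \<zeta>))"
      by (simp add: h_def mult_ac)
  qed (use \<rho> in simp)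
  also have "\<dots> = exp (- (of_nat n * z)) * (poly P z / W z)"
    by (simp only: circle_mean_cmult exterior_Cauchy_formula[OF F \<rho>(1) \<tau> lim \<rho>(2)])
  finally have 2: "K 1 = exp (- (of_nat n * z)) * poly P z / W z" by simp
  have 3: "((\<lambda>r. K (T + of_real r * cnj z)) \<longlongrightarrow> 0) at_top" for T
  proof -
    have "bounded ((\<lambda>\<zeta>. h \<zeta> * exp (u \<zeta> * T)) ` sphere 0 \<rho>)"
      by (intro compact_imp_bounded compact_continuous_image continuous_intros ch cu compact_sphere)
    then obtain B where "\<forall>x\<in>(\<lambda>\<zeta>. h \<zeta> * exp (u \<zeta> * T)) ` sphere 0 \<rho>. norm x \<le> B" by (auto simp: bounded_iff)
    then have B: "norm (h \<zeta> * exp (u \<zeta> * T)) \<le> B" if "norm \<zeta> = \<rho>" for \<zeta> using that by auto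
    define \<delta> where "\<delta> = n * norm z * (norm z - \<rho>)"
    have \<delta>: "\<delta> > 0" unfolding \<delta>_def using n \<rho> \<tau> z by (intro mult_pos_pos) auto
    have "norm (K (T + of_real r * cnj z)) \<le> B * exp (- \<delta> * r)" if r: "r \<ge> 0" for r
      unfolding K_def
    proof (rule norm_circle_mean_le)
      fix \<zeta> :: complex assume z': "norm \<zeta> = \<rho>"
      have "Re (u \<zeta> * (of_real r * cnj z)) = n * r * (Re (\<zeta> * cnj z) - (norm z)\<^sup>2)"
        unfolding cmod_power2 by (simp add: u_def algebra_simps power2_eq_square)
      also have "\<dots> \<le> n * r * (\<rho> * norm z - (norm z)\<^sup>2)"
        using r complex_Re_le_cmod[of "\<zeta> * cnj z"] by (intro mult_left_mono) (auto simp: norm_mult z')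
      also have "\<dots> = - \<delta> * r" by (simp add: \<delta>_def algebra_simps power2_eq_square)
      finally have e1: "norm (exp (u \<zeta> * (of_real r * cnj z))) \<le> exp (- \<delta> * r)" by (simp add: norm_exp_eq_Re)
      have e2: "norm (h \<zeta> * exp (u \<zeta> * (T + of_real r * cnj z))) =
          norm (h \<zeta> * exp (u \<zeta> * T)) * norm (exp (u \<zeta> * (of_real r * cnj z)))"
        unfolding norm_mult[symmetric, where x = "h \<zeta> * exp (u \<zeta> * T)"] distrib_left exp_add by (simp only: mult.assoc)
      show "norm (h \<zeta> * exp (u \<zeta> * (T + of_real r * cnj z))) \<le> B * exp (- \<delta> * r)"
        unfolding e2 by (rule mult_mono[OF B[OF z'] e1 order_trans[OF norm_ge_zero B[OF z']] norm_ge_zero])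
    qed (use \<rho> in \<open>auto intro!: continuous_intros ch cu\<close>)
    then have ev: "eventually (\<lambda>r. norm (K (T + of_real r * cnj z)) \<le> B * exp (- \<delta> * r)) at_top"
      by (intro eventually_at_top_linorderI[of 0]) auto
    have "((\<lambda>r. B * exp (- \<delta> * r)) \<longlongrightarrow> B * 0) at_top"
      using \<delta> by (intro tendsto_intros filterlim_compose[OF exp_at_bot] filterlim_tendsto_neg_mult_at_bot[OF tendsto_const] filterlim_ident) auto
    then show ?thesis by (intro Lim_null_comparison[OF ev]) (simp only: mult_zero_right)
  qed
  show ?thesis by (rule that[OF 1 2 3])
qed

text \<open>\<zeta> is a point where \<bar>P\<bar> is maximal on the circle. A large value of
  \<open>G\<close> thus forces a large value of \<open>P\<close> on each circle of radius above
  \<open>\<tau>\<close>.\<close>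

lemma norm_G_le_norm_P:
  fixes \<delta> :: real
  assumes \<delta>: "\<tau> < \<delta>"
  obtains \<zeta> where "norm \<zeta> = \<delta>" "norm (G t) \<le> \<delta> * norm (poly P \<zeta>) * exp (n * \<delta> * (1 + norm t)) / (\<delta> - \<tau>) ^ (2 * n + 1)"
proof -
  have \<delta>0: "\<delta> > 0" using \<delta> \<tau> by simp
  have "continuous_on (sphere 0 \<delta>) (\<lambda>\<zeta>. norm (poly P \<zeta>))" by (intro continuous_intros)
  then obtain \<zeta>0 where \<zeta>0: "\<zeta>0 \<in> sphere 0 \<delta>" "\<And>\<zeta>. \<zeta> \<in> sphere 0 \<delta> \<Longrightarrow> norm (poly P \<zeta>) \<le> norm (poly P \<zeta>0)"
    using continuous_attains_sup[of "sphere (0::complex) \<delta>" "\<lambda>\<zeta>. norm (poly P \<zeta>)"] \<delta>0 by auto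
  have "norm (G t) \<le> \<delta> * norm (poly P \<zeta>0) * exp (n * \<delta> * (1 + norm t)) / (\<delta> - \<tau>) ^ (2 * n + 1)"
    unfolding G_eq[OF \<delta>]
  proof (rule norm_circle_mean_le)
    fix \<zeta> :: complex assume z: "norm \<zeta> = \<delta>"
    have W: "(\<delta> - \<tau>) ^ (2 * n + 1) \<le> norm (W \<zeta>)" using norm_W_ge[of \<zeta>] z \<delta> by simp
    have Wp: "0 < (\<delta> - \<tau>) ^ (2 * n + 1)" using \<delta> by simp
    have "norm (exp (- (of_nat n * \<zeta>)) * exp (of_nat n * \<zeta> * t)) = exp (Re (of_nat n * \<zeta> * (t - 1)))"
      by (simp add: norm_exp_eq_Re exp_add[symmetric] algebra_simps)
    also have "\<dots> \<le> exp (n * \<delta> * (1 + norm t))"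
    proof -
      have "Re (of_nat n * \<zeta> * (t - 1)) \<le> norm (of_nat n * \<zeta> * (t - 1))" by (rule complex_Re_le_cmod)
      also have "\<dots> = n * \<delta> * norm (t - 1)" by (simp add: norm_mult z)
      also have "\<dots> \<le> n * \<delta> * (1 + norm t)" using norm_triangle_ineq4[of t 1] \<delta>0 by (intro mult_left_mono) auto
      finally show ?thesis by simp
    qed
    finally have e: "norm (exp (- (of_nat n * \<zeta>)) * exp (of_nat n * \<zeta> * t)) \<le> exp (n * \<delta> * (1 + norm t))" .
    have "norm (\<zeta> * \<phi> \<zeta> * exp (of_nat n * \<zeta> * t)) =
      \<delta> * norm (poly P \<zeta>) * norm (exp (- (of_nat n * \<zeta>)) * exp (of_nat n * \<zeta> * t)) / norm (W \<zeta>)"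
      by (simp add: \<phi>_def norm_mult norm_divide z)
    also have "\<dots> \<le> \<delta> * norm (poly P \<zeta>0) * exp (n * \<delta> * (1 + norm t)) / (\<delta> - \<tau>) ^ (2 * n + 1)"
      using e W Wp \<delta>0 \<zeta>0(2)[of \<zeta>] z by (intro frac_le mult_mono) auto
    finally show "norm (\<zeta> * \<phi> \<zeta> * exp (of_nat n * \<zeta> * t)) \<le> \<delta> * norm (poly P \<zeta>0) * exp (n * \<delta> * (1 + norm t)) / (\<delta> - \<tau>) ^ (2 * n + 1)" .
  qed (use \<delta> \<delta>0 in \<open>auto intro!: continuous_intros continuous_\<phi>\<close>)
  then show ?thesis using that \<zeta>0(1) by auto
qed

text \<open>If \<open>P\<close> were 0, the entire function E(w) exp (- n w) would equal Q / W far
  out and tend to 0. By Liouville it would vanish, and with it \<open>Q\<close>.\<close>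

lemma P_nz: "P \<noteq> 0"
proof
  assume P: "P = 0"
  have "(\<lambda>w. E w * exp (- (of_nat n * w))) holomorphic_on UNIV" by (intro holomorphic_intros E)
  moreover have "((\<lambda>w. E w * exp (- (of_nat n * w))) \<longlongrightarrow> 0) at_infinity"
  proof (rule Lim_transform_eventually)
    show "((\<lambda>w. poly Q w / W w) \<longlongrightarrow> 0) at_infinity"
      unfolding W_def using degQ by (intro tendsto_poly_div_prod_at_infinity) auto
    show "eventually (\<lambda>w. poly Q w / W w = E w * exp (- (of_nat n * w))) at_infinity"
    proof (rule eventually_at_infinityI[of "\<tau> + 1"])
      fix w :: complex assume "\<tau> + 1 \<le> norm w"
      then have "W w \<noteq> 0" using W_nz by simp
      then show "poly Q w / W w = E w * exp (- (of_nat n * w))"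
        using interp[of w] unfolding W_def[symmetric] P by (simp add: exp_minus field_simps)
    qed
  qed
  ultimately have "E w * exp (- (of_nat n * w)) = 0" for w by (rule Liouville_weak_0)
  then have "poly Q w = 0" for w using interp[of w] P by simp
  then have "Q = 0" by (intro poly_all_0_iff_0[THEN iffD1] allI)
  then show False using P PQ by simp
qed

text \<open>Were \<open>G\<close> zero, the primitive \<open>K\<close> of the Laplace representation
  would be constant and tend to 0, so \<open>P\<close> would vanish outside a disc.\<close>

lemma G_not_identically_zero: "\<exists>t. G t \<noteq> 0"
proof (rule ccontr)
  assume "\<not> ?thesis"
  then have G0: "G t = 0" for t by simp
  have "poly P z = 0" if z: "\<tau> < norm z" for z
  proof -
    obtain K where K: "\<And>t. (K has_field_derivative (- of_nat n * G t * exp (- (of_nat n * z * t)))) (at t)"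
      "K 1 = exp (- (of_nat n * z)) * poly P z / W z" "\<And>T. ((\<lambda>r. K (T + of_real r * cnj z)) \<longlongrightarrow> 0) at_top"
      by (rule Laplace_representation[OF z]) blast
    have "K constant_on UNIV"
      using K(1) by (intro has_field_derivative_0_imp_constant_on) (auto simp: G0)
    then obtain c where c: "\<And>t. K t = c" by (auto simp: constant_on_def)
    have "c = 0" using K(3)[of 0] unfolding c by (simp add: tendsto_const_iff)
    then show ?thesis using K(2) W_nz[OF z] by (simp add: c)
  qed
  then have "{z. \<tau> < norm z} \<subseteq> {z. poly P z = 0}" by auto
  then have "finite {z::complex. \<tau> < norm z}" using P_nz poly_roots_finite finite_subset by blast
  moreover have "(\<lambda>k::nat. of_real (\<tau> + 1 + k) :: complex) ` UNIV \<subseteq> {z. \<tau> < norm z}"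
    using \<tau> by (auto simp: norm_of_real simp del: of_real_add of_real_of_nat_eq)
  moreover have "infinite ((\<lambda>k::nat. of_real (\<tau> + 1 + k) :: complex) ` UNIV)"
    by (intro range_inj_infinite injI) (simp del: of_real_add of_real_of_nat_eq)
  ultimately show False using finite_subset by blast
qed

end

section \<open>Paths through the critical points\<close>

text \<open>The modulus of (1 - t^2) exp (- z t). Its \<open>n\<close>-th power is, up to
  subexponential factors, the bound for G(t) exp (- n z t) relative to \<open>N n\<close>. The
  critical points are the solutions of \<open>z * (t\<^sup>2 - 1) = 2 * t\<close>.\<close>

definition height :: "complex \<Rightarrow> complex \<Rightarrow> real" where
  "height z t = norm (1 - t\<^sup>2) * exp (- Re (z * t))"

lemma height_nonneg: "0 \<le> height z t" by (simp add: height_def)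

lemma height_minus: "height (- z) (- t) = height z t" by (simp add: height_def)

lemma one_plus_le_exp_minus_half_sq:
  fixes \<mu> :: real
  assumes "- 1 < \<mu>" "\<mu> \<le> 0"
  shows "1 + \<mu> \<le> exp (\<mu> - \<mu>\<^sup>2 / 2)"
proof -
  have "(\<lambda>x. x - x\<^sup>2 / 2 - ln (1 + x)) 0 \<le> (\<lambda>x. x - x\<^sup>2 / 2 - ln (1 + x)) \<mu>"
  proof (rule DERIV_nonpos_imp_nonincreasing[OF assms(2)])
    fix x assume x: "\<mu> \<le> x" "x \<le> 0"
    have "((\<lambda>x. x - x\<^sup>2 / 2 - ln (1 + x)) has_real_derivative 1 - x - 1 / (1 + x)) (at x)"
      using x assms by (auto intro!: derivative_eq_intros)
    moreover have "1 - x - 1 / (1 + x) \<le> 0"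
      using x assms by (simp add: field_simps power2_eq_square)
    ultimately show "\<exists>y. ((\<lambda>x. x - x\<^sup>2 / 2 - ln (1 + x)) has_real_derivative y) (at x) \<and> y \<le> 0" by blast
  qed
  then have "ln (1 + \<mu>) \<le> \<mu> - \<mu>\<^sup>2 / 2" by simp
  then show ?thesis using assms by (metis add.commute exp_le_cancel_iff exp_ln less_add_same_cancel2 minus_less_iff neg_less_iff_less add_uminus_conv_diff diff_gt_0_iff_gt minus_minus)
qed

lemma critical_point_ne:
  fixes T z :: complex
  assumes "z * (T\<^sup>2 - 1) = 2 * T"
  shows "T \<noteq> 1" "T \<noteq> - 1"
  using assms by auto

text \<open>Relative to its value at \<open>T\<close>, the function (1 - t^2) exp (- z t) acquires
  at parameter \<open>l = 1 + \<mu>\<close> the factors 1 + \<mu>, 1 + \<mu> e and exp (- \<mu> (1 +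
  e)) with \<open>e = (T + 1) / (T - 1)\<close>. The linear terms cancel because \<open>T\<close> is
  critical. The logarithms of the first two have quadratic terms - \<mu>^2 / 2 and at most \<mu>^2 /
  2, the latter because \<open>Re T \<le> 0\<close> makes \<open>norm e \<le> 1\<close>.\<close>

lemma height_segment_minus_one_le:
  assumes T: "z * (T\<^sup>2 - 1) = 2 * T" and Re: "Re T \<le> 0" and l: "0 \<le> l" "l \<le> 1"
  shows "height z (- 1 + of_real l * (T + 1)) \<le> height z T"
proof (cases "l = 0")
  case True
  then show ?thesis by (simp add: height_nonneg) (simp add: height_def)
next
  case False
  note ne = critical_point_ne[OF T]
  define \<mu> where "\<mu> = l - 1"
  have \<mu>: "- 1 < \<mu>" "\<mu> \<le> 0" "l = 1 + \<mu>" using l False by (auto simp: \<mu>_def)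
  define e where "e = (T + 1) / (T - 1)"
  have e1: "norm e \<le> 1"
  proof -
    have "norm (T + 1) ^ 2 \<le> norm (T - 1) ^ 2"
      using Re by (simp add: cmod_power2) (simp add: power2_eq_square algebra_simps)
    then have "norm (T + 1) \<le> norm (T - 1)" by (rule power2_le_imp_le) simp
    then show ?thesis using ne by (simp add: e_def norm_divide divide_simps)
  qed
  define t where "t = - 1 + of_real l * (T + 1)"
  have f1: "1 - t\<^sup>2 = (1 - T\<^sup>2) * (of_real l * (1 + of_real \<mu> * e))"
  proof -
    have "of_real \<mu> = of_real l - (1::complex)" by (simp add: \<mu>_def)
    then show ?thesis using ne unfolding t_def e_def by (simp add: divide_simps) (simp add: power2_eq_square algebra_simps)
  qed
  have f2: "z * t = z * T + of_real \<mu> * (1 + e)"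
  proof -
    have zt: "z * (T + 1) = 1 + e"
    proof -
      have "z * (T + 1) * (T - 1) = 2 * T" using T by (simp add: power2_eq_square algebra_simps)
      then show ?thesis using ne by (simp add: e_def field_simps)
    qed
    have "t = T + of_real \<mu> * (T + 1)" by (simp add: t_def \<mu>_def algebra_simps)
    then have "z * t = z * T + of_real \<mu> * (z * (T + 1))" by (simp add: algebra_simps)
    then show ?thesis by (simp only: zt)
  qed
  have g1: "norm (1 + of_real \<mu> * e) \<le> exp (\<mu> * Re e + \<mu>\<^sup>2 / 2)"
  proof (rule power2_le_imp_le)
    have "norm (1 + of_real \<mu> * e) ^ 2 = 1 + 2 * \<mu> * Re e + \<mu>\<^sup>2 * (norm e)\<^sup>2"
      by (simp add: cmod_power2) (simp add: power2_eq_square algebra_simps)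
    also have "\<dots> \<le> 1 + (2 * \<mu> * Re e + \<mu>\<^sup>2)"
      using e1 power_le_one[of "norm e" 2] mult_left_mono[of "(norm e)\<^sup>2" 1 "\<mu>\<^sup>2"] by simp
    also have "\<dots> \<le> exp (2 * \<mu> * Re e + \<mu>\<^sup>2)" by (rule exp_ge_add_one_self)
    also have "\<dots> = exp (\<mu> * Re e + \<mu>\<^sup>2 / 2) ^ 2" by (simp add: exp_double[symmetric] algebra_simps)
    finally show "norm (1 + of_real \<mu> * e) ^ 2 \<le> exp (\<mu> * Re e + \<mu>\<^sup>2 / 2) ^ 2" .
  qed simp
  have "l * norm (1 + of_real \<mu> * e) \<le> exp (\<mu> - \<mu>\<^sup>2 / 2) * exp (\<mu> * Re e + \<mu>\<^sup>2 / 2)"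
    using one_plus_le_exp_minus_half_sq[OF \<mu>(1,2)] g1 l \<mu>(3) by (intro mult_mono) auto
  also have "\<dots> = exp (\<mu> * (1 + Re e))" by (simp add: exp_add[symmetric] algebra_simps)
  finally have "l * norm (1 + of_real \<mu> * e) * exp (- (\<mu> * (1 + Re e))) \<le> exp (\<mu> * (1 + Re e)) * exp (- (\<mu> * (1 + Re e)))"
    by (intro mult_right_mono) auto
  then have "l * norm (1 + of_real \<mu> * e) * exp (- (\<mu> * (1 + Re e))) \<le> 1" by (simp add: exp_add[symmetric])
  then have "height z T * (l * norm (1 + of_real \<mu> * e) * exp (- (\<mu> * (1 + Re e)))) \<le> height z T * 1"
    by (intro mult_left_mono height_nonneg)
  moreover have "height z t = height z T * (l * norm (1 + of_real \<mu> * e) * exp (- (\<mu> * (1 + Re e))))"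
  proof -
    have "Re (z * t) = Re (z * T) + \<mu> * (1 + Re e)" unfolding f2 by simp
    then have "exp (- Re (z * t)) = exp (- Re (z * T)) * exp (- (\<mu> * (1 + Re e)))" by (simp only: exp_add[symmetric]) simp
    then show ?thesis using l unfolding height_def f1 by (simp add: norm_mult)
  qed
  ultimately show ?thesis by (simp add: t_def)
qed

lemma height_segment_one_le:
  assumes T: "z * (T\<^sup>2 - 1) = 2 * T" and Re: "0 \<le> Re T" and l: "0 \<le> l" "l \<le> 1"
  shows "height z (1 + of_real l * (T - 1)) \<le> height z T"
proof -
  have "height (- z) (- 1 + of_real l * (- T + 1)) \<le> height (- z) (- T)"
    using assms by (intro height_segment_minus_one_le) auto
  moreover have "- 1 + of_real l * (- T + 1) = - (1 + of_real l * (T - 1))" by (simp add: algebra_simps)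
  ultimately show ?thesis by (simp only: height_minus)
qed

text \<open>In the direction \<open>cnj z\<close> the product of the increment \<rho> with
  \<open>z\<close> is the real number \<open>k\<close>, and criticality gives 1 - (T + \<rho>)^2 =
  (1 - T^2) (1 + k + \<rho>^2 / (T^2 - 1)). From \<open>1 \<le> norm T\<close> one gets \<bar>T^2 -
  1\<bar> \<le> 2 \<bar>T\<bar>^2, which bounds the last term by k^2 / 2. Since 1 + k + k^2 / 2
  starts the series of exp k, the height never exceeds its value at \<open>T\<close>.\<close>

lemma height_ray_le:
  assumes T: "z * (T\<^sup>2 - 1) = 2 * T" and nT: "1 \<le> norm T" and r: "0 \<le> r" and k: "k = r * (norm z)\<^sup>2"
  shows "height z (T + of_real r * cnj z) \<le> height z T * ((1 + k + k\<^sup>2 / 2) * exp (- k))"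
proof -
  note ne = critical_point_ne[OF T]
  define \<rho> where "\<rho> = of_real r * cnj z"
  have zc: "z * cnj z = of_real ((norm z)\<^sup>2)" by (rule complex_norm_square[symmetric])
  have \<rho>z: "\<rho> * z = of_real k" using zc by (simp add: \<rho>_def k mult_ac)
  have T21: "T\<^sup>2 - 1 \<noteq> 0" using ne by (simp add: power2_eq_1_iff)
  have f1: "1 - (T + \<rho>)\<^sup>2 = (1 - T\<^sup>2) * (1 + \<rho> * z + \<rho>\<^sup>2 / (T\<^sup>2 - 1))"
  proof -
    have "(T\<^sup>2 - 1) * (1 + \<rho> * z + \<rho>\<^sup>2 / (T\<^sup>2 - 1)) = (T\<^sup>2 - 1) + \<rho> * (z * (T\<^sup>2 - 1)) + \<rho>\<^sup>2"
      using T21 by (simp add: field_simps)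
    also have "\<dots> = (T + \<rho>)\<^sup>2 - 1" unfolding T by (simp add: power2_eq_square algebra_simps)
    finally have "(T\<^sup>2 - 1) * (1 + \<rho> * z + \<rho>\<^sup>2 / (T\<^sup>2 - 1)) = (T + \<rho>)\<^sup>2 - 1" .
    then show ?thesis by (metis minus_diff_eq mult_minus_left)
  qed
  have nz: "norm z * norm (T\<^sup>2 - 1) = 2 * norm T" using T by (metis norm_mult norm_numeral)
  have T2: "norm (T\<^sup>2 - 1) \<le> 2 * (norm T)\<^sup>2"
  proof -
    have "norm (T\<^sup>2 - 1) \<le> (norm T)\<^sup>2 + 1" using norm_triangle_ineq4[of "T\<^sup>2" 1] by (simp add: norm_power)
    moreover have "1 \<le> (norm T)\<^sup>2" by (rule one_le_power[OF nT])
    ultimately show ?thesis by linarith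
  qed
  have "(norm z)\<^sup>2 * (norm (T\<^sup>2 - 1))\<^sup>2 = 4 * (norm T)\<^sup>2" using nz by (metis power_mult_distrib four_x_squared)
  also have "\<dots> \<ge> 2 * norm (T\<^sup>2 - 1)" using T2 by simp
  finally have "2 * norm (T\<^sup>2 - 1) \<le> (norm z)\<^sup>2 * norm (T\<^sup>2 - 1) * norm (T\<^sup>2 - 1)" by (simp add: power2_eq_square mult.assoc)
  then have z2: "2 \<le> (norm z)\<^sup>2 * norm (T\<^sup>2 - 1)" using T21 by (intro mult_right_le_imp_le[of 2 "norm (T\<^sup>2 - 1)"]) auto
  have n2: "norm (\<rho>\<^sup>2 / (T\<^sup>2 - 1)) \<le> k\<^sup>2 / 2"
  proof -
    have "norm (\<rho>\<^sup>2 / (T\<^sup>2 - 1)) = r\<^sup>2 * (norm z)\<^sup>2 / norm (T\<^sup>2 - 1)"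
      by (simp add: \<rho>_def norm_divide norm_mult norm_power power_mult_distrib)
    also have "\<dots> \<le> r\<^sup>2 * (norm z)\<^sup>2 * ((norm z)\<^sup>2 / 2)"
      using T21 z2 mult_left_mono[OF z2, of "r\<^sup>2 * (norm z)\<^sup>2"] by (simp add: divide_simps mult_ac)
    also have "\<dots> = k\<^sup>2 / 2" by (simp add: k power2_eq_square)
    finally show ?thesis .
  qed
  have k0: "0 \<le> k" using r by (simp add: k)
  have "norm (1 + \<rho> * z + \<rho>\<^sup>2 / (T\<^sup>2 - 1)) \<le> norm (1 + \<rho> * z) + norm (\<rho>\<^sup>2 / (T\<^sup>2 - 1))" by (rule norm_triangle_ineq)
  also have "norm (1 + \<rho> * z) = 1 + k" using k0 unfolding \<rho>z by (metis norm_of_real of_real_1 of_real_add abs_of_nonneg add_nonneg_nonneg zero_le_one)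
  finally have n3: "norm (1 + \<rho> * z + \<rho>\<^sup>2 / (T\<^sup>2 - 1)) \<le> 1 + k + k\<^sup>2 / 2" using n2 by simp
  have "Re (z * (T + \<rho>)) = Re (z * T) + k" using \<rho>z by (simp add: distrib_left mult.commute[of z \<rho>] del: times_complex.sel)
  then have "exp (- Re (z * (T + \<rho>))) = exp (- Re (z * T)) * exp (- k)" by (simp only: exp_add[symmetric]) simp
  then have "height z (T + \<rho>) = height z T * (norm (1 + \<rho> * z + \<rho>\<^sup>2 / (T\<^sup>2 - 1)) * exp (- k))"
    unfolding height_def f1 by (simp add: norm_mult)
  also have "\<dots> \<le> height z T * ((1 + k + k\<^sup>2 / 2) * exp (- k))"
    by (intro mult_left_mono mult_right_mono n3 height_nonneg) auto
  finally show ?thesis by (simp add: \<rho>_def)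
qed

text \<open>The circular arcs through \<open>\<plusminus>1\<close>: in the coordinate \<open>(1 + t) / (1 - t)\<close> they are the rays from \<open>0\<close>.\<close>

lemma height_arc_point:
  fixes u :: complex
  assumes u: "norm u = 1" and \<kappa>: "0 < \<kappa>" and c: "0 \<le> Re u"
    and t: "t = (of_real \<kappa> * u - 1) / (of_real \<kappa> * u + 1)" and X: "X = \<kappa> + 1 / \<kappa> + 2 * Re u"
  shows "norm (1 - t\<^sup>2) = 4 / X" "t = Complex ((\<kappa> - 1 / \<kappa>) / X) (2 * Im u / X)"
proof -
  define w where "w = of_real \<kappa> * u"
  have Rw: "Re w = \<kappa> * Re u" "Im w = \<kappa> * Im u" by (auto simp: w_def)
  have uu: "Re u * Re u + Im u * Im u = 1" using u cmod_power2[of u] by (simp add: power2_eq_square)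
  have "0 \<le> Re w" using \<kappa> c by (simp add: Rw)
  then have w1: "w + 1 \<noteq> 0" by (auto simp: complex_eq_iff)
  have X0: "X > 0" using \<kappa> c by (simp add: X add_pos_nonneg)
  have nw: "norm w = \<kappa>" using u \<kappa> by (simp add: w_def norm_mult)
  have n1: "(norm (w + 1))\<^sup>2 = \<kappa> * X"
  proof -
    have "(norm (w + 1))\<^sup>2 = \<kappa> * \<kappa> * (Re u * Re u + Im u * Im u) + 2 * \<kappa> * Re u + 1"
      by (simp add: cmod_power2 Rw) (simp add: power2_eq_square algebra_simps)
    then show ?thesis using \<kappa> unfolding uu by (simp add: X field_simps)
  qed
  have tw: "t = (w - 1) / (w + 1)" by (simp add: t w_def)
  have "1 - t\<^sup>2 = 4 * w / (w + 1)\<^sup>2" using w1 unfolding tw by (simp add: power2_eq_square divide_simps) (simp add: algebra_simps)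
  then have "norm (1 - t\<^sup>2) = 4 * \<kappa> / (\<kappa> * X)" using nw n1 by (simp add: norm_divide norm_mult norm_power)
  then show "norm (1 - t\<^sup>2) = 4 / X" using \<kappa> by simp
  have cw: "cnj (w + 1) \<noteq> 0" using w1 by (simp only: complex_cnj_zero_iff) simp
  have "t = ((w - 1) * cnj (w + 1)) / ((w + 1) * cnj (w + 1))" unfolding tw using cw by simp
  also have "(w + 1) * cnj (w + 1) = of_real (\<kappa> * X)" using n1 by (simp only: complex_norm_square[symmetric])
  also have "(w - 1) * cnj (w + 1) = of_real \<kappa> * Complex (\<kappa> - 1 / \<kappa>) (2 * Im u)"
  proof -
    have "Re ((w - 1) * cnj (w + 1)) = \<kappa> * \<kappa> * (Re u * Re u + Im u * Im u) - 1" by (simp add: Rw algebra_simps)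
    then have "Re ((w - 1) * cnj (w + 1)) = \<kappa> * \<kappa> - 1" by (simp only: uu mult_1_right)
    moreover have "Im ((w - 1) * cnj (w + 1)) = 2 * \<kappa> * Im u" by (simp add: Rw algebra_simps)
    ultimately show ?thesis using \<kappa> by (auto intro!: complex_eqI simp: right_diff_distrib)
  qed
  also have "of_real \<kappa> * Complex (\<kappa> - 1 / \<kappa>) (2 * Im u) / of_real (\<kappa> * X) = Complex ((\<kappa> - 1 / \<kappa>) / X) (2 * Im u / X)"
    using \<kappa> X0 by (simp add: complex_eq_iff divide_simps)
  finally show "t = Complex ((\<kappa> - 1 / \<kappa>) / X) (2 * Im u / X)" .
qed

text \<open>With \<kappa> = exp x and u = exp (\<i> \<theta>), \<open>C\<close> and \<open>S\<close>
  are cosh x and sinh x, and 1 - t^2 has modulus 2 / (cosh x + cos \<theta>). The claim comes down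
  to cosh (x - x0) \<ge> 1, where x0 belongs to \<open>T\<close>, and to 1 + v \<le> exp v.\<close>

lemma height_arc_le:
  fixes u :: complex
  assumes T: "z * (T\<^sup>2 - 1) = 2 * T" and u: "norm u = 1" and c: "0 \<le> Re u"
    and T0: "0 < \<kappa>\<^sub>0" "T = (of_real \<kappa>\<^sub>0 * u - 1) / (of_real \<kappa>\<^sub>0 * u + 1)"
    and t: "0 < \<kappa>" "t = (of_real \<kappa> * u - 1) / (of_real \<kappa> * u + 1)"
  shows "height z t \<le> height z T"
proof -
  define X where "X k = k + 1 / k + 2 * Re u" for k
  have X0: "X k > 0" if "k > 0" for k using that c by (simp add: X_def add_pos_nonneg)
  have uu: "Re u * Re u + Im u * Im u = 1" using u cmod_power2[of u] by (simp add: power2_eq_square)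
  then have ii: "Im u * Im u = 1 - Re u * Re u" by simp
  note At = height_arc_point[OF u t(1) c t(2) X_def]
  note AT = height_arc_point[OF u T0(1) c T0(2) X_def]
  define w where "w = of_real \<kappa>\<^sub>0 * u"
  have "0 \<le> Re w" using T0 c by (simp add: w_def)
  then have "w + 1 \<noteq> 0" by (auto simp: complex_eq_iff)
  moreover have "w \<noteq> 0" using u T0(1) by (auto simp: w_def)
  ultimately have w1: "w + 1 \<noteq> 0" "w \<noteq> 0" .
  have zw: "z = - (w - 1 / w) / 2"
  proof -
    have "T\<^sup>2 - 1 = - 4 * w / (w + 1)\<^sup>2" using w1 unfolding T0(2) w_def[symmetric]
      by (simp add: power2_eq_square divide_simps) (simp add: algebra_simps)
    then have "z * (- 4 * w / (w + 1)\<^sup>2) = 2 * ((w - 1) / (w + 1))" using T by (simp add: T0(2) w_def)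
    then have "z * (- 4 * w / (w + 1)\<^sup>2) * (w + 1)\<^sup>2 = 2 * ((w - 1) / (w + 1)) * (w + 1)\<^sup>2" by simp
    then have "z * (- 4 * w) = 2 * (w - 1) * (w + 1)" using w1 by (simp add: power2_eq_square)
    moreover have "- (w - 1 / w) / 2 * (- 4 * w) = 2 * (w - 1) * (w + 1)" using w1 by (simp add: field_simps)
    ultimately have "z * (- 4 * w) = - (w - 1 / w) / 2 * (- 4 * w)" by simp
    moreover have "- 4 * w \<noteq> 0" using w1 by simp
    ultimately show ?thesis by (metis mult_right_cancel)
  qed
  have iw: "1 / w = of_real (1 / \<kappa>\<^sub>0) * cnj u"
  proof -
    have "u * cnj u = 1" using u by (simp add: complex_norm_square[symmetric])
    then show ?thesis using w1 T0 by (simp add: w_def field_simps)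
  qed
  define C S where "C k = (k + 1 / k) / 2" and "S k = (k - 1 / k) / 2" for k :: real
  have Rz: "Re z = - Re u * S \<kappa>\<^sub>0" "Im z = - Im u * C \<kappa>\<^sub>0"
    unfolding zw iw by (auto simp: w_def C_def S_def algebra_simps diff_divide_distrib add_divide_distrib)
  have Rzt: "X k * Re (z * Complex ((k - 1 / k) / X k) (2 * Im u / X k)) = - 2 * Re u * S \<kappa>\<^sub>0 * S k + 2 * (1 - Re u * Re u) * C \<kappa>\<^sub>0"
    if "k > 0" for k
  proof -
    have "X k * Re (z * Complex ((k - 1 / k) / X k) (2 * Im u / X k)) = Re z * (2 * S k) - Im z * (2 * Im u)"
      using X0[OF that] by (simp add: S_def field_simps)
    also have "\<dots> = - 2 * Re u * S \<kappa>\<^sub>0 * S k + 2 * (Im u * Im u) * C \<kappa>\<^sub>0" unfolding Rz by (simp add: algebra_simps)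
    finally show ?thesis unfolding ii .
  qed
  have CS: "C k * C k - S k * S k = 1" if "k > 0" for k using that by (simp add: C_def S_def field_simps power2_eq_square)
  have XC: "X k = 2 * (C k + Re u)" for k by (simp add: X_def C_def field_simps)
  have RT: "Re (z * T) = 1 - Re u * C \<kappa>\<^sub>0"
  proof -
    have "X \<kappa>\<^sub>0 * Re (z * T) = X \<kappa>\<^sub>0 * (1 - Re u * C \<kappa>\<^sub>0)"
    proof -
      have "X \<kappa>\<^sub>0 * Re (z * T) = - 2 * Re u * (S \<kappa>\<^sub>0 * S \<kappa>\<^sub>0) + 2 * (1 - Re u * Re u) * C \<kappa>\<^sub>0"
        unfolding AT(2) Rzt[OF T0(1)] by simp
      also have "S \<kappa>\<^sub>0 * S \<kappa>\<^sub>0 = C \<kappa>\<^sub>0 * C \<kappa>\<^sub>0 - 1" using CS[OF T0(1)] by simp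
      finally show ?thesis unfolding XC by (simp add: algebra_simps)
    qed
    then show ?thesis using X0[OF T0(1)] by simp
  qed
  have cosh: "1 \<le> C \<kappa>\<^sub>0 * C \<kappa> - S \<kappa>\<^sub>0 * S \<kappa>"
  proof -
    have "C \<kappa>\<^sub>0 * C \<kappa> - S \<kappa>\<^sub>0 * S \<kappa> = (\<kappa>\<^sub>0 / \<kappa> + \<kappa> / \<kappa>\<^sub>0) / 2" using T0(1) t(1) by (simp add: C_def S_def field_simps)
    moreover have "2 \<le> \<kappa>\<^sub>0 / \<kappa> + \<kappa> / \<kappa>\<^sub>0"
    proof -
      have "0 \<le> (\<kappa>\<^sub>0 - \<kappa>)\<^sup>2" by simp
      then have "2 * (\<kappa>\<^sub>0 * \<kappa>) \<le> \<kappa>\<^sub>0 * \<kappa>\<^sub>0 + \<kappa> * \<kappa>" by (simp add: power2_eq_square algebra_simps)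
      then show ?thesis using T0(1) t(1) by (simp add: field_simps)
    qed
    ultimately show ?thesis by simp
  qed
  have "X \<kappa>\<^sub>0 - X \<kappa> \<le> X \<kappa> * (Re (z * t) - Re (z * T))"
  proof -
    have "X \<kappa> * (Re (z * t) - Re (z * T)) = - 2 * Re u * S \<kappa>\<^sub>0 * S \<kappa> + 2 * (1 - Re u * Re u) * C \<kappa>\<^sub>0 - X \<kappa> * (1 - Re u * C \<kappa>\<^sub>0)"
      unfolding RT right_diff_distrib At(2) Rzt[OF t(1)] by simp
    also have "\<dots> = X \<kappa>\<^sub>0 - X \<kappa> + 2 * Re u * (C \<kappa>\<^sub>0 * C \<kappa> - S \<kappa>\<^sub>0 * S \<kappa> - 1)" unfolding XC by (simp add: algebra_simps)
    finally show ?thesis using cosh c by simp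
  qed
  then have "X \<kappa>\<^sub>0 / X \<kappa> \<le> 1 + (Re (z * t) - Re (z * T))" using X0[OF t(1)] by (simp add: field_simps)
  also have "\<dots> \<le> exp (Re (z * t) - Re (z * T))" by (rule exp_ge_add_one_self)
  finally have "X \<kappa>\<^sub>0 / X \<kappa> \<le> exp (Re (z * t) - Re (z * T))" .
  moreover have "4 / x * exp (- p) \<le> 4 / y * exp (- q)" if "y / x \<le> exp (p - q)" "0 < x" "0 < y" for x y p q :: real
    using that by (simp add: exp_diff exp_minus field_simps)
  ultimately have "4 / X \<kappa> * exp (- Re (z * t)) \<le> 4 / X \<kappa>\<^sub>0 * exp (- Re (z * T))"
    using X0[OF t(1)] X0[OF T0(1)] by blast
  then show ?thesis unfolding height_def At(1) AT(1) .
qed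

text \<open>Setting \<open>\<kappa> = l / (1 - l)\<close> parametrizes the arc from - 1 to 1
  including both ends. The bound on the denominator later limits the speed to 4.\<close>

lemma arc_parametrization:
  fixes u :: complex
  assumes u: "norm u = 1" and c: "0 \<le> Re u" and l: "0 \<le> l" "l \<le> 1"
  shows "1 / 2 \<le> (norm (of_real l * u + (1 - of_real l)))\<^sup>2"
    and "norm ((of_real l * u - (1 - of_real l)) / (of_real l * u + (1 - of_real l))) \<le> 1"
proof -
  have uu: "Re u * Re u + Im u * Im u = 1" using u cmod_power2[of u] by (simp add: power2_eq_square)
  have n: "(norm (of_real l * u + (1 - of_real l)))\<^sup>2 = l * l * (Re u * Re u + Im u * Im u) + (1 - l)\<^sup>2 + 2 * l * (1 - l) * Re u"
    by (simp add: cmod_power2) (simp add: power2_eq_square algebra_simps)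
  have "0 \<le> (2 * l - 1)\<^sup>2" by simp
  then have "1 / 2 \<le> l * l + (1 - l)\<^sup>2" by (simp add: power2_eq_square algebra_simps)
  moreover have "0 \<le> 2 * l * (1 - l) * Re u" using l c by simp
  ultimately show a: "1 / 2 \<le> (norm (of_real l * u + (1 - of_real l)))\<^sup>2" unfolding n uu mult_1_right by linarith
  have "(norm (of_real l * u + (1 - of_real l)))\<^sup>2 - (norm (of_real l * u - (1 - of_real l)))\<^sup>2 = 4 * (l * (1 - l) * Re u)"
    by (simp add: cmod_power2) (simp add: power2_eq_square algebra_simps)
  moreover have "0 \<le> l * (1 - l) * Re u" using l c by simp
  ultimately have "(norm (of_real l * u - (1 - of_real l)))\<^sup>2 \<le> (norm (of_real l * u + (1 - of_real l)))\<^sup>2" by linarith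
  then have "norm (of_real l * u - (1 - of_real l)) \<le> norm (of_real l * u + (1 - of_real l))" by (rule power2_le_imp_le) simp
  moreover have "norm (of_real l * u + (1 - of_real l)) > 0" using a by (auto simp: zero_less_norm_iff)
  ultimately show "norm ((of_real l * u - (1 - of_real l)) / (of_real l * u + (1 - of_real l))) \<le> 1"
    by (simp add: norm_divide)
qed

section \<open>The two critical points and their heights\<close>

definition root_plus :: "complex \<Rightarrow> complex" where "root_plus z = (1 + csqrt (z\<^sup>2 + 1)) / z"
definition root_minus :: "complex \<Rightarrow> complex" where "root_minus z = (1 - csqrt (z\<^sup>2 + 1)) / z"

lemma root_critical:
  assumes "z \<noteq> 0"
  shows "z * ((root_plus z)\<^sup>2 - 1) = 2 * root_plus z" "z * ((root_minus z)\<^sup>2 - 1) = 2 * root_minus z"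
    "root_plus z * root_minus z = - 1"
proof -
  define s where "s = csqrt (z\<^sup>2 + 1)"
  have s: "s * s = z * z + 1" using power2_csqrt[of "z\<^sup>2 + 1"] by (simp add: s_def power2_eq_square)
  have 1: "z * (((1 + s) / z)\<^sup>2 - 1) = ((1 + 2 * s + s * s) - z * z) / z"
    and 2: "z * (((1 - s) / z)\<^sup>2 - 1) = ((1 - 2 * s + s * s) - z * z) / z"
    using assms by (simp_all add: power2_eq_square field_simps)
  show "z * ((root_plus z)\<^sup>2 - 1) = 2 * root_plus z"
    unfolding root_plus_def s_def[symmetric] 1 s by simp
  show "z * ((root_minus z)\<^sup>2 - 1) = 2 * root_minus z"
    unfolding root_minus_def s_def[symmetric] 2 s by (simp add: diff_divide_distrib)
  have "(1 + s) * (1 - s) = - (z * z)" using s by (simp add: algebra_simps)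
  then show "root_plus z * root_minus z = - 1" using assms
    unfolding root_plus_def root_minus_def s_def[symmetric] by (simp add: field_simps)
qed

lemma height_root:
  assumes "z \<noteq> 0"
  shows "height z (root_plus z) = 2 * norm (1 + csqrt (z\<^sup>2 + 1)) / (norm z)\<^sup>2 * exp (- 1 - Re (csqrt (z\<^sup>2 + 1)))"
    "height z (root_minus z) = 2 * norm (1 - csqrt (z\<^sup>2 + 1)) / (norm z)\<^sup>2 * exp (- 1 + Re (csqrt (z\<^sup>2 + 1)))"
proof -
  have n: "norm (1 - T\<^sup>2) = 2 * norm T / norm z" if "z * (T\<^sup>2 - 1) = 2 * T" for T
  proof -
    have "norm z * norm (T\<^sup>2 - 1) = 2 * norm T" using that by (metis norm_mult norm_numeral)
    then show ?thesis using assms by (simp add: field_simps norm_minus_commute)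
  qed
  have e: "z * root_plus z = 1 + csqrt (z\<^sup>2 + 1)" "z * root_minus z = 1 - csqrt (z\<^sup>2 + 1)"
    using assms by (simp_all add: root_plus_def root_minus_def)
  show "height z (root_plus z) = 2 * norm (1 + csqrt (z\<^sup>2 + 1)) / (norm z)\<^sup>2 * exp (- 1 - Re (csqrt (z\<^sup>2 + 1)))"
    unfolding height_def e n[OF root_critical(1)[OF assms]]
    by (simp add: root_plus_def norm_divide power2_eq_square del: csqrt.sel)
  show "height z (root_minus z) = 2 * norm (1 - csqrt (z\<^sup>2 + 1)) / (norm z)\<^sup>2 * exp (- 1 + Re (csqrt (z\<^sup>2 + 1)))"
    unfolding height_def e n[OF root_critical(2)[OF assms]]
    by (simp add: root_minus_def norm_divide power2_eq_square del: csqrt.sel)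
qed

lemma Re_csqrt_pos:
  assumes "Re z \<noteq> 0"
  shows "0 < Re (csqrt (z\<^sup>2 + 1))"
proof -
  define s where "s = csqrt (z\<^sup>2 + 1)"
  have s: "s\<^sup>2 = z\<^sup>2 + 1" by (simp only: s_def power2_csqrt)
  have "Re s \<noteq> 0"
  proof
    assume 0: "Re s = 0"
    have "Im (s\<^sup>2) = Im (z\<^sup>2)" using s by simp
    then have "Im z = 0" using 0 assms by (simp add: Im_power2)
    moreover have "Re (s\<^sup>2) = Re (z\<^sup>2) + 1" using s by simp
    ultimately have "- (Im s)\<^sup>2 = (Re z)\<^sup>2 + 1" using 0 by (simp add: Re_power2)
    then show False using zero_le_power2[of "Re z"] zero_le_power2[of "Im s"] by linarith
  qed
  moreover have "0 \<le> Re s" unfolding s_def by (rule Re_csqrt)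
  ultimately show ?thesis by (simp only: s_def[symmetric])
qed

text \<open>The principal root s has nonnegative real part, so 1 + s is at least as large as 1 - s
  in modulus, and the product of the two critical points is - 1.\<close>

lemma norm_root_plus_ge: "z \<noteq> 0 \<Longrightarrow> 1 \<le> norm (root_plus z)"
proof (rule ccontr)
  assume z: "z \<noteq> 0" and lt: "\<not> 1 \<le> norm (root_plus z)"
  define s where "s = csqrt (z\<^sup>2 + 1)"
  have "0 \<le> Re s" unfolding s_def by (rule Re_csqrt)
  moreover have "(norm (1 + s))\<^sup>2 - (norm (1 - s))\<^sup>2 = 4 * Re s"
    by (simp add: cmod_power2) (simp add: power2_eq_square algebra_simps)
  ultimately have "(norm (1 - s))\<^sup>2 \<le> (norm (1 + s))\<^sup>2" by linarith
  then have "norm (1 - s) \<le> norm (1 + s)" by (rule power2_le_imp_le) simp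
  then have le: "norm (root_minus z) \<le> norm (root_plus z)"
    unfolding root_minus_def root_plus_def norm_divide s_def[symmetric] by (rule divide_right_mono) simp
  have "norm (root_plus z) * norm (root_minus z) = 1" using root_critical(3)[OF z] by (metis norm_minus_cancel norm_mult norm_one)
  moreover have "norm (root_plus z) * norm (root_minus z) \<le> norm (root_plus z) * 1"
    using le lt by (intro mult_left_mono) auto
  ultimately show False using lt by simp
qed

text \<open>The sign decides from which of the points \<plusminus>1 the critical point
  \<open>root_plus z\<close> can be reached along a segment.\<close>

lemma Re_root_plus:
  assumes "Re z \<noteq> 0"
  shows "0 < Re z * Re (root_plus z)"
proof -
  define s where "s = csqrt (z\<^sup>2 + 1)"
  have z: "z \<noteq> 0" using assms by auto
  have a: "0 < Re s" using Re_csqrt_pos[OF assms] by (simp only: s_def)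
  have s: "s\<^sup>2 = z\<^sup>2 + 1" by (simp only: s_def power2_csqrt)
  have "Im (s\<^sup>2) = Im (z\<^sup>2)" using s by simp
  then have ab: "Re s * Im s = Re z * Im z" by (simp add: Im_power2)
  have "root_plus z * of_real ((norm z)\<^sup>2) = (1 + s) * cnj z"
    using z unfolding root_plus_def s_def[symmetric] complex_norm_square by simp
  then have "Re (root_plus z * of_real ((norm z)\<^sup>2)) = Re ((1 + s) * cnj z)" by (rule arg_cong)
  then have "Re (root_plus z) * (norm z)\<^sup>2 = Re z + (Re s * Re z + Im s * Im z)"
    by (simp add: algebra_simps)
  then have "Re z * Re (root_plus z) * (norm z)\<^sup>2 = Re z * (Re z + (Re s * Re z + Im s * Im z))"
    by simp
  moreover have "0 < Re z * (Re z + (Re s * Re z + Im s * Im z))"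
  proof -
    have "Re s * (Re z * (Re s * Re z + Im s * Im z)) = (Re s)\<^sup>2 * (Re z)\<^sup>2 + Re z * Im z * (Re s * Im s)"
      by (simp add: power2_eq_square algebra_simps)
    also have "\<dots> = (Re s)\<^sup>2 * (Re z)\<^sup>2 + (Re z * Im z)\<^sup>2" unfolding ab by (simp add: power2_eq_square)
    finally have "0 \<le> Re s * (Re z * (Re s * Re z + Im s * Im z))" by simp
    then have "0 \<le> Re z * (Re s * Re z + Im s * Im z)" using a by (simp add: zero_le_mult_iff)
    moreover have "0 < Re z * Re z" using assms by (simp add: power2_eq_square[symmetric])
    ultimately show ?thesis unfolding distrib_left[of "Re z" "Re z"] by simp
  qed
  ultimately show ?thesis using z by (metis zero_less_mult_pos2 zero_less_norm_iff zero_less_power)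
qed

section \<open>Propagation of lower bounds\<close>

lemma exists_holomorphic_log_ball:
  assumes "f holomorphic_on ball c r" "\<And>z. z \<in> ball c r \<Longrightarrow> f z \<noteq> 0"
  obtains l where "l holomorphic_on ball c r" "\<And>z. z \<in> ball c r \<Longrightarrow> f z = exp (l z)"
proof -
  have "simply_connected (ball c r)" by (simp add: convex_imp_simply_connected)
  then show ?thesis
    using assms that unfolding simply_connected_eq_holomorphic_log[OF open_ball] by blast
qed

lemma maximum_modulus_cball:
  fixes f :: "complex \<Rightarrow> complex"
  assumes "f holomorphic_on S" "cball c r \<subseteq> S" "\<And>z. norm (z - c) = r \<Longrightarrow> norm (f z) \<le> B" "norm (z - c) \<le> r"
  shows "norm (f z) \<le> B"
proof (rule maximum_modulus_frontier[of f "cball c r"])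
  show "f holomorphic_on interior (cball c r)"
    by (rule holomorphic_on_subset[OF assms(1)]) (use assms(2) interior_subset in blast)
  show "continuous_on (closure (cball c r)) f"
    by (intro holomorphic_on_imp_continuous_on holomorphic_on_subset[OF assms(1)]) (use assms(2) in auto)
  show "norm (f z) \<le> B" if "z \<in> frontier (cball c r)" for z
    using that assms(3)[of z] by (simp add: frontier_def interior_cball dist_norm norm_minus_commute)
qed (use assms(4) in \<open>auto simp: dist_norm norm_minus_commute\<close>)

text \<open>Harnack's inequality for the nonnegative harmonic function A - ln \<bar>F\<bar>, with
  constant (1 + 1/2) / (1 - 1/2) = 3 at half the radius. It comes from the Schwarz lemma for
  \<open>\<psi>\<close>, which is \<open>h\<close> followed by the Moebius map of the right
  half-plane onto the disc that takes \<open>h 0\<close> to 0; \<open>\<delta>\<close> makes the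
  real part of \<open>h\<close> strictly positive.\<close>

lemma Harnack_half_disc:
  assumes F: "F holomorphic_on ball c d" and nz: "\<And>z. z \<in> ball c d \<Longrightarrow> F z \<noteq> 0" and d: "0 < d"
    and A: "\<And>z. z \<in> ball c d \<Longrightarrow> ln (norm (F z)) \<le> A" and z: "norm (z - c) \<le> d / 2"
  shows "A - ln (norm (F z)) \<le> 3 * (A - ln (norm (F c)))"
proof -
  obtain l where l: "l holomorphic_on ball c d" "\<And>z. z \<in> ball c d \<Longrightarrow> F z = exp (l z)"
    using exists_holomorphic_log_ball[OF F nz] by blast
  have lnF: "ln (norm (F z)) = Re (l z)" if "z \<in> ball c d" for z
    using l(2)[OF that] by (simp add: norm_exp_eq_Re)
  have cb: "c \<in> ball c d" using d by simp
  have zb: "z \<in> ball c d" using z d by (simp add: dist_norm norm_minus_commute)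
  have "A + \<delta> - Re (l z) \<le> 3 * (A + \<delta> - Re (l c))" if \<delta>: "\<delta> > 0" for \<delta>
  proof -
    define h where "h w = of_real (A + \<delta>) - l (c + of_real d * w)" for w
    have inb: "c + of_real d * w \<in> ball c d" if "norm w < 1" for w
      using that d by (simp add: dist_norm norm_mult)
    have h_hol: "h holomorphic_on ball 0 1" unfolding h_def
      by (intro holomorphic_intros holomorphic_on_compose_gen[OF _ l(1), unfolded o_def]) (use inb in auto)
    have hpos: "0 < Re (h w)" if "norm w < 1" for w
      using A[OF inb[OF that]] lnF[OF inb[OF that]] \<delta> by (simp add: h_def)
    define b where "b = Re (h 0)"
    have b: "b > 0" using hpos[of 0] by (simp add: b_def)
    have den: "h w + cnj (h 0) \<noteq> 0" if "norm w < 1" for w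
      using hpos[OF that] b by (auto simp: complex_eq_iff b_def)
    define \<psi> where "\<psi> w = (h w - h 0) / (h w + cnj (h 0))" for w
    have diff: "(norm (h w + cnj (h 0)))\<^sup>2 - (norm (h w - h 0))\<^sup>2 = 4 * Re (h w) * b" for w
      unfolding cmod_power2 b_def by (simp add: power2_eq_square algebra_simps)
    have "norm (\<psi> ((z - c) / of_real d)) \<le> norm ((z - c) / of_real d)"
    proof (rule Schwarz_Lemma(1))
      show "\<psi> holomorphic_on ball 0 1" unfolding \<psi>_def using den by (intro holomorphic_intros h_hol) auto
      show "\<psi> 0 = 0" by (simp add: \<psi>_def)
      show "norm (\<psi> w) < 1" if w: "norm w < 1" for w
      proof -
        have "0 < 4 * Re (h w) * b" using hpos[OF w] b by simp
        then have "(norm (h w - h 0))\<^sup>2 < (norm (h w + cnj (h 0)))\<^sup>2" using diff[of w] by linarith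
        then have "norm (h w - h 0) < norm (h w + cnj (h 0))" by (rule power2_less_imp_less) simp
        then show ?thesis using den[OF w] by (simp add: \<psi>_def norm_divide)
      qed
      show "norm ((z - c) / of_real d) < 1" using z d by (simp add: norm_divide)
    qed
    also have "\<dots> \<le> 1 / 2" using z d by (simp add: norm_divide divide_simps)
    finally have p: "norm (\<psi> ((z - c) / of_real d)) \<le> 1 / 2" .
    define w where "w = (z - c) / of_real d"
    have w1: "norm w < 1" using z d by (simp add: w_def norm_divide)
    have hw: "h w = of_real (A + \<delta>) - l z" using d by (simp add: h_def w_def)
    define a where "a = Re (h w)"
    define y where "y = Im (h w) - Im (h 0)"
    have "norm (h w - h 0) * 2 \<le> norm (h w + cnj (h 0))"
      using p den[OF w1] by (simp add: \<psi>_def w_def[symmetric] norm_divide divide_simps)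
    then have "(norm (h w - h 0) * 2)\<^sup>2 \<le> (norm (h w + cnj (h 0)))\<^sup>2" by (rule power_mono) simp
    then have "4 * ((a - b)\<^sup>2 + y\<^sup>2) \<le> (a + b)\<^sup>2 + y\<^sup>2"
      by (simp add: power_mult_distrib cmod_power2 a_def b_def y_def)
    then have "4 * (a - b)\<^sup>2 \<le> (a + b)\<^sup>2" using zero_le_power2[of y] unfolding distrib_left by linarith
    then have "(2 * (a - b))\<^sup>2 \<le> (a + b)\<^sup>2" unfolding four_x_squared .
    then have "2 * (a - b) \<le> a + b"
      using hpos[OF w1] b by (intro power2_le_imp_le[of "2 * (a - b)"]) (auto simp: a_def)
    then have "a \<le> 3 * b" by simp
    then show ?thesis by (simp add: a_def b_def hw) (simp add: h_def)
  qed
  then have le: "A - Re (l z) - 3 * (A - Re (l c)) \<le> 2 * \<delta>" if "\<delta> > 0" for \<delta>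
    using that[THEN \<open>\<And>\<delta>. \<delta> > 0 \<Longrightarrow> A + \<delta> - Re (l z) \<le> 3 * (A + \<delta> - Re (l c))\<close>] by (simp add: algebra_simps)
  have "A - Re (l z) - 3 * (A - Re (l c)) \<le> 0"
  proof (rule field_le_epsilon)
    fix e :: real assume "0 < e"
    then show "A - Re (l z) - 3 * (A - Re (l c)) \<le> 0 + e" using le[of "e / 2"] by simp
  qed
  then show ?thesis by (simp add: lnF[OF zb] lnF[OF cb])
qed

section \<open>Products over multisets of zeros\<close>

lemma holomorphic_on_prod_mset [holomorphic_intros]:
  assumes "\<And>\<zeta>. \<zeta> \<in># Z \<Longrightarrow> f \<zeta> holomorphic_on S"
  shows "(\<lambda>z. \<Prod>\<zeta>\<in>#Z. f \<zeta> z) holomorphic_on S"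
  using assms by (induction Z) (auto intro!: holomorphic_intros)

lemma norm_prod_mset: "norm (\<Prod>\<zeta>\<in>#Z. f \<zeta> :: complex) = (\<Prod>\<zeta>\<in>#Z. norm (f \<zeta>))"
  by (induction Z) (auto simp: norm_mult)

lemma prod_mset_mono_real:
  fixes f g :: "'a \<Rightarrow> real"
  assumes "\<And>\<zeta>. \<zeta> \<in># Z \<Longrightarrow> 0 \<le> f \<zeta> \<and> f \<zeta> \<le> g \<zeta>"
  shows "(\<Prod>\<zeta>\<in>#Z. f \<zeta>) \<le> (\<Prod>\<zeta>\<in>#Z. g \<zeta>) \<and> 0 \<le> (\<Prod>\<zeta>\<in>#Z. f \<zeta>)"
  using assms
proof (induction Z)
  case (add x Z)
  then have "(\<Prod>\<zeta>\<in>#Z. f \<zeta>) \<le> (\<Prod>\<zeta>\<in>#Z. g \<zeta>)" "0 \<le> (\<Prod>\<zeta>\<in>#Z. f \<zeta>)" "0 \<le> f x" "f x \<le> g x" by auto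
  then show ?case by (auto intro!: mult_mono)
qed simp

lemma prod_mset_split:
  fixes f :: "'a \<Rightarrow> 'b::comm_monoid_mult"
  shows "(\<Prod>\<zeta>\<in>#Z. f \<zeta>) = (\<Prod>\<zeta>\<in>#filter_mset p Z. f \<zeta>) * (\<Prod>\<zeta>\<in>#filter_mset (\<lambda>\<zeta>. \<not> p \<zeta>) Z. f \<zeta>)"
  by (induction Z) (auto simp: mult_ac)

lemma prod_mset_const_real: "(\<Prod>\<zeta>\<in>#Z. c :: real) = c ^ size Z"
  by (induction Z) auto

text \<open>In the variable w with argument y + 1 / w, the monic product of degree k becomes w^(-k)
  times a polynomial \<open>q\<close> with \<open>q 0 = 1\<close>, and the maximum principle applies
  to \<open>q\<close>.\<close>

lemma exists_norm_monic_ge: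
  fixes y :: complex
  assumes r: "0 < r"
  obtains w where "norm (w - y) = r" "r ^ size Z \<le> norm (\<Prod>\<zeta>\<in>#Z. w - \<zeta>)"
proof -
  define q where "q w = (\<Prod>\<zeta>\<in>#Z. 1 - w * (\<zeta> - y))" for w
  have q: "q holomorphic_on S" for S unfolding q_def by (intro holomorphic_intros)
  have q0: "q 0 = 1" unfolding q_def by (induction Z) auto
  have "\<exists>w. norm w = 1 / r \<and> 1 \<le> norm (q w)"
  proof -
    have "\<exists>w0\<in>sphere 0 (1 / r). \<forall>w\<in>sphere 0 (1 / r). norm (q w) \<le> norm (q w0)"
      using r by (intro continuous_attains_sup continuous_intros holomorphic_on_imp_continuous_on q) auto
    then obtain w0 where w0: "norm w0 = 1 / r" "\<And>w. norm w = 1 / r \<Longrightarrow> norm (q w) \<le> norm (q w0)" by auto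
    have "norm (q 0) \<le> norm (q w0)"
      by (rule maximum_modulus_cball[OF q[of UNIV], of 0 "1 / r"]) (use w0 r in auto)
    then show ?thesis using w0(1) q0 by auto
  qed
  then obtain w where w: "norm w = 1 / r" "1 \<le> norm (q w)" by blast
  have w0: "w \<noteq> 0" using w r by auto
  have "(\<Prod>\<zeta>\<in>#Z. (y + 1 / w) - \<zeta>) = (1 / w) ^ size Z * q w"
    unfolding q_def
  proof (induction Z)
    case (add x Z)
    have "y + 1 / w - x = (1 / w) * (1 - w * (x - y))" using w0 by (simp add: field_simps)
    then show ?case using add by (simp add: mult_ac)
  qed simp
  then have "norm (\<Prod>\<zeta>\<in>#Z. (y + 1 / w) - \<zeta>) = r ^ size Z * norm (q w)"
    using w r by (simp add: norm_mult norm_power norm_divide)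
  then show ?thesis using w r that[of "y + 1 / w"] by (simp add: norm_divide mult_left_le[of 1] )
qed

text \<open>\<open>Z\<close> may contain points outside \<open>S\<close>: all zeros of a polynomial
  can be listed once, whatever the domain.\<close>

definition zero_factored :: "(complex \<Rightarrow> complex) \<Rightarrow> complex multiset \<Rightarrow> complex set \<Rightarrow> bool" where
  "zero_factored f Z S \<longleftrightarrow> (\<exists>g. g holomorphic_on S \<and> (\<forall>z\<in>S. g z \<noteq> 0 \<and> f z = (\<Prod>\<zeta>\<in>#Z. z - \<zeta>) * g z))"

lemma zero_factored_subset: "zero_factored f Z S \<Longrightarrow> T \<subseteq> S \<Longrightarrow> zero_factored f Z T"
  unfolding zero_factored_def by (meson holomorphic_on_subset subsetD)

definition subexp_bounded :: "(nat \<Rightarrow> complex \<Rightarrow> complex) \<Rightarrow> complex set \<Rightarrow> bool" where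
  "subexp_bounded f S \<longleftrightarrow> (\<forall>\<epsilon>>0. \<forall>\<^sub>F n in sequentially. \<forall>z\<in>S. norm (f n z) \<le> exp (real n * \<epsilon>))"

text \<open>Only some point near \<open>y\<close> is asked to be large, since \<open>y\<close>
  itself may be a zero of infinitely many \<open>f n\<close>.\<close>

definition subexp_large_near :: "(nat \<Rightarrow> complex \<Rightarrow> complex) \<Rightarrow> complex \<Rightarrow> bool" where
  "subexp_large_near f y \<longleftrightarrow>
     (\<forall>s>0. \<forall>\<eta>>0. \<forall>\<^sub>F n in sequentially. \<exists>y'\<in>ball y s. exp (- (real n * \<eta>)) \<le> norm (f n y'))"

lemma subexp_bounded_subset: "subexp_bounded f S \<Longrightarrow> T \<subseteq> S \<Longrightarrow> subexp_bounded f T"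
  unfolding subexp_bounded_def by (rule allI, rule impI, drule spec, drule mp, assumption, erule eventually_mono) blast

text \<open>A function that is not small at one point \<open>c\<close> has few zeros near \<open>c\<close>; after they are divided out, Harnack's
  inequality bounds it below in a neighbourhood of \<open>c\<close>, and the divided factors are not small somewhere in every disc.\<close>

lemma lower_bound_propagates:
  fixes f :: "complex \<Rightarrow> complex"
  assumes f: "zero_factored f Z (ball y0 R)" and R: "0 < R" and \<Theta>: "0 \<le> \<Theta>"
    and ub: "\<And>z. z \<in> ball y0 R \<Longrightarrow> norm (f z) \<le> exp \<Theta>"
    and c: "norm (c - y0) < R / 64" "exp (- \<Theta>) \<le> norm (f c)"
    and y: "norm (y - y0) < R / 64" and s: "0 < s" "s \<le> R / 64"
  obtains w where "norm (w - y) = s" "exp (- (5 + 3 * ln (R / s)) * \<Theta>) \<le> norm (f w)"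
proof -
  obtain g where g: "g holomorphic_on ball y0 R" "\<And>z. z \<in> ball y0 R \<Longrightarrow> g z \<noteq> 0"
    "\<And>z. z \<in> ball y0 R \<Longrightarrow> f z = (\<Prod>\<zeta>\<in>#Z. z - \<zeta>) * g z" using f unfolding zero_factored_def by blast
  \<comment> \<open>On the circle of radius R / 2 about \<open>c\<close> the factors of the near
    zeros are at least R / 3, at \<open>c\<close> at most R / 6. Comparing \<open>f c\<close> with
    the maximum of the remaining factor \<open>G\<close> gives 2^K \<le> exp (2 \<Theta>), and ln 2
    \<ge> 2 / 3 turns this into \<open>K \<le> 3 * \<Theta>\<close>.\<close>
  define near where "near \<zeta> \<longleftrightarrow> norm (\<zeta> - c) < R / 6" for \<zeta>
  define Z1 where "Z1 = filter_mset near Z"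
  define G where "G z = (\<Prod>\<zeta>\<in>#filter_mset (\<lambda>\<zeta>. \<not> near \<zeta>) Z. z - \<zeta>) * g z" for z
  define K where "K = size Z1"
  have fG: "f z = (\<Prod>\<zeta>\<in>#Z1. z - \<zeta>) * G z" if "z \<in> ball y0 R" for z
    using g(3)[OF that] prod_mset_split[of "\<lambda>\<zeta>. z - \<zeta>" Z near] by (simp add: Z1_def G_def mult_ac)
  have G: "G holomorphic_on ball y0 R" unfolding G_def by (intro holomorphic_intros g)
  have cb: "cball c (R / 2) \<subseteq> ball y0 R"
  proof
    fix z assume "z \<in> cball c (R / 2)"
    then have "norm (z - c) \<le> R / 2" by (simp add: dist_norm norm_minus_commute)
    then have "norm (z - y0) < R" using norm_triangle_ineq[of "z - c" "c - y0"] c R by simp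
    then show "z \<in> ball y0 R" by (simp add: dist_norm norm_minus_commute)
  qed
  have cbD: "z \<in> ball y0 R" if "norm (z - c) \<le> R / 2" for z
    by (rule subsetD[OF cb]) (use that in \<open>simp add: dist_norm norm_minus_commute\<close>)
  have cc: "c \<in> ball y0 R" using cb R by (meson centre_in_cball half_gt_zero less_imp_le subsetD)
  have G0: "G z \<noteq> 0" if z: "z \<in> ball c (R / 6)" for z
  proof -
    have "z \<in> ball y0 R" using z R by (intro cbD) (simp add: dist_norm norm_minus_commute)
    moreover have "z - \<zeta> \<noteq> 0" if "\<not> near \<zeta>" for \<zeta> using that z by (auto simp: near_def dist_norm norm_minus_commute)
    ultimately show ?thesis using g(2) by (auto simp: G_def prod_mset_zero_iff)
  qed
  have Gle: "norm (G z) \<le> exp \<Theta> * (3 / R) ^ K" if z: "norm (z - c) \<le> R / 2" for z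
  proof (rule maximum_modulus_cball[OF G cb _ z])
    fix z assume z: "norm (z - c) = R / 2"
    then have zb: "z \<in> ball y0 R" by (intro cbD) simp
    have "(\<Prod>\<zeta>\<in>#Z1. R / 3) \<le> (\<Prod>\<zeta>\<in>#Z1. norm (z - \<zeta>))"
    proof (intro prod_mset_mono_real[THEN conjunct1] conjI)
      fix \<zeta> assume "\<zeta> \<in># Z1"
      then have "norm (\<zeta> - c) < R / 6" by (simp add: Z1_def near_def)
      then show "R / 3 \<le> norm (z - \<zeta>)" using norm_triangle_ineq[of "z - \<zeta>" "\<zeta> - c"] z by simp
    qed (use R in auto)
    then have 1: "(R / 3) ^ K \<le> norm (\<Prod>\<zeta>\<in>#Z1. z - \<zeta>)" by (simp add: prod_mset_const_real norm_prod_mset K_def)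
    have "(R / 3) ^ K * norm (G z) \<le> exp \<Theta>"
      using mult_right_mono[OF 1 norm_ge_zero[of "G z"]] ub[OF zb] by (simp add: fG[OF zb] norm_mult)
    then show "norm (G z) \<le> exp \<Theta> * (3 / R) ^ K" using R by (simp add: field_simps)
  qed
  have pc: "norm (\<Prod>\<zeta>\<in>#Z1. c - \<zeta>) \<le> (R / 6) ^ K"
    unfolding norm_prod_mset K_def prod_mset_const_real[symmetric]
    by (intro prod_mset_mono_real[THEN conjunct1]) (auto simp: Z1_def near_def norm_minus_commute)
  have fc: "norm (f c) \<le> (R / 6) ^ K * norm (G c)"
    unfolding fG[OF cc] norm_mult by (intro mult_right_mono pc) simp
  have "exp (- \<Theta>) \<le> (R / 6) ^ K * norm (G c)" using c(2) fc by linarith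
  also have "\<dots> \<le> (R / 6) ^ K * (exp \<Theta> * (3 / R) ^ K)" using R Gle[of c] by (intro mult_left_mono) auto
  also have "\<dots> = exp \<Theta> * (1 / 2) ^ K" using R by (simp add: power_mult_distrib[symmetric])
  finally have "exp (- \<Theta>) * 2 ^ K \<le> exp \<Theta>" by (simp add: field_simps power_divide)
  then have "2 ^ K \<le> exp \<Theta> * exp \<Theta>" by (simp add: exp_minus field_simps)
  then have "2 ^ K \<le> exp (2 * \<Theta>)" unfolding exp_add[symmetric] by simp
  then have "ln (2 ^ K) \<le> ln (exp (2 * \<Theta>))" by (subst ln_le_cancel_iff) auto
  then have "K * ln 2 \<le> 2 * \<Theta>" by (simp add: ln_realpow)
  moreover have "2 / 3 \<le> ln (2::real)" using ln2_ge_two_thirds by simp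
  ultimately have K: "real K \<le> 3 * \<Theta>" using mult_left_mono[of "2 / 3" "ln 2" "real K"] by linarith
  \<comment> \<open>\<open>A\<close> is the logarithm of the bound for \<bar>G\<bar>. It exceeds ln
    \<bar>G c\<bar> by at most 2 \<Theta>, and Harnack's inequality triples this gap.\<close>
  define A where "A = \<Theta> + K * ln (3 / R)"
  have eA: "exp A = exp \<Theta> * (3 / R) ^ K" using R by (simp add: A_def exp_add exp_of_nat_mult)
  have lnG: "ln (norm (G z)) \<le> A" if z: "z \<in> ball c (R / 6)" for z
  proof -
    have "norm (G z) \<le> exp A" using Gle[of z] z R by (simp add: eA dist_norm norm_minus_commute)
    then show ?thesis using G0[OF z] by (metis exp_gt_zero ln_exp ln_le_cancel_iff zero_less_norm_iff)
  qed
  have lnGc: "A - ln (norm (G c)) \<le> 2 * \<Theta>"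
  proof -
    have Gc: "norm (G c) > 0" using G0[of c] R by simp
    have "exp (- \<Theta>) \<le> (R / 6) ^ K * norm (G c)" using c(2) fc by linarith
    then have "ln (exp (- \<Theta>)) \<le> ln ((R / 6) ^ K * norm (G c))" using Gc R by (subst ln_le_cancel_iff) auto
    then have "- \<Theta> \<le> K * ln (R / 6) + ln (norm (G c))" using Gc R by (simp add: ln_mult_pos ln_realpow)
    moreover have "ln (R / 6) + ln (3 / R) \<le> 0" using R by (simp add: ln_div ln_mult)
    then have "K * (ln (R / 6) + ln (3 / R)) \<le> 0" by (simp add: mult_nonneg_nonpos)
    ultimately show ?thesis by (simp add: A_def algebra_simps)
  qed
  obtain w where w: "norm (w - y) = s" "s ^ size Z1 \<le> norm (\<Prod>\<zeta>\<in>#Z1. w - \<zeta>)"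
    using exists_norm_monic_ge[OF s(1)] by blast
  \<comment> \<open>The distance is below 3 R / 64, hence below R / 12; the constant 64 in the
    hypotheses provides this room.\<close>
  have wc: "norm (w - c) \<le> (R / 6) / 2"
    using norm_triangle_ineq[of "w - y" "y - c"] norm_triangle_ineq4[of "y - y0" "c - y0"] w y c s by simp
  then have wb: "w \<in> ball c (R / 6)" using R by (simp add: dist_norm norm_minus_commute)
  have wR: "w \<in> ball y0 R" using wc R by (intro cbD) simp
  have "A - ln (norm (G w)) \<le> 3 * (A - ln (norm (G c)))"
  proof (rule Harnack_half_disc[of G c "R / 6"])
    have "ball c (R / 6) \<subseteq> ball y0 R" using R by (auto intro!: cbD simp: dist_norm norm_minus_commute)
    then show "G holomorphic_on ball c (R / 6)" by (rule holomorphic_on_subset[OF G])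
  qed (use wc R lnG G0 in auto)
  also have "\<dots> \<le> 3 * (2 * \<Theta>)" by (rule mult_left_mono[OF lnGc]) simp
  finally have lnGw: "A - 6 * \<Theta> \<le> ln (norm (G w))" by simp
  have Gw: "norm (G w) > 0" using G0[OF wb] by simp
  have "exp (- (5 + 3 * ln (R / s)) * \<Theta>) \<le> exp (K * ln s + (A - 6 * \<Theta>))"
  proof -
    have "ln (R / s) \<ge> 0" using s R by simp
    have 1: "K * ln s + (A - 6 * \<Theta>) = - 5 * \<Theta> + K * (ln s + ln (3 / R))" by (simp add: A_def algebra_simps)
    have "- ln (R / s) \<le> ln s + ln (3 / R)" using R s by (simp add: ln_div)
    then have 2: "K * (- ln (R / s)) \<le> K * (ln s + ln (3 / R))" by (rule mult_left_mono) simp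
    have 3: "K * ln (R / s) \<le> 3 * \<Theta> * ln (R / s)" by (rule mult_right_mono[OF K \<open>ln (R / s) \<ge> 0\<close>])
    have "- (5 + 3 * ln (R / s)) * \<Theta> = - 5 * \<Theta> - 3 * \<Theta> * ln (R / s)" by (simp add: algebra_simps)
    then show ?thesis using 2 3 unfolding 1 exp_le_cancel_iff by simp
  qed
  also have "\<dots> \<le> exp (K * ln s) * norm (G w)"
    unfolding exp_add using lnGw Gw by (intro mult_left_mono) (auto simp: ln_ge_iff)
  also have "exp (K * ln s) = s ^ K" using s by (simp add: exp_of_nat_mult)
  also have "s ^ K * norm (G w) \<le> norm (f w)"
    unfolding fG[OF wR] norm_mult using w(2) by (intro mult_right_mono) (auto simp: K_def)
  finally show ?thesis using that w(1) by blast
qed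

lemma subexp_large_near_propagates:
  assumes f: "\<forall>\<^sub>F n in sequentially. zero_factored (f n) (Z n) (ball y0 R)" and R: "0 < R"
    and ub: "subexp_bounded f (ball y0 R)" and y0: "subexp_large_near f y0" and y: "norm (y - y0) < R / 64"
  shows "subexp_large_near f y"
  unfolding subexp_large_near_def
proof (intro allI impI)
  fix s \<eta> :: real assume s: "0 < s" and \<eta>: "0 < \<eta>"
  define s' where "s' = min (s / 2) (R / 64)"
  have s': "0 < s'" "s' \<le> R / 64" "s' < s" using s R by (auto simp: s'_def)
  define L where "L = 5 + 3 * ln (R / s')"
  have L: "L > 0" using s' R by (simp add: L_def add_pos_nonneg)
  \<comment> \<open>Propagation multiplies the exponent by \<open>L\<close>, which depends on
    \<open>R\<close> and \<open>s'\<close> but not on \<open>n\<close>.\<close>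
  define \<theta> where "\<theta> = \<eta> / L"
  have \<theta>: "\<theta> > 0" using L \<eta> by (simp add: \<theta>_def)
  have 1: "\<forall>\<^sub>F n in sequentially. \<forall>z\<in>ball y0 R. norm (f n z) \<le> exp (n * \<theta>)"
    using ub \<theta> by (simp add: subexp_bounded_def)
  have 2: "\<forall>\<^sub>F n in sequentially. \<exists>c\<in>ball y0 (R / 64). exp (- (n * \<theta>)) \<le> norm (f n c)"
    using y0 \<theta> R by (simp add: subexp_large_near_def)
  from 1 2 f show "\<forall>\<^sub>F n in sequentially. \<exists>y'\<in>ball y s. exp (- (n * \<eta>)) \<le> norm (f n y')"
  proof eventually_elim
    case (elim n)
    then obtain c where c: "norm (c - y0) < R / 64" "exp (- (n * \<theta>)) \<le> norm (f n c)"
      by (auto simp: dist_norm norm_minus_commute)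
    obtain w where w: "norm (w - y) = s'" "exp (- (5 + 3 * ln (R / s')) * (n * \<theta>)) \<le> norm (f n w)"
      by (rule lower_bound_propagates[OF elim(3) R _ _ c y s'(1,2)]) (use elim(1) \<theta> in auto)
    have "- (5 + 3 * ln (R / s')) * (n * \<theta>) = - (n * \<eta>)" using L by (simp add: L_def[symmetric] \<theta>_def)
    then show ?case using w s' by (intro bexI[of _ w]) (auto simp: dist_norm norm_minus_commute)
  qed
qed

lemma subexp_large_near_closure:
  assumes "\<And>y. y \<in> S \<Longrightarrow> subexp_large_near f y" "y \<in> closure S"
  shows "subexp_large_near f y"
  unfolding subexp_large_near_def
proof (intro allI impI)
  fix s \<eta> :: real assume s: "0 < s" and \<eta>: "0 < \<eta>"
  obtain x where x: "x \<in> S" "dist x y < s / 2" using assms(2) s unfolding closure_approachable by (meson half_gt_zero)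
  have "\<forall>\<^sub>F n in sequentially. \<exists>y'\<in>ball x (s / 2). exp (- (n * \<eta>)) \<le> norm (f n y')"
    using assms(1)[OF x(1)] s \<eta> by (simp add: subexp_large_near_def)
  then show "\<forall>\<^sub>F n in sequentially. \<exists>y'\<in>ball y s. exp (- (n * \<eta>)) \<le> norm (f n y')"
  proof eventually_elim
    case (elim n)
    then obtain y' where "y' \<in> ball x (s / 2)" "exp (- (n * \<eta>)) \<le> norm (f n y')" by blast
    moreover from this have "y' \<in> ball y s"
      using x(2) dist_triangle[of y y' x] by (simp add: dist_commute)
    ultimately show ?case by blast
  qed
qed

text \<open>The points with this property form an open set, since every point passes it on to a
  small disc, and a relatively closed one, since limit points inherit it.\<close>

lemma subexp_large_near_connected:
  assumes \<Omega>: "open \<Omega>" "connected \<Omega>"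
    and f: "\<forall>\<^sub>F n in sequentially. zero_factored (f n) (Z n) \<Omega>"
    and ub: "\<And>K. compact K \<Longrightarrow> K \<subseteq> \<Omega> \<Longrightarrow> subexp_bounded f K"
    and y0: "y0 \<in> \<Omega>" "subexp_large_near f y0" and y: "y \<in> \<Omega>"
  shows "subexp_large_near f y"
proof -
  define T where "T = {y \<in> \<Omega>. subexp_large_near f y}"
  have "open T"
    unfolding open_contains_ball
  proof
    fix x assume "x \<in> T"
    then have x: "x \<in> \<Omega>" "subexp_large_near f x" by (auto simp: T_def)
    obtain R where R: "R > 0" "cball x R \<subseteq> \<Omega>" using \<Omega>(1) x(1) open_contains_cball by blast
    have "subexp_bounded f (cball x R)" by (rule ub[OF compact_cball R(2)])
    then have ubb: "subexp_bounded f (ball x R)" by (rule subexp_bounded_subset[OF _ ball_subset_cball])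
    have fb: "\<forall>\<^sub>F n in sequentially. zero_factored (f n) (Z n) (ball x R)"
      proof (rule eventually_mono[OF f])
      have "ball x R \<subseteq> \<Omega>" using R(2) ball_subset_cball by blast
      then show "zero_factored (f n) (Z n) (ball x R)" if "zero_factored (f n) (Z n) \<Omega>" for n
        using that zero_factored_subset by blast
    qed
    have "ball x (R / 64) \<subseteq> T"
    proof
      fix y assume "y \<in> ball x (R / 64)"
      then have y: "norm (y - x) < R / 64" by (simp add: dist_norm norm_minus_commute)
      then have "y \<in> cball x R" using R(1) by (simp add: dist_norm norm_minus_commute)
      then have "y \<in> \<Omega>" using R(2) by blast
      then show "y \<in> T" using subexp_large_near_propagates[OF fb R(1) ubb x(2) y] by (simp add: T_def)
    qed
    then show "\<exists>e>0. ball x e \<subseteq> T" using R(1) by (intro exI[of _ "R / 64"]) auto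
  qed
  then have "openin (top_of_set \<Omega>) T" by (intro open_subset) (auto simp: T_def)
  moreover have "T = \<Omega> \<inter> closure T"
  proof
    show "T \<subseteq> \<Omega> \<inter> closure T" using closure_subset[of T] unfolding T_def by blast
    show "\<Omega> \<inter> closure T \<subseteq> T"
    proof
      fix x assume x: "x \<in> \<Omega> \<inter> closure T"
      have "subexp_large_near f x"
        by (rule subexp_large_near_closure[of T]) (use x in \<open>simp_all add: T_def\<close>)
      then show "x \<in> T" using x by (simp add: T_def)
    qed
  qed
  then have "closedin (top_of_set \<Omega>) T" by (metis closedin_closed_Int closed_closure)
  ultimately have "T = {} \<or> T = \<Omega>" using \<Omega>(2) unfolding connected_clopen by blast
  then have "y \<in> T" using y0 y unfolding T_def by blast
  then show ?thesis by (simp add: T_def)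
qed

section \<open>Asymptotics of the Borel transform\<close>

lemma norm_le_if_exp_decay:
  fixes f :: "real \<Rightarrow> complex"
  assumes f: "\<And>r. 0 \<le> r \<Longrightarrow> (f has_vector_derivative f' r) (at r)"
    and le: "\<And>r. 0 \<le> r \<Longrightarrow> norm (f' r) \<le> C * exp (- (a * r))"
    and a: "0 < a" and lim: "(f \<longlongrightarrow> 0) at_top"
  shows "norm (f 0) \<le> C / a"
proof -
  define \<phi> where "\<phi> r = - (C / a) * exp (- (a * r))" for r
  have \<phi>: "(\<phi> has_vector_derivative C * exp (- (a * r))) (at r)" for r
    unfolding \<phi>_def has_real_derivative_iff_has_vector_derivative[symmetric]
    using a by (auto intro!: derivative_eq_intros)
  have C: "0 \<le> C" using order_trans[OF norm_ge_zero le[of 0]] by simp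
  have b: "norm (f 0) \<le> C / a + norm (f r)" if r: "0 < r" for r
  proof -
    have "norm (f r - f 0) \<le> \<phi> r - \<phi> 0"
    proof (rule differentiable_bound_general[OF r])
      show "continuous_on {0..r} f" by (intro continuous_at_imp_continuous_on ballI) (auto intro: has_vector_derivative_continuous[OF f])
      show "continuous_on {0..r} \<phi>" unfolding \<phi>_def by (intro continuous_intros)
      show "(f has_vector_derivative f' x) (at x)" if "0 < x" "x < r" for x using f that by simp
      show "norm (f' x) \<le> C * exp (- (a * x))" if "0 < x" "x < r" for x using le that by simp
    qed (use \<phi> in auto)
    also have "\<dots> \<le> C / a" using C a by (simp add: \<phi>_def)
    finally have "norm (f r - f 0) \<le> C / a" .
    then show ?thesis using norm_triangle_ineq2[of "f 0" "f r"] by (simp add: norm_minus_commute)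
  qed
  have "((\<lambda>r. C / a + norm (f r)) \<longlongrightarrow> C / a + norm (0::complex)) at_top" by (intro tendsto_intros lim)
  then have "((\<lambda>r. C / a + norm (f r)) \<longlongrightarrow> C / a) at_top" by simp
  moreover have "eventually (\<lambda>r. norm (f 0) \<le> C / a + norm (f r)) at_top"
    using eventually_gt_at_top[of 0] by eventually_elim (rule b)
  ultimately show ?thesis by (rule tendsto_lowerbound) simp
qed

lemma norm_diff_le_path:
  fixes K :: "complex \<Rightarrow> complex" and p :: "real \<Rightarrow> complex"
  assumes K: "\<And>t. (K has_field_derivative K' t) (at t)"
    and p: "\<And>l. 0 \<le> l \<Longrightarrow> l \<le> 1 \<Longrightarrow> (p has_vector_derivative p' l) (at l)"
    and p': "\<And>l. 0 \<le> l \<Longrightarrow> l \<le> 1 \<Longrightarrow> norm (p' l) \<le> A"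
    and K': "\<And>l. 0 \<le> l \<Longrightarrow> l \<le> 1 \<Longrightarrow> norm (K' (p l)) \<le> B"
  shows "norm (K (p 1) - K (p 0)) \<le> A * B"
proof -
  have A: "0 \<le> A" using order_trans[OF norm_ge_zero p'[of 0]] by simp
  have B: "0 \<le> B" using order_trans[OF norm_ge_zero K'[of 0]] by simp
  have d: "((\<lambda>l. K (p l)) has_vector_derivative p' l * K' (p l)) (at l)" if "0 \<le> l" "l \<le> 1" for l
    using field_vector_diff_chain_at[OF p[OF that] K] by (simp add: o_def)
  have "norm ((\<lambda>l. K (p l)) 1 - (\<lambda>l. K (p l)) 0) \<le> (\<lambda>l. A * B * l) 1 - (\<lambda>l. A * B * l) 0"
  proof (rule differentiable_bound_general)
    show "continuous_on {0..1} (\<lambda>l. K (p l))"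
      by (intro continuous_at_imp_continuous_on ballI) (auto intro: has_vector_derivative_continuous[OF d])
    show "((\<lambda>l. A * B * l) has_vector_derivative A * B) (at x)" for x
      unfolding has_real_derivative_iff_has_vector_derivative[symmetric] by (auto intro!: derivative_eq_intros)
    show "norm (p' x * K' (p x)) \<le> A * B" if "0 < x" "x < 1" for x
      unfolding norm_mult using that by (intro mult_mono p' K' A) auto
  qed (use d in \<open>auto intro!: continuous_intros\<close>)
  then show ?thesis by simp
qed

text \<open>The first two factors describe the height along a ray, the third the error of the
  kernel. Up to \<open>k = 8\<close> the first two together are at most 1, and exp 2 pays for exp (-
  k / 4). Beyond 8 one has 1 + k + k^2 / 2 \<le> exp (k / 2), and a single one of the
  \<open>n\<close> factors supplies the decay.\<close>

lemma one_plus_half_sq_exp_bound: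
  fixes k \<theta> :: real
  assumes k: "0 \<le> k" and \<theta>: "0 \<le> \<theta>" "\<theta> \<le> 1 / 4" and n: "0 < n"
  shows "((1 + k + k\<^sup>2 / 2) * exp (- k) * exp (\<theta> * k)) ^ n \<le> exp (8 * real n * \<theta> + 2) * exp (- (k / 4))"
proof (cases "k \<le> 8")
  case True
  have "1 + k + k\<^sup>2 / 2 \<le> exp k" using exp_lower_Taylor_quadratic[OF k] by simp
  then have "(1 + k + k\<^sup>2 / 2) * exp (- k) \<le> exp k * exp (- k)" by (rule mult_right_mono) simp
  then have "(1 + k + k\<^sup>2 / 2) * exp (- k) \<le> 1" by (simp add: exp_add[symmetric])
  then have "(1 + k + k\<^sup>2 / 2) * exp (- k) * exp (\<theta> * k) \<le> 1 * exp (\<theta> * k)" by (rule mult_right_mono) simp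
  also have "\<dots> \<le> exp (8 * \<theta>)" using True \<theta> by (simp add: mult.commute mult_left_mono)
  finally have "((1 + k + k\<^sup>2 / 2) * exp (- k) * exp (\<theta> * k)) ^ n \<le> exp (8 * \<theta>) ^ n"
    using k by (intro power_mono) auto
  also have "\<dots> = exp (8 * real n * \<theta>)" by (simp add: exp_of_nat_mult[symmetric] mult_ac)
  also have "\<dots> \<le> exp (8 * real n * \<theta> + 2) * exp (- (k / 4))" unfolding exp_add[symmetric] using True by simp
  finally show ?thesis .
next
  case False
  have q: "1 + k + k\<^sup>2 / 2 \<le> exp (k / 2)"
  proof -
    define x where "x = k / 2"
    have x: "4 \<le> x" "0 \<le> x" using False by (auto simp: x_def)
    have "(\<Sum>i<6. x ^ i / fact i) \<le> exp x"
      using sum_le_suminf[OF summable_exp[of x], of "{..<6}"] x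
      by (simp add: exp_def divide_inverse scaleR_conv_of_real mult.commute)
    then have e: "1 + x + x\<^sup>2 / 2 + x ^ 3 / 6 + x ^ 4 / 24 + x ^ 5 / 120 \<le> exp x"
      by (simp add: eval_nat_numeral fact_reduce numeral_eq_Suc)
    have "4 * x\<^sup>2 \<le> x ^ 3" "16 * x\<^sup>2 \<le> x ^ 4" "64 * x\<^sup>2 \<le> x ^ 5"
    proof -
      have "(4 * (4 * 4)) * x\<^sup>2 \<le> (x * (x * x)) * x\<^sup>2" using x by (intro mult_right_mono mult_mono) auto
      then show "64 * x\<^sup>2 \<le> x ^ 5" by (simp add: eval_nat_numeral mult_ac)
      have "4 * x\<^sup>2 \<le> x * x\<^sup>2" using x by (intro mult_right_mono) auto
      then show "4 * x\<^sup>2 \<le> x ^ 3" by (simp add: power2_eq_square power3_eq_cube mult_ac)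
      have "(4 * 4) * x\<^sup>2 \<le> (x * x) * x\<^sup>2" using x by (intro mult_right_mono mult_mono) auto
      then show "16 * x\<^sup>2 \<le> x ^ 4" by (simp add: power2_eq_square power4_eq_xxxx mult_ac)
    qed
    moreover have "4 * x \<le> x\<^sup>2" using x by (simp add: power2_eq_square mult_right_mono)
    ultimately have "1 + 2 * x + 2 * x\<^sup>2 \<le> 1 + x + x\<^sup>2 / 2 + x ^ 3 / 6 + x ^ 4 / 24 + x ^ 5 / 120" using x by linarith
    then have "1 + 2 * x + 2 * x\<^sup>2 \<le> exp x" using e by linarith
    then show ?thesis by (simp add: x_def power2_eq_square)
  qed
  have "(1 + k + k\<^sup>2 / 2) * exp (- k) * exp (\<theta> * k) \<le> exp (k / 2) * exp (- k) * exp (\<theta> * k)"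
    by (intro mult_right_mono q) auto
  also have "\<dots> \<le> exp (- (k / 4))"
    unfolding exp_add[symmetric] exp_le_cancel_iff using mult_right_mono[OF \<theta>(2) k] by simp
  finally have le: "(1 + k + k\<^sup>2 / 2) * exp (- k) * exp (\<theta> * k) \<le> exp (- (k / 4))" .
  have "((1 + k + k\<^sup>2 / 2) * exp (- k) * exp (\<theta> * k)) ^ n \<le> exp (- (k / 4)) ^ n"
    using k by (intro power_mono le) auto
  also have "\<dots> \<le> exp (- (k / 4)) ^ 1" using n False by (intro power_decreasing) auto
  also have "\<dots> \<le> exp (8 * real n * \<theta> + 2) * exp (- (k / 4))" using \<theta> by simp
  finally show ?thesis .
qed

section \<open>Size of the kernels on large circles\<close>

locale pade_sequence =
  fixes a :: "nat \<Rightarrow> nat \<Rightarrow> complex" and P Q :: "nat \<Rightarrow> complex poly" and E :: "nat \<Rightarrow> complex \<Rightarrow> complex"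
    and \<tau> \<rho> :: "nat \<Rightarrow> real"
  assumes pade: "\<And>n. 0 < n \<Longrightarrow> pade_pair n (a n) (P n) (Q n) (E n) (\<tau> n)"
    and \<rho>: "filterlim \<rho> at_top sequentially" and \<tau>\<rho>: "(\<lambda>n. \<tau> n * \<rho> n) \<longlonglongrightarrow> 0"
begin

definition kernel where "kernel n = pade_pair.G n (a n) (P n) (\<tau> n)"
definition g where "g n = (SOME g. g holomorphic_on UNIV \<and> (\<forall>t. kernel n t = (1 - t\<^sup>2) ^ n * g t))"
definition N where "N n = Sup ((\<lambda>t. norm (g n t)) ` sphere 0 (\<rho> n))"

lemma g:
  assumes "0 < n"
  shows "g n holomorphic_on S" "kernel n t = (1 - t\<^sup>2) ^ n * g n t"
proof -
  interpret pade_pair n "a n" "P n" "Q n" "E n" "\<tau> n" by (rule pade[OF assms])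
  have "\<exists>g. g holomorphic_on UNIV \<and> (\<forall>t. kernel n t = (1 - t\<^sup>2) ^ n * g t)"
    unfolding kernel_def using G_factor by blast
  then have "g n holomorphic_on UNIV \<and> (\<forall>t. kernel n t = (1 - t\<^sup>2) ^ n * g n t)"
    unfolding g_def by (rule someI_ex)
  then show "g n holomorphic_on S" "kernel n t = (1 - t\<^sup>2) ^ n * g n t"
    by (auto intro: holomorphic_on_subset)
qed

lemma \<tau>_nonneg: "0 < n \<Longrightarrow> 0 \<le> \<tau> n"
  using pade_pair.\<tau>[OF pade] .

lemma N_attained:
  assumes "0 < n" "0 \<le> \<rho> n"
  shows "\<exists>t. norm t = \<rho> n \<and> norm (g n t) = N n" "norm t \<le> \<rho> n \<Longrightarrow> norm (g n t) \<le> N n"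
proof -
  have c: "continuous_on (sphere 0 (\<rho> n)) (\<lambda>t. norm (g n t))"
    by (intro continuous_intros holomorphic_on_imp_continuous_on g assms)
  obtain t0 where t0: "t0 \<in> sphere 0 (\<rho> n)" "\<And>t. t \<in> sphere 0 (\<rho> n) \<Longrightarrow> norm (g n t) \<le> norm (g n t0)"
    using continuous_attains_sup[OF compact_sphere _ c] assms(2) by auto
  then have N: "N n = norm (g n t0)" unfolding N_def by (intro cSup_eq_maximum) auto
  then show "\<exists>t. norm t = \<rho> n \<and> norm (g n t) = N n" using t0(1) by auto
  show "norm (g n t) \<le> N n" if "norm t \<le> \<rho> n"
    by (rule maximum_modulus_cball[OF g(1)[OF assms(1), of UNIV], of 0 "\<rho> n"]) (use t0 N that in auto)
qed

text \<open>\<open>G\<close> gains at most (R / r)^(2n) up to lower factors, while (1 - t^2)^n is at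
  most (r^2 + 1)^n in modulus on the inner circle and at least (R^2 - 1)^n on the outer one. The
  powers of R / r cancel.\<close>

lemma norm_g_growth:
  assumes n: "0 < n" and r: "1 < r" "r \<le> R" and M: "\<And>t. norm t = r \<Longrightarrow> norm (g n t) \<le> M" and t: "norm t = R"
  shows "norm (g n t) \<le> M * (real (2 * n + 1) * ((1 + 1 / r\<^sup>2) / (1 - 1 / R\<^sup>2)) ^ n * exp (n * \<tau> n * (r + R)))"
proof -
  interpret pade_pair n "a n" "P n" "Q n" "E n" "\<tau> n" by (rule pade[OF n])
  have G: "G t = (1 - t\<^sup>2) ^ n * g n t" for t using g(2)[OF n, of t] by (simp add: kernel_def)
  have M0: "0 \<le> M"
  proof -
    have "norm (of_real r :: complex) = r" using r by simp
    then show ?thesis using M norm_ge_zero order_trans by blast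
  qed
  have R1: "R > 1" using r by simp
  have r2: "1 < r\<^sup>2" "1 < R\<^sup>2" using r R1 by (auto intro: one_less_power)
  have "norm (G t) \<le> ((r\<^sup>2 + 1) ^ n * M) * exp (n * \<tau> n * (r + R)) * (\<Sum>k<2*n+1. (R / r) ^ k)"
  proof (rule norm_G_le_ratio)
    fix t :: complex assume t: "norm t = r"
    have "norm (1 - t\<^sup>2) \<le> r\<^sup>2 + 1" using norm_triangle_ineq4[of 1 "t\<^sup>2"] t by (simp add: norm_power)
    then show "norm (G t) \<le> (r\<^sup>2 + 1) ^ n * M" unfolding G norm_mult norm_power using M[OF t] M0
      by (intro mult_mono power_mono) auto
  qed (use r t in auto)
  also have "(\<Sum>k<2*n+1. (R / r) ^ k) \<le> (\<Sum>k<2*n+1. (R / r) ^ (2 * n))"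
    using r by (intro sum_mono power_increasing) auto
  also have "\<dots> = real (2 * n + 1) * (R\<^sup>2 / r\<^sup>2) ^ n" by (simp add: power_mult power_divide)
  finally have 1: "norm (G t) \<le> ((r\<^sup>2 + 1) ^ n * M) * exp (n * \<tau> n * (r + R)) * (real (2 * n + 1) * (R\<^sup>2 / r\<^sup>2) ^ n)"
    using M0 by (simp add: mult_left_mono)
  have "R\<^sup>2 - 1 \<le> norm (1 - t\<^sup>2)" using norm_triangle_ineq2[of "t\<^sup>2" 1] t by (simp add: norm_power norm_minus_commute)
  then have "(R\<^sup>2 - 1) ^ n * norm (g n t) \<le> norm (G t)" unfolding G norm_mult norm_power
    using r2 by (intro mult_right_mono power_mono) auto
  then have "(R\<^sup>2 - 1) ^ n * norm (g n t) \<le> ((r\<^sup>2 + 1) ^ n * M) * exp (n * \<tau> n * (r + R)) * (real (2 * n + 1) * (R\<^sup>2 / r\<^sup>2) ^ n)"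
    using 1 by linarith
  moreover have "(r\<^sup>2 + 1) ^ n * (R\<^sup>2 / r\<^sup>2) ^ n = (R\<^sup>2 - 1) ^ n * ((1 + 1 / r\<^sup>2) / (1 - 1 / R\<^sup>2)) ^ n"
  proof -
    have "(r\<^sup>2 + 1) * (R\<^sup>2 / r\<^sup>2) = (R\<^sup>2 - 1) * ((1 + 1 / r\<^sup>2) / (1 - 1 / R\<^sup>2))"
    proof -
      have "1 + 1 / r\<^sup>2 = (r\<^sup>2 + 1) / r\<^sup>2" "1 - 1 / R\<^sup>2 = (R\<^sup>2 - 1) / R\<^sup>2" using r r2 by (auto simp: field_simps)
      then show ?thesis using r2 by simp
    qed
    then show ?thesis by (simp only: power_mult_distrib[symmetric])
  qed
  moreover have "((r\<^sup>2 + 1) ^ n * M) * exp (n * \<tau> n * (r + R)) * (real (2 * n + 1) * (R\<^sup>2 / r\<^sup>2) ^ n)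
     = ((r\<^sup>2 + 1) ^ n * (R\<^sup>2 / r\<^sup>2) ^ n) * (M * (real (2 * n + 1) * exp (n * \<tau> n * (r + R))))" by simp
  ultimately have "(R\<^sup>2 - 1) ^ n * norm (g n t) \<le> (R\<^sup>2 - 1) ^ n * ((M * (real (2 * n + 1) * exp (n * \<tau> n * (r + R)))) * ((1 + 1 / r\<^sup>2) / (1 - 1 / R\<^sup>2)) ^ n)"
    by (simp only: mult.assoc mult.left_commute[of "((1 + 1 / r\<^sup>2) / (1 - 1 / R\<^sup>2)) ^ n"]) (simp only: mult_ac)
  then have "norm (g n t) \<le> (M * (real (2 * n + 1) * exp (n * \<tau> n * (r + R)))) * ((1 + 1 / r\<^sup>2) / (1 - 1 / R\<^sup>2)) ^ n"
    using r2 by (simp only: mult_le_cancel_left_pos zero_less_power diff_gt_0_iff_gt)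
  then show ?thesis by (simp only: mult_ac)
qed

lemma \<tau>_tendsto_0: "\<tau> \<longlonglongrightarrow> 0"
proof (rule tendsto_sandwich)
  show "\<forall>\<^sub>F n in sequentially. 0 \<le> \<tau> n" using eventually_gt_at_top[of 0] by eventually_elim (rule \<tau>_nonneg)
  have "\<forall>\<^sub>F n in sequentially. 1 \<le> \<rho> n" using \<rho> by (rule filterlim_at_top[THEN iffD1, THEN spec])
  with eventually_gt_at_top[of 0] show "\<forall>\<^sub>F n in sequentially. \<tau> n \<le> \<tau> n * \<rho> n"
  proof eventually_elim
    case (elim n)
    show ?case using mult_left_mono[OF elim(2) \<tau>_nonneg[OF elim(1)]] by simp
  qed
  show "(\<lambda>n. \<tau> n * \<rho> n) \<longlonglongrightarrow> 0" by (rule \<tau>\<rho>)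
qed (rule tendsto_const)

lemma inverse_\<rho>_sq_tendsto_0: "(\<lambda>n. 1 / (\<rho> n)\<^sup>2) \<longlonglongrightarrow> 0"
proof -
  have "filterlim (\<lambda>n. (\<rho> n)\<^sup>2) at_top sequentially" by (rule filterlim_pow_at_top[OF _ \<rho>]) simp
  then have "(\<lambda>n. inverse ((\<rho> n)\<^sup>2)) \<longlonglongrightarrow> 0" by (rule filterlim_compose[OF tendsto_inverse_0_at_top filterlim_ident, rotated])
  then show ?thesis by (simp only: inverse_eq_divide)
qed

lemma ln_linear_over_n_tendsto_0: "(\<lambda>n. ln (real (2 * n + 1)) / real n) \<longlonglongrightarrow> 0"
  by real_asymp

lemma \<rho>_ge: "\<forall>\<^sub>F n in sequentially. C \<le> \<rho> n"
  using \<rho> by (rule filterlim_at_top[THEN iffD1, THEN spec])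

lemma N_pos: "0 < n \<Longrightarrow> 0 < \<rho> n \<Longrightarrow> 0 < N n"
proof (rule ccontr)
  assume n: "0 < n" and \<rho>: "0 < \<rho> n" and "\<not> 0 < N n"
  then have "N n \<le> 0" by simp
  then have z: "g n t = 0" if "norm t \<le> \<rho> n" for t
  proof -
    have "norm (g n t) \<le> 0" using N_attained(2)[OF n less_imp_le[OF \<rho>] that] \<open>N n \<le> 0\<close> by linarith
    then show ?thesis by simp
  qed
  have "g n t = 0" for t
  proof (rule analytic_continuation[OF g(1)[OF n, of UNIV] open_UNIV connected_UNIV, of "ball 0 (\<rho> n)" 0])
    show "0 islimpt ball (0::complex) (\<rho> n)" using \<rho> by (simp add: islimpt_ball)
  qed (use z in auto)
  then have "kernel n t = 0" for t using g(2)[OF n] by simp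
  then show False using pade_pair.G_not_identically_zero[OF pade[OF n]] by (simp add: kernel_def)
qed

text \<open>Inside the circle of radius \<open>\<rho> n\<close> this is the maximum principle for
  \<open>g n\<close>. Outside, the growth estimate starts from that circle, and its factor exp (n
  \<tau> (\<rho> + \<bar>t\<bar>)) is absorbed by the exponential in \<open>norm t\<close>.\<close>

lemma kernel_upper:
  assumes \<epsilon>: "0 < \<epsilon>"
  shows "\<forall>\<^sub>F n in sequentially. \<forall>t. norm (kernel n t) \<le> N n * norm (1 - t\<^sup>2) ^ n * exp (real n * \<epsilon> * (1 + norm t))"
proof -
  have "(\<lambda>n. ln (real (2 * n + 1)) / real n + ln ((1 + 1 / (\<rho> n)\<^sup>2) / (1 - 1 / (\<rho> n)\<^sup>2))) \<longlonglongrightarrow> 0 + ln ((1 + 0) / (1 - 0))"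
    by (intro tendsto_intros ln_linear_over_n_tendsto_0 inverse_\<rho>_sq_tendsto_0) auto
  then have 1: "\<forall>\<^sub>F n in sequentially. ln (real (2 * n + 1)) / real n + ln ((1 + 1 / (\<rho> n)\<^sup>2) / (1 - 1 / (\<rho> n)\<^sup>2)) < \<epsilon>"
    using \<epsilon> by (intro order_tendstoD) auto
  have 2: "\<forall>\<^sub>F n in sequentially. \<tau> n < \<epsilon> / 2" using \<tau>_tendsto_0 \<epsilon> by (intro order_tendstoD) auto
  from 1 2 \<rho>_ge[of 2] eventually_gt_at_top[of 0] show ?thesis
  proof eventually_elim
    case (elim n)
    note n = elim(4)
    show ?case
    proof
      fix t
      have "norm (g n t) \<le> N n * exp (real n * \<epsilon> * (1 + norm t))"
      proof (cases "norm t \<le> \<rho> n")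
        case True
        have "norm (g n t) \<le> N n" using N_attained(2)[OF n _ True] elim(3) by simp
        also have "\<dots> \<le> N n * exp (real n * \<epsilon> * (1 + norm t))"
          using N_pos[OF n] elim(3) \<epsilon> by (intro mult_le_cancel_left1[THEN iffD2]) auto
        finally show ?thesis .
      next
        case False
        define R where "R = norm t"
        have R: "\<rho> n \<le> R" "2 \<le> R" using False elim(3) by (auto simp: R_def)
        have "norm (g n t) \<le> N n * (real (2 * n + 1) * ((1 + 1 / (\<rho> n)\<^sup>2) / (1 - 1 / R\<^sup>2)) ^ n * exp (n * \<tau> n * (\<rho> n + R)))"
          by (rule norm_g_growth[OF n _ R(1) N_attained(2)[OF n]]) (use elim(3) in \<open>auto simp: R_def\<close>)
        also have "\<dots> \<le> N n * exp (real n * \<epsilon> * (1 + norm t))"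
        proof (rule mult_left_mono)
          have s: "4 \<le> (\<rho> n)\<^sup>2" "(\<rho> n)\<^sup>2 \<le> R\<^sup>2" using elim(3) R power_mono[of 2 "\<rho> n" 2] power_mono[of "\<rho> n" R 2] by auto
          define q where "q = (1 + 1 / (\<rho> n)\<^sup>2) / (1 - 1 / (\<rho> n)\<^sup>2)"
          have i: "0 \<le> 1 / (\<rho> n)\<^sup>2" "1 / (\<rho> n)\<^sup>2 \<le> 1 / 4" using s by (auto simp: divide_simps)
          have q: "0 < q" unfolding q_def using i by (intro divide_pos_pos) linarith+
          have d: "1 / R\<^sup>2 \<le> 1 / (\<rho> n)\<^sup>2" using s by (intro divide_left_mono mult_pos_pos) linarith+
          have "(1 + 1 / (\<rho> n)\<^sup>2) / (1 - 1 / R\<^sup>2) \<le> q" unfolding q_def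
            using i d by (intro divide_left_mono mult_pos_pos) linarith+
          moreover have "0 \<le> (1 + 1 / (\<rho> n)\<^sup>2) / (1 - 1 / R\<^sup>2)" using i d by (intro divide_nonneg_nonneg) linarith+
          ultimately have "((1 + 1 / (\<rho> n)\<^sup>2) / (1 - 1 / R\<^sup>2)) ^ n \<le> q ^ n" by (rule power_mono)
          then have "real (2 * n + 1) * ((1 + 1 / (\<rho> n)\<^sup>2) / (1 - 1 / R\<^sup>2)) ^ n * exp (n * \<tau> n * (\<rho> n + R))
              \<le> real (2 * n + 1) * q ^ n * exp (n * \<tau> n * (\<rho> n + R))"
            by (intro mult_left_mono mult_right_mono) auto
          also have "\<dots> = exp (ln (real (2 * n + 1)) + n * ln q + n * \<tau> n * (\<rho> n + R))"
            using q by (simp add: exp_add exp_of_nat_mult del: of_nat_Suc of_nat_add)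
          also have "\<dots> \<le> exp (real n * \<epsilon> * (1 + norm t))"
            unfolding exp_le_cancel_iff
          proof -
            have "ln (real (2 * n + 1)) + n * ln q = n * (ln (real (2 * n + 1)) / real n + ln q)"
              using n by (simp add: field_simps)
            also have "\<dots> \<le> real n * \<epsilon>" using elim(1) unfolding q_def by (intro mult_left_mono) auto
            finally have a: "ln (real (2 * n + 1)) + n * ln q \<le> real n * \<epsilon>" .
            have "\<tau> n * (\<rho> n + R) \<le> \<epsilon> / 2 * (2 * R)"
              using elim(2,3) R \<tau>_nonneg[OF n] by (intro mult_mono) auto
            then have "real n * (\<tau> n * (\<rho> n + R)) \<le> real n * (\<epsilon> * R)" by (intro mult_left_mono) auto
            then show "ln (real (2 * n + 1)) + n * ln q + n * \<tau> n * (\<rho> n + R) \<le> real n * \<epsilon> * (1 + norm t)"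
              using a by (simp add: R_def algebra_simps)
          qed
          finally show "real (2 * n + 1) * ((1 + 1 / (\<rho> n)\<^sup>2) / (1 - 1 / R\<^sup>2)) ^ n * exp (n * \<tau> n * (\<rho> n + R)) \<le> exp (real n * \<epsilon> * (1 + norm t))" .
        qed (use N_pos[OF n] elim(3) in simp)
        finally show ?thesis .
      qed
      then have "norm (1 - t\<^sup>2) ^ n * norm (g n t) \<le> norm (1 - t\<^sup>2) ^ n * (N n * exp (real n * \<epsilon> * (1 + norm t)))"
        by (rule mult_left_mono) simp
      then show "norm (kernel n t) \<le> N n * norm (1 - t\<^sup>2) ^ n * exp (real n * \<epsilon> * (1 + norm t))"
        unfolding g(2)[OF n] norm_mult norm_power by (simp only: mult_ac)
    qed
  qed
qed

text \<open>The growth estimate from the circle of radius \<open>K\<close> out to radius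
  \<open>\<rho> n\<close> bounds \<open>N n\<close> by the maximum on the smaller circle; this step
  uses that \<open>\<tau> n * \<rho> n\<close> tends to 0. Since ln (1 + 1 / K^2) \<le> 1 / K^2, the
  exponent 2 / K^2 leaves room for the subexponential factors.\<close>

lemma kernel_lower:
  assumes K: "1 < K"
  shows "\<forall>\<^sub>F n in sequentially. \<exists>t. norm t = K \<and> N n * (K\<^sup>2 - 1) ^ n * exp (- (2 * n / K\<^sup>2)) \<le> norm (kernel n t)"
proof -
  have K2: "1 < K\<^sup>2" using K by (simp add: one_less_power)
  have "(\<lambda>n. \<tau> n * K + \<tau> n * \<rho> n) \<longlonglongrightarrow> 0 * K + 0" by (intro tendsto_intros \<tau>\<rho> \<tau>_tendsto_0)
  moreover have "(\<lambda>n. ln (real (2 * n + 1)) / real n + ln ((1 + 1 / K\<^sup>2) / (1 - 1 / (\<rho> n)\<^sup>2))) \<longlonglongrightarrow> 0 + ln ((1 + 1 / K\<^sup>2) / (1 - 0))"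
  proof (intro tendsto_intros ln_linear_over_n_tendsto_0 inverse_\<rho>_sq_tendsto_0)
    have "0 < 1 + 1 / K\<^sup>2" by (intro add_pos_nonneg) auto
    then show "(1 + 1 / K\<^sup>2) / (1 - 0) \<noteq> 0" by simp
  qed auto
  ultimately have "(\<lambda>n. ln (real (2 * n + 1)) / real n + ln ((1 + 1 / K\<^sup>2) / (1 - 1 / (\<rho> n)\<^sup>2)) + (\<tau> n * K + \<tau> n * \<rho> n))
      \<longlonglongrightarrow> 0 + ln ((1 + 1 / K\<^sup>2) / (1 - 0)) + (0 * K + 0)"
    by (rule tendsto_add[rotated])
  moreover have "ln ((1 + 1 / K\<^sup>2) / (1 - 0)) < 2 / K\<^sup>2"
  proof -
    have "ln (1 + 1 / K\<^sup>2) \<le> 1 / K\<^sup>2" by (rule ln_add_one_self_le_self) simp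
    also have "\<dots> < 2 / K\<^sup>2" using K2 by (intro divide_strict_right_mono) auto
    finally show ?thesis by simp
  qed
  ultimately have 1: "\<forall>\<^sub>F n in sequentially. ln (real (2 * n + 1)) / real n + ln ((1 + 1 / K\<^sup>2) / (1 - 1 / (\<rho> n)\<^sup>2)) + (\<tau> n * K + \<tau> n * \<rho> n) < 2 / K\<^sup>2"
    by (intro order_tendstoD) auto
  from 1 \<rho>_ge[of "max 2 K"] eventually_gt_at_top[of 0] show ?thesis
  proof eventually_elim
    case (elim n)
    note n = elim(3)
    have \<rho>n: "2 \<le> \<rho> n" "K \<le> \<rho> n" using elim(2) by auto
    have c: "continuous_on (sphere 0 K) (\<lambda>t. norm (g n t))"
      by (intro continuous_intros holomorphic_on_imp_continuous_on g n)
    obtain t0 where t0: "norm t0 = K" "\<And>t. norm t = K \<Longrightarrow> norm (g n t) \<le> norm (g n t0)"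
      using continuous_attains_sup[OF compact_sphere _ c] K by auto
    define M where "M = norm (g n t0)"
    obtain t1 where t1: "norm t1 = \<rho> n" "norm (g n t1) = N n" using N_attained(1)[OF n] \<rho>n by auto
    define q where "q = (1 + 1 / K\<^sup>2) / (1 - 1 / (\<rho> n)\<^sup>2)"
    have s: "4 \<le> (\<rho> n)\<^sup>2" using \<rho>n power_mono[of 2 "\<rho> n" 2] by auto
    have i: "0 \<le> 1 / K\<^sup>2" "1 / (\<rho> n)\<^sup>2 \<le> 1 / 4" using s by (auto simp: divide_simps)
    have q: "0 < q" unfolding q_def using i by (intro divide_pos_pos) linarith+
    have "N n \<le> M * (real (2 * n + 1) * q ^ n * exp (n * \<tau> n * (K + \<rho> n)))"
      unfolding t1(2)[symmetric] q_def M_def by (rule norm_g_growth[OF n K \<rho>n(2) t0(2) t1(1)])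
    also have "real (2 * n + 1) * q ^ n * exp (n * \<tau> n * (K + \<rho> n)) = exp (ln (real (2 * n + 1)) + n * ln q + n * \<tau> n * (K + \<rho> n))"
      using q by (simp add: exp_add exp_of_nat_mult del: of_nat_Suc of_nat_add)
    also have "ln (real (2 * n + 1)) + n * ln q + n * \<tau> n * (K + \<rho> n) = n * (ln (real (2 * n + 1)) / real n + ln q + (\<tau> n * K + \<tau> n * \<rho> n))"
      using n by (simp add: field_simps)
    also have "M * exp (n * (ln (real (2 * n + 1)) / real n + ln q + (\<tau> n * K + \<tau> n * \<rho> n))) \<le> M * exp (n * (2 / K\<^sup>2))"
      unfolding M_def by (intro mult_left_mono exp_le_cancel_iff[THEN iffD2] less_imp_le[OF elim(1)[folded q_def]] norm_ge_zero of_nat_0_le_iff)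
    finally have "N n \<le> M * exp (2 * n / K\<^sup>2)" by (simp add: mult.commute)
    moreover have "x * exp (- y) \<le> m" if "x \<le> m * exp y" for x y m :: real
      using that by (simp add: exp_minus field_simps)
    ultimately have NM: "N n * exp (- (2 * n / K\<^sup>2)) \<le> M" by blast
    have "K\<^sup>2 - 1 \<le> norm (1 - t0\<^sup>2)" using norm_triangle_ineq2[of "t0\<^sup>2" 1] t0(1) by (simp add: norm_power norm_minus_commute)
    then have p: "(K\<^sup>2 - 1) ^ n \<le> norm (1 - t0\<^sup>2) ^ n" using K2 by (intro power_mono) auto
    have "(N n * exp (- (2 * n / K\<^sup>2))) * (K\<^sup>2 - 1) ^ n \<le> M * norm (1 - t0\<^sup>2) ^ n"
      using NM p K2 by (intro mult_mono) (auto simp: M_def)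
    also have "\<dots> = norm (kernel n t0)" unfolding g(2)[OF n] norm_mult norm_power M_def by (rule mult.commute)
    finally show ?case using t0(1) by (intro exI[of _ t0]) (simp add: mult_ac)
  qed
qed

end

section \<open>Counting zeros near a line\<close>

text \<open>The limiting potential near the curve is \<bar>Re\<bar> plus a harmonic function. That
  its mean is linear in the radius produces the density n / \<pi> of zeros per unit length.\<close>

lemma integral_abs_Re_circle:
  assumes "0 \<le> \<rho>"
  shows "((\<lambda>s. \<bar>Re (of_real \<rho> * exp (2 * of_real pi * \<i> * of_real s))\<bar>) has_integral 2 * \<rho> / pi) {0..1}"
proof -
  have Re: "Re (of_real \<rho> * exp (2 * of_real pi * \<i> * of_real s)) = \<rho> * cos (2 * pi * s)" for s :: real
    by (simp add: Re_exp)
  define F where "F s = \<rho> * sin (2 * pi * s) / (2 * pi)" for s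
  have F: "(F has_vector_derivative \<rho> * cos (2 * pi * s)) (at s within S)" for s S
    unfolding F_def by (auto intro!: derivative_eq_intros simp: has_real_derivative_iff_has_vector_derivative[symmetric])
  have F': "((\<lambda>s. - F s) has_vector_derivative - (\<rho> * cos (2 * pi * s))) (at s within S)" for s S
    by (intro derivative_intros F)
  have c1: "\<bar>\<rho> * cos (2 * pi * s)\<bar> = \<rho> * cos (2 * pi * s)" if "s \<in> {0..1/4} \<union> {3/4..1}" for s
  proof -
    have "0 \<le> cos (2 * pi * s)"
    proof (cases "s \<le> 1 / 4")
      case True
      then have "2 * pi * s \<le> 2 * pi * (1 / 4)" by (intro mult_left_mono) auto
      moreover have "0 \<le> 2 * pi * s" using that by auto
      moreover have "0 < pi" by simp
      ultimately show ?thesis by (intro cos_ge_zero) linarith+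
    next
      case False
      then have s: "3 / 4 \<le> s" "s \<le> 1" using that by auto
      have "cos (2 * pi * s) = cos (2 * pi - 2 * pi * s)" by (simp add: cos_2pi_minus)
      also have "2 * pi - 2 * pi * s = 2 * pi * (1 - s)" by (simp add: algebra_simps)
      also have "0 \<le> cos (2 * pi * (1 - s))"
      proof (rule cos_ge_zero)
        have "2 * pi * (1 - s) \<le> 2 * pi * (1 / 4)" using s by (intro mult_left_mono) auto
        then show "2 * pi * (1 - s) \<le> pi / 2" by simp
        have "0 \<le> 2 * pi * (1 - s)" using s by simp
        then show "- (pi / 2) \<le> 2 * pi * (1 - s)" using pi_gt_zero by linarith
      qed
      finally show ?thesis .
    qed
    then show ?thesis using assms by simp
  qed
  have c2: "\<bar>\<rho> * cos (2 * pi * s)\<bar> = - (\<rho> * cos (2 * pi * s))" if "s \<in> {1/4..3/4}" for s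
  proof -
    have "0 \<le> cos (2 * pi * s - pi)"
    proof (rule cos_ge_zero)
      have "2 * pi * (1 / 4) \<le> 2 * pi * s" "2 * pi * s \<le> 2 * pi * (3 / 4)" using that by (auto intro!: mult_left_mono)
      then show "- (pi / 2) \<le> 2 * pi * s - pi" "2 * pi * s - pi \<le> pi / 2" by linarith+
    qed
    then have "cos (2 * pi * s) \<le> 0" by (simp add: cos_diff)
    then have "\<rho> * cos (2 * pi * s) \<le> 0" using assms by (simp add: mult_nonneg_nonpos)
    then show ?thesis by simp
  qed
  have i1: "((\<lambda>s. \<rho> * cos (2 * pi * s)) has_integral F (1/4) - F 0) {0..1/4}"
    by (rule fundamental_theorem_of_calculus) (auto intro: F)
  have i2: "((\<lambda>s. - (\<rho> * cos (2 * pi * s))) has_integral (- F (3/4)) - (- F (1/4))) {1/4..3/4}"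
    by (rule fundamental_theorem_of_calculus) (auto intro: F')
  have i3: "((\<lambda>s. \<rho> * cos (2 * pi * s)) has_integral F 1 - F (3/4)) {3/4..1}"
    by (rule fundamental_theorem_of_calculus) (auto intro: F)
  have j1: "((\<lambda>s. \<bar>\<rho> * cos (2 * pi * s)\<bar>) has_integral F (1/4) - F 0) {0..1/4}"
    by (rule has_integral_eq[OF _ i1]) (use c1 in auto)
  have j2: "((\<lambda>s. \<bar>\<rho> * cos (2 * pi * s)\<bar>) has_integral (- F (3/4)) - (- F (1/4))) {1/4..3/4}"
    by (rule has_integral_eq[OF _ i2]) (use c2 in auto)
  have j3: "((\<lambda>s. \<bar>\<rho> * cos (2 * pi * s)\<bar>) has_integral F 1 - F (3/4)) {3/4..1}"
    by (rule has_integral_eq[OF _ i3]) (use c1 in auto)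
  have "((\<lambda>s. \<bar>\<rho> * cos (2 * pi * s)\<bar>) has_integral (F (1/4) - F 0 + ((- F (3/4)) - (- F (1/4)))) + (F 1 - F (3/4))) {0..1}"
    by (rule has_integral_combine[OF _ _ has_integral_combine[OF _ _ j1 j2] j3]) auto
  moreover have "F (1/4) = \<rho> / (2 * pi)" "F 0 = 0" "F 1 = 0" by (simp_all add: F_def)
  moreover have "F (3/4) = - \<rho> / (2 * pi)"
  proof -
    have "2 * pi * (3 / 4) = pi + pi / 2" by simp
    then have "sin (2 * pi * (3 / 4)) = - 1" by (simp only: sin_add) simp
    then show ?thesis unfolding F_def by simp
  qed
  ultimately show ?thesis unfolding Re by (simp add: field_simps)
qed

text \<open>\<open>G\<close> is the quotient by the Blaschke product of the zeros in the disc of radius \<open>\<rho>\<close>.\<close>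

lemma blaschke_quotient:
  fixes g :: "complex \<Rightarrow> complex"
  assumes g: "g holomorphic_on ball 0 r0" "\<And>z. z \<in> ball 0 r0 \<Longrightarrow> g z \<noteq> 0"
    and \<rho>: "0 < \<rho>" "\<rho> < r0"
  obtains G where "G holomorphic_on ball 0 r0" "\<And>z. z \<in> ball 0 \<rho> \<Longrightarrow> G z \<noteq> 0"
    "\<And>z. norm z = \<rho> \<Longrightarrow> norm (G z) = norm ((\<Prod>\<zeta>\<in>#Z. z - \<zeta>) * g z)"
    "\<And>z. norm z \<le> \<rho> \<Longrightarrow> norm ((\<Prod>\<zeta>\<in>#Z. z - \<zeta>) * g z) \<le> norm (G z)"
    "norm (G 0) = norm (g 0) * (\<Prod>\<zeta>\<in>#Z. max (norm \<zeta>) \<rho>)"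
proof -
  \<comment> \<open>Only zeros in the open disc are moved to their mirror images in the circle; on
    the circle this changes no modulus.\<close>
  define b where "b \<zeta> z = (if norm \<zeta> < \<rho> then (of_real (\<rho>\<^sup>2) - cnj \<zeta> * z) / of_real \<rho> else z - \<zeta>)" for \<zeta> z
  define G where "G z = (\<Prod>\<zeta>\<in>#Z. b \<zeta> z) * g z" for z
  have b_hol: "b \<zeta> holomorphic_on S" for \<zeta> S
    unfolding b_def using \<rho> by (cases "norm \<zeta> < \<rho>") (auto intro!: holomorphic_intros)
  have sq: "(norm (of_real (\<rho>\<^sup>2) - cnj \<zeta> * z))\<^sup>2 - (\<rho> * norm (z - \<zeta>))\<^sup>2 = (\<rho>\<^sup>2 - (norm z)\<^sup>2) * (\<rho>\<^sup>2 - (norm \<zeta>)\<^sup>2)" for z \<zeta>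
    unfolding power_mult_distrib cmod_power2 by (simp add: power2_eq_square algebra_simps)
  have eq: "norm (b \<zeta> z) = norm (z - \<zeta>)" if z: "norm z = \<rho>" for z \<zeta>
  proof -
    have "(norm (of_real (\<rho>\<^sup>2) - cnj \<zeta> * z))\<^sup>2 = (\<rho> * norm (z - \<zeta>))\<^sup>2" using sq[of \<zeta> z] z by simp
    then have "norm (of_real (\<rho>\<^sup>2) - cnj \<zeta> * z) = \<rho> * norm (z - \<zeta>)" using \<rho> by (subst (asm) power2_eq_iff_nonneg) auto
    then show ?thesis using \<rho> by (simp add: b_def norm_divide)
  qed
  have le: "norm (z - \<zeta>) \<le> norm (b \<zeta> z)" if z: "norm z \<le> \<rho>" for z \<zeta>
  proof (cases "norm \<zeta> < \<rho>")
    case True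
    have "0 \<le> \<rho>\<^sup>2 - (norm z)\<^sup>2" "0 \<le> \<rho>\<^sup>2 - (norm \<zeta>)\<^sup>2" using z True \<rho> by (auto intro!: power_mono)
    then have "(\<rho> * norm (z - \<zeta>))\<^sup>2 \<le> (norm (of_real (\<rho>\<^sup>2) - cnj \<zeta> * z))\<^sup>2" using sq[of \<zeta> z] mult_nonneg_nonneg[of "\<rho>\<^sup>2 - (norm z)\<^sup>2" "\<rho>\<^sup>2 - (norm \<zeta>)\<^sup>2"] by linarith
    then have "\<rho> * norm (z - \<zeta>) \<le> norm (of_real (\<rho>\<^sup>2) - cnj \<zeta> * z)" by (rule power2_le_imp_le) simp
    then show ?thesis using True \<rho> by (simp add: b_def norm_divide field_simps)
  qed (simp add: b_def)
  have nz: "b \<zeta> z \<noteq> 0" if z: "norm z < \<rho>" for z \<zeta>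
  proof (cases "norm \<zeta> < \<rho>")
    case True
    have "norm (cnj \<zeta> * z) < \<rho> * \<rho>" using True z unfolding norm_mult by (intro mult_strict_mono') auto
    then have "norm (cnj \<zeta> * z) \<noteq> norm (of_real (\<rho>\<^sup>2) :: complex)" unfolding norm_of_real power2_eq_square by simp
    then have "cnj \<zeta> * z \<noteq> of_real (\<rho>\<^sup>2)" by metis
    then show ?thesis using True \<rho> by (simp add: b_def)
  qed (use z in \<open>auto simp: b_def\<close>)
  have b0: "norm (b \<zeta> 0) = max (norm \<zeta>) \<rho>" for \<zeta>
    using \<rho> by (auto simp: b_def norm_divide norm_power power2_eq_square norm_mult max_def)
  show ?thesis
  proof (rule that)
    show "G holomorphic_on ball 0 r0" unfolding G_def by (intro holomorphic_intros b_hol g)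
    show "G z \<noteq> 0" if "z \<in> ball 0 \<rho>" for z
      using that nz[of z] g(2)[of z] \<rho> by (auto simp: G_def prod_mset_zero_iff)
    show "norm (G z) = norm ((\<Prod>\<zeta>\<in>#Z. z - \<zeta>) * g z)" if "norm z = \<rho>" for z
      by (simp add: G_def norm_mult norm_prod_mset eq[OF that])
    show "norm ((\<Prod>\<zeta>\<in>#Z. z - \<zeta>) * g z) \<le> norm (G z)" if "norm z \<le> \<rho>" for z
      unfolding G_def norm_mult norm_prod_mset
      by (intro mult_right_mono prod_mset_mono_real[THEN conjunct1]) (auto simp: le[OF that])
    show "norm (G 0) = norm (g 0) * (\<Prod>\<zeta>\<in>#Z. max (norm \<zeta>) \<rho>)"
      by (simp add: G_def norm_mult norm_prod_mset b0)
  qed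
qed

text \<open>The barrier: on the circle, \<open>\<bar>Re z\<bar>\<close> lies below a function that is affine in \<open>z\<close> and close to \<open>\<bar>Re w\<bar>\<close> at \<open>w\<close>.\<close>

lemma affine_barrier:
  assumes G: "G holomorphic_on ball 0 r0" and \<rho>: "0 < \<rho>" "\<rho> < r0" and \<kappa>: "0 < \<kappa>" and w: "norm w = \<rho>"
    and ub: "\<And>z. norm z = \<rho> \<Longrightarrow> norm (G z) \<le> exp (real n * (\<bar>Re z\<bar> + \<epsilon>))" and z: "norm z \<le> \<rho>"
  shows "norm (G z) \<le> exp (real n * (\<bar>Re w\<bar> + \<kappa> + \<epsilon> + (\<rho>\<^sup>2 - Re (z * cnj w)) / (2 * \<kappa>)))"
proof -
  define H where "H z = G z * exp (of_real (n / (2 * \<kappa>)) * (z * cnj w))" for z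
  define B where "B = exp (real n * (\<bar>Re w\<bar> + \<kappa> + \<epsilon> + \<rho>\<^sup>2 / (2 * \<kappa>)))"
  have nH: "norm (H z) = norm (G z) * exp (n / (2 * \<kappa>) * Re (z * cnj w))" for z
    by (simp add: H_def norm_mult norm_exp_eq_Re)
  have "norm (H z) \<le> B"
  proof (rule maximum_modulus_cball[of H "ball 0 r0" 0 \<rho>])
    show "H holomorphic_on ball 0 r0" unfolding H_def by (intro holomorphic_intros G)
    show "norm (H z) \<le> B" if "norm (z - 0) = \<rho>" for z
    proof -
      have z: "norm z = \<rho>" using that by simp
      define a where "a = norm (z - w)"
      have a2: "a\<^sup>2 = 2 * (\<rho>\<^sup>2 - Re (z * cnj w))"
      proof -
        have "(norm (z - w))\<^sup>2 = (norm z)\<^sup>2 + (norm w)\<^sup>2 - 2 * Re (z * cnj w)"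
          unfolding cmod_power2 by (simp add: power2_eq_square algebra_simps)
        then show ?thesis using z w by (simp add: a_def)
      qed
      \<comment> \<open>The resulting a \<le> \<kappa> + a^2 / (4 \<kappa>) trades the distance from
        \<open>w\<close> for its square, which on the circle is the real part of an affine function
        and can be absorbed into an exponential factor.\<close>
      have "0 \<le> (a - 2 * \<kappa>)\<^sup>2" by simp
      then have "4 * \<kappa> * a \<le> a\<^sup>2 + 4 * \<kappa>\<^sup>2" by (simp add: power2_eq_square algebra_simps)
      then have "a \<le> \<kappa> + a\<^sup>2 / (4 * \<kappa>)" using \<kappa> by (simp add: field_simps power2_eq_square)
      moreover have "\<bar>Re z\<bar> \<le> \<bar>Re w\<bar> + a"
        using abs_Re_le_cmod[of "z - w"] by (simp add: a_def)
      moreover have "a\<^sup>2 / (4 * \<kappa>) = (\<rho>\<^sup>2 - Re (z * cnj w)) / (2 * \<kappa>)" unfolding a2 using \<kappa> by (simp add: field_simps)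
      ultimately have "\<bar>Re z\<bar> + \<epsilon> + Re (z * cnj w) / (2 * \<kappa>) \<le> \<bar>Re w\<bar> + \<kappa> + \<epsilon> + \<rho>\<^sup>2 / (2 * \<kappa>)"
        by (simp add: diff_divide_distrib)
      then have "real n * (\<bar>Re z\<bar> + \<epsilon> + Re (z * cnj w) / (2 * \<kappa>)) \<le> real n * (\<bar>Re w\<bar> + \<kappa> + \<epsilon> + \<rho>\<^sup>2 / (2 * \<kappa>))"
        by (rule mult_left_mono) simp
      moreover have "norm (H z) \<le> exp (real n * (\<bar>Re z\<bar> + \<epsilon>)) * exp (n / (2 * \<kappa>) * Re (z * cnj w))"
        unfolding nH by (intro mult_right_mono ub z) simp
      moreover have "\<dots> = exp (real n * (\<bar>Re z\<bar> + \<epsilon> + Re (z * cnj w) / (2 * \<kappa>)))"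
        unfolding exp_add[symmetric] by (simp add: field_simps)
      ultimately show ?thesis unfolding B_def by (metis exp_le_cancel_iff order_trans)
    qed
  qed (use \<rho> z in auto)
  then have "norm (G z) * exp (n / (2 * \<kappa>) * Re (z * cnj w)) * exp (- (n / (2 * \<kappa>) * Re (z * cnj w))) \<le> B * exp (- (n / (2 * \<kappa>) * Re (z * cnj w)))"
    unfolding nH by (rule mult_right_mono) simp
  moreover have "exp x * exp (- x) = (1::real)" for x by (simp add: exp_add[symmetric])
  moreover have "B * exp (- (n / (2 * \<kappa>) * Re (z * cnj w))) = exp (real n * (\<bar>Re w\<bar> + \<kappa> + \<epsilon> + (\<rho>\<^sup>2 - Re (z * cnj w)) / (2 * \<kappa>)))"
    unfolding B_def exp_add[symmetric] using \<kappa> by (simp add: field_simps)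
  ultimately show ?thesis by (simp only: mult.assoc mult_1_right)
qed

text \<open>\<open>G\<close> is known to be zero-free only in the open disc, so the mean value
  property of ln \<bar>G\<bar> is used on the circle of radius \<open>l * \<rho>\<close>, while the
  comparison with \<bar>Re\<bar> refers to the radial projection on the circle of radius
  \<open>\<rho>\<close>.\<close>

lemma ln_norm_center_circle_bounds:
  assumes G: "G holomorphic_on ball 0 r0" and nz: "\<And>z. z \<in> ball 0 \<rho> \<Longrightarrow> G z \<noteq> 0" and \<rho>: "0 < \<rho>" "\<rho> \<le> r0"
    and l: "0 < l" "l < 1"
  shows "(\<And>w. norm w = \<rho> \<Longrightarrow> ln (norm (G (of_real l * w))) \<le> real n * (\<bar>Re w\<bar> + \<delta>)) \<Longrightarrow>
       ln (norm (G 0)) \<le> real n * (2 * \<rho> / pi + \<delta>)"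
    and "(\<And>w. norm w = \<rho> \<Longrightarrow> real n * (\<bar>Re w\<bar> - \<delta>) \<le> ln (norm (G (of_real l * w)))) \<Longrightarrow>
       real n * (2 * \<rho> / pi - \<delta>) \<le> ln (norm (G 0))"
proof -
  have "ball 0 \<rho> \<subseteq> ball (0::complex) r0" using \<rho> by (rule_tac subset_ball) simp
  then have "G holomorphic_on ball 0 \<rho>" by (rule holomorphic_on_subset[OF G])
  then obtain L where L: "L holomorphic_on ball 0 \<rho>" "\<And>z. z \<in> ball 0 \<rho> \<Longrightarrow> G z = exp (L z)"
    using exists_holomorphic_log_ball nz by blast
  have lnG: "ln (norm (G z)) = Re (L z)" if "z \<in> ball 0 \<rho>" for z
    using L(2)[OF that] by (simp add: norm_exp_eq_Re)
  define e where "e s = of_real \<rho> * exp (2 * of_real pi * \<i> * complex_of_real s)" for s :: real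
  have ne: "norm (e s) = \<rho>" for s using \<rho> by (simp add: e_def)
  have l\<rho>: "l * \<rho> < \<rho>" "0 < l * \<rho>" using l \<rho> by auto
  have cL: "continuous_on (sphere 0 (l * \<rho>)) L"
    by (rule continuous_on_subset[OF holomorphic_on_imp_continuous_on[OF L(1)]]) (use l\<rho> in auto)
  have int: "(\<lambda>s. L (of_real (l * \<rho>) * exp (2 * of_real pi * \<i> * of_real s))) integrable_on {0..1}"
    by (rule integrable_circle_mean[OF cL]) (use l\<rho> in simp)
  have m: "circle_mean (l * \<rho>) L = L 0" by (rule circle_mean_eq_center[OF L(1)]) (use l\<rho> in auto)
  have "((\<lambda>s. L (of_real (l * \<rho>) * exp (2 * of_real pi * \<i> * of_real s))) has_integral L 0) {0..1}"
    using int m unfolding circle_mean_def by (simp add: has_integral_iff)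
  then have "((\<lambda>s. Re (L (of_real (l * \<rho>) * exp (2 * of_real pi * \<i> * of_real s)))) has_integral Re (L 0)) {0..1}"
    by (rule has_integral_Re)
  moreover have "Re (L (of_real (l * \<rho>) * exp (2 * of_real pi * \<i> * of_real s))) = ln (norm (G (of_real l * e s)))" for s :: real
  proof -
    have "of_real l * e s \<in> ball 0 \<rho>" using l\<rho> l ne[of s] by (simp add: norm_mult)
    then show ?thesis by (simp add: lnG e_def mult.assoc)
  qed
  ultimately have I: "((\<lambda>s. ln (norm (G (of_real l * e s)))) has_integral ln (norm (G 0))) {0..1}"
    using lnG[of 0] \<rho> by simp
  have J: "((\<lambda>s. real n * (\<bar>Re (e s)\<bar> + d)) has_integral real n * (2 * \<rho> / pi + d)) {0..1}" for d
  proof -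
    have "((\<lambda>s. \<bar>Re (e s)\<bar> + d) has_integral 2 * \<rho> / pi + d) {0..1}"
      using has_integral_add[OF integral_abs_Re_circle has_integral_const_real[of d 0 1]] \<rho> by (simp add: e_def)
    then show ?thesis by (rule has_integral_mult_right)
  qed
  show "ln (norm (G 0)) \<le> real n * (2 * \<rho> / pi + \<delta>)"
    if "\<And>w. norm w = \<rho> \<Longrightarrow> ln (norm (G (of_real l * w))) \<le> real n * (\<bar>Re w\<bar> + \<delta>)"
    by (rule has_integral_le[OF I J]) (use that ne in auto)
  show "real n * (2 * \<rho> / pi - \<delta>) \<le> ln (norm (G 0))"
    if "\<And>w. norm w = \<rho> \<Longrightarrow> real n * (\<bar>Re w\<bar> - \<delta>) \<le> ln (norm (G (of_real l * w)))"
    using has_integral_le[OF J[of "- \<delta>"] I] that ne by auto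
qed

text \<open>As the radius grows from \<open>r1\<close> to \<open>r\<close>, only factors of zeros in
  the disc of radius \<open>r\<close> change, each by at most \<open>r / r1\<close>. This is the
  slope estimate for Jensen's function.\<close>

lemma prod_max_ratio:
  assumes "0 < r1" "r1 < r"
  shows "(\<Prod>\<zeta>\<in>#Z. max (norm \<zeta>) r) \<le> (r / r1) ^ size (filter_mset (\<lambda>\<zeta>. norm \<zeta> < r) Z) * (\<Prod>\<zeta>\<in>#Z. max (norm (\<zeta> :: complex)) r1)"
    and "0 < (\<Prod>\<zeta>\<in>#Z. max (norm (\<zeta> :: complex)) r1)"
proof -
  have pos: "0 < (\<Prod>\<zeta>\<in>#Z. max (norm \<zeta>) t)" if "0 < t" for Z :: "complex multiset" and t
  proof (induction Z)
    case (add x Z)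
    have "0 < max (norm x) t" using that by (simp add: less_max_iff_disj)
    then show ?case using add by (simp add: zero_less_mult_iff)
  qed simp
  show "0 < (\<Prod>\<zeta>\<in>#Z. max (norm (\<zeta> :: complex)) r1)" by (rule pos[OF assms(1)])
  show "(\<Prod>\<zeta>\<in>#Z. max (norm \<zeta>) r) \<le> (r / r1) ^ size (filter_mset (\<lambda>\<zeta>. norm \<zeta> < r) Z) * (\<Prod>\<zeta>\<in>#Z. max (norm \<zeta>) r1)"
  proof (induction Z)
    case (add x Z)
    define q where "q = (if norm x < r then r / r1 else 1)"
    have m: "max (norm x) r \<le> q * max (norm x) r1"
    proof (cases "norm x < r")
      case True
      have "r = r / r1 * r1" using assms by simp
      also have "\<dots> \<le> r / r1 * max (norm x) r1" using assms by (intro mult_left_mono) auto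
      finally show ?thesis using True by (simp add: q_def)
    qed (use assms in \<open>auto simp: q_def\<close>)
    have "0 \<le> (\<Prod>\<zeta>\<in>#Z. max (norm \<zeta>) r)" using pos[of r Z] assms by simp
    moreover have "0 \<le> q * max (norm x) r1" using assms by (simp add: q_def le_max_iff_disj)
    ultimately have "max (norm x) r * (\<Prod>\<zeta>\<in>#Z. max (norm \<zeta>) r) \<le> (q * max (norm x) r1) * ((r / r1) ^ size (filter_mset (\<lambda>\<zeta>. norm \<zeta> < r) Z) * (\<Prod>\<zeta>\<in>#Z. max (norm \<zeta>) r1))"
      by (intro mult_mono[OF m add.IH])
    moreover have "(r / r1) ^ size (filter_mset (\<lambda>\<zeta>. norm \<zeta> < r) (add_mset x Z)) = q * (r / r1) ^ size (filter_mset (\<lambda>\<zeta>. norm \<zeta> < r) Z)"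
      by (simp add: q_def)
    ultimately show ?case by (simp only: image_mset_add_mset prod_mset.add_mset mult_ac)
  qed simp
qed

lemma eventually_large_near_circle:
  assumes good: "\<And>w s \<eta>. w \<in> ball 0 r0 \<Longrightarrow> 0 < s \<Longrightarrow> 0 < \<eta> \<Longrightarrow>
      \<forall>\<^sub>F n in sequentially. \<exists>w'\<in>ball w s. exp (real n * (\<bar>Re w'\<bar> - \<eta>)) \<le> norm (f n w')"
    and K: "compact K" "K \<subseteq> ball 0 r0" and s: "0 < s" "0 < \<eta>"
  shows "\<forall>\<^sub>F n in sequentially. \<forall>w\<in>K. \<exists>w'\<in>ball w s. exp (real n * (\<bar>Re w'\<bar> - \<eta>)) \<le> norm (f n w' :: complex)"
proof -
  obtain N where N: "N \<subseteq> K" "finite N" "K \<subseteq> (\<Union>x\<in>N. ball x (s / 2))"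
  proof (rule compactE_image[OF K(1)])
    show "K \<subseteq> (\<Union>x\<in>K. ball x (s / 2))"
    proof
      fix x assume "x \<in> K"
      moreover have "x \<in> ball x (s / 2)" using s by simp
      ultimately show "x \<in> (\<Union>x\<in>K. ball x (s / 2))" by (rule UN_I)
    qed
  qed auto
  have "\<forall>\<^sub>F n in sequentially. \<forall>x\<in>N. \<exists>w'\<in>ball x (s / 2). exp (real n * (\<bar>Re w'\<bar> - \<eta>)) \<le> norm (f n w')"
    by (intro eventually_ball_finite N(2) ballI good) (use N K s in auto)
  then show ?thesis
  proof eventually_elim
    case (elim n)
    show ?case
    proof
      fix w assume "w \<in> K"
      then obtain x where x: "x \<in> N" "w \<in> ball x (s / 2)" using N by blast
      then obtain w' where w': "w' \<in> ball x (s / 2)" "exp (real n * (\<bar>Re w'\<bar> - \<eta>)) \<le> norm (f n w')" using elim by blast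
      have "dist w w' < s" using x(2) w'(1) dist_triangle[of w w' x] by (simp add: dist_commute)
      then show "\<exists>w'\<in>ball w s. exp (real n * (\<bar>Re w'\<bar> - \<eta>)) \<le> norm (f n w')" using w'(2) by auto
    qed
  qed
qed

lemma zero_count_lower_bound:
  fixes f g :: "nat \<Rightarrow> complex \<Rightarrow> complex" and Z :: "nat \<Rightarrow> complex multiset"
  assumes g: "\<forall>\<^sub>F n in sequentially. g n holomorphic_on ball 0 r0 \<and> (\<forall>z\<in>ball 0 r0. g n z \<noteq> 0 \<and> f n z = (\<Prod>\<zeta>\<in>#Z n. z - \<zeta>) * g n z)"
    and ub: "\<And>\<epsilon>. 0 < \<epsilon> \<Longrightarrow> \<forall>\<^sub>F n in sequentially. \<forall>z\<in>ball 0 r0. norm (f n z) \<le> exp (real n * (\<bar>Re z\<bar> + \<epsilon>))"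
    and good: "\<And>w s \<eta>. w \<in> ball 0 r0 \<Longrightarrow> 0 < s \<Longrightarrow> 0 < \<eta> \<Longrightarrow>
      \<forall>\<^sub>F n in sequentially. \<exists>w'\<in>ball w s. exp (real n * (\<bar>Re w'\<bar> - \<eta>)) \<le> norm (f n w')"
    and r: "0 < r" "r < r0" and \<epsilon>: "0 < \<epsilon>"
  shows "\<forall>\<^sub>F n in sequentially. real n * (2 * r / pi - \<epsilon>) \<le> real (size (filter_mset (\<lambda>\<zeta>. norm \<zeta> < r) (Z n)))"
proof -
  \<comment> \<open>By Jensen's formula ln (M n \<rho>) is the mean of ln \<bar>f n\<bar> over the
    circle of radius \<rho>; as a function of ln \<rho> its slope is the number of zeros in the
    disc. It is accessible as the value at 0 of the Blaschke quotient.\<close>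
  define M where "M n \<rho> = norm (g n 0) * (\<Prod>\<zeta>\<in>#Z n. max (norm \<zeta>) \<rho>)" for n \<rho>
  have upper: "\<forall>\<^sub>F n in sequentially. ln (M n \<rho>) \<le> real n * (2 * \<rho> / pi + \<delta>)" if \<rho>: "0 < \<rho>" "\<rho> < r0" and \<delta>: "0 < \<delta>" for \<rho> \<delta>
  proof -
    \<comment> \<open>The error \<delta> is split in three: \<open>\<kappa>\<close> for the bound of
      \<open>f\<close>, \<open>\<kappa>\<close> for the barrier, and a third for evaluating the
      barrier at \<open>(1 - d) * w\<close> instead of \<open>w\<close>.\<close>
    define \<kappa> where "\<kappa> = \<delta> / 3"
    define d where "d = min (1/2) (\<delta> * \<kappa> / (3 * \<rho>\<^sup>2))"
    have \<kappa>: "0 < \<kappa>" and d: "0 < d" "d < 1" using \<delta> \<rho> by (auto simp: \<kappa>_def d_def)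
    have d2: "\<rho>\<^sup>2 * d / (2 * \<kappa>) \<le> \<delta> / 3"
    proof -
      have "d \<le> \<delta> * \<kappa> / (3 * \<rho>\<^sup>2)" by (simp add: d_def)
      then have "\<rho>\<^sup>2 * d \<le> \<delta> * \<kappa> / 3" using \<rho> by (simp add: field_simps)
      then have "\<rho>\<^sup>2 * d / (2 * \<kappa>) \<le> \<delta> * \<kappa> / 3 / (2 * \<kappa>)" using \<kappa> by (intro divide_right_mono) auto
      also have "\<dots> \<le> \<delta> / 3" using \<kappa> \<delta> by (simp add: field_simps)
      finally show ?thesis .
    qed
    from g ub[OF \<kappa>] show ?thesis
    proof eventually_elim
      case (elim n)
      then have g': "g n holomorphic_on ball 0 r0" "\<And>z. z \<in> ball 0 r0 \<Longrightarrow> g n z \<noteq> 0" by auto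
      obtain G where G: "G holomorphic_on ball 0 r0" "\<And>z. z \<in> ball 0 \<rho> \<Longrightarrow> G z \<noteq> 0"
        "\<And>z. norm z = \<rho> \<Longrightarrow> norm (G z) = norm ((\<Prod>\<zeta>\<in>#Z n. z - \<zeta>) * g n z)"
        "\<And>z. norm z \<le> \<rho> \<Longrightarrow> norm ((\<Prod>\<zeta>\<in>#Z n. z - \<zeta>) * g n z) \<le> norm (G z)"
        "norm (G 0) = M n \<rho>" unfolding M_def using blaschke_quotient[OF g' \<rho>] by blast
      have Gub: "norm (G z) \<le> exp (real n * (\<bar>Re z\<bar> + \<kappa>))" if "norm z = \<rho>" for z
        using G(3)[OF that] elim that \<rho> by auto
      have "ln (norm (G 0)) \<le> real n * (2 * \<rho> / pi + \<delta>)"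
      proof (rule ln_norm_center_circle_bounds(1)[OF G(1,2) \<rho>(1) less_imp_le[OF \<rho>(2)], of "1 - d"])
        fix w :: complex assume w: "norm w = \<rho>"
        define z where "z = of_real (1 - d) * w"
        have nz: "norm z = (1 - d) * \<rho>" using w d by (simp add: z_def norm_mult del: of_real_diff)
        then have nz': "norm z < \<rho>" using d \<rho> by simp
        have "z * cnj w = of_real ((1 - d) * (norm w)\<^sup>2)"
          unfolding z_def of_real_mult complex_norm_square by simp
        then have Rz: "Re (z * cnj w) = (1 - d) * \<rho>\<^sup>2" unfolding w by (simp only: Re_complex_of_real)
        have "norm (G z) \<le> exp (real n * (\<bar>Re w\<bar> + \<kappa> + \<kappa> + (\<rho>\<^sup>2 - Re (z * cnj w)) / (2 * \<kappa>)))"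
          by (rule affine_barrier[OF G(1) \<rho> \<kappa> w Gub less_imp_le[OF nz']])
        also have "\<dots> \<le> exp (real n * (\<bar>Re w\<bar> + \<delta>))"
          unfolding exp_le_cancel_iff
        proof (rule mult_left_mono)
          have "(\<rho>\<^sup>2 - Re (z * cnj w)) / (2 * \<kappa>) = \<rho>\<^sup>2 * d / (2 * \<kappa>)" unfolding Rz by (simp add: algebra_simps)
          then show "\<bar>Re w\<bar> + \<kappa> + \<kappa> + (\<rho>\<^sup>2 - Re (z * cnj w)) / (2 * \<kappa>) \<le> \<bar>Re w\<bar> + \<delta>"
            using d2 \<kappa>_def by linarith
        qed simp
        finally have le: "norm (G z) \<le> exp (real n * (\<bar>Re w\<bar> + \<delta>))" .
        have "norm (G z) > 0" using G(2)[of z] nz' by simp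
        then have "ln (norm (G z)) \<le> ln (exp (real n * (\<bar>Re w\<bar> + \<delta>)))" using le by (subst ln_le_cancel_iff) auto
        then show "ln (norm (G (of_real (1 - d) * w))) \<le> real n * (\<bar>Re w\<bar> + \<delta>)" by (simp only: z_def[symmetric] ln_exp)
      qed (use d in auto)
      then show ?case by (simp only: G(5))
    qed
  qed
  have lower: "\<forall>\<^sub>F n in sequentially. real n * (2 * \<rho> / pi - \<delta>) \<le> ln (M n \<rho>)" if \<rho>: "0 < \<rho>" "\<rho> < r0" and \<delta>: "0 < \<delta>" for \<rho> \<delta>
  proof -
    \<comment> \<open>Harnack's inequality costs a factor 3, so the error at the good point
      \<open>w'\<close> has to stay below \<delta> / 3: three times \<open>\<kappa>\<close>, then
      \<delta> / 15 for \<open>\<rho> * d / \<kappa>\<close>, and \<delta> / 15 for the change of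
      \<bar>Re\<bar> over a distance of at most 2 d.\<close>
    define \<kappa> where "\<kappa> = \<delta> / 15"
    define d where "d = min (\<rho> / 2) (min (\<delta> / 30) (\<delta> * \<kappa> / (15 * \<rho>)))"
    have \<kappa>: "0 < \<kappa>" and d: "0 < d" "d < \<rho>" "d \<le> \<delta> / 30" using \<delta> \<rho> by (auto simp: \<kappa>_def d_def)
    have d2: "\<rho> * d / \<kappa> \<le> \<delta> / 15"
    proof -
      have "d \<le> \<delta> * \<kappa> / (15 * \<rho>)" by (simp add: d_def)
      then show ?thesis using \<rho> \<kappa> by (simp add: field_simps)
    qed
    define l where "l = (\<rho> - d) / \<rho>"
    have l: "0 < l" "l < 1" "l * \<rho> = \<rho> - d" using d \<rho> by (auto simp: l_def)
    have near: "\<forall>\<^sub>F n in sequentially. \<forall>w\<in>sphere 0 (\<rho> - d). \<exists>w'\<in>ball w (d / 8). exp (real n * (\<bar>Re w'\<bar> - \<kappa>)) \<le> norm (f n w')"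
      by (rule eventually_large_near_circle[OF good]) (use d \<rho> \<kappa> in auto)
    from g ub[OF \<kappa>] near show ?thesis
    proof eventually_elim
      case (elim n)
      then have g': "g n holomorphic_on ball 0 r0" "\<And>z. z \<in> ball 0 r0 \<Longrightarrow> g n z \<noteq> 0" by auto
      obtain G where G: "G holomorphic_on ball 0 r0" "\<And>z. z \<in> ball 0 \<rho> \<Longrightarrow> G z \<noteq> 0"
        "\<And>z. norm z = \<rho> \<Longrightarrow> norm (G z) = norm ((\<Prod>\<zeta>\<in>#Z n. z - \<zeta>) * g n z)"
        "\<And>z. norm z \<le> \<rho> \<Longrightarrow> norm ((\<Prod>\<zeta>\<in>#Z n. z - \<zeta>) * g n z) \<le> norm (G z)"
        "norm (G 0) = M n \<rho>" unfolding M_def using blaschke_quotient[OF g' \<rho>] by blast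
      have Gub: "norm (G z) \<le> exp (real n * (\<bar>Re z\<bar> + \<kappa>))" if "norm z = \<rho>" for z
        using G(3)[OF that] elim that \<rho> by auto
      have "real n * (2 * \<rho> / pi - \<delta>) \<le> ln (norm (G 0))"
      proof (rule ln_norm_center_circle_bounds(2)[OF G(1,2) \<rho>(1) less_imp_le[OF \<rho>(2)] l(1,2)])
        fix w0 :: complex assume w0: "norm w0 = \<rho>"
        define w where "w = of_real l * w0"
        have nw: "norm w = \<rho> - d" using w0 l by (simp add: w_def norm_mult)
        have w0w: "norm (w0 - w) = d"
        proof -
          have "w0 - w = of_real (1 - l) * w0" by (simp add: w_def algebra_simps)
          then have "norm (w0 - w) = (1 - l) * \<rho>" using l w0 by (simp add: norm_mult del: of_real_diff)
          then show ?thesis using l(3) by (simp add: algebra_simps)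
        qed
        obtain w' where w': "w' \<in> ball w (d / 8)" "exp (real n * (\<bar>Re w'\<bar> - \<kappa>)) \<le> norm (f n w')"
        proof -
          have "w \<in> sphere 0 (\<rho> - d)" using nw by simp
          then show ?thesis using elim(3) that by blast
        qed
        then have ww': "norm (w - w') < d / 8" by (simp add: dist_norm)
        define A where "A = real n * (\<bar>Re w0\<bar> + \<kappa> + \<kappa> + \<rho> * d / \<kappa>)"
        have inb: "norm (\<xi> - w) < d \<and> norm \<xi> < \<rho>" if "\<xi> \<in> ball w' (d / 2)" for \<xi>
        proof -
          have "norm (\<xi> - w') < d / 2" using that by (simp add: dist_norm norm_minus_commute)
          then have "norm (\<xi> - w) < d" using norm_triangle_ineq[of "\<xi> - w'" "w' - w"] ww' d(1) by (simp add: norm_minus_commute)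
          moreover from this have "norm \<xi> < \<rho>" using norm_triangle_ineq[of "\<xi> - w" w] nw by simp
          ultimately show ?thesis by simp
        qed
        have sub: "ball w' (d / 2) \<subseteq> ball 0 \<rho>" using inb by auto
        have sub': "ball w' (d / 2) \<subseteq> ball 0 r0" using inb \<rho> by fastforce
        have lnGle: "ln (norm (G \<xi>)) \<le> A" if \<xi>: "\<xi> \<in> ball w' (d / 2)" for \<xi>
        proof -
          have "Re ((w0 - \<xi>) * cnj w0) \<le> norm ((w0 - \<xi>) * cnj w0)" by (rule complex_Re_le_cmod)
          also have "\<dots> \<le> (2 * d) * \<rho>" unfolding norm_mult complex_mod_cnj w0
            using norm_triangle_ineq[of "w0 - w" "w - \<xi>"] w0w inb[OF \<xi>] \<rho> by (intro mult_right_mono) (auto simp: norm_minus_commute)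
          also have "Re ((w0 - \<xi>) * cnj w0) = \<rho>\<^sup>2 - Re (\<xi> * cnj w0)"
            unfolding left_diff_distrib minus_complex.sel complex_norm_square[symmetric] w0 Re_complex_of_real ..
          finally have "(\<rho>\<^sup>2 - Re (\<xi> * cnj w0)) / (2 * \<kappa>) \<le> (2 * d) * \<rho> / (2 * \<kappa>)" using \<kappa> by (intro divide_right_mono) auto
          then have b: "(\<rho>\<^sup>2 - Re (\<xi> * cnj w0)) / (2 * \<kappa>) \<le> \<rho> * d / \<kappa>" using \<kappa> by (simp add: field_simps)
          have "norm (G \<xi>) \<le> exp (real n * (\<bar>Re w0\<bar> + \<kappa> + \<kappa> + (\<rho>\<^sup>2 - Re (\<xi> * cnj w0)) / (2 * \<kappa>)))"
            using inb[OF \<xi>] by (intro affine_barrier[OF G(1) \<rho> \<kappa> w0 Gub]) auto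
          also have "\<dots> \<le> exp A" unfolding A_def exp_le_cancel_iff by (intro mult_left_mono add_left_mono b) simp
          finally have "norm (G \<xi>) \<le> exp A" .
          moreover have "norm (G \<xi>) > 0" using G(2) sub \<xi> by auto
          ultimately have "ln (norm (G \<xi>)) \<le> ln (exp A)" by (subst ln_le_cancel_iff) auto
          then show ?thesis by simp
        qed
        \<comment> \<open>\<open>w\<close> is within d / 8 of \<open>w'\<close>, hence in the half
          disc of radius d / 4 to which the inequality applies.\<close>
        have "A - ln (norm (G w)) \<le> 3 * (A - ln (norm (G w')))"
          by (rule Harnack_half_disc[of G w' "d / 2"])
            (use sub' sub G(2) d ww' lnGle in \<open>auto intro!: holomorphic_on_subset[OF G(1)]\<close>)
        also have "3 * (A - ln (norm (G w'))) \<le> 3 * (real n * (\<delta> / 3))"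
        proof (rule mult_left_mono)
          have w'\<rho>: "norm w' < \<rho>" using inb[of w'] d by simp
          have "exp (real n * (\<bar>Re w'\<bar> - \<kappa>)) \<le> norm (G w')"
            using w'(2) G(4)[of w'] w'\<rho> elim(1) \<rho> by fastforce
          then have "ln (exp (real n * (\<bar>Re w'\<bar> - \<kappa>))) \<le> ln (norm (G w'))"
            by (intro ln_mono) auto
          then have "real n * (\<bar>Re w'\<bar> - \<kappa>) \<le> ln (norm (G w'))" by simp
          then have "A - ln (norm (G w')) \<le> real n * (\<bar>Re w0\<bar> + \<kappa> + \<kappa> + \<rho> * d / \<kappa> - (\<bar>Re w'\<bar> - \<kappa>))"
            by (simp add: A_def algebra_simps)
          also have "\<dots> \<le> real n * (\<delta> / 3)"
          proof (rule mult_left_mono)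
            have "\<bar>Re w0\<bar> - \<bar>Re w'\<bar> \<le> norm (w0 - w')" using abs_Re_le_cmod[of "w0 - w'"] by simp
            also have "\<dots> \<le> 2 * d" using norm_triangle_ineq[of "w0 - w" "w - w'"] w0w ww' d(1) by simp
            finally show "\<bar>Re w0\<bar> + \<kappa> + \<kappa> + \<rho> * d / \<kappa> - (\<bar>Re w'\<bar> - \<kappa>) \<le> \<delta> / 3"
              using d2 d(3) unfolding \<kappa>_def by linarith
          qed simp
          finally show "A - ln (norm (G w')) \<le> real n * (\<delta> / 3)" .
        qed simp
        finally have "A - real n * \<delta> \<le> ln (norm (G w))" by simp
        moreover have "real n * (\<bar>Re w0\<bar> - \<delta>) \<le> A - real n * \<delta>"
        proof -
          have "real n * \<bar>Re w0\<bar> \<le> A" unfolding A_def using \<kappa> \<rho> d by (intro mult_left_mono) auto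
          then show ?thesis by (simp add: algebra_simps)
        qed
        ultimately show "real n * (\<bar>Re w0\<bar> - \<delta>) \<le> ln (norm (G (of_real l * w0)))" by (simp add: w_def)
      qed
      then show ?case by (simp only: G(5))
    qed
  qed
  \<comment> \<open>The slope of ln M between \<open>r1\<close> and \<open>r\<close> is about (2 n /
    \<pi>) (r - r1) / ln (r / r1), which is at least 2 n r1 / \<pi>. Replacing \<open>r1\<close> by
    \<open>r\<close> here costs at most half of \<epsilon>; the choice of \<open>\<delta>\<close>
    below accounts for the other half.\<close>
  define r1 where "r1 = max (r / 2) (r - \<epsilon> * pi / 4)"
  have r1: "0 < r1" "r1 < r" using r \<epsilon> by (auto simp: r1_def)
  have r1\<epsilon>: "2 * (r - r1) / pi \<le> \<epsilon> / 2"
  proof -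
    have "r - \<epsilon> * pi / 4 \<le> r1" unfolding r1_def by (rule max.cobounded2)
    then have "r - r1 \<le> \<epsilon> * pi / 4" by linarith
    then have "2 * (r - r1) \<le> \<epsilon> / 2 * pi" by (simp add: field_simps)
    then show ?thesis by (subst pos_divide_le_eq) auto
  qed
  define L where "L = ln (r / r1)"
  have L: "L > 0" using r1 by (simp add: L_def)
  define \<delta> where "\<delta> = \<epsilon> * L / 4"
  have \<delta>: "\<delta> > 0" using L \<epsilon> by (simp add: \<delta>_def)
  have Lr: "L * r1 \<le> r - r1"
  proof -
    have "L \<le> r / r1 - 1" unfolding L_def using r1 by (intro ln_le_minus_one) auto
    then show ?thesis using r1 by (simp add: field_simps)
  qed
  from g upper[OF r1(1) less_trans[OF r1(2) r(2)] \<delta>] lower[OF r \<delta>] show ?thesis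
  proof eventually_elim
    case (elim n)
    define N where "N = size (filter_mset (\<lambda>\<zeta>. norm \<zeta> < r) (Z n))"
    have gp: "norm (g n 0) > 0" using elim(1) r by auto
    have M1: "M n r1 > 0" using gp prod_max_ratio(2)[OF r1, of "Z n"] by (simp add: M_def)
    have "M n r \<le> (r / r1) ^ N * M n r1"
      using mult_left_mono[OF prod_max_ratio(1)[OF r1, of "Z n"], of "norm (g n 0)"]
      by (simp add: M_def N_def mult_ac)
    moreover have "M n r > 0" using gp prod_max_ratio(2)[of r "r + 1" "Z n"] r by (simp add: M_def)
    ultimately have "ln (M n r) \<le> ln ((r / r1) ^ N * M n r1)" by (intro ln_mono) auto
    also have "\<dots> = N * L + ln (M n r1)" using r1 M1 by (simp add: ln_mult_pos ln_realpow L_def)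
    finally have "real n * (2 * r / pi - \<delta>) \<le> N * L + real n * (2 * r1 / pi + \<delta>)" using elim by linarith
    then have 1: "real n * (2 * (r - r1) / pi - 2 * \<delta>) \<le> N * L" by (simp add: algebra_simps diff_divide_distrib)
    have "L * (2 * r / pi - \<epsilon>) \<le> 2 * (r - r1) / pi - 2 * \<delta>"
    proof -
      have "L * (2 * r / pi - \<epsilon>) \<le> L * (2 * r1 / pi - \<epsilon> / 2)"
        using r1\<epsilon> L by (intro mult_left_mono) (auto simp: diff_divide_distrib right_diff_distrib)
      also have "\<dots> = 2 * (L * r1) / pi - 2 * \<delta>" by (simp add: \<delta>_def algebra_simps)
      also have "\<dots> \<le> 2 * (r - r1) / pi - 2 * \<delta>" using Lr by (simp add: divide_right_mono)
      finally show ?thesis .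
    qed
    then have "real n * (L * (2 * r / pi - \<epsilon>)) \<le> real n * (2 * (r - r1) / pi - 2 * \<delta>)" by (rule mult_left_mono) simp
    with 1 have "L * (real n * (2 * r / pi - \<epsilon>)) \<le> L * N" by (simp only: mult_ac)
    then show ?case using L unfolding N_def by (simp only: mult_le_cancel_left_pos)
  qed
qed

section \<open>Upper and lower bounds for \<open>P\<close>\<close>

context pade_sequence
begin

context
  fixes n :: nat and z :: complex and \<epsilon> \<delta> D B :: real and K :: "complex \<Rightarrow> complex"
  assumes n: "0 < n" and z: "\<delta> \<le> norm z" "norm z \<le> D" "0 < \<delta>" and \<epsilon>: "0 < \<epsilon>" "\<epsilon> \<le> \<delta> / 4"
    and N: "0 \<le> N n"
    and kern: "\<And>t. norm (kernel n t) \<le> N n * norm (1 - t\<^sup>2) ^ n * exp (real n * \<epsilon> * (1 + norm t))"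
    and K: "\<And>t. (K has_field_derivative (- of_nat n * kernel n t * exp (- (of_nat n * z * t)))) (at t)"
    and K_lim: "\<And>T. ((\<lambda>r. K (T + of_real r * cnj z)) \<longlongrightarrow> 0) at_top"
    and B: "B = (2 + D) / \<delta>"
begin

lemma z_nz: "z \<noteq> 0" using z by auto

lemma norm_K'_le:
  "norm (- of_nat n * kernel n t * exp (- (of_nat n * z * t))) \<le> n * N n * height z t ^ n * exp (real n * \<epsilon> * (1 + norm t))"
proof -
  have "norm (- of_nat n * kernel n t * exp (- (of_nat n * z * t))) = n * norm (kernel n t) * exp (- (n * Re (z * t)))"
  proof -
    have "Re (of_nat n * z * t) = n * Re (z * t)" by (simp add: algebra_simps)
    then show ?thesis by (simp only: norm_mult norm_minus_cancel norm_of_nat norm_exp_eq_Re uminus_complex.sel)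
  qed
  also have "\<dots> \<le> n * (N n * norm (1 - t\<^sup>2) ^ n * exp (real n * \<epsilon> * (1 + norm t))) * exp (- (n * Re (z * t)))"
    by (intro mult_right_mono mult_left_mono kern) auto
  also have "exp (- (n * Re (z * t))) = exp (- Re (z * t)) ^ n" unfolding exp_of_nat_mult[symmetric] by (simp only: mult_minus_right)
  finally show ?thesis by (simp only: height_def power_mult_distrib mult_ac)
qed

lemma norm_root_plus_le: "norm (root_plus z) \<le> B"
proof -
  have "(norm (csqrt (z\<^sup>2 + 1)))\<^sup>2 = norm (z\<^sup>2 + 1)" by (metis norm_power power2_csqrt)
  also have "\<dots> \<le> (norm z)\<^sup>2 + 1" using norm_triangle_ineq[of "z\<^sup>2" 1] by (simp add: norm_power)
  also have "\<dots> \<le> (1 + D)\<^sup>2" using z power_mono[of "norm z" D 2] by (simp add: power2_eq_square algebra_simps)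
  finally have "norm (csqrt (z\<^sup>2 + 1)) \<le> 1 + D" by (rule power2_le_imp_le) (use z norm_ge_zero[of z] in linarith)
  then have "norm (1 + csqrt (z\<^sup>2 + 1)) \<le> 2 + D" using norm_triangle_ineq[of 1 "csqrt (z\<^sup>2 + 1)"] by simp
  then show ?thesis unfolding root_plus_def norm_divide B using z by (intro frac_le) auto
qed

lemma B_ge_1: "1 \<le> B" using z by (simp add: B field_simps)

text \<open>\<open>K\<close> tends to 0 along the ray from the critical point in the direction
  \<open>cnj z\<close>, so its value at the critical point is controlled by its derivative on that
  ray. The decay rate \<bar>z\<bar>^2 / 4 is exp (- k / 4) rewritten in the parameter
  \<open>r\<close>.\<close>

lemma norm_K_root_plus_le:
  "norm (K (root_plus z)) \<le> n * N n * height z (root_plus z) ^ n * exp (real n * \<epsilon> * (2 + B + 8 / \<delta>) + 2) * (4 / \<delta>)"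
proof -
  define T where "T = root_plus z"
  define H where "H = height z T"
  define C where "C = norm z * (n * N n * H ^ n * exp (real n * \<epsilon> * (1 + B) + 8 * real n * (\<epsilon> / \<delta>) + 2))"
  have C: "0 \<le> C" unfolding C_def H_def using N height_nonneg by (intro mult_nonneg_nonneg zero_le_power) auto
  have "norm ((\<lambda>r. K (T + of_real r * cnj z)) 0) \<le> C / ((norm z)\<^sup>2 / 4)"
  proof (rule norm_le_if_exp_decay)
    fix r :: real assume r: "0 \<le> r"
    let ?t = "T + of_real r * cnj z"
    show "((\<lambda>r. K (T + of_real r * cnj z)) has_vector_derivative cnj z * (- of_nat n * kernel n ?t * exp (- (of_nat n * z * ?t)))) (at r)"
    proof -
      have "((\<lambda>r. T + of_real r * cnj z) has_vector_derivative cnj z) (at r)"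
        by (auto intro!: derivative_eq_intros simp: has_vector_derivative_def scaleR_conv_of_real)
      from field_vector_diff_chain_at[OF this K] show ?thesis by (simp add: o_def)
    qed
    define k where "k = r * (norm z)\<^sup>2"
    define \<theta> where "\<theta> = \<epsilon> / \<delta>"
    have k: "0 \<le> k" using r by (simp add: k_def)
    have \<theta>: "0 \<le> \<theta>" "\<theta> \<le> 1 / 4" using \<epsilon> z by (auto simp: \<theta>_def field_simps)
    have h: "height z ?t \<le> H * ((1 + k + k\<^sup>2 / 2) * exp (- k))"
      unfolding H_def T_def
      by (rule height_ray_le[OF root_critical(1)[OF z_nz] norm_root_plus_ge[OF z_nz] r k_def])
    have nt: "\<epsilon> * (1 + norm ?t) \<le> \<epsilon> * (1 + B) + \<theta> * k"
    proof -
      have "norm ?t \<le> B + r * norm z"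
        using norm_triangle_ineq[of T "of_real r * cnj z"] norm_root_plus_le r by (simp add: norm_mult T_def)
      then have 1: "\<epsilon> * (1 + norm ?t) \<le> \<epsilon> * (1 + B) + \<epsilon> * (r * norm z)"
        using \<epsilon> mult_left_mono[of "1 + norm ?t" "1 + B + r * norm z" \<epsilon>] by (simp add: algebra_simps)
      have "r * norm z * \<delta> \<le> r * norm z * norm z" using r z by (intro mult_left_mono) auto
      then have "r * norm z \<le> k / \<delta>" using z by (simp add: k_def power2_eq_square field_simps)
      then have "\<epsilon> * (r * norm z) \<le> \<epsilon> * (k / \<delta>)" using \<epsilon> by (intro mult_left_mono) auto
      then show ?thesis using 1 by (simp add: \<theta>_def)
    qed
    have "norm (cnj z * (- of_nat n * kernel n ?t * exp (- (of_nat n * z * ?t))))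
       \<le> norm z * (n * N n * height z ?t ^ n * exp (real n * \<epsilon> * (1 + norm ?t)))"
      unfolding norm_mult[of "cnj z"] complex_mod_cnj by (intro mult_left_mono norm_K'_le) auto
    also have "\<dots> \<le> norm z * (n * N n * (H * ((1 + k + k\<^sup>2 / 2) * exp (- k))) ^ n * exp (real n * (\<epsilon> * (1 + B) + \<theta> * k)))"
    proof (intro mult_left_mono mult_mono power_mono h)
      show "exp (real n * \<epsilon> * (1 + norm ?t)) \<le> exp (real n * (\<epsilon> * (1 + B) + \<theta> * k))"
        unfolding exp_le_cancel_iff mult.assoc by (intro mult_left_mono nt) auto
    qed (use N k height_nonneg in \<open>auto simp: H_def\<close>)
    also have "\<dots> = norm z * (n * N n * H ^ n * exp (real n * \<epsilon> * (1 + B))) * ((1 + k + k\<^sup>2 / 2) * exp (- k) * exp (\<theta> * k)) ^ n"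
    proof -
      have "exp (real n * (\<epsilon> * (1 + B) + \<theta> * k)) = exp (real n * \<epsilon> * (1 + B)) * exp (\<theta> * k) ^ n"
        by (simp only: distrib_left[of "real n"] exp_add exp_of_nat_mult mult.assoc)
      then show ?thesis by (simp only: power_mult_distrib mult_ac)
    qed
    also have "\<dots> \<le> norm z * (n * N n * H ^ n * exp (real n * \<epsilon> * (1 + B))) * (exp (8 * real n * \<theta> + 2) * exp (- (k / 4)))"
      by (intro mult_left_mono one_plus_half_sq_exp_bound k \<theta> n mult_nonneg_nonneg) (use N in \<open>auto simp: H_def height_nonneg\<close>)
    also have "\<dots> = C * exp (- ((norm z)\<^sup>2 / 4 * r))"
      by (simp add: C_def k_def \<theta>_def exp_add mult_ac)
    finally show "norm (cnj z * (- of_nat n * kernel n ?t * exp (- (of_nat n * z * ?t)))) \<le> C * exp (- ((norm z)\<^sup>2 / 4 * r))" .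
  next
    show "0 < (norm z)\<^sup>2 / 4" using z_nz by simp
    show "((\<lambda>r. K (T + of_real r * cnj z)) \<longlongrightarrow> 0) at_top" by (rule K_lim)
  qed
  then have "norm (K T) \<le> C / ((norm z)\<^sup>2 / 4)" by simp
  also have "\<dots> = (n * N n * H ^ n * exp (real n * \<epsilon> * (1 + B) + 8 * real n * (\<epsilon> / \<delta>) + 2)) * (4 / norm z)"
    using z_nz by (simp add: C_def power2_eq_square)
  also have "\<dots> \<le> (n * N n * H ^ n * exp (real n * \<epsilon> * (2 + B + 8 / \<delta>) + 2)) * (4 / \<delta>)"
  proof (intro mult_mono mult_left_mono)
    show "4 / norm z \<le> 4 / \<delta>" using z by (intro divide_left_mono mult_pos_pos) auto
    have "real n * \<epsilon> * (1 + B) + 8 * real n * (\<epsilon> / \<delta>) \<le> real n * \<epsilon> * (2 + B + 8 / \<delta>)"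
      using \<epsilon> by (simp add: algebra_simps)
    then show "exp (real n * \<epsilon> * (1 + B) + 8 * real n * (\<epsilon> / \<delta>) + 2) \<le> exp (real n * \<epsilon> * (2 + B + 8 / \<delta>) + 2)" by simp
  qed (use N in \<open>auto simp: H_def height_nonneg\<close>)
  finally show ?thesis by (simp add: T_def H_def)
qed

lemma norm_K_segment_le:
  assumes \<sigma>: "norm \<sigma> = 1" and h: "\<And>l. 0 \<le> l \<Longrightarrow> l \<le> 1 \<Longrightarrow> height z (\<sigma> + of_real l * (root_plus z - \<sigma>)) \<le> H"
  shows "norm (K (root_plus z) - K \<sigma>) \<le> n * N n * H ^ n * exp (real n * \<epsilon> * (2 + B + 8 / \<delta>) + 2) * (B + 1)"
proof -
  define T where "T = root_plus z"
  have H: "0 \<le> H" using order_trans[OF height_nonneg h[of 0]] by simp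
  have "norm (K (\<sigma> + of_real 1 * (T - \<sigma>)) - K (\<sigma> + of_real 0 * (T - \<sigma>))) \<le> (B + 1) * (n * N n * H ^ n * exp (real n * \<epsilon> * (2 + B + 8 / \<delta>) + 2))"
  proof (rule norm_diff_le_path[OF K])
    fix l :: real assume l: "0 \<le> l" "l \<le> 1"
    show "((\<lambda>l. \<sigma> + of_real l * (T - \<sigma>)) has_vector_derivative (T - \<sigma>)) (at l)"
      by (auto intro!: derivative_eq_intros simp: has_vector_derivative_def scaleR_conv_of_real)
    show "norm (T - \<sigma>) \<le> B + 1" using norm_triangle_ineq4[of T \<sigma>] norm_root_plus_le \<sigma> by (simp add: T_def)
    let ?t = "\<sigma> + of_real l * (T - \<sigma>)"
    have "?t = of_real (1 - l) * \<sigma> + of_real l * T" by (simp add: algebra_simps)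
    then have "norm ?t \<le> norm (of_real (1 - l) * \<sigma>) + norm (of_real l * T)" by (metis norm_triangle_ineq)
    also have "\<dots> = (1 - l) + l * norm T" using l \<sigma> by (simp add: norm_mult del: of_real_diff)
    also have "\<dots> \<le> 1 + B" using l norm_root_plus_le mult_mono[of l 1 "norm T" B] B_ge_1 by (simp add: T_def)
    finally have nt: "norm ?t \<le> 1 + B" .
    have "norm (- of_nat n * kernel n ?t * exp (- (of_nat n * z * ?t))) \<le> n * N n * height z ?t ^ n * exp (real n * \<epsilon> * (1 + norm ?t))"
      by (rule norm_K'_le)
    also have "\<dots> \<le> n * N n * H ^ n * exp (real n * \<epsilon> * (2 + B + 8 / \<delta>) + 2)"
    proof (intro mult_mono mult_left_mono power_mono)
      show "height z ?t \<le> H" unfolding T_def by (rule h[OF l])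
      have "real n * \<epsilon> * (1 + norm ?t) \<le> real n * \<epsilon> * (2 + B + 8 / \<delta>)"
      proof (rule mult_left_mono)
        have "0 \<le> 8 / \<delta>" using z by simp
        then show "1 + norm ?t \<le> 2 + B + 8 / \<delta>" using nt by linarith
      qed (use \<epsilon> in auto)
      then show "exp (real n * \<epsilon> * (1 + norm ?t)) \<le> exp (real n * \<epsilon> * (2 + B + 8 / \<delta>) + 2)" by simp
    qed (use N H height_nonneg in auto)
    finally show "norm (- of_nat n * kernel n ?t * exp (- (of_nat n * z * ?t))) \<le> n * N n * H ^ n * exp (real n * \<epsilon> * (2 + B + 8 / \<delta>) + 2)" .
  qed
  then show ?thesis by (simp add: T_def mult_ac)
qed

text \<open>As minus the inverse of \<open>root_plus z\<close>, the point
  \<open>root_minus z\<close> lies in the closed unit disc. The coordinate (1 + t) / (1 - t)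
  therefore puts it on a ray from 0 in the closed right half-plane, that is on an arc from - 1 to 1
  of which it is the highest point.\<close>

lemma norm_K_arc_le:
  "norm (K 1 - K (-1)) \<le> n * N n * height z (root_minus z) ^ n * exp (real n * \<epsilon> * (2 + B + 8 / \<delta>) + 2) * 4"
proof -
  define T where "T = root_minus z"
  note crit = root_critical(2)[OF z_nz, folded T_def]
  note ne = critical_point_ne[OF crit]
  have T1: "norm T \<le> 1"
  proof -
    have "norm (root_plus z) * norm T = 1" using root_critical(3)[OF z_nz] by (metis T_def norm_minus_cancel norm_mult norm_one)
    moreover have "1 * norm T \<le> norm (root_plus z) * norm T" by (intro mult_right_mono norm_root_plus_ge z_nz) simp
    ultimately show ?thesis by simp
  qed
  define w where "w = (1 + T) / (1 - T)"
  define u where "u = w / of_real (norm w)"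
  have T1': "1 - T \<noteq> 0" using ne by simp
  have w0: "w \<noteq> 0" using ne T1' by (auto simp: w_def add_eq_0_iff)
  have u: "norm u = 1" using w0 by (simp add: u_def norm_divide)
  have wu: "w = of_real (norm w) * u" using w0 by (simp add: u_def)
  have Tw: "T = (w - 1) / (w + 1)"
  proof -
    have "w - 1 = 2 * T / (1 - T)" "w + 1 = 2 / (1 - T)" using T1' by (auto simp: w_def field_simps)
    then show ?thesis using T1' by simp
  qed
  have "Re w \<ge> 0"
  proof -
    have "w * of_real ((norm (1 - T))\<^sup>2) = (1 + T) * cnj (1 - T)"
      unfolding complex_norm_square w_def using T1' by simp
    then have "Re (w * of_real ((norm (1 - T))\<^sup>2)) = Re ((1 + T) * cnj (1 - T))" by (rule arg_cong)
    then have "Re w * (norm (1 - T))\<^sup>2 = 1 - (norm T)\<^sup>2"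
      by (simp add: cmod_power2) (simp add: power2_eq_square algebra_simps)
    moreover have "(norm T)\<^sup>2 \<le> 1" using T1 by (simp add: power_le_one)
    ultimately have "0 \<le> Re w * (norm (1 - T))\<^sup>2" by simp
    then show ?thesis using T1' by (simp add: zero_le_mult_iff)
  qed
  then have Ru: "0 \<le> Re u" by (simp add: u_def)
  define p where "p l = (of_real l * u - (1 - of_real l)) / (of_real l * u + (1 - of_real l))" for l :: real
  have den: "of_real l * u + (1 - of_real l) \<noteq> 0" if "0 \<le> l" "l \<le> 1" for l
    using arc_parametrization(1)[OF u Ru that] by auto
  have hp: "height z (p l) \<le> height z T" if l: "0 \<le> l" "l \<le> 1" for l
  proof (cases "l = 0 \<or> l = 1")
    case True
    then have "(p l)\<^sup>2 = 1" using u by (auto simp: p_def)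
    then have "height z (p l) = 0" by (simp add: height_def)
    then show ?thesis by (simp add: height_nonneg)
  next
    case False
    then have l': "0 < l" "l < 1" using l by auto
    have "p l = (of_real (l / (1 - l)) * u - 1) / (of_real (l / (1 - l)) * u + 1)"
    proof -
      have c: "complex_of_real 1 - of_real l \<noteq> 0" using l' by (metis of_real_diff of_real_eq_0_iff less_irrefl diff_gt_0_iff_gt)
      have "of_real (l / (1 - l)) * u - 1 = (of_real l * u - (1 - of_real l)) / (1 - of_real l)"
        "of_real (l / (1 - l)) * u + 1 = (of_real l * u + (1 - of_real l)) / (1 - of_real l)"
        using c by (auto simp: divide_simps)
      then show ?thesis using c by (simp add: p_def)
    qed
    moreover have "T = (of_real (norm w) * u - 1) / (of_real (norm w) * u + 1)" unfolding wu[symmetric] by (rule Tw)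
    ultimately show ?thesis using l' w0
      by (intro height_arc_le[OF crit u Ru, of "norm w" "l / (1 - l)"]) auto
  qed
  have "norm (K (p 1) - K (p 0)) \<le> 4 * (n * N n * height z T ^ n * exp (real n * \<epsilon> * (2 + B + 8 / \<delta>) + 2))"
  proof (rule norm_diff_le_path[OF K])
    fix l :: real assume l: "0 \<le> l" "l \<le> 1"
    let ?d = "of_real l * u + (1 - of_real l)"
    have "((\<lambda>l. (l * u - (1 - l)) / (l * u + (1 - l))) has_field_derivative
       ((u + 1) * ?d - (of_real l * u - (1 - of_real l)) * (u - 1)) / (?d * ?d)) (at (of_real l))"
      using den[OF l] by (auto intro!: derivative_eq_intros)
    also have "(u + 1) * ?d - (of_real l * u - (1 - of_real l)) * (u - 1) = 2 * u" by (simp add: algebra_simps)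
    finally show "(p has_vector_derivative 2 * u / (?d * ?d)) (at l)"
      unfolding p_def by (rule has_vector_derivative_real_field)
    have "norm (2 * u / (?d * ?d)) = 2 / (norm ?d)\<^sup>2" using u by (simp add: norm_divide norm_mult power2_eq_square)
    also have "\<dots> \<le> 2 / (1 / 2)" using arc_parametrization(1)[OF u Ru l] by (intro divide_left_mono mult_pos_pos) linarith+
    finally show "norm (2 * u / (?d * ?d)) \<le> 4" by simp
    have nt: "norm (p l) \<le> 1" unfolding p_def by (rule arc_parametrization(2)[OF u Ru l])
    have "norm (- of_nat n * kernel n (p l) * exp (- (of_nat n * z * p l))) \<le> n * N n * height z (p l) ^ n * exp (real n * \<epsilon> * (1 + norm (p l)))"
      by (rule norm_K'_le)
    also have "\<dots> \<le> n * N n * height z T ^ n * exp (real n * \<epsilon> * (2 + B + 8 / \<delta>) + 2)"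
    proof (intro mult_mono mult_left_mono power_mono hp l)
      have "real n * \<epsilon> * (1 + norm (p l)) \<le> real n * \<epsilon> * (2 + B + 8 / \<delta>)"
      proof (rule mult_left_mono)
        have "0 \<le> 8 / \<delta>" using z by simp
        then show "1 + norm (p l) \<le> 2 + B + 8 / \<delta>" using nt B_ge_1 by linarith
      qed (use \<epsilon> in auto)
      then show "exp (real n * \<epsilon> * (1 + norm (p l))) \<le> exp (real n * \<epsilon> * (2 + B + 8 / \<delta>) + 2)" by simp
    qed (use N height_nonneg in auto)
    finally show "norm (- of_nat n * kernel n (p l) * exp (- (of_nat n * z * p l))) \<le> n * N n * height z T ^ n * exp (real n * \<epsilon> * (2 + B + 8 / \<delta>) + 2)" .
  qed
  moreover have "p 1 = 1" "p 0 = - 1" using u by (auto simp: p_def)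
  ultimately show ?thesis by (simp add: T_def mult_ac)
qed

text \<open>For \<open>Re z > 0\<close> the path goes from 1 straight to \<open>root_plus z\<close>
  and on along the ray. For \<open>Re z < 0\<close> the segment to \<open>root_plus z\<close> has to
  start at - 1; the arc from 1 to - 1 through \<open>root_minus z\<close> precedes it, so that both
  heights enter.\<close>

lemma norm_K_1_le:
  assumes Re: "Re z \<noteq> 0"
    and H: "H = (if Re z < 0 then max (height z (root_plus z)) (height z (root_minus z)) else height z (root_plus z))"
  shows "norm (K 1) \<le> n * N n * H ^ n * exp (real n * \<epsilon> * (2 + B + 8 / \<delta>) + 2) * (4 / \<delta> + B + 5)"
proof -
  define X where "X = n * N n * exp (real n * \<epsilon> * (2 + B + 8 / \<delta>) + 2)"
  have X: "0 \<le> X" using N by (simp add: X_def)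
  have le: "n * N n * h ^ n * exp (real n * \<epsilon> * (2 + B + 8 / \<delta>) + 2) * c \<le> X * H ^ n * c" if "0 \<le> h" "h \<le> H" "0 \<le> c" for h c
  proof -
    have "X * h ^ n * c \<le> X * H ^ n * c" using that X by (intro mult_right_mono mult_left_mono power_mono) auto
    then show ?thesis by (simp only: X_def mult_ac)
  qed
  have H0: "height z (root_plus z) \<le> H" "0 \<le> H" using height_nonneg by (auto simp: H le_max_iff_disj)
  have B0: "0 \<le> B + 1" using B_ge_1 by simp
  have 1: "norm (K (root_plus z)) \<le> X * H ^ n * (4 / \<delta>)"
    by (rule order_trans[OF norm_K_root_plus_le le]) (use H0 height_nonneg z in auto)
  have "norm (K 1) \<le> X * H ^ n * (4 / \<delta>) + X * H ^ n * (B + 1) + X * H ^ n * 4"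
  proof (cases "Re z < 0")
    case True
    then have R: "Re (root_plus z) \<le> 0" using Re_root_plus[OF Re] by (simp add: zero_less_mult_iff)
    have s: "norm (K (root_plus z) - K (- 1)) \<le> X * H ^ n * (B + 1)"
    proof (rule order_trans[OF norm_K_segment_le le])
      show "height z (- 1 + of_real l * (root_plus z - - 1)) \<le> height z (root_plus z)" if "0 \<le> l" "l \<le> 1" for l
        using height_segment_minus_one_le[OF root_critical(1)[OF z_nz] R that] by simp
    qed (use H0 height_nonneg B0 in auto)
    have a: "norm (K 1 - K (- 1)) \<le> X * H ^ n * 4"
      by (rule order_trans[OF norm_K_arc_le le]) (use True height_nonneg H in auto)
    have "K 1 = (K 1 - K (- 1)) - (K (root_plus z) - K (- 1)) + K (root_plus z)" by simp
    then have "norm (K 1) \<le> norm (K 1 - K (- 1)) + norm (K (root_plus z) - K (- 1)) + norm (K (root_plus z))"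
      by (metis norm_triangle_ineq norm_triangle_ineq4 add_right_mono order_trans)
    then show ?thesis using 1 s a by linarith
  next
    case False
    then have R: "0 \<le> Re (root_plus z)" using Re_root_plus[OF Re] by (simp add: zero_less_mult_iff)
    have s: "norm (K (root_plus z) - K 1) \<le> X * H ^ n * (B + 1)"
    proof (rule order_trans[OF norm_K_segment_le le])
      show "height z (1 + of_real l * (root_plus z - 1)) \<le> height z (root_plus z)" if "0 \<le> l" "l \<le> 1" for l
        using height_segment_one_le[OF root_critical(1)[OF z_nz] R that] by simp
    qed (use H0 height_nonneg B0 in auto)
    have "norm (K 1) \<le> norm (K (root_plus z) - K 1) + norm (K (root_plus z))"
      using norm_triangle_ineq4[of "K (root_plus z)" "K (root_plus z) - K 1"] by simp
    moreover have "0 \<le> X * H ^ n * 4" using X H0 by simp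
    ultimately show ?thesis using 1 s by linarith
  qed
  also have "\<dots> = X * H ^ n * (4 / \<delta> + B + 5)" by (simp add: algebra_simps)
  finally show ?thesis by (simp only: X_def mult_ac)
qed

end

text \<open>\<open>P z\<close> is \<open>K 1\<close> times exp (n z) W(z). The error is spent as
  \<epsilon> / 4 three times: for the factor linear in \<open>n\<close>, for the kernel bound, and
  for \<bar>W z\<bar> against \<bar>z\<bar>^(2n).\<close>

lemma P_upper:
  assumes \<delta>: "0 < \<delta>" and \<epsilon>: "0 < \<epsilon>" and D: "0 < D"
  shows "\<forall>\<^sub>F n in sequentially. \<forall>z. \<delta> \<le> norm z \<longrightarrow> norm z \<le> D \<longrightarrow> Re z \<noteq> 0 \<longrightarrow>
     norm (poly (P n) z) \<le> N n * (exp \<epsilon> * (exp (Re z) * (norm z)\<^sup>2 *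
       (if Re z < 0 then max (height z (root_plus z)) (height z (root_minus z)) else height z (root_plus z)))) ^ n"
proof -
  define B where "B = (2 + D) / \<delta>"
  have B0: "0 \<le> B" using \<delta> D by (simp add: B_def)
  define L where "L = 2 + B + 8 / \<delta>"
  have L: "0 < L" using \<delta> B0 by (simp add: L_def add_pos_nonneg add_pos_pos)
  define \<epsilon>1 where "\<epsilon>1 = min (\<epsilon> / (4 * L)) (\<delta> / 4)"
  have \<epsilon>1: "0 < \<epsilon>1" "\<epsilon>1 \<le> \<delta> / 4" "\<epsilon>1 * L \<le> \<epsilon> / 4"
  proof -
    show "0 < \<epsilon>1" "\<epsilon>1 \<le> \<delta> / 4" using \<epsilon> \<delta> L by (auto simp: \<epsilon>1_def)
    have "\<epsilon>1 * L \<le> \<epsilon> / (4 * L) * L" using L by (intro mult_right_mono) (auto simp: \<epsilon>1_def)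
    then show "\<epsilon>1 * L \<le> \<epsilon> / 4" using L by simp
  qed
  define C where "C = exp 2 * (4 / \<delta> + B + 5) * (D + 1)"
  have C: "0 < C" using \<delta> B0 D by (simp add: C_def add_pos_pos add_nonneg_pos)
  have "(\<lambda>n. real n * C * exp (- (real n * (\<epsilon> / 4)))) \<longlonglongrightarrow> 0" using \<epsilon> C by real_asymp
  then have 1: "\<forall>\<^sub>F n in sequentially. real n * C * exp (- (real n * (\<epsilon> / 4))) < 1" by (rule order_tendstoD) simp
  have 2: "\<forall>\<^sub>F n in sequentially. \<tau> n < min \<delta> (min 1 (\<delta> * \<epsilon> / 8))" using \<tau>_tendsto_0 \<epsilon> \<delta> by (intro order_tendstoD) auto
  from 1 2 kernel_upper[OF \<epsilon>1(1)] \<rho>_ge[of 1] eventually_gt_at_top[of 0] show ?thesis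
  proof eventually_elim
    case (elim n)
    note n = elim(5)
    interpret pade_pair n "a n" "P n" "Q n" "E n" "\<tau> n" by (rule pade[OF n])
    have N0: "0 \<le> N n" using N_pos[OF n] elim(4) by simp
    show ?case
    proof (intro allI impI)
      fix z :: complex assume z: "\<delta> \<le> norm z" "norm z \<le> D" "Re z \<noteq> 0"
      define H where "H = (if Re z < 0 then max (height z (root_plus z)) (height z (root_minus z)) else height z (root_plus z))"
      have H0: "0 \<le> H" using height_nonneg by (auto simp: H_def le_max_iff_disj)
      have \<tau>n: "\<tau> n < \<delta>" "\<tau> n < 1" "\<tau> n < \<delta> * \<epsilon> / 8" "0 \<le> \<tau> n" using elim(2) \<tau> by auto
      then have \<tau>z: "\<tau> n < norm z" using z by simp
      have z0: "0 < norm z" using z(1) \<delta> by linarith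
      obtain K where K: "\<And>t. (K has_field_derivative (- of_nat n * kernel n t * exp (- (of_nat n * z * t)))) (at t)"
        "K 1 = exp (- (of_nat n * z)) * poly (P n) z / W z" "\<And>T. ((\<lambda>r. K (T + of_real r * cnj z)) \<longlongrightarrow> 0) at_top"
        using Laplace_representation[OF \<tau>z] unfolding kernel_def by blast
      have K1: "norm (K 1) \<le> n * N n * H ^ n * exp (real n * \<epsilon>1 * L + 2) * (4 / \<delta> + B + 5)"
        unfolding L_def
        by (rule norm_K_1_le[OF n z(1,2) \<delta> \<epsilon>1(1,2) N0 _ K(1,3) B_def z(3) H_def]) (use elim(3) in blast)
      have Wn: "norm (W z) \<le> (norm z)\<^sup>2 ^ n * exp (real n * (\<epsilon> / 4)) * (D + 1)"
      proof -
        have "norm (W z) \<le> (norm z + \<tau> n) ^ (2 * n + 1)" by (rule norm_W_le)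
        also have "\<dots> = (norm z)\<^sup>2 ^ n * (1 + \<tau> n / norm z) ^ (2 * n) * (norm z + \<tau> n)"
        proof -
          have "norm z + \<tau> n = norm z * (1 + \<tau> n / norm z)" using z0 by (simp add: field_simps)
          then have "(norm z + \<tau> n) ^ (2 * n) = (norm z) ^ (2 * n) * (1 + \<tau> n / norm z) ^ (2 * n)" by (metis power_mult_distrib)
          then show ?thesis by (simp add: power_mult)
        qed
        also have "\<dots> \<le> (norm z)\<^sup>2 ^ n * exp (real n * (\<epsilon> / 4)) * (D + 1)"
        proof (intro mult_mono mult_left_mono)
          have "1 + \<tau> n / norm z \<le> exp (\<tau> n / norm z)" by (rule exp_ge_add_one_self)
          also have "\<dots> \<le> exp (\<epsilon> / 8)"
          proof -
            have "\<tau> n / norm z \<le> \<tau> n / \<delta>" using z(1) \<delta> z0 \<tau>n by (intro divide_left_mono) auto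
            also have "\<dots> \<le> \<epsilon> / 8" using \<tau>n \<delta> by (simp add: field_simps)
            finally show ?thesis by simp
          qed
          finally have "(1 + \<tau> n / norm z) ^ (2 * n) \<le> exp (\<epsilon> / 8) ^ (2 * n)" using \<tau>n z0 by (intro power_mono) auto
          also have "\<dots> = exp (real n * (\<epsilon> / 4))" by (simp add: exp_of_nat_mult[symmetric])
          finally show "(1 + \<tau> n / norm z) ^ (2 * n) \<le> exp (real n * (\<epsilon> / 4))" .
        qed (use z \<tau>n in auto)
        finally show ?thesis .
      qed
      have Pz: "poly (P n) z = exp (of_nat n * z) * (W z * K 1)"
        using W_nz[OF \<tau>z] unfolding K(2) by (simp add: exp_minus)
      have "norm (poly (P n) z) = exp (Re z) ^ n * (norm (W z) * norm (K 1))"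
        unfolding Pz norm_mult exp_of_nat_mult norm_power norm_exp_eq_Re ..
      also have "\<dots> \<le> exp (Re z) ^ n * (((norm z)\<^sup>2 ^ n * exp (real n * (\<epsilon> / 4)) * (D + 1)) * (n * N n * H ^ n * exp (real n * \<epsilon>1 * L + 2) * (4 / \<delta> + B + 5)))"
        using Wn K1 D by (intro mult_left_mono mult_mono) auto
      also have "\<dots> = N n * (exp (Re z) * (norm z)\<^sup>2 * H) ^ n * (real n * C * exp (real n * (\<epsilon> / 4)) * exp (real n * \<epsilon>1 * L))"
        by (simp only: exp_add C_def power_mult_distrib mult_ac)
      also have "\<dots> \<le> N n * (exp (Re z) * (norm z)\<^sup>2 * H) ^ n * exp \<epsilon> ^ n"
      proof (rule mult_left_mono)
        have "real n * C * exp (- (real n * (\<epsilon> / 4))) \<le> 1" using elim(1) by simp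
        then have a: "real n * C \<le> exp (real n * (\<epsilon> / 4))" by (simp add: exp_minus field_simps)
        have "real n * (\<epsilon>1 * L) \<le> real n * (\<epsilon> / 4)" by (intro mult_left_mono \<epsilon>1) simp
        then have b: "exp (real n * \<epsilon>1 * L) \<le> exp (real n * (\<epsilon> / 4))" by (simp add: mult.assoc)
        have "real n * C * exp (real n * (\<epsilon> / 4)) * exp (real n * \<epsilon>1 * L) \<le> exp (real n * (\<epsilon> / 4)) * exp (real n * (\<epsilon> / 4)) * exp (real n * (\<epsilon> / 4))"
          using C by (intro mult_mono a b) auto
        also have "\<dots> = exp (real n * (3 * \<epsilon> / 4))" unfolding exp_add[symmetric] by (simp add: field_simps)
        also have "\<dots> \<le> exp (real n * \<epsilon>)" using \<epsilon> by (intro exp_le_cancel_iff[THEN iffD2] mult_left_mono) auto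
        also have "\<dots> = exp \<epsilon> ^ n" by (simp add: exp_of_nat_mult)
        finally show "real n * C * exp (real n * (\<epsilon> / 4)) * exp (real n * \<epsilon>1 * L) \<le> exp \<epsilon> ^ n" .
      qed (use N0 H0 in auto)
      finally show "norm (poly (P n) z) \<le> N n * (exp \<epsilon> * (exp (Re z) * (norm z)\<^sup>2 *
         (if Re z < 0 then max (height z (root_plus z)) (height z (root_minus z)) else height z (root_plus z)))) ^ n"
        unfolding H_def[symmetric] by (simp only: power_mult_distrib mult_ac)
    qed
  qed
qed

text \<open>The kernel is read on the circle of radius \<open>K = 2 / \<delta>\<close>, about the
  modulus of \<open>root_plus z\<close> for \<open>norm z = \<delta>\<close>. The leading part of
  the resulting rate is x^2 exp (- x) with x = \<delta> K, and x = 2 is its maximum. As \<delta>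
  tends to 0 the rate tends to 4 exp (- 2), which is also the limit of the upper rate at 0.\<close>

lemma P_lower_near_0:
  assumes \<delta>: "0 < \<delta>" "\<delta> < 1"
  shows "\<forall>\<^sub>F n in sequentially. \<exists>z. norm z = \<delta> \<and> N n * ((4 - \<delta>\<^sup>2) * exp (- 2 - 2 * \<delta>)) ^ n \<le> norm (poly (P n) z)"
proof -
  define K where "K = 2 / \<delta>"
  have K: "1 < K" using \<delta> by (simp add: K_def)
  have "(\<lambda>n. 3 * ln ((\<delta> - \<tau> n) / \<delta>)) \<longlonglongrightarrow> 3 * ln ((\<delta> - 0) / \<delta>)"
    using \<delta> by (intro tendsto_intros \<tau>_tendsto_0) auto
  then have 1: "\<forall>\<^sub>F n in sequentially. - (\<delta> / 2) < 3 * ln ((\<delta> - \<tau> n) / \<delta>)"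
    by (rule order_tendstoD) (use \<delta> in simp)
  have 2: "\<forall>\<^sub>F n in sequentially. \<tau> n < \<delta>" using \<tau>_tendsto_0 \<delta> by (intro order_tendstoD) auto
  from 1 2 kernel_lower[OF K] \<rho>_ge[of 1] eventually_gt_at_top[of 0] show ?thesis
  proof eventually_elim
    case (elim n)
    note n = elim(5)
    interpret pade_pair n "a n" "P n" "Q n" "E n" "\<tau> n" by (rule pade[OF n])
    have N0: "0 \<le> N n" using N_pos[OF n] elim(4) by simp
    obtain t where t: "norm t = K" "N n * (K\<^sup>2 - 1) ^ n * exp (- (2 * n / K\<^sup>2)) \<le> norm (kernel n t)" using elim(3) by blast
    obtain z where z: "norm z = \<delta>" "norm (kernel n t) \<le> \<delta> * norm (poly (P n) z) * exp (n * \<delta> * (1 + norm t)) / (\<delta> - \<tau> n) ^ (2 * n + 1)"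
      using norm_G_le_norm_P[OF elim(2), of t] unfolding kernel_def by blast
    define q where "q = (\<delta> - \<tau> n) / \<delta>"
    have q: "0 < q" "q \<le> 1" using elim(2) \<delta> \<tau> by (auto simp: q_def field_simps)
    have dq: "\<delta> - \<tau> n = \<delta> * q" using \<delta> by (simp add: q_def)
    have "N n * (K\<^sup>2 - 1) ^ n * exp (- (2 * n / K\<^sup>2)) \<le> \<delta> * norm (poly (P n) z) * exp (n * \<delta> * (1 + K)) / (\<delta> * q) ^ (2 * n + 1)"
      using t z dq by simp
    then have "N n * (K\<^sup>2 - 1) ^ n * exp (- (2 * n / K\<^sup>2)) * (\<delta> * q) ^ (2 * n + 1) \<le> \<delta> * norm (poly (P n) z) * exp (n * \<delta> * (1 + K))"
      using \<delta> q by (simp add: pos_le_divide_eq)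
    also have "(\<delta> * q) ^ (2 * n + 1) = \<delta> * (\<delta>\<^sup>2 ^ n * q ^ (2 * n + 1))" by (simp add: power_mult_distrib power_mult)
    finally have "\<delta> * (N n * (K\<^sup>2 - 1) ^ n * exp (- (2 * n / K\<^sup>2)) * (\<delta>\<^sup>2 ^ n * q ^ (2 * n + 1))) \<le> \<delta> * (norm (poly (P n) z) * exp (n * \<delta> * (1 + K)))"
      by (simp only: mult_ac)
    then have "N n * (K\<^sup>2 - 1) ^ n * exp (- (2 * n / K\<^sup>2)) * (\<delta>\<^sup>2 ^ n * q ^ (2 * n + 1)) \<le> norm (poly (P n) z) * exp (n * \<delta> * (1 + K))"
      using \<delta> by (simp only: mult_le_cancel_left_pos)
    moreover have "(K\<^sup>2 - 1) ^ n * \<delta>\<^sup>2 ^ n = (4 - \<delta>\<^sup>2) ^ n"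
    proof -
      have "(K\<^sup>2 - 1) * \<delta>\<^sup>2 = 4 - \<delta>\<^sup>2" using \<delta> by (simp add: K_def power_divide field_simps)
      then show ?thesis by (metis power_mult_distrib)
    qed
    moreover have "N n * (K\<^sup>2 - 1) ^ n * exp (- (2 * n / K\<^sup>2)) * (\<delta>\<^sup>2 ^ n * q ^ (2 * n + 1)) = N n * ((K\<^sup>2 - 1) ^ n * \<delta>\<^sup>2 ^ n) * (exp (- (2 * n / K\<^sup>2)) * q ^ (2 * n + 1))"
      by (simp only: mult_ac)
    ultimately have main: "N n * (4 - \<delta>\<^sup>2) ^ n * (exp (- (2 * n / K\<^sup>2)) * q ^ (2 * n + 1)) \<le> norm (poly (P n) z) * exp (n * \<delta> * (1 + K))"
      by (simp only:)
    have e: "exp (n * \<delta> * (1 + K)) * exp (real n * (- 2 - 2 * \<delta>)) \<le> exp (- (2 * n / K\<^sup>2)) * q ^ (2 * n + 1)"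
    proof -
      have "q ^ (2 * n + 1) = exp (real (2 * n + 1) * ln q)" using q by (simp add: exp_of_nat_mult del: of_nat_add of_nat_Suc)
      moreover have "real n * (3 * ln q) \<le> real (2 * n + 1) * ln q"
      proof -
        have "real (2 * n + 1) \<le> 3 * real n" using n by simp
        then have "3 * real n * ln q \<le> real (2 * n + 1) * ln q" using q by (intro mult_right_mono_neg) auto
        then show ?thesis by simp
      qed
      moreover have "real n * (- (\<delta> / 2)) \<le> real n * (3 * ln q)" using elim(1) unfolding q_def by (intro mult_left_mono) auto
      ultimately have q': "exp (real n * (- (\<delta> / 2))) \<le> q ^ (2 * n + 1)" by simp
      have dK: "\<delta> * (1 + K) = \<delta> + 2" using \<delta> by (simp add: K_def field_simps)
      have "2 * n / K\<^sup>2 = real n * (\<delta>\<^sup>2 / 2)" using \<delta> by (simp add: K_def power_divide field_simps)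
      also have "\<dots> \<le> real n * (\<delta> / 2)" using \<delta> by (intro mult_left_mono divide_right_mono) (auto simp: power2_eq_square mult_left_le)
      finally have k2: "2 * n / K\<^sup>2 \<le> real n * (\<delta> / 2)" .
      have "exp (n * \<delta> * (1 + K)) * exp (real n * (- 2 - 2 * \<delta>)) = exp (- (real n * (\<delta> / 2))) * exp (real n * (- (\<delta> / 2)))"
        unfolding exp_add[symmetric] mult.assoc dK by (simp add: algebra_simps)
      also have "\<dots> \<le> exp (- (2 * n / K\<^sup>2)) * q ^ (2 * n + 1)" using k2 q' by (intro mult_mono) auto
      finally show ?thesis .
    qed
    have "(N n * (4 - \<delta>\<^sup>2) ^ n * exp (real n * (- 2 - 2 * \<delta>))) * exp (n * \<delta> * (1 + K)) \<le> norm (poly (P n) z) * exp (n * \<delta> * (1 + K))"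
    proof -
      have "0 \<le> 4 - \<delta>\<^sup>2" using \<delta> power_le_one[of \<delta> 2] by simp
      then have "N n * (4 - \<delta>\<^sup>2) ^ n * (exp (n * \<delta> * (1 + K)) * exp (real n * (- 2 - 2 * \<delta>))) \<le> N n * (4 - \<delta>\<^sup>2) ^ n * (exp (- (2 * n / K\<^sup>2)) * q ^ (2 * n + 1))"
        using N0 by (intro mult_left_mono e) auto
      then show ?thesis using main by (simp only: mult_ac)
    qed
    then have "N n * (4 - \<delta>\<^sup>2) ^ n * exp (real n * (- 2 - 2 * \<delta>)) \<le> norm (poly (P n) z)" by (simp only: mult_le_cancel_right_pos exp_gt_zero)
    then show ?case using z(1) by (intro exI[of _ z]) (simp add: power_mult_distrib exp_of_nat_mult mult.assoc)
  qed
qed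

end

section \<open>The branches of the square root\<close>

text \<open>The inversion \<open>w = 1 / (z - \<i>)\<close> turns the complement of the arc (with \<open>\<infinity>\<close> added) into a simply
  connected plane domain, on which \<open>(z + \<i>) / (z - \<i>) = 1 + 2 \<i> w\<close> has a holomorphic square root.\<close>

lemma exists_sqrt_branch_arc:
  assumes \<gamma>: "arc \<gamma>" "pathstart \<gamma> = \<i>" "pathfinish \<gamma> = - \<i>"
  shows "\<exists>R. R holomorphic_on (- path_image \<gamma>) \<and> (\<forall>z\<in>- path_image \<gamma>. (R z)\<^sup>2 = z\<^sup>2 + 1) \<and>
     ((\<lambda>z. R z / z) \<longlongrightarrow> 1) at_infinity"
proof -
  define \<Gamma> where "\<Gamma> = path_image \<gamma>"
  have cpt: "compact \<Gamma>" using \<gamma> by (simp add: \<Gamma>_def compact_arc_image)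
  have i\<Gamma>: "\<i> \<in> \<Gamma>" "- \<i> \<in> \<Gamma>" using \<gamma> pathstart_in_path_image pathfinish_in_path_image unfolding \<Gamma>_def by metis+
  \<comment> \<open>\<open>T\<close> is the image of the arc without its starting point \<i>, which
    goes to infinity; 0, which is not in \<open>T\<close>, stands for infinity in the original
    plane.\<close>
  define T where "T = {w. w \<noteq> 0 \<and> \<i> + 1 / w \<in> \<Gamma>}"
  obtain b where b: "0 < b" "\<And>z. z \<in> \<Gamma> \<Longrightarrow> norm z \<le> b" using compact_imp_bounded[OF cpt] bounded_pos by blast
  define e where "e = 1 / (b + 2)"
  have e: "0 < e" using b by (simp add: e_def)
  have Tfar: "e \<le> norm w" if "w \<in> T" for w
  proof -
    have w: "w \<noteq> 0" "norm (\<i> + 1 / w) \<le> b" using that b(2) by (auto simp: T_def)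
    have "norm (1 / w) \<le> norm (\<i> + 1 / w) + norm \<i>" using norm_triangle_ineq4[of "\<i> + 1 / w" \<i>] by simp
    then have "1 / norm w \<le> b + 2" using w(2) by (simp add: norm_divide)
    then show ?thesis using w b by (simp add: e_def field_simps)
  qed
  have T_eq: "T = {w. e \<le> norm w} \<inter> (\<lambda>w. \<i> + 1 / w) -` \<Gamma>"
  proof
    show "T \<subseteq> {w. e \<le> norm w} \<inter> (\<lambda>w. \<i> + 1 / w) -` \<Gamma>" using Tfar by (auto simp: T_def)
    show "{w. e \<le> norm w} \<inter> (\<lambda>w. \<i> + 1 / w) -` \<Gamma> \<subseteq> T" using e by (auto simp: T_def)
  qed
  have "closed T"
    unfolding T_eq
  proof (rule continuous_closed_preimage)
    show "continuous_on {w. e \<le> norm w} (\<lambda>w. \<i> + 1 / w)" using e by (intro continuous_intros) auto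
    show "closed {w::complex. e \<le> norm w}" by (intro closed_Collect_le continuous_intros)
  qed (use cpt compact_imp_closed in blast)
  define S where "S = - T"
  have opS: "open S" using \<open>closed T\<close> by (simp add: S_def open_Compl)
  have inv: "1 / (z - \<i>) \<in> S \<longleftrightarrow> z \<notin> \<Gamma>" if "z \<noteq> \<i>" for z
    using that by (auto simp: S_def T_def)
  have S0: "S - {0} = (\<lambda>z. 1 / (z - \<i>)) ` (- \<Gamma>)"
  proof
    show "S - {0} \<subseteq> (\<lambda>z. 1 / (z - \<i>)) ` (- \<Gamma>)"
    proof
      fix w assume "w \<in> S - {0}"
      then show "w \<in> (\<lambda>z. 1 / (z - \<i>)) ` (- \<Gamma>)" by (intro image_eqI[of _ _ "\<i> + 1 / w"]) (auto simp: S_def T_def)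
    qed
    show "(\<lambda>z. 1 / (z - \<i>)) ` (- \<Gamma>) \<subseteq> S - {0}"
    proof
      fix w assume "w \<in> (\<lambda>z. 1 / (z - \<i>)) ` (- \<Gamma>)"
      then obtain z where z: "z \<notin> \<Gamma>" "w = 1 / (z - \<i>)" by blast
      then have "z \<noteq> \<i>" using i\<Gamma> by blast
      then show "w \<in> S - {0}" using inv z by auto
    qed
  qed
  have "connected (- \<Gamma>)" unfolding \<Gamma>_def by (rule connected_arc_complement[OF \<gamma>(1)]) simp
  then have "connected (S - {0})" unfolding S0 using i\<Gamma> by (intro connected_continuous_image continuous_intros) auto
  moreover have "0 \<in> S" by (simp add: S_def T_def)
  then have "S \<subseteq> closure (S - {0})"
  proof -
    have "0 islimpt S" using opS \<open>0 \<in> S\<close> by (simp add: interior_limit_point interior_open)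
    then have "0 \<in> closure (S - {0})" by (simp add: islimpt_in_closure)
    then show ?thesis using closure_subset[of "S - {0}"] by blast
  qed
  ultimately have conS: "connected S" by (intro connected_intermediate_closure[of "S - {0}" S]) auto
  have T_img: "T = (\<lambda>t. 1 / (\<gamma> t - \<i>)) ` {0<..1}"
  proof
    have inj: "\<gamma> t \<noteq> \<i>" if "t \<in> {0<..1}" for t
      using \<gamma> that arcD[OF \<gamma>(1), of t 0] by (auto simp: pathstart_def)
    show "(\<lambda>t. 1 / (\<gamma> t - \<i>)) ` {0<..1} \<subseteq> T" using inj by (auto simp: T_def \<Gamma>_def path_image_def)
    show "T \<subseteq> (\<lambda>t. 1 / (\<gamma> t - \<i>)) ` {0<..1}"
    proof
      fix w assume "w \<in> T"
      then obtain t where t: "t \<in> {0..1}" "\<i> + 1 / w = \<gamma> t" "w \<noteq> 0" by (auto simp: T_def \<Gamma>_def path_image_def)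
      then have "w = 1 / (\<gamma> t - \<i>)" by (metis add_diff_cancel_left' divide_divide_eq_right div_by_1 mult_1)
      moreover have "t \<noteq> 0" using t \<gamma>(2) by (auto simp: pathstart_def)
      ultimately show "w \<in> (\<lambda>t. 1 / (\<gamma> t - \<i>)) ` {0<..1}" using t by auto
    qed
  qed
  have inj: "\<gamma> t \<noteq> \<i>" if "t \<in> {0<..1}" for t
    using \<gamma> that arcD[OF \<gamma>(1), of t 0] by (auto simp: pathstart_def)
  have c\<gamma>: "continuous_on {0..1} \<gamma>" using \<gamma>(1) by (simp add: arc_def path_def)
  have conT: "connected T" unfolding T_img
    using inj by (intro connected_continuous_image continuous_intros continuous_on_subset[OF c\<gamma>]) auto
  have unbT: "\<not> bounded T"
  proof
    assume "bounded T"
    then obtain B where B: "0 < B" "\<And>w. w \<in> T \<Longrightarrow> norm w \<le> B" using bounded_pos by blast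
    have far: "1 / B \<le> norm (\<gamma> t - \<i>)" if t: "t \<in> {0<..1}" for t
    proof -
      have "norm (1 / (\<gamma> t - \<i>)) \<le> B" using t by (intro B(2)) (auto simp: T_img)
      then show ?thesis using inj[OF t] B(1) by (simp add: norm_divide field_simps)
    qed
    have "continuous_on {0..1} (\<lambda>t. norm (\<gamma> t - \<i>))" by (intro continuous_intros c\<gamma>)
    then have "\<exists>d>0. \<forall>t\<in>{0..1}. dist t 0 < d \<longrightarrow> dist (norm (\<gamma> t - \<i>)) (norm (\<gamma> 0 - \<i>)) < 1 / B"
      using B(1) by (intro continuous_on_iff[THEN iffD1, rule_format]) auto
    then obtain d where d: "0 < d" "\<And>t. t \<in> {0..1} \<Longrightarrow> dist t 0 < d \<Longrightarrow> dist (norm (\<gamma> t - \<i>)) (norm (\<gamma> 0 - \<i>)) < 1 / B"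
      by blast
    define t where "t = min (d / 2) 1"
    have t: "t \<in> {0<..1}" "dist t 0 < d" using d(1) by (auto simp: t_def)
    have "norm (\<gamma> t - \<i>) < 1 / B" using d(2)[of t] t \<gamma>(2) by (auto simp: pathstart_def dist_norm)
    then show False using far[OF t(1)] by simp
  qed
  \<comment> \<open>The complement of \<open>S\<close> is the connected unbounded set
    \<open>T\<close>, so it has no bounded component and \<open>S\<close> is simply
    connected.\<close>
  have "\<forall>C \<in> components (- S). \<not> bounded C"
  proof -
    have "T \<noteq> {}" unfolding T_img by auto
    then have "components T = {T}" using conT by (simp add: components_eq_sing_iff)
    then show ?thesis using unbT by (simp add: S_def)
  qed
  then have sc: "simply_connected S"
    using conS simply_connected_eq_unbounded_complement_components[OF opS, THEN iffD2] by blast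
  have f1: "(\<lambda>w. 1 + 2 * \<i> * w) holomorphic_on S" by (intro holomorphic_intros)
  have f2: "1 + 2 * \<i> * w \<noteq> 0" if "w \<in> S" for w
  proof
    assume "1 + 2 * \<i> * w = 0"
    then have "Re (1 + 2 * \<i> * w) = 0" "Im (1 + 2 * \<i> * w) = 0" by simp_all
    then have w': "w = \<i> / 2" by (simp add: complex_eq_iff)
    have "1 / w = - 2 * \<i>" unfolding w' by (simp add: field_simps)
    then have "\<i> + 1 / w = - \<i>" by simp
    moreover have "w \<noteq> 0" unfolding w' by simp
    ultimately have "w \<in> T" using i\<Gamma>(2) unfolding T_def mem_Collect_eq by (simp only: simp_thms)
    then show False using that by (simp add: S_def)
  qed
  have "\<exists>s. s holomorphic_on S \<and> (\<forall>w\<in>S. 1 + 2 * \<i> * w = (s w)\<^sup>2)"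
    using simply_connected_eq_holomorphic_sqrt[OF opS, THEN iffD1, OF sc, THEN conjunct2, rule_format, of "\<lambda>w. 1 + 2 * \<i> * w"] f1 f2
    by simp
  then obtain s0 where s0: "s0 holomorphic_on S" "\<And>w. w \<in> S \<Longrightarrow> 1 + 2 * \<i> * w = (s0 w)\<^sup>2" by blast
  \<comment> \<open>\<open>s0 0\<close> is 1 or - 1. Normalizing the value at 0 selects the branch
    that behaves like z at infinity.\<close>
  define s where "s w = s0 w / s0 0" for w
  have s00: "(s0 0)\<^sup>2 = 1" using s0(2)[OF \<open>0 \<in> S\<close>] by simp
  then have s0nz: "s0 0 \<noteq> 0" by auto
  have s: "s holomorphic_on S" "\<And>w. w \<in> S \<Longrightarrow> 1 + 2 * \<i> * w = (s w)\<^sup>2" "s 0 = 1"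
  proof -
    show "s holomorphic_on S" unfolding s_def using s0nz by (intro holomorphic_intros s0(1)) auto
    show "1 + 2 * \<i> * w = (s w)\<^sup>2" if "w \<in> S" for w unfolding s_def power_divide s00 s0(2)[OF that] by simp
    show "s 0 = 1" using s0nz by (simp add: s_def)
  qed
  define R where "R z = (z - \<i>) * s (1 / (z - \<i>))" for z
  have inS: "1 / (z - \<i>) \<in> S" if "z \<in> - \<Gamma>" for z using inv[of z] that i\<Gamma> by blast
  have "R holomorphic_on - \<Gamma>" unfolding R_def
    by (intro holomorphic_intros holomorphic_on_compose_gen[OF _ s(1), unfolded o_def]) (use inS i\<Gamma> in auto)
  moreover have "(R z)\<^sup>2 = z\<^sup>2 + 1" if z: "z \<in> - \<Gamma>" for z
  proof -
    have zi: "z - \<i> \<noteq> 0" using z i\<Gamma> by auto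
    have "(R z)\<^sup>2 = (z - \<i>)\<^sup>2 * (1 + 2 * \<i> * (1 / (z - \<i>)))" unfolding R_def power_mult_distrib using s(2)[OF inS[OF z]] by simp
    also have "\<dots> = (z - \<i>) * (z - \<i> + 2 * \<i>)" using zi by (simp add: power2_eq_square field_simps)
    also have "\<dots> = z\<^sup>2 + 1" by (simp add: power2_eq_square algebra_simps)
    finally show ?thesis .
  qed
  moreover have "((\<lambda>z. R z / z) \<longlongrightarrow> 1) at_infinity"
  proof -
    have i1: "((\<lambda>z. 1 / (z - \<i>)) \<longlongrightarrow> 0) at_infinity"
      using tendsto_inverse_0[THEN filterlim_compose, OF tendsto_add_filterlim_at_infinity'[OF filterlim_ident tendsto_const[of "- \<i>"]]]
      by (simp add: inverse_eq_divide)
    have "isCont s 0" using holomorphic_on_imp_continuous_on[OF s(1)] opS \<open>0 \<in> S\<close> continuous_on_eq_continuous_at by blast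
    then have s1: "((\<lambda>z. s (1 / (z - \<i>))) \<longlongrightarrow> s 0) at_infinity" using i1 by (rule isCont_tendsto_compose)
    have "((\<lambda>z::complex. (1 - \<i> * inverse z) * s (1 / (z - \<i>))) \<longlongrightarrow> (1 - \<i> * 0) * s 0) at_infinity"
      by (intro tendsto_intros s1 tendsto_inverse_0)
    moreover have "eventually (\<lambda>z. (1 - \<i> * inverse z) * s (1 / (z - \<i>)) = R z / z) at_infinity"
    proof (rule eventually_at_infinityI[of 1])
      fix z :: complex assume "1 \<le> norm z"
      then have "z \<noteq> 0" by auto
      then show "(1 - \<i> * inverse z) * s (1 / (z - \<i>)) = R z / z" by (simp add: R_def field_simps)
    qed
    ultimately show ?thesis using s(3) by (simp add: tendsto_cong)
  qed
  ultimately show ?thesis unfolding \<Gamma>_def by blast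
qed

lemma sqrt_branch_arc:
  assumes "arc \<gamma>" "pathstart \<gamma> = \<i>" "pathfinish \<gamma> = - \<i>"
  defines "R \<equiv> sqrt_branch (path_image \<gamma>)"
  shows "R holomorphic_on (- path_image \<gamma>)" "\<And>z. z \<notin> path_image \<gamma> \<Longrightarrow> (R z)\<^sup>2 = z\<^sup>2 + 1"
    "((\<lambda>z. R z / z) \<longlongrightarrow> 1) at_infinity"
  using someI_ex[OF exists_sqrt_branch_arc[OF assms(1-3)]] unfolding R_def sqrt_branch_def by auto

section \<open>The principal branch and the level function\<close>

definition R0 :: "complex \<Rightarrow> complex" where "R0 z = csqrt (z\<^sup>2 + 1)"

lemma R0_sq: "(R0 z)\<^sup>2 = z\<^sup>2 + 1" by (simp add: R0_def del: csqrt.sel)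

lemma R0_0: "R0 0 = 1" by (simp add: R0_def)

lemma Re_R0: "Re (R0 z) = sqrt ((norm (z\<^sup>2 + 1) + Re (z\<^sup>2 + 1)) / 2)"
  by (simp add: R0_def)

lemma R0_arg: "z\<^sup>2 + 1 \<in> \<real>\<^sub>\<le>\<^sub>0 \<Longrightarrow> Re z = 0 \<and> 1 \<le> \<bar>Im z\<bar>"
proof -
  assume "z\<^sup>2 + 1 \<in> \<real>\<^sub>\<le>\<^sub>0"
  then have "Im (z\<^sup>2) = 0" "Re (z\<^sup>2) + 1 \<le> 0" by (auto simp: complex_nonpos_Reals_iff)
  then have 1: "Re z * Im z = 0" "(Re z)\<^sup>2 + 1 \<le> (Im z)\<^sup>2" by (auto simp: Im_power2 Re_power2)
  have "Im z \<noteq> 0"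
  proof
    assume "Im z = 0"
    then show False using 1(2) zero_le_power2[of "Re z"] by simp
  qed
  then have "Re z = 0" using 1(1) by simp
  then have "1\<^sup>2 \<le> \<bar>Im z\<bar>\<^sup>2" using 1(2) by simp
  then have "1 \<le> \<bar>Im z\<bar>" by (rule power2_le_imp_le) simp
  then show ?thesis using \<open>Re z = 0\<close> by simp
qed

lemma R0_field_derivative:
  assumes "Re z \<noteq> 0 \<or> \<bar>Im z\<bar> < 1"
  shows "(R0 has_field_derivative z / R0 z) (at z)"
proof -
  have "z\<^sup>2 + 1 \<notin> \<real>\<^sub>\<le>\<^sub>0" using R0_arg assms by fastforce
  then show ?thesis unfolding R0_def
    by (auto intro!: derivative_eq_intros)
qed

lemma isCont_R0: "Re z \<noteq> 0 \<or> \<bar>Im z\<bar> < 1 \<Longrightarrow> isCont R0 z"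
  using R0_field_derivative DERIV_isCont by blast

lemma R0_nz: "z \<noteq> \<i> \<Longrightarrow> z \<noteq> - \<i> \<Longrightarrow> R0 z \<noteq> 0"
proof
  assume z: "z \<noteq> \<i>" "z \<noteq> - \<i>" "R0 z = 0"
  then have "(z - \<i>) * (z + \<i>) = 0" using R0_sq[of z] by (simp add: power2_eq_square algebra_simps)
  then show False using z by (auto simp: add_eq_0_iff2)
qed

lemma Re_R0_cnj:
  assumes "Re z \<noteq> 0"
  shows "0 < Re z * Re (R0 z * cnj z)"
proof -
  have a: "0 < Re (R0 z)" using Re_csqrt_pos[OF assms] by (simp only: R0_def)
  have "Im ((R0 z)\<^sup>2) = Im (z\<^sup>2)" using R0_sq by simp
  then have ab: "Re (R0 z) * Im (R0 z) = Re z * Im z" by (simp add: Im_power2)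
  have "Re (R0 z) * (Re z * Re (R0 z * cnj z)) = (Re (R0 z))\<^sup>2 * (Re z)\<^sup>2 + Re z * Im z * (Re (R0 z) * Im (R0 z))"
    by (simp add: power2_eq_square algebra_simps)
  also have "\<dots> = (Re (R0 z))\<^sup>2 * (Re z)\<^sup>2 + (Re z * Im z)\<^sup>2" unfolding ab by (simp add: power2_eq_square)
  also have "\<dots> > 0" using a assms by (intro add_pos_nonneg) auto
  finally show ?thesis using a by (simp add: zero_less_mult_iff)
qed

text \<open>The quotient squares to 1 + 1 / z^2 and its real part has the sign of Re z. Hence at
  infinity the principal branch behaves like z on the right, but like - z on the left.\<close>

lemma R0_over_z_eq:
  assumes "Re z \<noteq> 0"
  shows "R0 z / z = (if 0 < Re z then 1 else - 1) * csqrt (1 + 1 / z\<^sup>2)"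
proof -
  have z: "z \<noteq> 0" using assms by auto
  define \<sigma> where "\<sigma> = (if 0 < Re z then 1 else - 1 :: real)"
  have "R0 z / z * of_real ((norm z)\<^sup>2) = R0 z * cnj z" unfolding complex_norm_square using z by simp
  moreover have "Re (w * of_real x) = Re w * x" for w x by simp
  ultimately have "Re (R0 z / z) * (norm z)\<^sup>2 = Re (R0 z * cnj z)" by metis
  moreover have "0 < \<sigma> * Re (R0 z * cnj z)" using Re_R0_cnj[OF assms] assms by (auto simp: \<sigma>_def zero_less_mult_iff)
  ultimately have "0 < \<sigma> * Re (R0 z / z) * (norm z)\<^sup>2" by (simp add: mult.assoc)
  then have "0 < Re (of_real \<sigma> * (R0 z / z))" using z by (simp add: zero_less_mult_iff \<sigma>_def split: if_splits)
  moreover have "(of_real \<sigma> * (R0 z / z))\<^sup>2 = 1 + 1 / z\<^sup>2"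
    using z R0_sq[of z] by (simp add: power_mult_distrib power_divide \<sigma>_def add_divide_distrib)
  ultimately have "csqrt (1 + 1 / z\<^sup>2) = of_real \<sigma> * (R0 z / z)" by (metis csqrt_square)
  then show ?thesis by (auto simp: \<sigma>_def)
qed

lemma root_minus_R0: "root_minus z = (1 - R0 z) / z" by (simp add: root_minus_def R0_def del: csqrt.sel)
lemma root_plus_R0: "root_plus z = (1 + R0 z) / z" by (simp add: root_plus_def R0_def del: csqrt.sel)

lemma one_minus_R0_nz: "z \<noteq> 0 \<Longrightarrow> 1 - R0 z \<noteq> 0"
proof
  assume z: "z \<noteq> 0" "1 - R0 z = 0"
  then have "R0 z = 1" by simp
  then show False using R0_sq[of z] z(1) by simp
qed

text \<open>On the left half-plane \<open>Phi\<close> is the function \<open>\<eta>\<close> that defines the trajectories, up to a constant \<open>\<plusminus>\<i> \<pi>\<close>, and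
  \<open>level\<close> is its real part.\<close>

definition Phi :: "complex \<Rightarrow> complex" where "Phi z = R0 z + Ln (root_minus z)"
definition level :: "complex \<Rightarrow> real" where "level z = Re (R0 z) + ln (norm (root_minus z))"

lemma root_minus_nz: "z \<noteq> 0 \<Longrightarrow> root_minus z \<noteq> 0"
  using one_minus_R0_nz by (simp add: root_minus_R0)

lemma Re_Phi: "z \<noteq> 0 \<Longrightarrow> Re (Phi z) = level z"
  by (simp add: Phi_def level_def Re_Ln root_minus_nz)

text \<open>Keeps \<open>root_minus z\<close> off the cut of \<open>Ln\<close>, so that
  \<open>Phi\<close> is holomorphic on the left half-plane. The sign follows from that of
  \<open>root_plus z\<close>, of which it is minus the inverse.\<close>

lemma Re_root_minus_pos:
  assumes "Re z < 0"
  shows "0 < Re (root_minus z)"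
proof -
  have z: "z \<noteq> 0" using assms by auto
  have "Re (root_plus z) < 0" using Re_root_plus[of z] assms by (simp add: zero_less_mult_iff)
  have "root_plus z \<noteq> 0" using \<open>Re (root_plus z) < 0\<close> by auto
  then have "root_minus z = - inverse (root_plus z)" using root_critical(3)[OF z] by (simp add: field_simps)
  then have "root_minus z * of_real ((norm (root_plus z))\<^sup>2) = - cnj (root_plus z)"
    unfolding complex_norm_square using \<open>root_plus z \<noteq> 0\<close> by simp
  moreover have "Re (w * of_real x) = Re w * x" for w x by simp
  ultimately have "Re (root_minus z) * (norm (root_plus z))\<^sup>2 = - Re (root_plus z)" by (metis complex_cnj_minus cnj.sel(1) uminus_complex.sel(1))
  then have "0 < Re (root_minus z) * (norm (root_plus z))\<^sup>2" using \<open>Re (root_plus z) < 0\<close> by simp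
  then show ?thesis using \<open>root_plus z \<noteq> 0\<close> by (simp add: zero_less_mult_iff)
qed

lemma Phi_field_derivative:
  assumes z: "Re z < 0"
  shows "(Phi has_field_derivative R0 z / z) (at z)"
proof -
  have z0: "z \<noteq> 0" using z by auto
  have s0: "R0 z \<noteq> 0" using z by (intro R0_nz) auto
  have m: "root_minus z \<notin> \<real>\<^sub>\<le>\<^sub>0" using Re_root_minus_pos[OF z] by (auto simp: complex_nonpos_Reals_iff)
  note m' = one_minus_R0_nz[OF z0]
  have dR: "(R0 has_field_derivative z / R0 z) (at z)" using z by (intro R0_field_derivative) auto
  have dm: "(root_minus has_field_derivative (- (z / R0 z) * z - (1 - R0 z) * 1) / (z * z)) (at z)"
    unfolding root_minus_R0[abs_def] using z0 by (auto intro!: derivative_eq_intros dR)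
  have "(Phi has_field_derivative z / R0 z + inverse (root_minus z) * ((- (z / R0 z) * z - (1 - R0 z) * 1) / (z * z))) (at z)"
    unfolding Phi_def by (intro derivative_intros dR DERIV_chain2[OF has_field_derivative_Ln[OF m] dm])
  moreover have "z / R0 z + inverse (root_minus z) * ((- (z / R0 z) * z - (1 - R0 z) * 1) / (z * z)) = R0 z / z"
  proof -
    define s where "s = R0 z"
    have zz: "z * z = (s - 1) * (s + 1)" using R0_sq[of z] by (simp add: s_def power2_eq_square algebra_simps)
    have n: "- (z / s) * z - (1 - s) = (1 - s) / s"
    proof -
      have "- (z / s) * z = - (z * z) / s" by simp
      also have "\<dots> = (1 - s) * (s + 1) / s" unfolding zz by (simp add: algebra_simps)
      finally show ?thesis using s0 by (simp add: s_def field_simps)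
    qed
    have "inverse (root_minus z) * ((- (z / s) * z - (1 - s) * 1) / (z * z)) = 1 / (z * s)"
      unfolding root_minus_R0 s_def[symmetric] mult_1_right n using m' z0 s0 by (simp add: s_def field_simps)
    moreover have "z / s + 1 / (z * s) = s / z"
    proof -
      have "z / s + 1 / (z * s) = (z * z + 1) / (z * s)" using z0 s0 by (simp add: s_def field_simps)
      also have "z * z + 1 = s * s" using R0_sq[of z] by (simp add: s_def power2_eq_square)
      finally show ?thesis using z0 s0 by (simp add: s_def)
    qed
    ultimately show ?thesis by (simp only: s_def)
  qed
  ultimately show ?thesis by simp
qed

lemma norm_one_minus_R0: "(norm (1 - R0 z))\<^sup>2 = 1 - 2 * Re (R0 z) + norm (z\<^sup>2 + 1)"
proof -
  have "(norm (1 - R0 z))\<^sup>2 = 1 - 2 * Re (R0 z) + (norm (R0 z))\<^sup>2"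
    unfolding cmod_power2 by (simp add: power2_eq_square algebra_simps)
  also have "(norm (R0 z))\<^sup>2 = norm (z\<^sup>2 + 1)" by (metis R0_sq norm_power)
  finally show ?thesis .
qed

text \<open>\<open>R0\<close> jumps across its cuts on the imaginary axis, but Re (R0 z) and
  \<bar>z^2 + 1\<bar> are continuous everywhere. Written in terms of these, \<open>level\<close> is
  seen to be continuous across the cuts.\<close>

lemma level_eq:
  assumes "z \<noteq> 0"
  shows "level z = Re (R0 z) + ln (1 - 2 * Re (R0 z) + norm (z\<^sup>2 + 1)) / 2 - ln (norm z)"
proof -
  have "ln (norm (root_minus z)) = ln (norm (1 - R0 z)) - ln (norm z)"
    using assms one_minus_R0_nz[OF assms] by (simp add: root_minus_R0 norm_divide ln_div)
  moreover have "ln (1 - 2 * Re (R0 z) + norm (z\<^sup>2 + 1)) = 2 * ln (norm (1 - R0 z))"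
    unfolding norm_one_minus_R0[symmetric] using one_minus_R0_nz[OF assms] by (simp add: ln_realpow)
  ultimately show ?thesis by (simp add: level_def)
qed

lemma continuous_on_level: "continuous_on (- {0}) level"
proof -
  have pos: "1 - 2 * Re (R0 z) + norm (z\<^sup>2 + 1) \<noteq> 0" if "z \<noteq> 0" for z
    using one_minus_R0_nz[OF that] norm_one_minus_R0[of z] by (metis norm_eq_zero power_eq_0_iff)
  have c: "continuous_on S (\<lambda>z. Re (R0 z))" for S unfolding Re_R0 by (intro continuous_intros) simp
  have "continuous_on (- {0}) (\<lambda>z. Re (R0 z) + ln (1 - 2 * Re (R0 z) + norm (z\<^sup>2 + 1)) / 2 - ln (norm z))"
    by (intro continuous_on_add continuous_on_diff continuous_on_divide continuous_on_ln continuous_on_mult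
        continuous_on_const continuous_on_norm continuous_on_power continuous_on_id c) (use pos in simp_all)
  then show ?thesis by (rule continuous_on_eq) (rule level_eq[symmetric], simp)
qed

text \<open>These half-lines are the two vertical trajectories with their end points; on them
  \<open>Re (R0 z) = 0\<close> and the logarithms cancel.\<close>

lemma level_imaginary:
  assumes "Re z = 0" "1 \<le> \<bar>Im z\<bar>"
  shows "level z = 0"
proof -
  have z: "z \<noteq> 0" using assms by auto
  have y: "1 \<le> (Im z)\<^sup>2" using assms(2) power_mono[of 1 "\<bar>Im z\<bar>" 2] by simp
  have e: "z\<^sup>2 + 1 = of_real (1 - (Im z)\<^sup>2)" using assms by (simp add: complex_eq_iff Re_power2 Im_power2)
  have n: "norm (z\<^sup>2 + 1) = (Im z)\<^sup>2 - 1" unfolding e norm_of_real using y by simp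
  have "Re (z\<^sup>2 + 1) = 1 - (Im z)\<^sup>2" unfolding e by (rule Re_complex_of_real)
  then have r: "Re (R0 z) = 0" unfolding Re_R0 n by simp
  have nz: "norm z = \<bar>Im z\<bar>" using assms by (simp add: cmod_def)
  have "ln ((Im z)\<^sup>2) = 2 * ln \<bar>Im z\<bar>" using assms ln_realpow[of "\<bar>Im z\<bar>" 2] by simp
  then show ?thesis unfolding level_eq[OF z] r n nz by simp
qed

lemma Re_R0_over_z_neg:
  assumes "Re z < 0"
  shows "Re (R0 z / z) < 0"
proof -
  have z: "z \<noteq> 0" using assms by auto
  have "R0 z / z * of_real ((norm z)\<^sup>2) = R0 z * cnj z" unfolding complex_norm_square using z by simp
  moreover have "Re (w * of_real x) = Re w * x" for w x by simp
  ultimately have "Re (R0 z / z) * (norm z)\<^sup>2 = Re (R0 z * cnj z)" by metis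
  moreover have "Re (R0 z * cnj z) < 0" using Re_R0_cnj[of z] assms by (simp add: zero_less_mult_iff)
  ultimately have "Re (R0 z / z) * (norm z)\<^sup>2 < 0" by simp
  then show ?thesis using z by (simp add: mult_less_0_iff)
qed

lemma level_horizontal_deriv:
  assumes "Re z < 0"
  shows "((\<lambda>s. level (z + of_real s)) has_real_derivative Re (R0 z / z)) (at 0)"
proof -
  have "((\<lambda>s. Phi (z + of_real s)) has_vector_derivative R0 z / z) (at 0)"
  proof -
    have "((\<lambda>s. z + of_real s) has_vector_derivative 1) (at 0)"
      by (auto intro!: derivative_eq_intros simp: has_vector_derivative_def scaleR_conv_of_real)
    moreover have "(Phi has_field_derivative R0 z / z) (at (z + of_real 0))" using Phi_field_derivative[OF assms] by simp
    ultimately show ?thesis using field_vector_diff_chain_at by (force simp: o_def)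
  qed
  then have "((\<lambda>s. Re (Phi (z + of_real s))) has_real_derivative Re (R0 z / z)) (at 0)"
    by (simp add: has_vector_derivative_complex_iff)
  moreover have "eventually (\<lambda>s. Re (Phi (z + of_real s)) = level (z + of_real s)) (nhds (0::real))"
  proof -
    have "eventually (\<lambda>s. s \<in> {..<- Re z}) (nhds (0::real))" using assms by (intro eventually_nhds_in_open) simp_all
    then show ?thesis by eventually_elim (rule Re_Phi, auto dest: arg_cong[of _ _ Re])
  qed
  ultimately show ?thesis by (subst (asm) DERIV_cong_ev[OF refl _ refl])
qed

text \<open>The horizontal derivative of \<open>level\<close> is Re (R0 z / z), which is negative in
  the left half-plane. Each horizontal line meets the zero set of \<open>level\<close> there at most
  once, so the sign of \<open>level\<close> can serve to tell the two sides of the curve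
  apart.\<close>

lemma level_strict_decreasing:
  assumes "Re z < Re w" "Re w \<le> 0" "Im z = Im w" "w \<noteq> 0"
  shows "level w < level z"
proof -
  define p where "p x = Complex x (Im w)" for x
  have nz: "p x \<noteq> 0" if "x \<le> Re w" for x using that assms by (auto simp: p_def complex_eq_iff)
  have "level (p (Re w)) < level (p (Re z))"
  proof (rule DERIV_neg_imp_decreasing_open[OF assms(1)])
    fix x assume x: "Re z < x" "x < Re w"
    have "((\<lambda>s. level (p x + of_real s)) has_real_derivative Re (R0 (p x) / p x)) (at 0)"
      using x assms by (intro level_horizontal_deriv) (auto simp: p_def)
    moreover have "p x + of_real s = p (x + s)" for s by (simp add: p_def complex_eq_iff)
    ultimately have "((\<lambda>s. level (p (s + x))) has_real_derivative Re (R0 (p x) / p x)) (at 0)" by (simp add: add.commute)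
    then have "((\<lambda>x. level (p x)) has_real_derivative Re (R0 (p x) / p x)) (at x)"
      using DERIV_shift[of "\<lambda>x. level (p x)" _ 0 x] by simp
    moreover have "Re (R0 (p x) / p x) < 0" using x assms by (intro Re_R0_over_z_neg) (auto simp: p_def)
    ultimately show "\<exists>y. ((\<lambda>x. level (p x)) has_real_derivative y) (at x) \<and> y < 0" by blast
  next
    show "continuous_on {Re z..Re w} (\<lambda>x. level (p x))"
    proof (rule continuous_on_compose2[OF continuous_on_level])
      show "continuous_on {Re z..Re w} p" unfolding p_def complex_eq by (intro continuous_intros)
      show "p ` {Re z..Re w} \<subseteq> - {0}" using nz by auto
    qed
  qed
  then show ?thesis using assms by (simp add: p_def complex_eq_iff) (metis complex.collapse)
qed

lemma level_pos_if_Im_ge_1: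
  assumes "Re z < 0" "1 \<le> \<bar>Im z\<bar>"
  shows "0 < level z"
proof -
  have "level (Complex 0 (Im z)) < level z"
    using assms by (intro level_strict_decreasing) (auto simp: complex_eq_iff)
  then show ?thesis using level_imaginary[of "Complex 0 (Im z)"] assms by simp
qed

lemma Re_R0_pos: "Re z \<noteq> 0 \<Longrightarrow> 0 < Re (R0 z)"
  using Re_csqrt_pos by (simp only: R0_def)

text \<open>Along a horizontal ray that avoids the arc and the cuts of \<open>R0\<close>, the
  quotient of the two roots is continuous with values \<plusminus>1, hence constant. Its value is
  found at infinity, where the branch behaves like z and \<open>R0\<close> like \<sigma> z.\<close>

lemma sqrt_branch_on_ray:
  fixes \<sigma> :: real
  assumes \<gamma>: "arc \<gamma>" "pathstart \<gamma> = \<i>" "pathfinish \<gamma> = - \<i>"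
  assumes \<sigma>: "\<sigma> = 1 \<or> \<sigma> = - 1"
    and ray: "\<And>s. 0 \<le> s \<Longrightarrow> z + of_real (\<sigma> * s) \<notin> path_image \<gamma>"
    and off: "\<And>s. 0 \<le> s \<Longrightarrow> Re z + \<sigma> * s \<noteq> 0 \<or> \<bar>Im z\<bar> < 1"
  shows "sqrt_branch (path_image \<gamma>) z = of_real \<sigma> * R0 z"
proof -
  define \<Gamma> where "\<Gamma> = path_image \<gamma>"
  define R where "R = sqrt_branch \<Gamma>"
  note R = sqrt_branch_arc[OF \<gamma>, folded \<Gamma>_def, folded R_def]
  define p where "p s = z + of_real (\<sigma> * s)" for s
  define q where "q s = R (p s) / R0 (p s)" for s
  have i\<Gamma>: "\<i> \<in> \<Gamma>" "- \<i> \<in> \<Gamma>" using \<gamma> pathstart_in_path_image pathfinish_in_path_image unfolding \<Gamma>_def by metis+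
  have pG: "p s \<notin> \<Gamma>" if "0 \<le> s" for s using ray[OF that] by (simp add: p_def \<Gamma>_def)
  have nz: "R0 (p s) \<noteq> 0" if "0 \<le> s" for s using pG[OF that] i\<Gamma> by (intro R0_nz) auto
  have q2: "(q s)\<^sup>2 = 1" if "0 \<le> s" for s
    unfolding q_def power_divide R(2)[OF pG[OF that]] R0_sq[symmetric] using nz[OF that] by simp
  have cp: "continuous_on {0..} p" unfolding p_def by (intro continuous_intros)
  have op: "open (- \<Gamma>)" using \<gamma>(1) by (simp add: \<Gamma>_def open_Compl compact_arc_image compact_imp_closed)
  have "continuous_on {0..} (\<lambda>s. R (p s))"
    by (rule continuous_on_compose2[OF holomorphic_on_imp_continuous_on[OF R(1)] cp]) (use pG in auto)
  moreover have "continuous_on {0..} (\<lambda>s. R0 (p s))"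
  proof (rule continuous_on_compose2[OF continuous_at_imp_continuous_on cp subset_refl])
    show "\<forall>x\<in>p ` {0..}. isCont R0 x"
    proof
      fix x assume "x \<in> p ` {0..}"
      then obtain s where s: "0 \<le> s" "x = p s" by auto
      show "isCont R0 x" using off[OF s(1)] unfolding s(2) by (intro isCont_R0) (simp add: p_def)
    qed
  qed
  ultimately have "continuous_on {0..} q" unfolding q_def using nz by (intro continuous_on_divide) auto
  moreover have "finite (q ` {0..})"
  proof (rule finite_subset)
    show "q ` {0..} \<subseteq> {1, - 1}" using q2 by (auto simp: power2_eq_1_iff)
  qed simp
  ultimately have "q constant_on {0..}" by (intro continuous_finite_range_constant) auto
  then have const: "q s = q 0" if "0 \<le> s" for s using that unfolding constant_on_def by fastforce
  have lim_p: "filterlim p at_infinity at_top"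
  proof -
    have "filterlim (\<lambda>s::real. norm (of_real (\<sigma> * s) :: complex)) at_top at_top"
      using \<sigma> filterlim_abs_real by (auto simp: norm_mult abs_mult)
    then have "filterlim (\<lambda>s::real. of_real (\<sigma> * s) :: complex) at_infinity at_top"
      by (rule filterlim_norm_at_top_imp_at_infinity)
    then show ?thesis unfolding p_def by (rule tendsto_add_filterlim_at_infinity[OF tendsto_const])
  qed
  have l1: "((\<lambda>s. R (p s) / p s) \<longlongrightarrow> 1) at_top" using filterlim_compose[OF R(3) lim_p] .
  have l2: "((\<lambda>s. of_real \<sigma> * csqrt (1 + 1 / (p s)\<^sup>2)) \<longlongrightarrow> of_real \<sigma> * csqrt (1 + 0\<^sup>2)) at_top"
  proof -
    have "((\<lambda>s. 1 + (inverse (p s))\<^sup>2) \<longlongrightarrow> 1 + 0\<^sup>2) at_top"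
      by (intro tendsto_intros filterlim_compose[OF tendsto_inverse_0 lim_p])
    then have "((\<lambda>s. csqrt (1 + (inverse (p s))\<^sup>2)) \<longlongrightarrow> csqrt (1 + 0\<^sup>2)) at_top"
      by (intro isCont_tendsto_compose[of _ csqrt] continuous_at_csqrt) auto
    then show ?thesis by (intro tendsto_mult tendsto_const) (simp add: inverse_eq_divide power_divide)
  qed
  have "((\<lambda>s. (R (p s) / p s) / (of_real \<sigma> * csqrt (1 + 1 / (p s)\<^sup>2))) \<longlongrightarrow> 1 / (of_real \<sigma> * csqrt (1 + 0\<^sup>2))) at_top"
    using \<sigma> by (intro tendsto_divide l1 l2) auto
  moreover have "eventually (\<lambda>s. (R (p s) / p s) / (of_real \<sigma> * csqrt (1 + 1 / (p s)\<^sup>2)) = q 0) at_top"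
    using eventually_gt_at_top[of "\<bar>Re z\<bar>"]
  proof eventually_elim
    fix s assume s: "\<bar>Re z\<bar> < s"
    have re: "Re (p s) = Re z + \<sigma> * s" by (simp add: p_def)
    have nzr: "Re (p s) \<noteq> 0" and sg: "(if 0 < Re (p s) then 1 else - 1 :: complex) = of_real \<sigma>"
      unfolding re using s \<sigma> by auto
    have "p s \<noteq> 0" using nzr by auto
    have "(R (p s) / p s) / (of_real \<sigma> * csqrt (1 + 1 / (p s)\<^sup>2)) = (R (p s) / p s) / (R0 (p s) / p s)"
      unfolding R0_over_z_eq[OF nzr] sg by (rule refl)
    also have "\<dots> = q s" using \<open>p s \<noteq> 0\<close> by (simp add: q_def)
    also have "\<dots> = q 0" using s by (intro const) auto
    finally show "(R (p s) / p s) / (of_real \<sigma> * csqrt (1 + 1 / (p s)\<^sup>2)) = q 0" .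
  qed
  ultimately have "((\<lambda>s::real. q 0) \<longlongrightarrow> 1 / (of_real \<sigma> * csqrt (1 + 0\<^sup>2))) at_top"
    using tendsto_cong[THEN iffD1] by fast
  then have "q 0 = 1 / of_real \<sigma>" using tendsto_unique[OF trivial_limit_at_top_linorder _ tendsto_const] by fastforce
  then have "R z / R0 z = of_real \<sigma>" using \<sigma> by (auto simp: q_def p_def)
  then show ?thesis using nz[of 0] by (simp add: p_def R_def \<Gamma>_def field_simps)
qed

section \<open>Sign of the branch on either side of the arc\<close>

locale level_arc =
  fixes \<gamma> :: "real \<Rightarrow> complex"
  assumes arc: "arc \<gamma>" and start: "pathstart \<gamma> = \<i>" and finish: "pathfinish \<gamma> = - \<i>"
    and on_level: "\<And>z. z \<in> path_image \<gamma> \<Longrightarrow> z = \<i> \<or> z = - \<i> \<or> (Re z < 0 \<and> level z = 0)"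
begin

abbreviation "R \<equiv> sqrt_branch (path_image \<gamma>)"

lemma R_right:
  assumes "0 < Re z"
  shows "R z = R0 z"
proof -
  have "R z = of_real 1 * R0 z"
  proof (rule sqrt_branch_on_ray[OF arc start finish])
    fix s :: real assume s: "0 \<le> s"
    show "z + of_real (1 * s) \<notin> path_image \<gamma>"
    proof
      assume "z + of_real (1 * s) \<in> path_image \<gamma>"
      then have "Re (z + of_real (1 * s)) \<le> 0" using on_level by fastforce
      then show False using assms s by simp
    qed
    show "Re z + 1 * s \<noteq> 0 \<or> \<bar>Im z\<bar> < 1" using assms s by auto
  qed simp
  then show ?thesis by simp
qed

text \<open>Moving left increases \<open>level\<close>, so the ray to the left stays where
  \<open>level\<close> is positive and never meets the arc.\<close>

lemma R_outside:
  assumes "Re z < 0" "0 < level z"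
  shows "R z = - R0 z"
proof -
  have "R z = of_real (- 1) * R0 z"
  proof (rule sqrt_branch_on_ray[OF arc start finish])
    fix s :: real assume s: "0 \<le> s"
    have "level z \<le> level (z + of_real (- 1 * s))"
    proof (cases "s = 0")
      case False
      have "level z < level (z + of_real (- 1 * s))"
        by (rule level_strict_decreasing) (use False s assms in auto)
      then show ?thesis by simp
    qed simp
    then show "z + of_real (- 1 * s) \<notin> path_image \<gamma>"
    proof (rule contrapos_pn)
      assume "z + of_real (- 1 * s) \<in> path_image \<gamma>"
      moreover have "Re (z + of_real (- 1 * s)) < 0" using assms s by simp
      ultimately have "level (z + of_real (- 1 * s)) = 0" using on_level by fastforce
      then show "\<not> level z \<le> level (z + of_real (- 1 * s))" using assms by simp
    qed
    show "Re z + - 1 * s \<noteq> 0 \<or> \<bar>Im z\<bar> < 1" using assms s by auto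
  qed simp
  then show ?thesis by simp
qed

text \<open>The ray goes to the right: as long as it is in the left half-plane \<open>level\<close>
  stays negative, and beyond that only the end points \<plusminus>\<i> could be met, which the strip
  excludes. The strip also keeps the ray off the cuts of \<open>R0\<close>.\<close>

lemma R_strip:
  assumes "\<bar>Im z\<bar> < 1" "Re z < 0 \<Longrightarrow> level z < 0"
  shows "R z = R0 z"
proof -
  have "R z = of_real 1 * R0 z"
  proof (rule sqrt_branch_on_ray[OF arc start finish])
    fix s :: real assume s: "0 \<le> s"
    let ?w = "z + of_real (1 * s)"
    have neg: "level ?w < 0" if w: "Re ?w < 0"
    proof (cases "s = 0")
      case True
      then show ?thesis using w assms(2) by simp
    next
      case False
      have "level ?w < level z"
      proof (rule level_strict_decreasing)
        show "?w \<noteq> 0" using w by (metis less_irrefl zero_complex.sel(1))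
      qed (use False s w in auto)
      then show ?thesis using assms(2) w s by simp
    qed
    show "?w \<notin> path_image \<gamma>"
    proof
      assume "?w \<in> path_image \<gamma>"
      moreover have "Im ?w \<noteq> Im \<i>" "Im ?w \<noteq> Im (- \<i>)" using assms(1) by auto
      ultimately have "Re ?w < 0" "level ?w = 0" using on_level by metis+
      then show False using neg by simp
    qed
    show "Re z + 1 * s \<noteq> 0 \<or> \<bar>Im z\<bar> < 1" using assms(1) by auto
  qed simp
  then show ?thesis by simp
qed

lemma R_inside: "Re z < 0 \<Longrightarrow> level z < 0 \<Longrightarrow> R z = R0 z"
  using R_strip level_pos_if_Im_ge_1 by (metis not_less order.asym)

lemma R_at_0: "R 0 = 1"
  using R_strip[of 0] by (simp add: R0_0)

end

section \<open>The trajectory\<close>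

text \<open>Differentiation of the indefinite gauge integral almost everywhere. It recovers
  information on the integrand from the condition in \<open>is_gamma1\<close>, which is one on
  integrals.\<close>

lemma negligible_integral_zero:
  fixes f :: "real \<Rightarrow> real"
  assumes int: "\<And>t. t \<in> {0..1} \<Longrightarrow> f integrable_on {0..t}" and zero: "\<And>t. t \<in> {0..1} \<Longrightarrow> integral {0..t} f = 0"
  shows "\<exists>N. negligible N \<and> (\<forall>x\<in>{0<..<1} - N. f x = 0)"
proof -
  define F where "F x = (if x \<in> {0..1} then f x else 0)" for x
  have "f integrable_on {0..1}" using int[of 1] by simp
  then have "F integrable_on UNIV" unfolding F_def by (rule integrable_restrict_UNIV[THEN iffD2])
  then have "F integrable_on cbox a b" for a b by (rule integrable_on_subcbox) simp
  from integrable_ccontinuous_explicit[OF this] obtain N where N: "negligible N"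
    and lim: "\<And>x e. \<lbrakk>x \<notin> N; 0 < e\<rbrakk> \<Longrightarrow> \<exists>d>0. \<forall>h. 0 < h \<and> h < d \<longrightarrow>
                         norm(integral (cbox x (x + h *\<^sub>R One)) F /\<^sub>R h ^ DIM(real) - F x) < e" by metis
  have "f x = 0" if x: "x \<in> {0<..<1} - N" for x
  proof (rule ccontr)
    assume nz: "f x \<noteq> 0"
    have "x \<notin> N" using x by simp
    from lim[OF this, of "\<bar>f x\<bar>"] nz obtain d where d: "0 < d" "\<And>h. 0 < h \<Longrightarrow> h < d \<Longrightarrow>
        norm(integral (cbox x (x + h *\<^sub>R One)) F /\<^sub>R h ^ DIM(real) - F x) < \<bar>f x\<bar>" by auto
    define h where "h = min (d / 2) ((1 - x) / 2)"
    have h: "0 < h" "h < d" "x + h \<le> 1" using d(1) x by (auto simp: h_def min_def field_simps)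
    have "integral {x..x + h} F = integral {x..x + h} f"
      using x h by (intro integral_cong) (auto simp: F_def)
    moreover have "integral {0..x} f + integral {x..x + h} f = integral {0..x + h} f"
      using x h by (intro Henstock_Kurzweil_Integration.integral_combine int) auto
    ultimately have "integral {x..x + h} F = 0" using zero[of x] zero[of "x + h"] x h by simp
    then have "integral (cbox x (x + h *\<^sub>R One)) F = 0" by simp
    then have "norm (F x) < \<bar>f x\<bar>" using d(2)[OF h(1,2)] by simp
    then show False using x by (simp add: F_def)
  qed
  then show ?thesis using N by blast
qed

lemma zero_if_negligible_continuous:
  fixes f :: "real \<Rightarrow> real"
  assumes "continuous_on {0<..<1} f" "negligible N" "\<forall>x\<in>{0<..<1} - N. f x = 0" "x \<in> {0<..<1}"
  shows "f x = 0"
proof (rule ccontr)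
  assume "f x \<noteq> 0"
  define S where "S = {0<..<1} \<inter> f -` (- {0})"
  have "open S" unfolding S_def by (rule continuous_open_preimage[OF assms(1)]) auto
  moreover have "S \<subseteq> N" using assms(3) by (auto simp: S_def)
  then have "negligible S" using assms(2) negligible_subset by blast
  moreover have "S \<noteq> {}" using \<open>f x \<noteq> 0\<close> assms(4) by (auto simp: S_def)
  ultimately show False using open_not_negligible by blast
qed

section \<open>Boundary values along the trajectory\<close>

locale trajectory =
  fixes \<gamma> :: "real \<Rightarrow> complex"
  assumes is_gamma1: "is_gamma1 \<gamma>"
begin

abbreviation "d t \<equiv> vector_derivative \<gamma> (at t)"
definition "k0 t = R0 (\<gamma> t) / \<gamma> t * d t"

lemma arc: "arc \<gamma>" and start: "pathstart \<gamma> = \<i>" and finish: "pathfinish \<gamma> = - \<i>"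
  using is_gamma1 by (auto simp: is_gamma1_def)

lemma d_nz: "t \<in> {0<..<1} \<Longrightarrow> d t \<noteq> 0" and Re_neg: "t \<in> {0<..<1} \<Longrightarrow> Re (\<gamma> t) < 0"
  using is_gamma1 by (auto simp: is_gamma1_def)

lemma \<gamma>_0: "\<gamma> 0 = \<i>" and \<gamma>_1: "\<gamma> 1 = - \<i>"
  using start finish by (auto simp: pathstart_def pathfinish_def)

lemma \<gamma>_inj: "\<gamma> s = \<gamma> t \<Longrightarrow> s \<in> {0..1} \<Longrightarrow> t \<in> {0..1} \<Longrightarrow> s = t"
  using arc by (simp add: arc_def inj_on_def)

lemma cont: "continuous_on {0..1} \<gamma>" using arc by (simp add: arc_def path_def)

lemma C1: "\<gamma> C1_differentiable_on {0<..<1}" using is_gamma1 by (simp add: is_gamma1_def)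

lemma has_d: "t \<in> {0<..<1} \<Longrightarrow> (\<gamma> has_vector_derivative d t) (at t)"
  using C1 by (simp add: C1_differentiable_on_eq vector_derivative_works)

lemma cont_d: "continuous_on {0<..<1} d"
  using C1 by (simp add: C1_differentiable_on_eq)

lemma nz: "t \<in> {0..1} \<Longrightarrow> \<gamma> t \<noteq> 0"
proof -
  assume t: "t \<in> {0..1}"
  consider "t = 0" | "t = 1" | "t \<in> {0<..<1}" using t by force
  then show "\<gamma> t \<noteq> 0" by cases (use \<gamma>_0 \<gamma>_1 Re_neg in force)+
qed

definition "normal t \<epsilon> = \<gamma> t + of_real \<epsilon> * (\<i> * d t)"

text \<open>Points with parameter near \<open>t\<close> deviate from the tangent by at most half of
  their tangential displacement, so none of them is on the normal. The rest of the arc is compact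
  and has positive distance from \<open>\<gamma> t\<close>.\<close>

lemma normal_avoids:
  assumes t: "t \<in> {0<..<1}"
  shows "eventually (\<lambda>\<epsilon>. normal t \<epsilon> \<notin> path_image \<gamma> \<and> Re (normal t \<epsilon>) < 0) (at_right 0)"
proof -
  have "(\<gamma> has_derivative (\<lambda>x. x *\<^sub>R d t)) (at t)" using has_d[OF t] by (simp add: has_vector_derivative_def)
  moreover have e: "0 < norm (d t) / 2" using d_nz[OF t] by simp
  ultimately obtain \<delta> where \<delta>: "0 < \<delta>" "\<And>u. norm (u - t) < \<delta> \<Longrightarrow> norm (\<gamma> u - \<gamma> t - (u - t) *\<^sub>R d t) \<le> norm (d t) / 2 * norm (u - t)"
    unfolding has_derivative_at_alt by blast
  define K where "K = {0..1} - {t - \<delta><..<t + \<delta>}"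
  have "compact K" unfolding K_def by (intro compact_diff) auto
  then have "compact (\<gamma> ` K)" by (intro compact_continuous_image continuous_on_subset[OF cont]) (auto simp: K_def)
  moreover have "\<gamma> t \<notin> \<gamma> ` K"
  proof
    assume "\<gamma> t \<in> \<gamma> ` K"
    then obtain u where "u \<in> K" "\<gamma> t = \<gamma> u" by blast
    then show False using \<gamma>_inj[of t u] t \<delta>(1) by (auto simp: K_def)
  qed
  ultimately have "\<exists>m>0. \<forall>x\<in>\<gamma> ` K. m \<le> dist (\<gamma> t) x"
    using separate_point_closed compact_imp_closed by blast
  then obtain m where m: "0 < m" "\<And>u. u \<in> K \<Longrightarrow> m \<le> dist (\<gamma> t) (\<gamma> u)" by blast
  define b where "b = m / norm (d t)"
  have "0 < b" using m(1) d_nz[OF t] by (simp add: b_def)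
  then have "eventually (\<lambda>\<epsilon>. 0 < \<epsilon> \<and> \<epsilon> < b) (at_right 0)"
    unfolding eventually_at_right_field by blast
  moreover have "eventually (\<lambda>\<epsilon>. Re (normal t \<epsilon>) < 0) (at_right 0)"
  proof (rule order_tendstoD(2))
    have "((\<lambda>\<epsilon>. Re (\<gamma> t + of_real \<epsilon> * (\<i> * d t))) \<longlongrightarrow> Re (\<gamma> t + of_real 0 * (\<i> * d t))) (at_right 0)"
      by (intro tendsto_intros)
    then show "((\<lambda>\<epsilon>. Re (normal t \<epsilon>)) \<longlongrightarrow> Re (\<gamma> t)) (at_right 0)" by (simp add: normal_def)
  qed (rule Re_neg[OF t])
  ultimately show ?thesis
  proof eventually_elim
    fix \<epsilon> assume \<epsilon>: "0 < \<epsilon> \<and> \<epsilon> < b" and re: "Re (normal t \<epsilon>) < 0"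
    have "normal t \<epsilon> \<notin> path_image \<gamma>"
    proof
      assume "normal t \<epsilon> \<in> path_image \<gamma>"
      then obtain u where u: "u \<in> {0..1}" "\<gamma> u = normal t \<epsilon>" by (auto simp: path_image_def)
      have "dist (\<gamma> t) (\<gamma> u) = \<epsilon> * norm (d t)" using \<epsilon> u(2) by (simp add: dist_norm normal_def norm_mult)
      also have "\<dots> < m" using \<epsilon> d_nz[OF t] by (simp add: b_def pos_less_divide_eq)
      finally have "u \<notin> K" using m(2) by force
      then have "norm (u - t) < \<delta>" using u(1) by (auto simp: K_def)
      from \<delta>(2)[OF this] have "norm (of_real \<epsilon> * (\<i> * d t) - of_real (u - t) * d t) \<le> norm (d t) / 2 * \<bar>u - t\<bar>"
        unfolding u(2) normal_def scaleR_conv_of_real by simp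
      also have "of_real \<epsilon> * (\<i> * d t) - of_real (u - t) * d t = Complex (- (u - t)) \<epsilon> * d t"
        by (simp add: complex_eq_iff algebra_simps)
      finally have "norm (Complex (- (u - t)) \<epsilon>) \<le> \<bar>u - t\<bar> / 2" using d_nz[OF t] by (simp add: norm_mult)
      then have "\<bar>u - t\<bar> \<le> \<bar>u - t\<bar> / 2" using abs_Re_le_cmod[of "Complex (- (u - t)) \<epsilon>"] by simp
      then have "u = t" by simp
      then show False using u(2) \<epsilon> d_nz[OF t] by (simp add: normal_def)
    qed
    then show "normal t \<epsilon> \<notin> path_image \<gamma> \<and> Re (normal t \<epsilon>) < 0" using re by blast
  qed
qed

text \<open>On a short normal the quotient of the two roots is continuous with values \<plusminus>1.
  At this stage the sign \<open>k\<close> may depend on \<open>t\<close>: the sides of the curve are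
  identified only once \<open>level\<close> is known to vanish on it.\<close>

lemma sqrt_plus_eq_sign:
  assumes t: "t \<in> {0<..<1}"
  shows "\<exists>k::real. (k = 1 \<or> k = - 1) \<and> sqrt_plus \<gamma> t = of_real k * R0 (\<gamma> t) \<and>
    eventually (\<lambda>\<epsilon>. sqrt_branch (path_image \<gamma>) (normal t \<epsilon>) = of_real k * R0 (normal t \<epsilon>)) (at_right 0)"
proof -
  note R = sqrt_branch_arc[OF arc start finish]
  from normal_avoids[OF t] obtain b where b: "0 < b"
    "\<And>\<epsilon>. 0 < \<epsilon> \<Longrightarrow> \<epsilon> < b \<Longrightarrow> normal t \<epsilon> \<notin> path_image \<gamma> \<and> Re (normal t \<epsilon>) < 0"
    unfolding eventually_at_right_field by blast
  have Rn0: "R0 w \<noteq> 0" if "Re w < 0" for w using Re_R0_pos[of w] that by auto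
  define q where "q \<epsilon> = sqrt_branch (path_image \<gamma>) (normal t \<epsilon>) / R0 (normal t \<epsilon>)" for \<epsilon>
  have q2: "(q \<epsilon>)\<^sup>2 = 1" if "\<epsilon> \<in> {0<..<b}" for \<epsilon>
    unfolding q_def power_divide using that b(2)[of \<epsilon>] R(2)[of "normal t \<epsilon>"] R0_sq[of "normal t \<epsilon>"] Rn0[of "normal t \<epsilon>"] by auto
  have cn: "continuous_on {0<..<b} (normal t)" unfolding normal_def by (intro continuous_intros)
  have "continuous_on {0<..<b} (\<lambda>s. sqrt_branch (path_image \<gamma>) (normal t s))"
    by (rule continuous_on_compose2[OF holomorphic_on_imp_continuous_on[OF R(1)] cn]) (use b in auto)
  moreover have "continuous_on {0<..<b} (\<lambda>s. R0 (normal t s))"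
  proof (rule continuous_on_compose2[OF continuous_at_imp_continuous_on cn subset_refl])
    show "\<forall>x\<in>normal t ` {0<..<b}. isCont R0 x"
    proof
      fix x assume "x \<in> normal t ` {0<..<b}"
      then obtain s where s: "0 < s" "s < b" "x = normal t s" by auto
      show "isCont R0 x" using b(2)[OF s(1,2)] unfolding s(3) by (intro isCont_R0) simp
    qed
  qed
  ultimately have "continuous_on {0<..<b} q" unfolding q_def using Rn0 b(2) by (intro continuous_on_divide) auto
  moreover have "finite (q ` {0<..<b})"
  proof (rule finite_subset)
    show "q ` {0<..<b} \<subseteq> {1, - 1}"
    proof
      fix w assume "w \<in> q ` {0<..<b}"
      then have "w\<^sup>2 = 1" using q2 by blast
      then show "w \<in> {1, - 1}" by (simp add: power2_eq_1_iff)
    qed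
  qed simp
  ultimately have "q constant_on {0<..<b}" by (intro continuous_finite_range_constant) auto
  then obtain c where c: "\<And>\<epsilon>. \<epsilon> \<in> {0<..<b} \<Longrightarrow> q \<epsilon> = c" unfolding constant_on_def by blast
  have "c\<^sup>2 = 1" using q2[of "b / 2"] c[of "b / 2"] b(1) by simp
  then obtain k :: real where k: "k = 1 \<or> k = - 1" "c = of_real k"
    by (metis of_real_1 of_real_minus power2_eq_1_iff)
  have ev: "eventually (\<lambda>\<epsilon>. sqrt_branch (path_image \<gamma>) (normal t \<epsilon>) = of_real k * R0 (normal t \<epsilon>)) (at_right 0)"
    unfolding eventually_at_right_field
  proof (intro exI[of _ b] conjI allI impI b(1))
    fix \<epsilon> :: real assume e: "0 < \<epsilon>" "\<epsilon> < b"
    then show "sqrt_branch (path_image \<gamma>) (normal t \<epsilon>) = of_real k * R0 (normal t \<epsilon>)"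
      using c[of \<epsilon>] Rn0[of "normal t \<epsilon>"] b(2)[OF e] by (auto simp: q_def k(2) field_simps)
  qed
  have "((\<lambda>\<epsilon>. \<gamma> t + of_real \<epsilon> * (\<i> * d t)) \<longlongrightarrow> \<gamma> t + of_real 0 * (\<i> * d t)) (at_right 0)"
    by (intro tendsto_intros)
  then have "(normal t \<longlongrightarrow> \<gamma> t) (at_right 0)" by (simp add: normal_def[abs_def])
  then have "((\<lambda>\<epsilon>. R0 (normal t \<epsilon>)) \<longlongrightarrow> R0 (\<gamma> t)) (at_right 0)"
    using Re_neg[OF t] by (intro isCont_tendsto_compose[of _ R0] isCont_R0) auto
  then have "((\<lambda>\<epsilon>. of_real k * R0 (normal t \<epsilon>)) \<longlongrightarrow> of_real k * R0 (\<gamma> t)) (at_right 0)"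
    by (intro tendsto_intros)
  then have "((\<lambda>\<epsilon>. sqrt_branch (path_image \<gamma>) (normal t \<epsilon>)) \<longlongrightarrow> of_real k * R0 (\<gamma> t)) (at_right 0)"
    using tendsto_cong[OF ev] by simp
  then have "sqrt_plus \<gamma> t = of_real k * R0 (\<gamma> t)"
    unfolding sqrt_plus_def normal_def by (rule tendsto_Lim[rotated]) simp
  then show ?thesis using k ev by blast
qed

lemma cont_k0: "continuous_on {0<..<1} k0"
proof -
  have c: "continuous_on {0<..<1} \<gamma>" by (rule continuous_on_subset[OF cont]) auto
  have "continuous_on {0<..<1} (\<lambda>t. R0 (\<gamma> t))"
  proof (rule continuous_on_compose2[OF continuous_at_imp_continuous_on c subset_refl])
    show "\<forall>x\<in>\<gamma> ` {0<..<1}. isCont R0 x"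
    proof
      fix x assume "x \<in> \<gamma> ` {0<..<1}"
      then have "Re x < 0" using Re_neg by blast
      then show "isCont R0 x" by (intro isCont_R0) simp
    qed
  qed
  then show ?thesis unfolding k0_def[abs_def]
    by (intro continuous_on_mult continuous_on_divide c cont_d) (use nz in auto)
qed

lemma k0_nz: "t \<in> {0<..<1} \<Longrightarrow> k0 t \<noteq> 0"
proof -
  assume t: "t \<in> {0<..<1}"
  have "R0 (\<gamma> t) \<noteq> 0" using Re_R0_pos[of "\<gamma> t"] Re_neg[OF t] by auto
  moreover have "\<gamma> t \<noteq> 0" using t by (intro nz) auto
  ultimately show "k0 t \<noteq> 0" using d_nz[OF t] by (simp add: k0_def)
qed

text \<open>The unknown sign does not affect the vanishing of a real part. The integral condition
  gives it outside a negligible set, and continuity of \<open>k0\<close> extends it to all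
  parameters.\<close>

lemma Re_k0:
  assumes "t \<in> {0<..<1}"
  shows "Re (k0 t) = 0"
proof -
  define F where "F u = sqrt_plus \<gamma> u / \<gamma> u * d u" for u
  have F: "F integrable_on {0..t} \<and> Re (integral {0..t} F) = 0" if "t \<in> {0..1}" for t
    using is_gamma1 that unfolding is_gamma1_def F_def by blast
  have "\<exists>N. negligible N \<and> (\<forall>x\<in>{0<..<1} - N. (Re \<circ> F) x = 0)"
  proof (rule negligible_integral_zero)
    fix t :: real assume t: "t \<in> {0..1}"
    show "(Re \<circ> F) integrable_on {0..t}" using F[OF t] by (intro integrable_linear bounded_linear_Re) auto
    show "integral {0..t} (Re \<circ> F) = 0" using F[OF t] by (subst integral_linear[OF _ bounded_linear_Re]) auto
  qed
  then obtain N where N: "negligible N" "\<And>x. x \<in> {0<..<1} - N \<Longrightarrow> Re (F x) = 0" by auto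
  have "Re (k0 x) = 0" if x: "x \<in> {0<..<1} - N" for x
  proof -
    obtain k :: real where k: "k = 1 \<or> k = - 1" "sqrt_plus \<gamma> x = of_real k * R0 (\<gamma> x)"
      using sqrt_plus_eq_sign[of x] x by blast
    have "F x = of_real k * k0 x" by (simp add: F_def k0_def k(2))
    then show ?thesis using N(2)[OF x] k(1) by auto
  qed
  then show ?thesis
    using zero_if_negligible_continuous[OF continuous_on_Re[OF cont_k0] N(1) _ assms] by blast
qed

lemma Phi_\<gamma>_derivative:
  assumes "t \<in> {0<..<1}"
  shows "((\<lambda>t. Phi (\<gamma> t)) has_vector_derivative k0 t) (at t)"
  using field_vector_diff_chain_at[OF has_d[OF assms] Phi_field_derivative[OF Re_neg[OF assms]]]
  unfolding o_def k0_def mult.commute[of "d t"] .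

text \<open>In the open interval \<open>level (\<gamma> t)\<close> has derivative
  \<open>Re (k0 t)\<close>. Continuity of \<open>level\<close> takes care of the end points, where
  differentiability of \<open>\<gamma>\<close> is not assumed.\<close>

lemma level_\<gamma>:
  assumes t: "t \<in> {0..1}"
  shows "level (\<gamma> t) = 0"
proof -
  have "level (\<gamma> t) = level (\<gamma> 0)"
  proof (rule DERIV_isconst2[of 0 1 "\<lambda>t. level (\<gamma> t)"])
    show "continuous_on {0..1} (\<lambda>t. level (\<gamma> t))"
      by (rule continuous_on_compose2[OF continuous_on_level cont]) (use nz in auto)
    fix x :: real assume x: "0 < x" "x < 1"
    have "((\<lambda>t. Re (Phi (\<gamma> t))) has_real_derivative 0) (at x)"
      using Phi_\<gamma>_derivative[of x] Re_k0[of x] x by (simp add: has_vector_derivative_complex_iff)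
    moreover have "eventually (\<lambda>t. t \<in> {0<..<1}) (nhds x)" using x by (intro eventually_nhds_in_open) auto
    then have "eventually (\<lambda>t. Re (Phi (\<gamma> t)) = level (\<gamma> t)) (nhds x)"
      by eventually_elim (intro Re_Phi nz, auto)
    ultimately show "((\<lambda>t. level (\<gamma> t)) has_real_derivative 0) (at x)" by (subst (asm) DERIV_cong_ev[OF refl _ refl])
  qed (use t in auto)
  also have "\<dots> = 0" by (simp add: \<gamma>_0 level_imaginary)
  finally show ?thesis .
qed

sublocale level_arc \<gamma>
proof
  fix z assume "z \<in> path_image \<gamma>"
  then obtain t where t: "t \<in> {0..1}" "z = \<gamma> t" by (auto simp: path_image_def)
  consider "t = 0" | "t = 1" | "t \<in> {0<..<1}" using t by force
  then show "z = \<i> \<or> z = - \<i> \<or> (Re z < 0 \<and> level z = 0)"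
  proof cases
    case 3
    then show ?thesis using Re_neg[OF 3] level_\<gamma>[OF t(1)] t(2) by blast
  qed (simp_all only: t(2) \<gamma>_0 \<gamma>_1 simp_thms)
qed (fact arc start finish)+

end

text \<open>At the ends of its cuts \<open>R0\<close> is continuous because it tends to 0 in
  modulus. This gives access to the values of \<open>Phi\<close> at both ends of the curve.\<close>

lemma isCont_R0_branch_point: "w\<^sup>2 + 1 = 0 \<Longrightarrow> isCont R0 w"
proof -
  assume w: "w\<^sup>2 + 1 = 0"
  have "((\<lambda>z. sqrt (norm (z\<^sup>2 + 1))) \<longlongrightarrow> sqrt (norm (w\<^sup>2 + 1))) (at w)" by (intro tendsto_intros)
  moreover have "norm (R0 z) = sqrt (norm (z\<^sup>2 + 1))" for z
    by (metis R0_sq norm_ge_zero norm_power real_sqrt_unique)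
  ultimately have "((\<lambda>z. norm (R0 z)) \<longlongrightarrow> 0) (at w)" using w by simp
  then have "(R0 \<longlongrightarrow> 0) (at w)" by (rule tendsto_norm_zero_cancel)
  moreover have "R0 w = 0" using w R0_sq[of w] by simp
  ultimately show "isCont R0 w" by (simp add: isCont_def)
qed

lemma isCont_Phi:
  assumes "z \<noteq> 0" "isCont R0 z" "root_minus z \<notin> \<real>\<^sub>\<le>\<^sub>0"
  shows "isCont Phi z"
  unfolding Phi_def root_minus_R0[abs_def] using assms
  by (intro continuous_intros) (simp_all add: root_minus_R0[symmetric])

lemma Phi_i: "Phi \<i> = - (\<i> * of_real (pi / 2))" and Phi_minus_i: "Phi (- \<i>) = \<i> * of_real (pi / 2)"
  by (simp_all add: Phi_def root_minus_R0 R0_def)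

section \<open>The coordinate along the curve and the density\<close>

context trajectory
begin

definition "y t = Im (Phi (\<gamma> t))"

lemma y_0: "y 0 = - (pi / 2)" and y_1: "y 1 = pi / 2"
  by (simp_all add: y_def \<gamma>_0 \<gamma>_1 Phi_i Phi_minus_i)

lemma isCont_Phi_\<gamma>:
  assumes t: "t \<in> {0..1}"
  shows "isCont Phi (\<gamma> t)"
proof (rule isCont_Phi)
  consider "t = 0" | "t = 1" | "t \<in> {0<..<1}" using t by force
  then have "isCont R0 (\<gamma> t) \<and> root_minus (\<gamma> t) \<notin> \<real>\<^sub>\<le>\<^sub>0"
  proof cases
    case 3
    then show ?thesis using Re_neg[OF 3] Re_root_minus_pos[of "\<gamma> t"] isCont_R0[of "\<gamma> t"]
      by (simp add: complex_nonpos_Reals_iff)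
  qed (simp_all add: \<gamma>_0 \<gamma>_1 isCont_R0_branch_point root_minus_R0 R0_def complex_nonpos_Reals_iff)
  then show "isCont R0 (\<gamma> t)" "root_minus (\<gamma> t) \<notin> \<real>\<^sub>\<le>\<^sub>0" by blast+
qed (rule nz[OF t])

lemma cont_y: "continuous_on {0..1} y"
proof -
  have "continuous_on {0..1} (\<lambda>t. Phi (\<gamma> t))"
  proof (rule continuous_on_compose2[OF continuous_at_imp_continuous_on cont subset_refl])
    show "\<forall>x\<in>\<gamma> ` {0..1}. isCont Phi x" using isCont_Phi_\<gamma> by blast
  qed
  then show ?thesis unfolding y_def[abs_def] by (rule continuous_on_Im)
qed

lemma y_derivative: "t \<in> {0<..<1} \<Longrightarrow> (y has_real_derivative Im (k0 t)) (at t)"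
  using Phi_\<gamma>_derivative unfolding y_def[abs_def] has_vector_derivative_complex_iff by blast

lemma Phi_\<gamma>: "t \<in> {0..1} \<Longrightarrow> Phi (\<gamma> t) = \<i> * of_real (y t)"
  using Re_Phi[OF nz] level_\<gamma> by (simp add: complex_eq_iff y_def)

lemma k0_eq: "t \<in> {0<..<1} \<Longrightarrow> k0 t = \<i> * of_real (Im (k0 t))"
  using Re_k0 by (simp add: complex_eq_iff)

lemma Im_k0_nz: "t \<in> {0<..<1} \<Longrightarrow> Im (k0 t) \<noteq> 0"
  using Re_k0 k0_nz by (metis complex_eq_iff zero_complex.sel)

text \<open>The derivative of \<open>y\<close> is continuous without zeros, hence of one sign, and
  \<open>y 0 < y 1\<close> decides which.\<close>

lemma Im_k0_pos:
  assumes t: "t \<in> {0<..<1}"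
  shows "0 < Im (k0 t)"
proof -
  obtain l s where s: "0 < s" "s < 1" "(y has_real_derivative l) (at s)" "y 1 - y 0 = (1 - 0) * l"
    using MVT[of 0 1 y] cont_y y_derivative real_differentiable_def by (metis greaterThanLessThan_iff zero_less_one)
  moreover have "(y has_real_derivative Im (k0 s)) (at s)" using s by (intro y_derivative) simp
  ultimately have "l = Im (k0 s)" by (metis DERIV_unique)
  then have s: "s \<in> {0<..<1}" "0 < Im (k0 s)" using s y_0 y_1 pi_gt_zero by auto
  show ?thesis
  proof (rule ccontr)
    assume "\<not> 0 < Im (k0 t)"
    have con: "connected ((\<lambda>t. Im (k0 t)) ` {0<..<1})"
      by (intro connected_continuous_image continuous_on_Im cont_k0) simp
    have "0 \<in> (\<lambda>t. Im (k0 t)) ` {0<..<1}"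
      using connectedD_interval[OF con, of "Im (k0 t)" "Im (k0 s)" 0] \<open>\<not> 0 < Im (k0 t)\<close> s t by auto
    then show False using Im_k0_nz by auto
  qed
qed

lemma y_strict_mono:
  assumes "s < t" "0 \<le> s" "t \<le> 1"
  shows "y s < y t"
proof (rule DERIV_pos_imp_increasing_open[OF assms(1)])
  fix x assume "s < x" "x < t"
  then have "x \<in> {0<..<1}" using assms by simp
  then show "\<exists>l. (y has_real_derivative l) (at x) \<and> 0 < l" using y_derivative Im_k0_pos by blast
next
  show "continuous_on {s..t} y" using assms by (intro continuous_on_subset[OF cont_y]) auto
qed

text \<open>Along the left normal the derivative of \<open>Re Phi\<close> at the curve is -
  \<open>Im (k0 t)\<close>, which is negative. So the left side lies where \<open>level < 0\<close>,
  and there the branch is \<open>R0\<close>.\<close>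

lemma sqrt_plus_eq:
  assumes t: "t \<in> {0<..<1}"
  shows "sqrt_plus \<gamma> t = R0 (\<gamma> t)"
proof -
  obtain k :: real where k: "k = 1 \<or> k = - 1" "sqrt_plus \<gamma> t = of_real k * R0 (\<gamma> t)"
    and ev: "eventually (\<lambda>\<epsilon>. R (normal t \<epsilon>) = of_real k * R0 (normal t \<epsilon>)) (at_right 0)"
    using sqrt_plus_eq_sign[OF t] by blast
  have "((\<lambda>\<epsilon>. Phi (normal t \<epsilon>)) has_vector_derivative (\<i> * d t) * (R0 (\<gamma> t) / \<gamma> t)) (at 0)"
  proof -
    have "(normal t has_vector_derivative \<i> * d t) (at 0)" unfolding normal_def[abs_def]
      by (auto intro!: derivative_eq_intros simp: has_vector_derivative_def scaleR_conv_of_real)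
    moreover have "(Phi has_field_derivative R0 (\<gamma> t) / \<gamma> t) (at (normal t 0))"
      using Phi_field_derivative[OF Re_neg[OF t]] by (simp add: normal_def)
    ultimately show ?thesis using field_vector_diff_chain_at by (force simp: o_def)
  qed
  moreover have "(\<i> * d t) * (R0 (\<gamma> t) / \<gamma> t) = \<i> * k0 t" by (simp add: k0_def)
  ultimately have "((\<lambda>\<epsilon>. Re (Phi (normal t \<epsilon>))) has_real_derivative - Im (k0 t)) (at 0)"
    by (simp add: has_vector_derivative_complex_iff)
  moreover have "- Im (k0 t) < 0" using Im_k0_pos[OF t] by simp
  ultimately have "\<exists>b>0. \<forall>h>0. h < b \<longrightarrow> Re (Phi (normal t (0 + h))) < Re (Phi (normal t 0))"
    by (rule DERIV_neg_dec_right)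
  moreover have "Re (Phi (normal t 0)) = 0" using Phi_\<gamma>[of t] t by (simp add: normal_def)
  ultimately have "eventually (\<lambda>\<epsilon>. Re (Phi (normal t \<epsilon>)) < 0) (at_right 0)"
    unfolding eventually_at_right_field by simp
  then have "eventually (\<lambda>\<epsilon>. k = 1) (at_right (0::real))"
    using ev normal_avoids[OF t]
  proof eventually_elim
    case (elim \<epsilon>)
    then have re: "Re (normal t \<epsilon>) < 0" by blast
    then have "normal t \<epsilon> \<noteq> 0" by auto
    then have "level (normal t \<epsilon>) < 0" using elim(1) Re_Phi by metis
    then have "R (normal t \<epsilon>) = R0 (normal t \<epsilon>)" using R_inside re by blast
    moreover have "R0 (normal t \<epsilon>) \<noteq> 0" using Re_R0_pos[of "normal t \<epsilon>"] re by auto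
    ultimately have "of_real k = (1::complex)" using elim(2) by simp
    then show ?case by simp
  qed
  then have "k = 1" by simp
  then show ?thesis using k(2) by simp
qed

text \<open>The right-hand side is the derivative of \<open>y t / pi\<close>: in the coordinate
  \<open>y\<close> the measure becomes Lebesgue measure divided by \<pi>.\<close>

lemma density_eq:
  assumes t: "t \<in> {0<..<1}"
  shows "Re (1 / (\<i> * of_real pi) * (sqrt_plus \<gamma> t / \<gamma> t) * d t) = Im (k0 t) / pi"
proof -
  have "1 / (\<i> * of_real pi) * (sqrt_plus \<gamma> t / \<gamma> t) * d t = k0 t / (\<i> * of_real pi)"
    unfolding sqrt_plus_eq[OF t] k0_def by simp
  also have "\<dots> = of_real (Im (k0 t) / pi)" by (subst k0_eq[OF t]) simp
  finally show ?thesis by simp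
qed

end

section \<open>The univalent coordinate\<close>

definition left_half :: "complex set" where "left_half = {z. Re z < 0}"

lemma open_left_half: "open left_half"
  unfolding left_half_def by (rule open_halfspace_Re_lt)

lemma left_half_iff: "z \<in> left_half \<longleftrightarrow> Re z < 0" by (simp add: left_half_def)

lemma Phi_holomorphic: "Phi holomorphic_on left_half"
  using Phi_field_derivative by (auto simp: left_half_def holomorphic_on_open[OF open_left_half, unfolded left_half_def])

text \<open>The criterion of Noshiro and Warschawski on a convex domain: the derivative has negative
  real part, so along the segment from \<open>a\<close> to \<open>b\<close> the real part of Phi /
  (b - a) is strictly decreasing.\<close>

lemma inj_on_Phi: "inj_on Phi left_half"
proof (rule inj_onI, rule ccontr)
  fix a b assume ab: "a \<in> left_half" "b \<in> left_half" "Phi a = Phi b" "a \<noteq> b"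
  define l where "l t = a + of_real t * (b - a)" for t
  define h where "h t = Re (Phi (l t) / (b - a))" for t
  have "h 1 < h 0"
  proof (rule DERIV_neg_imp_decreasing[of 0 1 h])
    fix t :: real assume t: "0 \<le> t" "t \<le> 1"
    have "Re (l t) = (1 - t) * Re a + t * Re b" by (simp add: l_def algebra_simps)
    moreover have "\<dots> < 0"
    proof (cases "t = 1")
      case False
      then have "(1 - t) * Re a < 0" using ab(1) t by (simp add: left_half_iff mult_pos_neg)
      moreover have "t * Re b \<le> 0" using ab(2) t by (simp add: left_half_iff mult_nonneg_nonpos)
      ultimately show ?thesis by simp
    qed (use ab(2) in \<open>simp add: left_half_iff\<close>)
    ultimately have re: "Re (l t) < 0" by simp
    have "(l has_vector_derivative b - a) (at t)" unfolding l_def[abs_def]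
      by (auto intro!: derivative_eq_intros simp: has_vector_derivative_def scaleR_conv_of_real)
    from field_vector_diff_chain_at[OF this Phi_field_derivative[OF re]]
    have "((\<lambda>t. Phi (l t)) has_vector_derivative (b - a) * (R0 (l t) / l t)) (at t)" by (simp add: o_def)
    then have "((\<lambda>t. Phi (l t) / (b - a)) has_vector_derivative (b - a) * (R0 (l t) / l t) / (b - a)) (at t)"
      by (rule bounded_linear.has_vector_derivative[OF bounded_linear_divide])
    moreover have "(b - a) * (R0 (l t) / l t) / (b - a) = R0 (l t) / l t" using ab(4) by simp
    ultimately have "(h has_real_derivative Re (R0 (l t) / l t)) (at t)"
      by (simp only: has_vector_derivative_complex_iff h_def[abs_def])
    then show "\<exists>y. (h has_real_derivative y) (at t) \<and> y < 0" using Re_R0_over_z_neg[OF re] by blast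
  qed simp
  moreover have "l 0 = a" "l 1 = b" by (simp_all add: l_def)
  ultimately show False using ab(3) by (simp add: h_def)
qed

definition chart_domain :: "complex set" where "chart_domain = Phi ` left_half"
definition chart :: "complex \<Rightarrow> complex" where "chart = the_inv_into left_half Phi"

lemma open_chart_domain: "open chart_domain"
  unfolding chart_domain_def using Phi_holomorphic open_left_half inj_on_Phi by (rule open_mapping_thm3)

lemma chart_Phi: "Re z < 0 \<Longrightarrow> chart (Phi z) = z"
  unfolding chart_def using inj_on_Phi by (simp add: the_inv_into_f_f left_half_iff)

lemma Phi_chart: "\<xi> \<in> chart_domain \<Longrightarrow> Phi (chart \<xi>) = \<xi>"
  unfolding chart_def chart_domain_def using inj_on_Phi by (rule f_the_inv_into_f)

lemma Re_chart: "\<xi> \<in> chart_domain \<Longrightarrow> Re (chart \<xi>) < 0"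
  unfolding chart_domain_def using chart_Phi by (auto simp: left_half_iff)

lemma level_chart: "\<xi> \<in> chart_domain \<Longrightarrow> level (chart \<xi>) = Re \<xi>"
  using Re_Phi[of "chart \<xi>"] Re_chart[of \<xi>] Phi_chart[of \<xi>] by force

lemma Phi_in_chart_domain: "Re z < 0 \<Longrightarrow> Phi z \<in> chart_domain"
  by (simp add: chart_domain_def left_half_iff)

lemma chart_holomorphic: "chart holomorphic_on chart_domain"
  and deriv_chart_nz: "\<xi> \<in> chart_domain \<Longrightarrow> deriv chart \<xi> \<noteq> 0"
proof -
  obtain g where g: "g holomorphic_on (Phi ` left_half)"
    "\<And>z. z \<in> left_half \<Longrightarrow> deriv Phi z * deriv g (Phi z) = 1" "\<And>z. z \<in> left_half \<Longrightarrow> g (Phi z) = z"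
    using holomorphic_has_inverse[OF Phi_holomorphic open_left_half inj_on_Phi] by metis
  have eq: "g \<xi> = chart \<xi>" if "\<xi> \<in> chart_domain" for \<xi>
    using that g(3) chart_Phi by (auto simp: chart_domain_def left_half_iff)
  show "chart holomorphic_on chart_domain"
    using g(1) holomorphic_transform[OF _ eq] by (simp add: chart_domain_def)
  show "deriv chart \<xi> \<noteq> 0" if \<xi>: "\<xi> \<in> chart_domain"
  proof -
    have "eventually (\<lambda>x. x \<in> chart_domain) (nhds \<xi>)" using \<xi> open_chart_domain by (intro eventually_nhds_in_open)
    then have "eventually (\<lambda>x. g x = chart x) (nhds \<xi>)" by eventually_elim (rule eq)
    then have "deriv g \<xi> = deriv chart \<xi>" by (rule deriv_cong_ev) simp
    moreover obtain z where "z \<in> left_half" "\<xi> = Phi z" using \<xi> by (auto simp: chart_domain_def)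
    ultimately show ?thesis using g(2)[of z] by auto
  qed
qed

text \<open>The difference quotient of \<open>chart\<close> at \<open>Phi \<zeta>\<close> is
  zero-free, because \<open>chart\<close> is injective with nonvanishing derivative.\<close>

lemma chart_factor:
  assumes \<zeta>: "Re \<zeta> < 0"
  shows "\<exists>\<phi>. \<phi> holomorphic_on chart_domain \<and> (\<forall>\<xi>\<in>chart_domain. \<phi> \<xi> \<noteq> 0 \<and> chart \<xi> - \<zeta> = (\<xi> - Phi \<zeta>) * \<phi> \<xi>)"
proof -
  define \<phi> where "\<phi> \<xi> = (if \<xi> = Phi \<zeta> then deriv chart (Phi \<zeta>) else (chart \<xi> - chart (Phi \<zeta>)) / (\<xi> - Phi \<zeta>))" for \<xi>
  have in_V: "Phi \<zeta> \<in> chart_domain" using \<zeta> by (rule Phi_in_chart_domain)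
  have "\<phi> holomorphic_on chart_domain" unfolding \<phi>_def[abs_def]
    using in_V open_chart_domain by (intro pole_lemma chart_holomorphic) (simp add: interior_open)
  moreover have "\<phi> \<xi> \<noteq> 0 \<and> chart \<xi> - \<zeta> = (\<xi> - Phi \<zeta>) * \<phi> \<xi>" if \<xi>: "\<xi> \<in> chart_domain" for \<xi>
  proof (cases "\<xi> = Phi \<zeta>")
    case True
    then show ?thesis using deriv_chart_nz[OF in_V] chart_Phi[OF \<zeta>] by (simp add: \<phi>_def)
  next
    case False
    then have "chart \<xi> \<noteq> \<zeta>" using Phi_chart[OF \<xi>] by metis
    then show ?thesis using False chart_Phi[OF \<zeta>] by (simp add: \<phi>_def)
  qed
  ultimately show ?thesis by blast
qed

lemma poly_eq_prod_proots:
  fixes p :: "complex poly"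
  shows "poly p w = lead_coeff p * (\<Prod>\<zeta>\<in>#proots p. w - \<zeta>)"
proof -
  have "p = smult (lead_coeff p) (\<Prod>\<zeta>\<in>#proots p. [:- \<zeta>, 1:])" by (rule complex_poly_decompose_multiset[symmetric])
  then have "poly p w = lead_coeff p * poly (\<Prod>\<zeta>\<in>#proots p. [:- \<zeta>, 1:]) w" by (metis poly_smult)
  also have "poly (\<Prod>\<zeta>\<in>#Z. [:- \<zeta>, 1:]) w = (\<Prod>\<zeta>\<in>#Z. w - \<zeta>)" for Z by (induction Z) (auto simp: algebra_simps)
  finally show ?thesis .
qed

text \<open>Zeros in the left half-plane become zeros in the chart with the same multiplicity; the
  factors of all other zeros do not vanish there and are collected in \<open>g\<close>.\<close>

lemma zero_factored_chart:
  fixes p :: "complex poly"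
  assumes p: "p \<noteq> 0"
  shows "\<exists>g. g holomorphic_on chart_domain \<and> (\<forall>\<xi>\<in>chart_domain. g \<xi> \<noteq> 0 \<and>
     poly p (chart \<xi>) = (\<Prod>\<zeta>\<in>#filter_mset (\<lambda>\<zeta>. Re \<zeta> < 0) (proots p). \<xi> - Phi \<zeta>) * g \<xi>)"
proof -
  have *: "\<exists>g. g holomorphic_on chart_domain \<and> (\<forall>\<xi>\<in>chart_domain. g \<xi> \<noteq> 0 \<and>
     (\<Prod>\<zeta>\<in>#Z. chart \<xi> - \<zeta>) = (\<Prod>\<zeta>\<in>#filter_mset (\<lambda>\<zeta>. Re \<zeta> < 0) Z. \<xi> - Phi \<zeta>) * g \<xi>)" for Z
  proof (induction Z)
    case empty
    show ?case by (intro exI[of _ "\<lambda>_. 1"]) simp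
  next
    case (add \<zeta> Z)
    then obtain g where g: "g holomorphic_on chart_domain" "\<And>\<xi>. \<xi>\<in>chart_domain \<Longrightarrow> g \<xi> \<noteq> 0 \<and>
     (\<Prod>\<zeta>\<in>#Z. chart \<xi> - \<zeta>) = (\<Prod>\<zeta>\<in>#filter_mset (\<lambda>\<zeta>. Re \<zeta> < 0) Z. \<xi> - Phi \<zeta>) * g \<xi>" by blast
    show ?case
    proof (cases "Re \<zeta> < 0")
      case True
      from chart_factor[OF this] obtain \<phi> where \<phi>: "\<phi> holomorphic_on chart_domain"
        "\<And>\<xi>. \<xi>\<in>chart_domain \<Longrightarrow> \<phi> \<xi> \<noteq> 0 \<and> chart \<xi> - \<zeta> = (\<xi> - Phi \<zeta>) * \<phi> \<xi>" by blast
      show ?thesis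
        by (intro exI[of _ "\<lambda>\<xi>. \<phi> \<xi> * g \<xi>"] conjI ballI holomorphic_intros \<phi>(1) g(1)) (use True g(2) \<phi>(2) in simp_all)
    next
      case False
      then have "chart \<xi> - \<zeta> \<noteq> 0" if "\<xi> \<in> chart_domain" for \<xi> using Re_chart[OF that] by auto
      then show ?thesis
        by (intro exI[of _ "\<lambda>\<xi>. (chart \<xi> - \<zeta>) * g \<xi>"] conjI ballI holomorphic_intros chart_holomorphic g(1))
          (use False g(2) in simp_all)
    qed
  qed
  from *[of "proots p"] obtain g where g: "g holomorphic_on chart_domain" "\<And>\<xi>. \<xi>\<in>chart_domain \<Longrightarrow> g \<xi> \<noteq> 0 \<and>
     (\<Prod>\<zeta>\<in>#proots p. chart \<xi> - \<zeta>) = (\<Prod>\<zeta>\<in>#filter_mset (\<lambda>\<zeta>. Re \<zeta> < 0) (proots p). \<xi> - Phi \<zeta>) * g \<xi>" by blast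
  show ?thesis using p g poly_eq_prod_proots[of p]
    by (intro exI[of _ "\<lambda>\<xi>. lead_coeff p * g \<xi>"] conjI ballI holomorphic_intros g(1)) simp_all
qed

context trajectory
begin

lemma chart_y: "t \<in> {0<..<1} \<Longrightarrow> \<i> * of_real (y t) \<in> chart_domain \<and> chart (\<i> * of_real (y t)) = \<gamma> t"
  using Phi_\<gamma>[of t] Phi_in_chart_domain[OF Re_neg, of t] chart_Phi[OF Re_neg, of t] by auto

text \<open>By the intermediate value theorem \<open>u\<close> is a value of \<open>y\<close>, and
  \<open>\<i> * of_real (y t)\<close> is \<open>Phi (\<gamma> t)\<close>.\<close>

lemma segment_in_chart_domain:
  assumes "\<bar>u\<bar> < pi / 2"
  shows "\<i> * of_real u \<in> chart_domain"
proof -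
  have "y 0 \<le> u" "u \<le> y 1" using y_0 y_1 assms by linarith+
  from IVT'[OF this _ cont_y] obtain t where t: "0 \<le> t" "t \<le> 1" "y t = u" by auto
  then have "t \<in> {0<..<1}" using assms y_0 y_1 by (cases "t = 0"; cases "t = 1") auto
  then show ?thesis using chart_y t by blast
qed

end

section \<open>Asymptotics of \<open>P\<close> and its zeros\<close>

text \<open>The rate of the upper bound for \<bar>P\<bar> / \<open>N n\<close>. In the left
  half-plane the critical points contribute exp (- level z) and exp (level z), hence the absolute
  value; in the right half-plane only \<open>root_plus z\<close> contributes.\<close>

definition majorant :: "complex \<Rightarrow> real" where
  "majorant z = 2 * exp (- 1) * norm z * exp (Re z) * exp (if Re z < 0 then \<bar>level z\<bar> else - level z)"

lemma norm_root_minus: "z \<noteq> 0 \<Longrightarrow> norm (root_minus z) = exp (level z - Re (R0 z))"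
  using root_minus_nz by (simp add: level_def)

lemma norm_root_plus:
  assumes "z \<noteq> 0"
  shows "norm (root_plus z) = exp (Re (R0 z) - level z)"
proof -
  have "norm (root_plus z) * norm (root_minus z) = 1" using root_critical(3)[OF assms] by (metis norm_minus_cancel norm_mult norm_one)
  then have "norm (root_plus z) * exp (level z - Re (R0 z)) * exp (Re (R0 z) - level z) = exp (Re (R0 z) - level z)"
    unfolding norm_root_minus[OF assms] by simp
  then show ?thesis unfolding mult.assoc exp_add[symmetric] by simp
qed

lemma norm_one_plus_R0: "z \<noteq> 0 \<Longrightarrow> norm (1 + R0 z) = norm z * exp (Re (R0 z) - level z)"
  using norm_root_plus[of z] by (simp add: root_plus_R0 norm_divide field_simps)

lemma norm_one_minus_R0': "z \<noteq> 0 \<Longrightarrow> norm (1 - R0 z) = norm z * exp (level z - Re (R0 z))"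
  using norm_root_minus[of z] by (simp add: root_minus_R0 norm_divide field_simps)

lemma height_root_level:
  assumes "z \<noteq> 0"
  shows "height z (root_plus z) = 2 * exp (- 1) * exp (- level z) / norm z"
    "height z (root_minus z) = 2 * exp (- 1) * exp (level z) / norm z"
proof -
  have "height z (root_plus z) = 2 * (norm z * exp (Re (R0 z) - level z)) / (norm z)\<^sup>2 * exp (- 1 - Re (R0 z))"
    using height_root(1)[OF assms] unfolding R0_def[symmetric] norm_one_plus_R0[OF assms] .
  also have "\<dots> = 2 * (exp (Re (R0 z) - level z) * exp (- 1 - Re (R0 z))) / norm z"
    using assms by (simp add: power2_eq_square)
  also have "exp (Re (R0 z) - level z) * exp (- 1 - Re (R0 z)) = exp (- 1) * exp (- level z)"
    unfolding exp_add[symmetric] by simp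
  finally show "height z (root_plus z) = 2 * exp (- 1) * exp (- level z) / norm z" by simp
  have "height z (root_minus z) = 2 * (norm z * exp (level z - Re (R0 z))) / (norm z)\<^sup>2 * exp (- 1 + Re (R0 z))"
    using height_root(2)[OF assms] unfolding R0_def[symmetric] norm_one_minus_R0'[OF assms] .
  also have "\<dots> = 2 * (exp (level z - Re (R0 z)) * exp (- 1 + Re (R0 z))) / norm z"
    using assms by (simp add: power2_eq_square)
  also have "exp (level z - Re (R0 z)) * exp (- 1 + Re (R0 z)) = exp (- 1) * exp (level z)"
    unfolding exp_add[symmetric] by simp
  finally show "height z (root_minus z) = 2 * exp (- 1) * exp (level z) / norm z" by simp
qed

lemma majorant_eq_height:
  assumes "Re z \<noteq> 0"
  shows "exp (Re z) * (norm z)\<^sup>2 *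
       (if Re z < 0 then max (height z (root_plus z)) (height z (root_minus z)) else height z (root_plus z)) = majorant z"
proof -
  have z: "z \<noteq> 0" using assms by auto
  have m: "max (2 * exp (- 1) * exp (- l) / norm z) (2 * exp (- 1) * exp l / norm z) = 2 * exp (- 1) * exp \<bar>l\<bar> / norm z" for l :: real
  proof (cases "0 \<le> l")
    case True
    then have "2 * exp (- 1) * exp (- l) / norm z \<le> 2 * exp (- 1) * exp l / norm z"
      by (intro divide_right_mono mult_left_mono) auto
    then show ?thesis using True by (simp add: max_absorb2)
  next
    case False
    then have "2 * exp (- 1) * exp l / norm z \<le> 2 * exp (- 1) * exp (- l) / norm z"
      by (intro divide_right_mono mult_left_mono) auto
    then show ?thesis using False by (simp add: max_absorb1)
  qed
  show ?thesis using z unfolding height_root_level[OF z] m majorant_def by (simp add: power2_eq_square)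
qed

context level_arc
begin

definition "Y z = (1 + R z) * exp (z - R z)"

lemma R_sq: "z \<notin> path_image \<gamma> \<Longrightarrow> (R z)\<^sup>2 = z\<^sup>2 + 1" and R_holomorphic: "R holomorphic_on - path_image \<gamma>"
  using sqrt_branch_arc[OF arc start finish] by auto

lemma Y_nz: "z \<notin> path_image \<gamma> \<Longrightarrow> Y z \<noteq> 0"
proof
  assume z: "z \<notin> path_image \<gamma>" "Y z = 0"
  then have "R z = - 1" by (simp add: Y_def add_eq_0_iff)
  then have "z = 0" using R_sq[OF z(1)] by simp
  then show False using \<open>R z = - 1\<close> R_at_0 by simp
qed

lemma Y_holomorphic: "Y holomorphic_on - path_image \<gamma>"
  unfolding Y_def[abs_def] by (intro holomorphic_intros R_holomorphic)

lemma Y_0: "Y 0 = 2 * exp (- 1)" by (simp add: Y_def R_at_0)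

text \<open>Inside, \<open>R = R0\<close> and \<open>level < 0\<close>; outside,
  \<open>R = - R0\<close> and \<open>level > 0\<close>: the branch changes sign exactly where the
  other critical point becomes dominant. Points of level 0 off the arc are covered as well, because
  there both signs give the same modulus.\<close>

lemma norm_Y:
  assumes z: "z \<notin> path_image \<gamma>" "Re z \<noteq> 0"
  shows "2 * exp (- 1) * norm (Y z) = majorant z"
proof -
  have z0: "z \<noteq> 0" using z by auto
  have p: "2 * exp (- 1) * norm (Y z) = 2 * exp (- 1) * norm z * exp (Re z) * exp (- level z)" if "R z = R0 z"
  proof -
    have "norm (Y z) = norm z * (exp (Re (R0 z) - level z) * exp (Re z - Re (R0 z)))"
      using that norm_one_plus_R0[OF z0] by (simp add: Y_def norm_mult)
    also have "exp (Re (R0 z) - level z) * exp (Re z - Re (R0 z)) = exp (Re z) * exp (- level z)"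
      unfolding exp_add[symmetric] by simp
    finally show ?thesis by simp
  qed
  have m: "2 * exp (- 1) * norm (Y z) = 2 * exp (- 1) * norm z * exp (Re z) * exp (level z)" if "R z = - R0 z"
  proof -
    have "norm (Y z) = norm z * (exp (level z - Re (R0 z)) * exp (Re z + Re (R0 z)))"
      using that norm_one_minus_R0'[OF z0] by (simp add: Y_def norm_mult)
    also have "exp (level z - Re (R0 z)) * exp (Re z + Re (R0 z)) = exp (Re z) * exp (level z)"
      unfolding exp_add[symmetric] by simp
    finally show ?thesis by simp
  qed
  have "(R z)\<^sup>2 = (R0 z)\<^sup>2" using R_sq[OF z(1)] R0_sq[of z] by simp
  then have pm: "R z = R0 z \<or> R z = - R0 z" by (simp add: power2_eq_iff)
  consider "0 < Re z" | "Re z < 0" "level z < 0" | "Re z < 0" "0 < level z" | "Re z < 0" "level z = 0"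
    using z(2) by linarith
  then show ?thesis
  proof cases
    case 1
    then show ?thesis using p[OF R_right[OF 1]] by (simp add: majorant_def)
  next
    case 2
    then show ?thesis using p[OF R_inside[OF 2]] by (simp add: majorant_def)
  next
    case 3
    then show ?thesis using m[OF R_outside[OF 3]] by (simp add: majorant_def)
  next
    case 4
    have "majorant z = 2 * exp (- 1) * norm z * exp (Re z)" using 4 by (simp add: majorant_def)
    moreover have "2 * exp (- 1) * norm (Y z) = 2 * exp (- 1) * norm z * exp (Re z)"
      using pm
    proof
      assume "R z = R0 z"
      then show ?thesis using p 4(2) by simp
    next
      assume "R z = - R0 z"
      then show ?thesis using m 4(2) by simp
    qed
    ultimately show ?thesis by simp
  qed
qed

end

section \<open>Comparison of \<open>P\<close> with the majorant\<close>

locale pade_trajectory = trajectory \<gamma> + pade_sequence a P Q E \<tau> \<rho>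
  for \<gamma> and a :: "nat \<Rightarrow> nat \<Rightarrow> complex" and P Q :: "nat \<Rightarrow> complex poly" and E :: "nat \<Rightarrow> complex \<Rightarrow> complex"
    and \<tau> \<rho> :: "nat \<Rightarrow> real"
begin

lemma P_upper_majorant:
  assumes "0 < \<delta>" "0 < \<epsilon>" "0 < D"
  shows "\<forall>\<^sub>F n in sequentially. \<forall>z. \<delta> \<le> norm z \<longrightarrow> norm z \<le> D \<longrightarrow> Re z \<noteq> 0 \<longrightarrow>
     norm (poly (P n) z) \<le> N n * (exp \<epsilon> * majorant z) ^ n"
  using P_upper[OF assms]
proof eventually_elim
  case (elim n)
  then show ?case using majorant_eq_height by metis
qed

lemma eventually_N_pos: "\<forall>\<^sub>F n in sequentially. 0 < n \<and> 0 < N n"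
proof -
  have "\<forall>\<^sub>F n in sequentially. 0 < \<rho> n" using \<rho> by (simp add: filterlim_at_top_dense)
  then show ?thesis using eventually_gt_at_top[of 0]
  proof eventually_elim
    case (elim n)
    then show ?case using N_pos by blast
  qed
qed

definition "f n z = poly (P n) z / (of_real (N n) * (of_real (2 * exp (- 1)) * Y z) ^ n)"

lemma norm_f: "0 < N n \<Longrightarrow> norm (f n z) = norm (poly (P n) z) / (N n * (2 * exp (- 1) * norm (Y z)) ^ n)"
  by (simp add: f_def norm_divide norm_mult norm_power)

lemma open_\<Omega>: "open (- path_image \<gamma>)"
  using arc by (simp add: open_Compl compact_arc_image compact_imp_closed)

lemma f_holomorphic: "0 < N n \<Longrightarrow> f n holomorphic_on - path_image \<gamma>"
  unfolding f_def[abs_def] by (intro holomorphic_intros Y_holomorphic) (use Y_nz in auto)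

text \<open>The bound for \<open>P\<close> leaves out the imaginary axis. There it is obtained by
  continuity from the points \<open>z + s\<close> with small positive \<open>s\<close>, for which
  the annulus is enlarged beforehand.\<close>

lemma f_bounded_off_0:
  assumes "0 < \<delta>" "0 < \<epsilon>" "0 < D"
  shows "\<forall>\<^sub>F n in sequentially. \<forall>z. z \<notin> path_image \<gamma> \<longrightarrow> \<delta> \<le> norm z \<longrightarrow> norm z \<le> D \<longrightarrow> norm (f n z) \<le> exp (real n * \<epsilon>)"
proof -
  have "0 < \<delta> / 2" "0 < D + 1" using assms by auto
  from eventually_conj[OF eventually_N_pos P_upper_majorant[OF this(1) assms(2) this(2)]] show ?thesis
  proof eventually_elim
    case (elim n)
    then have N: "0 < N n" and ub: "\<And>z. \<delta> / 2 \<le> norm z \<Longrightarrow> norm z \<le> D + 1 \<Longrightarrow> Re z \<noteq> 0 \<Longrightarrow>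
       norm (poly (P n) z) \<le> N n * (exp \<epsilon> * majorant z) ^ n" by blast+
    have 1: "norm (f n z) \<le> exp (real n * \<epsilon>)"
      if z: "z \<notin> path_image \<gamma>" "\<delta> / 2 \<le> norm z" "norm z \<le> D + 1" "Re z \<noteq> 0" for z
    proof -
      have pos: "0 < N n * (2 * exp (- 1) * norm (Y z)) ^ n" using N Y_nz[OF z(1)] by simp
      have "norm (poly (P n) z) \<le> exp (real n * \<epsilon>) * (N n * (2 * exp (- 1) * norm (Y z)) ^ n)"
        using ub[OF z(2-4)] unfolding norm_Y[OF z(1,4)] power_mult_distrib[of "exp \<epsilon>"] exp_of_nat_mult by (simp only: mult_ac)
      then show ?thesis unfolding norm_f[OF N] using pos by (simp add: pos_divide_le_eq)
    qed
    show ?case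
    proof (intro allI impI)
      fix z assume z: "z \<notin> path_image \<gamma>" "\<delta> \<le> norm z" "norm z \<le> D"
      show "norm (f n z) \<le> exp (real n * \<epsilon>)"
      proof (cases "Re z = 0")
        case False
        then show ?thesis using 1[of z] z assms by simp
      next
        case True
        obtain b where b: "0 < b" "ball z b \<subseteq> - path_image \<gamma>" using open_\<Omega> z(1) open_contains_ball by blast
        define c where "c = min b (min (\<delta> / 2) 1)"
        have c: "0 < c" "c \<le> b" "c \<le> \<delta> / 2" "c \<le> 1" using b assms by (auto simp: c_def)
        have "isCont (f n) z" using holomorphic_on_imp_continuous_on[OF f_holomorphic[OF N]] open_\<Omega> z(1)
          by (simp add: continuous_on_eq_continuous_at)
        moreover have "((\<lambda>s. z + of_real s) \<longlongrightarrow> z + of_real 0) (at_right (0::real))" by (intro tendsto_intros)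
        ultimately have lim: "((\<lambda>s. norm (f n (z + of_real s))) \<longlongrightarrow> norm (f n z)) (at_right (0::real))"
          using isCont_tendsto_compose[of z "f n" "\<lambda>s. z + of_real s" "at_right 0"] by (intro tendsto_norm) simp
        have "eventually (\<lambda>s. norm (f n (z + of_real s)) \<le> exp (real n * \<epsilon>)) (at_right (0::real))"
          unfolding eventually_at_right_field
        proof (intro exI[of _ c] conjI allI impI c(1))
          fix s :: real assume s: "0 < s" "s < c"
          have n: "norm (z + of_real s) \<le> norm z + s" "norm z - s \<le> norm (z + of_real s)"
            using norm_triangle_ineq[of z "of_real s"] norm_diff_ineq[of z "of_real s"] s by auto
          have "z + of_real s \<in> ball z b" using s c by (simp add: dist_norm)
          then have "z + of_real s \<notin> path_image \<gamma>" using b(2) by blast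
          moreover have "\<delta> / 2 \<le> norm (z + of_real s)" "norm (z + of_real s) \<le> D + 1" using n s c z by linarith+
          moreover have "Re (z + of_real s) \<noteq> 0" using True s by simp
          ultimately show "norm (f n (z + of_real s)) \<le> exp (real n * \<epsilon>)" by (rule 1)
        qed
        then show ?thesis using lim by (intro tendsto_upperbound[OF lim]) auto
      qed
    qed
  qed
qed

lemma zero_in_\<Omega>: "0 \<notin> path_image \<gamma>"
  using on_level[of 0] by auto

text \<open>The disc around 0 left out so far is covered by the maximum principle.\<close>

lemma f_bounded:
  assumes K: "compact K" "K \<subseteq> - path_image \<gamma>"
  shows "subexp_bounded f K"
  unfolding subexp_bounded_def
proof (intro allI impI)
  fix \<epsilon> :: real assume \<epsilon>: "0 < \<epsilon>"
  obtain D0 where D0: "\<And>z. z \<in> K \<Longrightarrow> norm z \<le> D0" using compact_imp_bounded[OF K(1)] bounded_iff by blast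
  obtain \<delta> where \<delta>: "0 < \<delta>" "cball 0 \<delta> \<subseteq> - path_image \<gamma>" using open_\<Omega> zero_in_\<Omega> open_contains_cball by (metis ComplI)
  define D where "D = max D0 \<delta>"
  have "0 < D" using \<delta> by (simp add: D_def)
  from eventually_conj[OF eventually_N_pos f_bounded_off_0[OF \<delta>(1) \<epsilon> this]]
  show "\<forall>\<^sub>F n in sequentially. \<forall>z\<in>K. norm (f n z) \<le> exp (real n * \<epsilon>)"
  proof eventually_elim
    case (elim n)
    then have N: "0 < N n" and ub: "\<And>z. z \<notin> path_image \<gamma> \<Longrightarrow> \<delta> \<le> norm z \<Longrightarrow> norm z \<le> D \<Longrightarrow> norm (f n z) \<le> exp (real n * \<epsilon>)"
      by blast+
    show ?case
    proof
      fix z assume z: "z \<in> K"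
      show "norm (f n z) \<le> exp (real n * \<epsilon>)"
      proof (cases "\<delta> \<le> norm z")
        case True
        moreover have "norm z \<le> D" using D0[OF z] by (simp add: D_def)
        ultimately show ?thesis using z K(2) by (intro ub) blast+
      next
        case False
        show ?thesis
        proof (rule maximum_modulus_cball[OF f_holomorphic[OF N] \<delta>(2)])
          fix w :: complex assume "norm (w - 0) = \<delta>"
          then have "w \<in> cball 0 \<delta>" "norm w = \<delta>" by auto
          then show "norm (f n w) \<le> exp (real n * \<epsilon>)" using \<delta>(2) by (intro ub) (simp_all add: D_def subset_iff)
        qed (use False in simp)
      qed
    qed
  qed
qed

text \<open>The lower rate near 0 tends to 4 exp (- 2), and 2 exp (- 1) \<open>Y 0\<close> is the
  same number; close to 0 the two rates differ by less than the factor exp \<eta>.\<close>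

lemma f_large_near_0: "subexp_large_near f 0"
  unfolding subexp_large_near_def
proof (intro allI impI)
  fix s \<eta> :: real assume s: "0 < s" and \<eta>: "0 < \<eta>"
  have Y: "isCont Y 0" using holomorphic_on_imp_continuous_on[OF Y_holomorphic] open_\<Omega> zero_in_\<Omega>
    by (simp add: continuous_on_eq_continuous_at)
  have "norm (Y 0) < 2 * exp (- 1) * exp (\<eta> / 2)" using \<eta> by (simp add: Y_0 norm_mult)
  then have "eventually (\<lambda>z. norm (Y z) < 2 * exp (- 1) * exp (\<eta> / 2)) (at 0)"
    using Y by (intro order_tendstoD(2)[of _ "norm (Y 0)"] tendsto_norm) (simp_all add: isCont_def)
  then obtain d1 where d1: "0 < d1" "\<And>z. z \<noteq> 0 \<Longrightarrow> dist z 0 < d1 \<Longrightarrow> norm (Y z) < 2 * exp (- 1) * exp (\<eta> / 2)"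
    unfolding eventually_at by blast
  obtain d2 where d2: "0 < d2" "ball 0 d2 \<subseteq> - path_image \<gamma>" using open_\<Omega> zero_in_\<Omega> open_contains_ball by (metis ComplI)
  have "((\<lambda>\<delta>::real. (4 - \<delta>\<^sup>2) * exp (- 2 - 2 * \<delta>)) \<longlongrightarrow> (4 - 0\<^sup>2) * exp (- 2 - 2 * 0)) (at_right 0)"
    by (intro tendsto_intros)
  moreover have "4 * exp (- 2 - \<eta> / 2) < (4 - 0\<^sup>2) * exp (- 2 - 2 * 0)" using \<eta> by simp
  ultimately have "eventually (\<lambda>\<delta>. 4 * exp (- 2 - \<eta> / 2) < (4 - \<delta>\<^sup>2) * exp (- 2 - 2 * \<delta>)) (at_right 0)"
    by (rule order_tendstoD(1))
  then obtain d3 where d3: "0 < d3" "\<And>\<delta>. 0 < \<delta> \<Longrightarrow> \<delta> < d3 \<Longrightarrow> 4 * exp (- 2 - \<eta> / 2) < (4 - \<delta>\<^sup>2) * exp (- 2 - 2 * \<delta>)"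
    unfolding eventually_at_right_field by blast
  define \<delta> where "\<delta> = min (min d1 d2) (min (min d3 1) s) / 2"
  have \<delta>: "0 < \<delta>" "\<delta> < 1" "\<delta> < d1" "\<delta> < d2" "\<delta> < d3" "\<delta> < s"
    using d1(1) d2(1) d3(1) s unfolding \<delta>_def by linarith+
  from eventually_conj[OF eventually_N_pos P_lower_near_0[OF \<delta>(1,2)]]
  show "\<forall>\<^sub>F n in sequentially. \<exists>y'\<in>ball 0 s. exp (- (real n * \<eta>)) \<le> norm (f n y')"
  proof eventually_elim
    case (elim n)
    then obtain z where N: "0 < N n" and z: "norm z = \<delta>" "N n * ((4 - \<delta>\<^sup>2) * exp (- 2 - 2 * \<delta>)) ^ n \<le> norm (poly (P n) z)"
      by blast
    have "z \<in> ball 0 d2" "z \<noteq> 0" "dist z 0 < d1" using z(1) \<delta> by auto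
    then have Yz: "norm (Y z) \<le> 2 * exp (- 1) * exp (\<eta> / 2)" and out: "z \<notin> path_image \<gamma>"
      using d1(2) d2(2) by (auto simp: less_imp_le)
    have "exp (- \<eta>) * (2 * exp (- 1) * norm (Y z)) \<le> exp (- \<eta>) * (2 * exp (- 1) * (2 * exp (- 1) * exp (\<eta> / 2)))"
      by (intro mult_left_mono Yz) auto
    also have "\<dots> = 4 * (exp (- \<eta>) * exp (- 1) * exp (- 1) * exp (\<eta> / 2))" by simp
    also have "exp (- \<eta>) * exp (- 1) * exp (- 1) * exp (\<eta> / 2) = exp (- 2 - \<eta> / 2)"
      unfolding exp_add[symmetric] by simp
    also have "4 * exp (- 2 - \<eta> / 2) \<le> (4 - \<delta>\<^sup>2) * exp (- 2 - 2 * \<delta>)" using d3(2)[of \<delta>] \<delta> by simp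
    finally have "(exp (- \<eta>) * (2 * exp (- 1) * norm (Y z))) ^ n \<le> ((4 - \<delta>\<^sup>2) * exp (- 2 - 2 * \<delta>)) ^ n"
      by (intro power_mono) auto
    then have "N n * (exp (- \<eta>) * (2 * exp (- 1) * norm (Y z))) ^ n \<le> norm (poly (P n) z)"
      using z(2) N by (meson less_imp_le mult_left_mono order_trans)
    moreover have "N n * (exp (- \<eta>) * (2 * exp (- 1) * norm (Y z))) ^ n =
        exp (- (real n * \<eta>)) * (N n * (2 * exp (- 1) * norm (Y z)) ^ n)"
      unfolding power_mult_distrib[of "exp (- \<eta>)"] exp_of_nat_mult[symmetric] by simp
    moreover have "0 < N n * (2 * exp (- 1) * norm (Y z)) ^ n" using N Y_nz[OF out] by simp
    ultimately have "exp (- (real n * \<eta>)) \<le> norm (f n z)" unfolding norm_f[OF N] by (simp add: pos_le_divide_eq)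
    moreover have "z \<in> ball 0 s" using z(1) \<delta> by simp
    ultimately show ?case by blast
  qed
qed

lemma P_nz: "0 < n \<Longrightarrow> P n \<noteq> 0"
  using pade_pair.P_nz[OF pade] .

lemma f_zero_factored: "\<forall>\<^sub>F n in sequentially. zero_factored (f n) (proots (P n)) (- path_image \<gamma>)"
  using eventually_N_pos
proof eventually_elim
  case (elim n)
  then have N: "N n \<noteq> 0" and n: "0 < n" by auto
  define g where "g z = lead_coeff (P n) / (of_real (N n) * (of_real (2 * exp (- 1)) * Y z) ^ n)" for z
  have "g holomorphic_on - path_image \<gamma>" unfolding g_def[abs_def]
    by (intro holomorphic_intros Y_holomorphic) (use Y_nz N in auto)
  moreover have "g z \<noteq> 0" if "z \<in> - path_image \<gamma>" for z
    using that Y_nz N P_nz[OF n] by (simp add: g_def)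
  moreover have "f n z = (\<Prod>\<zeta>\<in>#proots (P n). z - \<zeta>) * g z" for z
    unfolding f_def g_def poly_eq_prod_proots[of "P n" z] by simp
  ultimately show ?case unfolding zero_factored_def by blast
qed

text \<open>An arc does not separate the plane, so the lower bound near 0 spreads to its whole
  complement.\<close>

lemma f_large_near: "z \<notin> path_image \<gamma> \<Longrightarrow> subexp_large_near f z"
proof -
  assume z: "z \<notin> path_image \<gamma>"
  have con: "connected (- path_image \<gamma>)" by (rule connected_arc_complement[OF arc]) simp
  show "subexp_large_near f z"
    by (rule subexp_large_near_connected[OF open_\<Omega> con f_zero_factored f_bounded _ f_large_near_0])
      (use z zero_in_\<Omega> in simp_all)
qed

definition "h n z = poly (P n) z / (of_real (N n) * (of_real (2 * exp (- 1)) * z * exp z) ^ n)"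

lemma norm_h: "0 < N n \<Longrightarrow> norm (h n z) = norm (poly (P n) z) / (N n * (2 * exp (- 1) * norm z * exp (Re z)) ^ n)"
  by (simp add: h_def norm_divide norm_mult norm_power)

lemma h_bounded:
  assumes "0 < \<delta>" "0 < \<epsilon>" "0 < D"
  shows "\<forall>\<^sub>F n in sequentially. \<forall>z. Re z < 0 \<longrightarrow> \<delta> \<le> norm z \<longrightarrow> norm z \<le> D \<longrightarrow>
     norm (h n z) \<le> exp (real n * (\<bar>level z\<bar> + \<epsilon>))"
  using eventually_conj[OF eventually_N_pos P_upper_majorant[OF assms]]
proof eventually_elim
  case (elim n)
  then have N: "0 < N n" and ub: "\<And>z. \<delta> \<le> norm z \<Longrightarrow> norm z \<le> D \<Longrightarrow> Re z \<noteq> 0 \<Longrightarrow>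
       norm (poly (P n) z) \<le> N n * (exp \<epsilon> * majorant z) ^ n" by blast+
  show ?case
  proof (intro allI impI)
    fix z assume z: "Re z < 0" "\<delta> \<le> norm z" "norm z \<le> D"
    define b where "b = 2 * exp (- 1) * norm z * exp (Re z)"
    have "z \<noteq> 0" using z by auto
    then have pos: "0 < N n * b ^ n" using N by (simp add: b_def)
    have "exp \<epsilon> * majorant z = exp (\<bar>level z\<bar> + \<epsilon>) * b"
      using z(1) unfolding majorant_def b_def exp_add by simp
    then have "norm (poly (P n) z) \<le> N n * (exp (\<bar>level z\<bar> + \<epsilon>) * b) ^ n"
      using ub[OF z(2,3)] z(1) by simp
    also have "\<dots> = exp (real n * (\<bar>level z\<bar> + \<epsilon>)) * (N n * b ^ n)"
      unfolding power_mult_distrib exp_of_nat_mult by simp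
    finally show "norm (h n z) \<le> exp (real n * (\<bar>level z\<bar> + \<epsilon>))"
      unfolding norm_h[OF N] b_def[symmetric] using pos by (simp add: pos_divide_le_eq)
  qed
qed

lemma norm_h_f:
  assumes N: "0 < N n" and z: "Re z < 0" "z \<notin> path_image \<gamma>"
  shows "norm (h n z) = norm (f n z) * exp (real n * \<bar>level z\<bar>)"
proof -
  define b where "b = 2 * exp (- 1) * norm z * exp (Re z)"
  have "2 * exp (- 1) * norm (Y z) = b * exp \<bar>level z\<bar>"
    using norm_Y[OF z(2)] z(1) by (simp add: majorant_def b_def)
  then have "norm (f n z) = norm (h n z) / exp \<bar>level z\<bar> ^ n"
    unfolding norm_f[OF N] norm_h[OF N] b_def[symmetric] by (simp add: power_mult_distrib)
  then show ?thesis by (simp add: exp_of_nat_mult)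
qed

lemma off_trajectory_dense:
  assumes w: "Re w < 0" and s: "0 < s"
  obtains x where "x \<in> ball w s" "Re x < 0" "x \<notin> path_image \<gamma>"
proof (cases "w \<in> path_image \<gamma>")
  case False
  then show ?thesis using that[of w] w s by simp
next
  case True
  then obtain t where t: "t \<in> {0..1}" "w = \<gamma> t" by (auto simp: path_image_def)
  then have "t \<noteq> 0" "t \<noteq> 1" using w by (auto simp: \<gamma>_0 \<gamma>_1)
  then have t': "t \<in> {0<..<1}" using t(1) by simp
  have "((\<lambda>\<epsilon>. \<gamma> t + of_real \<epsilon> * (\<i> * d t)) \<longlongrightarrow> \<gamma> t + of_real 0 * (\<i> * d t)) (at_right 0)"
    by (intro tendsto_intros)
  then have "((\<lambda>\<epsilon>. normal t \<epsilon>) \<longlongrightarrow> \<gamma> t) (at_right 0)" by (simp add: normal_def)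
  then have "eventually (\<lambda>\<epsilon>. dist (normal t \<epsilon>) (\<gamma> t) < s) (at_right 0)" using s by (rule tendstoD)
  from eventually_conj[OF this normal_avoids[OF t']]
  obtain \<epsilon> where "dist (normal t \<epsilon>) (\<gamma> t) < s \<and> normal t \<epsilon> \<notin> path_image \<gamma> \<and> Re (normal t \<epsilon>) < 0"
    using eventually_happens' trivial_limit_at_right_real by blast
  then show ?thesis using that[of "normal t \<epsilon>"] t(2) by (simp add: dist_commute)
qed

text \<open>Points off the curve are dense, so the lower bound for \<open>f\<close> in the
  complement reaches every neighbourhood of a point on the curve.\<close>

lemma h_large_near:
  assumes w: "Re w < 0" and s: "0 < s" and \<eta>: "0 < \<eta>"
  shows "\<forall>\<^sub>F n in sequentially. \<exists>w'\<in>ball w s. Re w' < 0 \<and> exp (real n * (\<bar>level w'\<bar> - \<eta>)) \<le> norm (h n w')"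
proof -
  obtain x where x: "x \<in> ball w s" "Re x < 0" "x \<notin> path_image \<gamma>" using off_trajectory_dense[OF w s] .
  have "open (ball w s \<inter> left_half \<inter> - path_image \<gamma>)" by (intro open_Int open_ball open_left_half open_\<Omega>)
  moreover have "x \<in> ball w s \<inter> left_half \<inter> - path_image \<gamma>" using x by (simp add: left_half_iff)
  ultimately obtain r where r: "0 < r" "ball x r \<subseteq> ball w s \<inter> left_half \<inter> - path_image \<gamma>"
    using open_contains_ball by blast
  have "\<forall>\<^sub>F n in sequentially. \<exists>y'\<in>ball x r. exp (- (real n * \<eta>)) \<le> norm (f n y')"
    using f_large_near[OF x(3)] r(1) \<eta> by (simp add: subexp_large_near_def)
  from eventually_conj[OF eventually_N_pos this] show ?thesis
  proof eventually_elim
    case (elim n)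
    then obtain w' where N: "0 < N n" and w': "w' \<in> ball x r" "exp (- (real n * \<eta>)) \<le> norm (f n w')" by blast
    then have in': "w' \<in> ball w s" "Re w' < 0" "w' \<notin> path_image \<gamma>" using r(2) by (auto simp: left_half_def)
    have "exp (real n * (\<bar>level w'\<bar> - \<eta>)) = exp (- (real n * \<eta>)) * exp (real n * \<bar>level w'\<bar>)"
      unfolding exp_add[symmetric] by (simp add: algebra_simps)
    also have "\<dots> \<le> norm (f n w') * exp (real n * \<bar>level w'\<bar>)" using w'(2) by (intro mult_right_mono) auto
    also have "\<dots> = norm (h n w')" using norm_h_f[OF N in'(2,3)] by simp
    finally show ?case using in' by blast
  qed
qed

text \<open>In the coordinate given by \<open>Phi\<close>, centred at \<i> u, the exponent
  \<bar>level\<bar> becomes \<bar>Re\<bar>, which is the situation of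
  \<open>zero_count_lower_bound\<close>.\<close>

lemma zero_count:
  assumes u: "cball (\<i> * of_real u) r0 \<subseteq> chart_domain" and r: "0 < r" "r < r0" and \<epsilon>: "0 < \<epsilon>"
  shows "\<forall>\<^sub>F n in sequentially. real n * (2 * r / pi - \<epsilon>) \<le>
     real (size (filter_mset (\<lambda>\<zeta>. Re \<zeta> < 0 \<and> norm (Phi \<zeta> - \<i> * of_real u) < r) (proots (P n))))"
proof -
  define c where "c = \<i> * complex_of_real u"
  define F where "F n \<xi> = h n (chart (c + \<xi>))" for n \<xi>
  define Z where "Z n = image_mset (\<lambda>\<zeta>. Phi \<zeta> - c) (filter_mset (\<lambda>\<zeta>. Re \<zeta> < 0) (proots (P n)))" for n
  have in_dom: "c + \<xi> \<in> chart_domain" if "\<xi> \<in> cball 0 r0" for \<xi>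
    using u that by (auto simp: c_def dist_norm subset_iff)
  have in_dom': "c + \<xi> \<in> chart_domain" if "\<xi> \<in> ball 0 r0" for \<xi>
    using that ball_subset_cball in_dom by blast
  have "\<exists>g. 0 < n \<longrightarrow> g holomorphic_on chart_domain \<and> (\<forall>\<xi>\<in>chart_domain. g \<xi> \<noteq> 0 \<and>
     poly (P n) (chart \<xi>) = (\<Prod>\<zeta>\<in>#filter_mset (\<lambda>\<zeta>. Re \<zeta> < 0) (proots (P n)). \<xi> - Phi \<zeta>) * g \<xi>)" for n
    using zero_factored_chart[OF P_nz] by blast
  then obtain g where g: "\<And>n. 0 < n \<Longrightarrow> g n holomorphic_on chart_domain"
    "\<And>n \<xi>. 0 < n \<Longrightarrow> \<xi> \<in> chart_domain \<Longrightarrow> g n \<xi> \<noteq> 0 \<and>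
      poly (P n) (chart \<xi>) = (\<Prod>\<zeta>\<in>#filter_mset (\<lambda>\<zeta>. Re \<zeta> < 0) (proots (P n)). \<xi> - Phi \<zeta>) * g n \<xi>"
    by metis
  define G where "G n \<xi> = g n (c + \<xi>) / (of_real (N n) * (of_real (2 * exp (- 1)) * chart (c + \<xi>) * exp (chart (c + \<xi>))) ^ n)" for n \<xi>
  have chart_nz: "chart (c + \<xi>) \<noteq> 0" if "\<xi> \<in> ball 0 r0" for \<xi>
    using Re_chart[OF in_dom'[OF that]] by auto
  have hol: "(\<lambda>\<xi>. k (c + \<xi>)) holomorphic_on ball 0 r0" if "k holomorphic_on chart_domain" for k
  proof (rule holomorphic_on_compose_gen[OF _ that, unfolded o_def])
    show "(\<lambda>\<xi>. c + \<xi>) ` ball 0 r0 \<subseteq> chart_domain" using in_dom' by blast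
  qed (intro holomorphic_intros)
  have 1: "\<forall>\<^sub>F n in sequentially. G n holomorphic_on ball 0 r0 \<and> (\<forall>z\<in>ball 0 r0. G n z \<noteq> 0 \<and> F n z = (\<Prod>\<zeta>\<in>#Z n. z - \<zeta>) * G n z)"
    using eventually_N_pos
  proof eventually_elim
    case (elim n)
    then have n: "0 < n" "N n \<noteq> 0" by auto
    have "G n holomorphic_on ball 0 r0" unfolding G_def[abs_def]
      by (intro holomorphic_intros hol chart_holomorphic g(1) n) (use chart_nz n in auto)
    moreover have "G n z \<noteq> 0" if "z \<in> ball 0 r0" for z
      using g(2)[OF n(1) in_dom'[OF that]] chart_nz[OF that] n(2) by (simp add: G_def)
    moreover have "F n z = (\<Prod>\<zeta>\<in>#Z n. z - \<zeta>) * G n z" if "z \<in> ball 0 r0" for z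
    proof -
      have "(\<Prod>\<zeta>\<in>#Z n. z - \<zeta>) = (\<Prod>\<zeta>\<in>#filter_mset (\<lambda>\<zeta>. Re \<zeta> < 0) (proots (P n)). c + z - Phi \<zeta>)"
        unfolding Z_def image_mset.compositionality o_def by (simp add: algebra_simps)
      then show ?thesis using g(2)[OF n(1) in_dom'[OF that]] by (simp add: F_def h_def G_def)
    qed
    ultimately show ?case by blast
  qed
  have 2: "\<forall>\<^sub>F n in sequentially. \<forall>z\<in>ball 0 r0. norm (F n z) \<le> exp (real n * (\<bar>Re z\<bar> + \<epsilon>))" if \<epsilon>: "0 < \<epsilon>" for \<epsilon>
  proof -
    have cc: "continuous_on chart_domain chart" by (rule holomorphic_on_imp_continuous_on[OF chart_holomorphic])
    have "compact (chart ` cball c r0)"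
      by (intro compact_continuous_image continuous_on_subset[OF cc] compact_cball u[folded c_def])
    then have b: "bounded (chart ` cball c r0)" and cl: "closed (chart ` cball c r0)"
      by (simp_all add: compact_imp_bounded compact_imp_closed)
    have "0 \<notin> chart ` cball c r0"
    proof
      assume "0 \<in> chart ` cball c r0"
      then obtain x where "0 = chart x" "x \<in> cball c r0" by (rule imageE)
      then have "x \<in> chart_domain" "chart x = 0" using subsetD[OF u[folded c_def]] by simp_all
      then show False using Re_chart[of x] by simp
    qed
    from separate_point_closed[OF cl this] obtain \<delta> where \<delta>: "0 < \<delta>" "\<And>x. x \<in> chart ` cball c r0 \<Longrightarrow> \<delta> \<le> dist 0 x"
      by metis
    obtain D where D: "0 < D" "\<And>x. x \<in> chart ` cball c r0 \<Longrightarrow> norm x \<le> D" using b unfolding bounded_pos by metis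
    show ?thesis using h_bounded[OF \<delta>(1) \<epsilon> D(1)]
    proof eventually_elim
      case (elim n)
      show ?case
      proof
        fix z :: complex assume z: "z \<in> ball 0 r0"
        then have "c + z \<in> cball c r0" by (simp add: dist_norm)
        then have "chart (c + z) \<in> chart ` cball c r0" by blast
        from \<delta>(2)[OF this] D(2)[OF this]
        have "\<delta> \<le> norm (chart (c + z))" "norm (chart (c + z)) \<le> D" by simp_all
        moreover have "level (chart (c + z)) = Re z" using level_chart[OF in_dom'[OF z]] by (simp add: c_def)
        moreover note elim[rule_format, OF Re_chart[OF in_dom'[OF z]]]
        ultimately show "norm (F n z) \<le> exp (real n * (\<bar>Re z\<bar> + \<epsilon>))"
          unfolding F_def by simp
      qed
    qed
  qed
  have 3: "\<forall>\<^sub>F n in sequentially. \<exists>w'\<in>ball w s. exp (real n * (\<bar>Re w'\<bar> - \<eta>)) \<le> norm (F n w')"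
    if w: "w \<in> ball 0 r0" and s: "0 < s" and \<eta>: "0 < \<eta>" for w s \<eta>
  proof -
    define b where "b = chart (c + w)"
    have b: "Re b < 0" "Phi b = c + w" using Re_chart[OF in_dom'[OF w]] Phi_chart[OF in_dom'[OF w]] by (auto simp: b_def)
    have "isCont Phi b" using Phi_field_derivative[OF b(1)] by (rule DERIV_isCont)
    then obtain s' where s': "0 < s'" "\<And>x. dist x b < s' \<Longrightarrow> dist (Phi x) (Phi b) < s"
      using s unfolding continuous_at_eps_delta by blast
    show ?thesis using h_large_near[OF b(1) s'(1) \<eta>]
    proof eventually_elim
      case (elim n)
      then obtain x where x: "x \<in> ball b s'" "Re x < 0" "exp (real n * (\<bar>level x\<bar> - \<eta>)) \<le> norm (h n x)" by blast
      define w' where "w' = Phi x - c"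
      have "dist (Phi x) (Phi b) < s" using x(1) by (intro s') (simp add: dist_commute)
      then have "w' \<in> ball w s" by (simp add: w'_def b(2) dist_norm norm_minus_commute algebra_simps)
      moreover have "Re w' = level x" using Re_Phi[of x] x(2) by (force simp: w'_def c_def)
      moreover have "F n w' = h n x" using chart_Phi[OF x(2)] by (simp add: F_def w'_def)
      ultimately show ?case using x(3) by metis
    qed
  qed
  have "\<forall>\<^sub>F n in sequentially. real n * (2 * r / pi - \<epsilon>) \<le> real (size (filter_mset (\<lambda>\<zeta>. norm \<zeta> < r) (Z n)))"
    by (rule zero_count_lower_bound[OF 1 2 3 r \<epsilon>])
  moreover have "size (filter_mset (\<lambda>\<zeta>. norm \<zeta> < r) (Z n)) =
     size (filter_mset (\<lambda>\<zeta>. Re \<zeta> < 0 \<and> norm (Phi \<zeta> - \<i> * of_real u) < r) (proots (P n)))" for n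
    unfolding Z_def c_def filter_mset_image_mset filter_filter_mset size_image_mset by (simp add: conj_commute)
  ultimately show ?thesis by simp
qed

end

section \<open>Weak convergence\<close>

text \<open>A combination of indicators that lies below \<open>g\<close> is summed over
  \<open>X\<close>, with the two finite sums interchanged.\<close>

lemma weighted_count_le:
  fixes m :: "nat \<Rightarrow> real"
  assumes "\<And>\<xi>. (\<Sum>k<M. if p k \<xi> then m k else 0) \<le> g \<xi>"
  shows "(\<Sum>k<M. m k * real (size (filter_mset (p k) X))) \<le> (\<Sum>\<xi>\<in>#X. g \<xi>)"
proof (induction X)
  case (add x X)
  have "m k * real (size (filter_mset (p k) (add_mset x X))) =
      m k * real (size (filter_mset (p k) X)) + (if p k x then m k else 0)" for k
    by (simp add: algebra_simps)
  then show ?case using add assms[of x] by (simp add: sum.distrib)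
qed simp

lemma segment_uniform_continuity:
  fixes g :: "complex \<Rightarrow> real"
  assumes V: "open V" and S: "compact S" "S \<subseteq> V" and g: "continuous_on V g" and \<epsilon>: "0 < \<epsilon>"
  obtains r where "0 < r" "\<And>x. x \<in> S \<Longrightarrow> cball x r \<subseteq> V" "\<And>x y. x \<in> S \<Longrightarrow> dist x y \<le> r \<Longrightarrow> \<bar>g y - g x\<bar> \<le> \<epsilon>"
proof -
  obtain r1 where r1: "0 < r1" "(\<Union>x\<in>S. cball x r1) \<subseteq> V"
    using compact_subset_open_imp_cball_epsilon_subset[OF S(1) V S(2)] by metis
  have eq: "(\<Union>x\<in>S. cball x r1) = {x + y |x y. x \<in> S \<and> y \<in> cball 0 r1}" (is "?K = ?T")
  proof
    show "?K \<subseteq> ?T"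
    proof
      fix z assume "z \<in> ?K"
      then obtain x where x: "x \<in> S" "dist x z \<le> r1" by auto
      then have "z = x + (z - x) \<and> x \<in> S \<and> z - x \<in> cball 0 r1" by (simp add: dist_norm norm_minus_commute)
      then show "z \<in> ?T" by blast
    qed
    show "?T \<subseteq> ?K" by (auto simp: dist_norm)
  qed
  have K: "compact ?K" unfolding eq by (rule compact_sums[OF S(1) compact_cball])
  have "uniformly_continuous_on ?K g" by (rule compact_uniformly_continuous[OF continuous_on_subset[OF g r1(2)] K])
  then obtain r2 where r2: "0 < r2" "\<And>x y. x \<in> ?K \<Longrightarrow> y \<in> ?K \<Longrightarrow> dist y x < r2 \<Longrightarrow> dist (g y) (g x) < \<epsilon>"
    using \<epsilon> unfolding uniformly_continuous_on_def by metis
  define r where "r = min r1 (r2 / 2)"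
  have r: "0 < r" "r \<le> r1" "r < r2" using r1(1) r2(1) by (auto simp: r_def)
  show ?thesis
  proof (rule that[OF r(1)])
    show "cball x r \<subseteq> V" if "x \<in> S" for x
    proof -
      have "cball x r \<subseteq> cball x r1" using r(2) by (rule subset_cball)
      also have "\<dots> \<subseteq> ?K" using that by blast
      finally show ?thesis using r1(2) by (rule subset_trans)
    qed
    show "\<bar>g y - g x\<bar> \<le> \<epsilon>" if x: "x \<in> S" and xy: "dist x y \<le> r" for x y
    proof -
      have "x \<in> ?K" "y \<in> ?K" using x xy r r1(1) by (auto intro!: bexI[of _ x])
      then have "dist (g y) (g x) < \<epsilon>" using xy r(3) by (intro r2(2)) (simp_all add: dist_commute)
      then show ?thesis by (simp add: dist_real_def)
    qed
  qed
qed

text \<open>\<open>V\<close> is only assumed to contain the open segment, so an end piece of length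
  \<eta> is cut off on either side and the rest is covered up to single points by \<open>M\<close>
  discs of equal radius \<open>r\<close>. Each contains nearly 2 r n / \<pi> points and
  \<open>g\<close> is nearly constant on it; summing over the discs gives a Riemann sum of
  \<open>F\<close>.\<close>

lemma counting_lower_bound:
  fixes X :: "nat \<Rightarrow> complex multiset" and g :: "complex \<Rightarrow> real" and F :: "real \<Rightarrow> real"
  assumes V: "open V" "\<And>u. \<bar>u\<bar> < pi / 2 \<Longrightarrow> \<i> * of_real u \<in> V"
    and g: "continuous_on V g" "\<And>\<xi>. 0 \<le> g \<xi>" "\<And>\<xi>. g \<xi> \<le> B"
    and F: "continuous_on {- (pi / 2)..pi / 2} F" "\<And>u. \<bar>u\<bar> < pi / 2 \<Longrightarrow> F u = g (\<i> * of_real u)" "\<And>u. F u \<le> B"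
    and count: "\<And>u r r0 \<epsilon>. cball (\<i> * of_real u) r0 \<subseteq> V \<Longrightarrow> 0 < r \<Longrightarrow> r < r0 \<Longrightarrow> 0 < \<epsilon> \<Longrightarrow>
      \<forall>\<^sub>F n in sequentially. real n * (2 * r / pi - \<epsilon>) \<le> real (size (filter_mset (\<lambda>\<xi>. norm (\<xi> - \<i> * of_real u) < r) (X n)))"
    and \<epsilon>: "0 < \<epsilon>"
  shows "\<forall>\<^sub>F n in sequentially. real n * (integral {- (pi / 2)..pi / 2} F / pi - \<epsilon>) \<le> (\<Sum>\<xi>\<in>#X n. g \<xi>)"
proof -
  have B0: "0 \<le> B" using g(2,3)[of 0] by linarith
  \<comment> \<open>\<open>B\<close> may be 0, while \<open>C\<close> can be used as a
    divisor.\<close>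
  define C where "C = B + 1"
  have C: "0 < C" "B \<le> C" using B0 by (auto simp: C_def)
  define \<eta> where "\<eta> = min (pi / 4) (\<epsilon> * pi / (8 * C))"
  have \<eta>: "0 < \<eta>" "\<eta> \<le> pi / 4" "2 * \<eta> * C / pi \<le> \<epsilon> / 4"
  proof -
    show "0 < \<eta>" using C \<epsilon> by (simp add: \<eta>_def)
    show "\<eta> \<le> pi / 4" by (simp add: \<eta>_def)
    have "\<eta> \<le> \<epsilon> * pi / (8 * C)" by (simp add: \<eta>_def)
    then show "2 * \<eta> * C / pi \<le> \<epsilon> / 4" using C pi_gt_zero by (simp add: field_simps)
  qed
  define A where "A = pi / 2 - \<eta>"
  have A: "0 < A" "A < pi / 2" using \<eta> pi_gt_zero unfolding A_def by linarith+
  define \<epsilon>1 where "\<epsilon>1 = \<epsilon> / 8"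
  have \<epsilon>1: "0 < \<epsilon>1" using \<epsilon> by (simp add: \<epsilon>1_def)
  define S where "S = (\<lambda>u. \<i> * complex_of_real u) ` {-A..A}"
  have S: "compact S" unfolding S_def by (intro compact_continuous_image continuous_intros) auto
  have SV: "S \<subseteq> V"
  proof
    fix x assume "x \<in> S"
    then obtain u where u: "x = \<i> * of_real u" "-A \<le> u" "u \<le> A" by (auto simp: S_def)
    then have "\<bar>u\<bar> < pi / 2" using A by linarith
    then show "x \<in> V" unfolding u(1) by (rule V(2))
  qed
  obtain r0 where r0: "0 < r0" "\<And>x. x \<in> S \<Longrightarrow> cball x r0 \<subseteq> V" "\<And>x y. x \<in> S \<Longrightarrow> dist x y \<le> r0 \<Longrightarrow> \<bar>g y - g x\<bar> \<le> \<epsilon>1"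
    using segment_uniform_continuity[OF V(1) S SV g(1) \<epsilon>1] by metis
  obtain M :: nat where M: "A / r0 < real M" using reals_Archimedean2 by blast
  have M0: "0 < M"
  proof -
    have "0 < A / r0" using A r0 by simp
    then have "0 < real M" using M by linarith
    then show ?thesis by simp
  qed
  define r where "r = A / real M"
  have r: "0 < r" "r < r0" "real M * r = A" using A M M0 r0 by (auto simp: r_def field_simps)
  \<comment> \<open>The centres lie at distances r, 3 r, 5 r, ... from the lower end, so
    neighbouring open discs touch without overlapping.\<close>
  define u where "u k = - A + (2 * real k + 1) * r" for k :: nat
  have uS: "\<i> * of_real (u k) \<in> S" if "k < M" for k
  proof -
    have "(2 * real k + 1) * r \<le> (2 * real M) * r" using that r(1) by (intro mult_right_mono) auto
    also have "\<dots> = 2 * A" using r(3) by simp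
    finally have "u k \<le> A" by (simp add: u_def)
    moreover have "- A \<le> u k" using r(1) by (simp add: u_def)
    ultimately show ?thesis by (simp add: S_def)
  qed
  have int: "F integrable_on {a..b}" if "- (pi / 2) \<le> a" "b \<le> pi / 2" for a b
    using that by (intro integrable_continuous_real continuous_on_subset[OF F(1)]) auto
  have riemann: "integral {- A..- A + 2 * real k * r} F \<le> (\<Sum>j<k. 2 * r * (g (\<i> * of_real (u j)) + \<epsilon>1))" if "k \<le> M" for k
    using that
  proof (induction k)
    case 0
    then show ?case by simp
  next
    case (Suc k)
    define b where "b = - A + 2 * real k * r"
    have b: "- A \<le> b" "- A + 2 * real (Suc k) * r = b + 2 * r" using r(1) by (auto simp: b_def algebra_simps)
    have "2 * real (Suc k) * r \<le> 2 * real M * r" using Suc.prems r(1) by (intro mult_right_mono) auto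
    also have "\<dots> = 2 * A" using r(3) by simp
    finally have b2: "b + 2 * r \<le> A" using b(2) by simp
    have "integral {- A..b + 2 * r} F = integral {- A..b} F + integral {b..b + 2 * r} F"
      using b b2 r(1) A by (intro Henstock_Kurzweil_Integration.integral_combine[symmetric] int) auto
    moreover have "integral {b..b + 2 * r} F \<le> integral {b..b + 2 * r} (\<lambda>_. g (\<i> * of_real (u k)) + \<epsilon>1)"
    proof (rule integral_le)
      show "F integrable_on {b..b + 2 * r}" using b b2 A by (intro int) auto
      fix x assume x: "x \<in> {b..b + 2 * r}"
      have "\<bar>x\<bar> < pi / 2" using x b(1) b2 A(2) by (auto simp: abs_less_iff)
      then have "F x = g (\<i> * of_real x)" by (rule F(2))
      moreover have "dist (\<i> * of_real (u k)) (\<i> * of_real x) = \<bar>u k - x\<bar>"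
        by (simp add: dist_norm norm_mult flip: right_diff_distrib of_real_diff)
      moreover have "u k = b + r" by (simp add: u_def b_def algebra_simps)
      then have "\<bar>u k - x\<bar> \<le> r" using x by (auto simp: abs_le_iff)
      ultimately have "\<bar>g (\<i> * of_real x) - g (\<i> * of_real (u k))\<bar> \<le> \<epsilon>1"
        using r(2) Suc.prems by (intro r0(3) uS) simp_all
      then show "F x \<le> g (\<i> * of_real (u k)) + \<epsilon>1" using \<open>F x = g (\<i> * of_real x)\<close> by linarith
    qed auto
    moreover have "integral {b..b + 2 * r} (\<lambda>_. g (\<i> * of_real (u k)) + \<epsilon>1) = 2 * r * (g (\<i> * of_real (u k)) + \<epsilon>1)"
      using r(1) by (subst integral_const_real) simp
    moreover have "integral {- A..b} F \<le> (\<Sum>j<k. 2 * r * (g (\<i> * of_real (u j)) + \<epsilon>1))"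
      using Suc by (simp add: b_def)
    ultimately show ?case unfolding b(2) sum.lessThan_Suc by linarith
  qed
  define G where "G = (\<Sum>k<M. g (\<i> * of_real (u k)))"
  have "integral {- A..A} F \<le> 2 * r * G + 2 * A * \<epsilon>1"
  proof -
    have "- A + 2 * real M * r = A" using r(3) by simp
    then have "integral {- A..A} F \<le> (\<Sum>j<M. 2 * r * (g (\<i> * of_real (u j)) + \<epsilon>1))" using riemann[OF order_refl] by (simp only:)
    also have "\<dots> = 2 * r * G + 2 * (real M * r) * \<epsilon>1"
      by (simp add: distrib_left sum.distrib sum_distrib_left G_def)
    finally show ?thesis unfolding r(3) .
  qed
  moreover have "integral {- (pi / 2)..pi / 2} F \<le> integral {- A..A} F + 2 * \<eta> * C"
  proof -
    have e: "integral {a..a + \<eta>} F \<le> \<eta> * C" if "- (pi / 2) \<le> a" "a + \<eta> \<le> pi / 2" for a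
    proof -
      have "integral {a..a + \<eta>} F \<le> integral {a..a + \<eta>} (\<lambda>_. C)"
        using that F(3) C(2) order_trans by (intro integral_le int) auto
      then show ?thesis using \<eta>(1) by simp
    qed
    have "integral {- (pi / 2)..- A} F \<le> \<eta> * C" "integral {A..pi / 2} F \<le> \<eta> * C"
      using e[of "- (pi / 2)"] e[of A] A by (simp_all add: A_def)
    moreover have "integral {- (pi / 2)..pi / 2} F = integral {- (pi / 2)..- A} F + integral {- A..pi / 2} F"
      using A by (intro Henstock_Kurzweil_Integration.integral_combine[symmetric] int) auto
    moreover have "integral {- A..pi / 2} F = integral {- A..A} F + integral {A..pi / 2} F"
      using A by (intro Henstock_Kurzweil_Integration.integral_combine[symmetric] int) auto
    ultimately show ?thesis by simp
  qed
  ultimately have I: "integral {- (pi / 2)..pi / 2} F \<le> 2 * r * G + 2 * A * \<epsilon>1 + 2 * \<eta> * C" by linarith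
  \<comment> \<open>Truncation at 0 keeps the weights nonnegative, so that they preserve the lower
    bounds for the counts.\<close>
  define m where "m k = max 0 (g (\<i> * of_real (u k)) - \<epsilon>1)" for k
  define p where "p k \<xi> \<longleftrightarrow> norm (\<xi> - \<i> * of_real (u k)) < r" for k \<xi>
  have disj: "j = k" if "p j \<xi>" "p k \<xi>" for j k \<xi>
  proof (rule ccontr)
    assume "j \<noteq> k"
    have "\<bar>u j - u k\<bar> = norm ((\<xi> - \<i> * of_real (u k)) - (\<xi> - \<i> * of_real (u j)))"
      by (simp add: norm_mult flip: right_diff_distrib of_real_diff)
    also have "\<dots> < r + r" using that unfolding p_def by (meson add_strict_mono norm_triangle_ineq4 order_le_less_trans)
    finally have "\<bar>u j - u k\<bar> < 2 * r" by simp
    moreover have "u j - u k = 2 * r * (real j - real k)" by (simp add: u_def algebra_simps)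
    ultimately have "\<bar>real j - real k\<bar> < 1" using r(1) by (simp add: abs_mult)
    then show False using \<open>j \<noteq> k\<close> by linarith
  qed
  have point: "(\<Sum>k<M. if p k \<xi> then m k else 0) \<le> g \<xi>" for \<xi>
  proof (cases "\<exists>k<M. p k \<xi>")
    case True
    then obtain k where k: "k < M" "p k \<xi>" by blast
    have "(\<Sum>j<M. if p j \<xi> then m j else 0) = (\<Sum>j<M. if j = k then m j else 0)"
    proof (rule sum.cong[OF refl])
      fix j
      have "p j \<xi> \<longleftrightarrow> j = k" using disj k(2) by blast
      then show "(if p j \<xi> then m j else 0) = (if j = k then m j else 0)" by simp
    qed
    also have "\<dots> = m k" using k(1) by simp
    also have "\<dots> \<le> g \<xi>"
    proof -
      have "dist (\<i> * of_real (u k)) \<xi> \<le> r0" using k(2) r(2) by (simp add: p_def dist_norm norm_minus_commute)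
      from r0(3)[OF uS[OF k(1)] this] have "g (\<i> * of_real (u k)) - \<epsilon>1 \<le> g \<xi>" by linarith
      then show ?thesis using g(2)[of \<xi>] by (simp add: m_def)
    qed
    finally show ?thesis .
  next
    case False
    then have "(\<Sum>j<M. if p j \<xi> then m j else 0) = 0" by (intro sum.neutral) auto
    then show ?thesis using g(2) by simp
  qed
  \<comment> \<open>The \<open>M\<close> counting errors, each weighted by at most \<open>C\<close>,
    add up to \<epsilon> / 4.\<close>
  define \<epsilon>2 where "\<epsilon>2 = \<epsilon> / (4 * real M * C)"
  have \<epsilon>2: "0 < \<epsilon>2" using \<epsilon> C M0 by (simp add: \<epsilon>2_def)
  have "\<forall>\<^sub>F n in sequentially. \<forall>k\<in>{..<M}. real n * (2 * r / pi - \<epsilon>2) \<le> real (size (filter_mset (p k) (X n)))"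
    unfolding p_def[abs_def]
  proof (rule eventually_ball_finite)
    show "\<forall>k\<in>{..<M}. \<forall>\<^sub>F n in sequentially. real n * (2 * r / pi - \<epsilon>2)
         \<le> real (size (filter_mset (\<lambda>\<xi>. cmod (\<xi> - \<i> * complex_of_real (u k)) < r) (X n)))"
      using r0(2) uS r \<epsilon>2 by (intro ballI count[of _ r0]) auto
  qed simp
  then show ?thesis
  proof eventually_elim
    case (elim n)
    have affine: "(\<Sum>k<M. (x k - e) * q - b) = ((\<Sum>k<M. x k) - real M * e) * q - real M * b" for x and e q b :: real
      by (simp add: sum_subtractf left_diff_distrib sum_distrib_right)
    have mC: "m k \<le> C" for k using g(3)[of "\<i> * of_real (u k)"] C \<epsilon>1 by (simp add: m_def)
    have "real n * (integral {- (pi / 2)..pi / 2} F / pi - \<epsilon>) \<le> real n * (\<Sum>k<M. m k * (2 * r / pi - \<epsilon>2))"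
    proof (rule mult_left_mono)
      have "(\<Sum>k<M. (g (\<i> * of_real (u k)) - \<epsilon>1) * (2 * r / pi) - C * \<epsilon>2) \<le> (\<Sum>k<M. m k * (2 * r / pi - \<epsilon>2))"
      proof (rule sum_mono)
        fix k
        have "(g (\<i> * of_real (u k)) - \<epsilon>1) * (2 * r / pi) \<le> m k * (2 * r / pi)"
          using r(1) by (intro mult_right_mono) (auto simp: m_def)
        moreover have "m k * \<epsilon>2 \<le> C * \<epsilon>2" using mC \<epsilon>2 by (intro mult_right_mono) auto
        ultimately show "(g (\<i> * of_real (u k)) - \<epsilon>1) * (2 * r / pi) - C * \<epsilon>2 \<le> m k * (2 * r / pi - \<epsilon>2)"
          by (simp add: right_diff_distrib)
      qed
      moreover have "(\<Sum>k<M. (g (\<i> * of_real (u k)) - \<epsilon>1) * (2 * r / pi) - C * \<epsilon>2) =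
          (G - real M * \<epsilon>1) * (2 * r / pi) - real M * C * \<epsilon>2"
        unfolding G_def using affine[of "\<lambda>k. g (\<i> * of_real (u k))"] by (simp only: mult.assoc)
      moreover have "real M * C * \<epsilon>2 = \<epsilon> / 4" using C M0 by (simp add: \<epsilon>2_def)
      moreover have "(G - real M * \<epsilon>1) * (2 * r / pi) = (2 * r * G - 2 * (real M * r) * \<epsilon>1) / pi"
        by (simp add: diff_divide_distrib algebra_simps)
      moreover have "(2 * r * G - 2 * (real M * r) * \<epsilon>1) / pi \<ge> (integral {- (pi / 2)..pi / 2} F - 2 * \<eta> * C - 4 * A * \<epsilon>1) / pi"
        unfolding r(3) using I pi_gt_zero by (intro divide_right_mono) linarith+
      moreover have "4 * A * \<epsilon>1 / pi \<le> \<epsilon> / 4"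
      proof -
        have "4 * A * \<epsilon>1 \<le> 2 * pi * \<epsilon>1" using A \<epsilon>1 by (intro mult_right_mono) auto
        then have "4 * A * \<epsilon>1 / pi \<le> 2 * pi * \<epsilon>1 / pi" by (intro divide_right_mono) auto
        then show ?thesis by (simp add: \<epsilon>1_def)
      qed
      moreover have "(integral {- (pi / 2)..pi / 2} F - 2 * \<eta> * C - 4 * A * \<epsilon>1) / pi =
        integral {- (pi / 2)..pi / 2} F / pi - 2 * \<eta> * C / pi - 4 * A * \<epsilon>1 / pi" by (simp only: diff_divide_distrib)
      ultimately show "integral {- (pi / 2)..pi / 2} F / pi - \<epsilon> \<le> (\<Sum>k<M. m k * (2 * r / pi - \<epsilon>2))"
        using \<eta>(3) \<epsilon> by linarith
    qed simp
    also have "\<dots> = (\<Sum>k<M. m k * (real n * (2 * r / pi - \<epsilon>2)))" by (simp add: sum_distrib_left mult.left_commute)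
    also have "\<dots> \<le> (\<Sum>k<M. m k * real (size (filter_mset (p k) (X n))))"
      using elim by (intro sum_mono mult_left_mono) (auto simp: m_def)
    also have "\<dots> \<le> (\<Sum>\<xi>\<in>#X n. g \<xi>)" by (rule weighted_count_le[OF point])
    finally show ?case .
  qed
qed

section \<open>Integrals against the counting measures and the limit measure\<close>

lemma sum_mset_eq_sum_count:
  fixes f :: "'a \<Rightarrow> real"
  assumes "finite S" "set_mset M \<subseteq> S"
  shows "(\<Sum>x\<in>#M. f x) = (\<Sum>x\<in>S. real (count M x) * f x)"
  using assms(2)
proof (induction M)
  case (add y M)
  have "real (count (add_mset y M) x) * f x = real (count M x) * f x + (if x = y then f x else 0)" for x
    by (simp add: algebra_simps)
  moreover have "(\<Sum>x\<in>S. if x = y then f x else 0) = f y" using add.prems assms(1) by simp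
  ultimately show ?case using add by (simp add: sum.distrib)
qed simp

lemma integral_zero_counting_measure:
  fixes p :: "complex poly" and f :: "complex \<Rightarrow> real"
  assumes p: "p \<noteq> 0" and f: "continuous_on UNIV f"
  shows "integral\<^sup>L (zero_counting_measure p) f = (\<Sum>\<zeta>\<in>#proots p. f \<zeta>) / real (degree p)"
proof -
  have fin: "finite {z. poly p z = 0}" using p by (rule poly_roots_finite)
  have "f \<in> borel_measurable borel" using f by (rule borel_measurable_continuous_onI)
  then have "integral\<^sup>L (zero_counting_measure p) f =
      integral\<^sup>L (point_measure {z. poly p z = 0} (\<lambda>z. ennreal (real (order z p) / real (degree p)))) f"
    unfolding zero_counting_measure_def by (intro integral_distr) auto
  also have "\<dots> = (\<Sum>z\<in>{z. poly p z = 0}. (real (order z p) / real (degree p)) *\<^sub>R f z)"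
    using fin by (intro lebesgue_integral_point_measure_finite) auto
  also have "\<dots> = (\<Sum>z\<in>{z. poly p z = 0}. real (count (proots p) z) * f z) / real (degree p)"
    using p by (simp add: sum_divide_distrib)
  also have "(\<Sum>z\<in>{z. poly p z = 0}. real (count (proots p) z) * f z) = (\<Sum>\<zeta>\<in>#proots p. f \<zeta>)"
    using p fin by (intro sum_mset_eq_sum_count[symmetric]) auto
  finally show ?thesis .
qed

context trajectory
begin

text \<open>The inverse of \<open>y\<close> reparametrizes \<open>\<gamma>\<close> by \<open>Im Phi\<close>.\<close>

definition "y_inv u = the_inv_into {0..1} y u"

lemma y_inj: "inj_on y {0..1}"
proof (rule inj_onI)
  fix s t assume "s \<in> {0..1}" "t \<in> {0..1}" "y s = y t"
  then show "s = t" using y_strict_mono[of s t] y_strict_mono[of t s] by (cases s t rule: linorder_cases) auto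
qed

lemma y_image: "y ` {0..1} = {- (pi / 2)..pi / 2}"
proof
  show "y ` {0..1} \<subseteq> {- (pi / 2)..pi / 2}"
  proof
    fix u assume "u \<in> y ` {0..1}"
    then obtain t where t: "0 \<le> t" "t \<le> 1" "u = y t" by auto
    have "y 0 \<le> y t" using y_strict_mono[of 0 t] t by (cases "t = 0") auto
    moreover have "y t \<le> y 1" using y_strict_mono[of t 1] t by (cases "t = 1") auto
    ultimately show "u \<in> {- (pi / 2)..pi / 2}" using t y_0 y_1 by simp
  qed
  show "{- (pi / 2)..pi / 2} \<subseteq> y ` {0..1}"
  proof
    fix u assume "u \<in> {- (pi / 2)..pi / 2}"
    then have "y 0 \<le> u" "u \<le> y 1" using y_0 y_1 by simp_all
    from IVT'[OF this _ cont_y] obtain t where "0 \<le> t" "t \<le> 1" "y t = u" by auto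
    then show "u \<in> y ` {0..1}" by auto
  qed
qed

lemma y_inv: "t \<in> {0..1} \<Longrightarrow> y_inv (y t) = t"
  unfolding y_inv_def using y_inj by (rule the_inv_into_f_f)

lemma continuous_y_inv: "continuous_on {- (pi / 2)..pi / 2} y_inv"
  unfolding y_image[symmetric] by (rule continuous_on_inv[OF cont_y compact_Icc]) (use y_inv in blast)

lemma y_inv_in: "u \<in> {- (pi / 2)..pi / 2} \<Longrightarrow> y_inv u \<in> {0..1}"
  unfolding y_image[symmetric] using y_inv by auto

lemma y_y_inv: "u \<in> {- (pi / 2)..pi / 2} \<Longrightarrow> y (y_inv u) = u"
  unfolding y_image[symmetric] using y_inv by auto

lemma continuous_along:
  fixes f :: "complex \<Rightarrow> real"
  assumes "continuous_on UNIV f"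
  shows "continuous_on {- (pi / 2)..pi / 2} (\<lambda>u. f (\<gamma> (y_inv u)))"
proof (rule continuous_on_compose2[OF assms])
  show "continuous_on {- (pi / 2)..pi / 2} (\<lambda>u. \<gamma> (y_inv u))"
    by (rule continuous_on_compose2[OF cont continuous_y_inv]) (use y_inv_in in blast)
qed simp

lemma along_eq_chart:
  assumes "\<bar>u\<bar> < pi / 2"
  shows "\<gamma> (y_inv u) = chart (\<i> * of_real u)"
proof -
  have u: "u \<in> {- (pi / 2)..pi / 2}" using assms by auto
  have "y_inv u \<noteq> 0" "y_inv u \<noteq> 1" using y_y_inv[OF u] y_0 y_1 assms by auto
  then have "y_inv u \<in> {0<..<1}" using y_inv_in[OF u] by simp
  then show ?thesis using chart_y[of "y_inv u"] y_y_inv[OF u] by simp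
qed

definition "mean f = integral {- (pi / 2)..pi / 2} (\<lambda>u. f (\<gamma> (y_inv u))) / pi" for f :: "complex \<Rightarrow> real"

text \<open>Substitution u = y t. The derivative of \<open>y\<close> is known in the open interval
  only, so the end points enter as an exceptional set.\<close>

lemma has_integral_along:
  fixes f :: "complex \<Rightarrow> real"
  assumes f: "continuous_on UNIV f"
  shows "((\<lambda>t. Im (k0 t) / pi * f (\<gamma> t)) has_integral mean f) {0<..<1}"
proof -
  define F where "F u = f (\<gamma> (y_inv u))" for u
  have "((\<lambda>t. Im (k0 t) *\<^sub>R F (y t)) has_integral (integral {y 0..y 1} F - integral {y 1..y 0} F)) {0..1}"
  proof (rule has_integral_substitution_general[of "{0, 1}" 0 1 y "- (pi / 2)" "pi / 2"])
    show "y ` {0..1} \<subseteq> {- (pi / 2)..pi / 2}" using y_image by simp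
    show "continuous_on {- (pi / 2)..pi / 2} F" unfolding F_def by (rule continuous_along[OF f])
    fix t :: real assume "t \<in> {0..1} - {0, 1}"
    then show "(y has_real_derivative Im (k0 t)) (at t within {0..1})"
      by (intro has_field_derivative_at_within[OF y_derivative]) auto
  qed (use cont_y in simp_all)
  moreover have "integral {y 1..y 0} F = 0" unfolding y_0 y_1 using pi_gt_zero by simp
  ultimately have "((\<lambda>t. Im (k0 t) * F (y t)) has_integral integral {- (pi / 2)..pi / 2} F) {0<..<1}"
    by (simp add: y_0 y_1 has_integral_Icc_iff_Ioo)
  then have "((\<lambda>t. Im (k0 t) * F (y t) / pi) has_integral mean f) {0<..<1}"
    unfolding mean_def F_def[symmetric] by (rule has_integral_divide)
  then show ?thesis
    by (rule has_integral_eq[rotated]) (simp add: F_def y_inv)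
qed

text \<open>The substitution is one for the gauge integral. Adding \<open>B\<close> makes the
  integrand nonnegative, hence absolutely integrable, which permits the passage to the Lebesgue
  integral.\<close>

lemma mu_P_integral:
  fixes f :: "complex \<Rightarrow> real"
  assumes f: "continuous_on UNIV f" and B: "\<And>z. \<bar>f z\<bar> \<le> B"
  shows "integral\<^sup>L (mu_P \<gamma>) f = mean f"
proof -
  define M where "M = restrict_space lborel {0<..<1::real}"
  have sp: "space M = {0<..<1}" by (simp add: M_def space_restrict_space)
  have sM: "sets M = sets (restrict_space borel {0<..<1})" unfolding M_def by (intro sets_restrict_space_cong) simp
  have meas: "k \<in> borel_measurable M" if "continuous_on {0<..<1} k" for k :: "real \<Rightarrow> 'b::topological_space"
    using borel_measurable_continuous_on_restrict[OF that] measurable_cong_sets[OF sM refl] by blast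
  have k0m: "(\<lambda>t. Im (k0 t) / pi) \<in> borel_measurable M" by (intro meas continuous_intros cont_k0) simp
  have \<gamma>m: "\<gamma> \<in> measurable M borel" by (intro meas continuous_on_subset[OF cont]) auto
  have fm: "f \<in> borel_measurable borel" using f by (rule borel_measurable_continuous_onI)
  have dens: "density M (\<lambda>t. ennreal (Re (1 / (\<i> * of_real pi) * (sqrt_plus \<gamma> t / \<gamma> t) * d t))) =
      density M (\<lambda>t. ennreal (Im (k0 t) / pi))"
  proof (rule density_cong)
    have eq: "ennreal (Im (k0 t) / pi) = ennreal (Re (1 / (\<i> * of_real pi) * (sqrt_plus \<gamma> t / \<gamma> t) * d t))" if "t \<in> space M" for t
      using that density_eq unfolding sp by metis
    show m: "(\<lambda>t. ennreal (Im (k0 t) / pi)) \<in> borel_measurable M" using k0m by (rule measurable_compose) simp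
    show "(\<lambda>t. ennreal (Re (1 / (\<i> * of_real pi) * (sqrt_plus \<gamma> t / \<gamma> t) * d t))) \<in> borel_measurable M"
      by (rule measurable_cong[THEN iffD1, OF eq m])
    show "AE t in M. ennreal (Re (1 / (\<i> * of_real pi) * (sqrt_plus \<gamma> t / \<gamma> t) * d t)) = ennreal (Im (k0 t) / pi)"
      using eq by (intro AE_I2) simp
  qed
  have hk: "integral {0<..<1} (\<lambda>t. Im (k0 t) / pi * g (\<gamma> t)) = mean g" "(\<lambda>t. Im (k0 t) / pi * g (\<gamma> t)) integrable_on {0<..<1}"
    if "continuous_on UNIV g" for g :: "complex \<Rightarrow> real"
    using integral_unique[OF has_integral_along[OF that]] has_integral_integrable[OF has_integral_along[OF that]] .
  have abs: "(\<lambda>t. Im (k0 t) / pi * g (\<gamma> t)) absolutely_integrable_on {0<..<1}"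
    if "continuous_on UNIV g" "\<And>z. 0 \<le> g z" for g :: "complex \<Rightarrow> real"
    using that Im_k0_pos by (intro nonnegative_absolutely_integrable_1 hk(2)) (auto intro!: mult_nonneg_nonneg divide_nonneg_pos simp: less_imp_le)
  have fB: "0 \<le> f z + B" "0 \<le> B" for z using B[of z] by linarith+
  have "(\<lambda>t. Im (k0 t) / pi * (f (\<gamma> t) + B) - Im (k0 t) / pi * B) absolutely_integrable_on {0<..<1}"
    by (intro set_integral_diff(1) abs continuous_on_add f continuous_on_const fB)
  moreover have "Im (k0 t) / pi * (f (\<gamma> t) + B) - Im (k0 t) / pi * B = Im (k0 t) / pi * f (\<gamma> t)" for t
    by (simp add: distrib_left add_divide_distrib)
  ultimately have abs_f: "set_integrable lebesgue {0<..<1} (\<lambda>t. Im (k0 t) / pi * f (\<gamma> t))" by (simp only:)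
  have prodm: "(\<lambda>t. Im (k0 t) / pi * f (\<gamma> t)) \<in> borel_measurable M"
    by (intro borel_measurable_times k0m measurable_compose[OF \<gamma>m fm])
  have "(\<lambda>t. indicator {0<..<1} t *\<^sub>R (Im (k0 t) / pi * f (\<gamma> t))) \<in> borel_measurable lborel"
    using prodm unfolding M_def by (subst (asm) borel_measurable_restrict_space_iff) simp_all
  then have "set_integrable lborel {0<..<1} (\<lambda>t. Im (k0 t) / pi * f (\<gamma> t))"
    using abs_f unfolding set_integrable_def by (subst (asm) integrable_completion) simp_all
  then have "(LINT t:{0<..<1}|lborel. Im (k0 t) / pi * f (\<gamma> t)) = mean f"
    using set_borel_integral_eq_integral(2) hk(1)[OF f] by metis
  moreover have "integral\<^sup>L (mu_P \<gamma>) f = integral\<^sup>L (density M (\<lambda>t. ennreal (Im (k0 t) / pi))) (\<lambda>t. f (\<gamma> t))"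
    unfolding mu_P_def M_def[symmetric] dens using fm \<gamma>m by (intro integral_distr) simp_all
  moreover have "\<dots> = integral\<^sup>L M (\<lambda>t. (Im (k0 t) / pi) *\<^sub>R f (\<gamma> t))"
    using Im_k0_pos by (intro integral_density measurable_compose[OF \<gamma>m fm] k0m AE_I2) (simp add: sp less_imp_le)
  moreover have "\<dots> = (LINT t:{0<..<1}|lborel. Im (k0 t) / pi * f (\<gamma> t))"
    unfolding M_def set_lebesgue_integral_def by (subst integral_restrict_space) simp_all
  ultimately show ?thesis by simp
qed

lemma integrable_along:
  fixes f :: "complex \<Rightarrow> real"
  assumes "continuous_on UNIV f"
  shows "(\<lambda>u. f (\<gamma> (y_inv u))) integrable_on {- (pi / 2)..pi / 2}"
  by (intro integrable_continuous_real continuous_along assms)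

lemma mean_add_const:
  assumes "continuous_on UNIV f"
  shows "mean (\<lambda>z. f z + B) = mean f + B"
  unfolding mean_def using integrable_along[OF assms]
  by (subst integral_add) (simp_all add: add_divide_distrib integrable_const_ivl)

lemma mean_const_diff:
  assumes "continuous_on UNIV f"
  shows "mean (\<lambda>z. B - f z) = B - mean f"
  unfolding mean_def using integrable_along[OF assms]
  by (subst integral_diff) (simp_all add: diff_divide_distrib integrable_const_ivl)

end

section \<open>From lower bounds on counts to convergence\<close>

context pade_trajectory
begin

text \<open>Zeros outside the left half-plane are dropped from the sum, which only lowers it because
  \<open>f\<close> is nonnegative.\<close>

lemma sum_over_zeros_lower:
  fixes f :: "complex \<Rightarrow> real"
  assumes f: "continuous_on UNIV f" "\<And>z. 0 \<le> f z" "\<And>z. f z \<le> B" and \<epsilon>: "0 < \<epsilon>"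
  shows "\<forall>\<^sub>F n in sequentially. real n * (mean f - \<epsilon>) \<le> (\<Sum>\<zeta>\<in>#proots (P n). f \<zeta>)"
proof -
  define X where "X n = image_mset Phi (filter_mset (\<lambda>\<zeta>. Re \<zeta> < 0) (proots (P n)))" for n
  have "\<forall>\<^sub>F n in sequentially. real n * (integral {- (pi / 2)..pi / 2} (\<lambda>u. f (\<gamma> (y_inv u))) / pi - \<epsilon>) \<le> (\<Sum>\<xi>\<in>#X n. f (chart \<xi>))"
  proof (rule counting_lower_bound[OF open_chart_domain segment_in_chart_domain _ _ _ continuous_along[OF f(1)] _ _ _ \<epsilon>])
    show "continuous_on chart_domain (\<lambda>\<xi>. f (chart \<xi>))"
      by (rule continuous_on_compose2[OF f(1) holomorphic_on_imp_continuous_on[OF chart_holomorphic]]) simp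
    show "f (\<gamma> (y_inv u)) = f (chart (\<i> * of_real u))" if "\<bar>u\<bar> < pi / 2" for u
      using along_eq_chart[OF that] by simp
    fix u r r0 \<epsilon> :: real assume a: "cball (\<i> * of_real u) r0 \<subseteq> chart_domain" "0 < r" "r < r0" "0 < \<epsilon>"
    have "size (filter_mset (\<lambda>\<xi>. norm (\<xi> - \<i> * of_real u) < r) (X n)) =
      size (filter_mset (\<lambda>\<zeta>. Re \<zeta> < 0 \<and> norm (Phi \<zeta> - \<i> * of_real u) < r) (proots (P n)))" for n
      unfolding X_def filter_mset_image_mset filter_filter_mset size_image_mset by (simp add: conj_commute)
    then show "\<forall>\<^sub>F n in sequentially. real n * (2 * r / pi - \<epsilon>) \<le> real (size (filter_mset (\<lambda>\<xi>. norm (\<xi> - \<i> * of_real u) < r) (X n)))"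
      using zero_count[OF a] by simp
  qed (use f in blast)+
  then show ?thesis
  proof eventually_elim
    case (elim n)
    have "(\<Sum>\<xi>\<in>#X n. f (chart \<xi>)) = (\<Sum>\<zeta>\<in>#filter_mset (\<lambda>\<zeta>. Re \<zeta> < 0) (proots (P n)). f (chart (Phi \<zeta>)))"
      unfolding X_def image_mset.compositionality o_def by (rule refl)
    also have "\<dots> = (\<Sum>\<zeta>\<in>#filter_mset (\<lambda>\<zeta>. Re \<zeta> < 0) (proots (P n)). f \<zeta>)"
      by (intro arg_cong[of _ _ sum_mset] image_mset_cong) (simp add: chart_Phi)
    also have "(\<Sum>\<zeta>\<in>#filter_mset (\<lambda>\<zeta>. Re \<zeta> < 0) Z. f \<zeta>) \<le> (\<Sum>\<zeta>\<in>#Z. f \<zeta>)" for Z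
      by (induction Z) (use f(2) in \<open>auto intro: add_increasing\<close>)
    finally show ?case using elim by (simp add: mean_def)
  qed
qed

lemma degree_P_le: "0 < n \<Longrightarrow> degree (P n) \<le> n"
  using pade[of n] by (simp add: pade_pair_def)

lemma degree_P_pos: "\<forall>\<^sub>F n in sequentially. 0 < degree (P n)"
proof -
  have "mean (\<lambda>_. 1) = 1" unfolding mean_def by simp
  moreover have "\<forall>\<^sub>F n in sequentially. real n * (mean (\<lambda>_. 1) - 1 / 2) \<le> (\<Sum>\<zeta>\<in>#proots (P n). 1)"
    by (rule sum_over_zeros_lower[of _ 1]) simp_all
  ultimately have "\<forall>\<^sub>F n in sequentially. real n * (1 / 2) \<le> (\<Sum>\<zeta>\<in>#proots (P n). 1::real)" by simp
  then show ?thesis using eventually_gt_at_top[of 0]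
  proof eventually_elim
    case (elim n)
    have "(\<Sum>\<zeta>\<in>#proots (P n). 1::real) = real (degree (P n))"
      by (simp add: size_proots_complex)
    then have "real n * (1 / 2) \<le> real (degree (P n))" using elim by simp
    moreover have "0 < real n" using elim by simp
    ultimately have "0 < real (degree (P n))" by linarith
    then show ?case by simp
  qed
qed

text \<open>Lower bounds for the nonnegative functions \<open>f + B\<close> and \<open>B - f\<close>
  amount to a lower and an upper bound for \<open>f\<close>. Since the degree of \<open>P n\<close>
  is at most \<open>n\<close>, it may replace \<open>n\<close> in them.\<close>

lemma mean_over_zeros_tendsto:
  fixes f :: "complex \<Rightarrow> real"
  assumes f: "continuous_on UNIV f" "\<And>z. \<bar>f z\<bar> \<le> B"
  shows "(\<lambda>n. (\<Sum>\<zeta>\<in>#proots (P n). f \<zeta>) / real (degree (P n))) \<longlonglongrightarrow> mean f"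
proof -
  have lower: "\<forall>\<^sub>F n in sequentially. (mean g - \<epsilon>) * real (degree (P n)) \<le> (\<Sum>\<zeta>\<in>#proots (P n). g \<zeta>)"
    if g: "continuous_on UNIV g" "\<And>z. 0 \<le> g z" "\<And>z. g z \<le> 2 * B" and \<epsilon>: "0 < \<epsilon>" for g :: "complex \<Rightarrow> real" and \<epsilon>
    using sum_over_zeros_lower[OF g \<epsilon>] eventually_gt_at_top[of 0]
  proof eventually_elim
    case (elim n)
    show ?case
    proof (cases "0 \<le> mean g - \<epsilon>")
      case True
      then have "(mean g - \<epsilon>) * real (degree (P n)) \<le> (mean g - \<epsilon>) * real n"
        using degree_P_le[of n] elim by (intro mult_left_mono) auto
      then show ?thesis using elim by (simp add: mult.commute)
    next
      case False
      then have "(mean g - \<epsilon>) * real (degree (P n)) \<le> 0" by (intro mult_nonpos_nonneg) auto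
      moreover have "0 \<le> (\<Sum>\<zeta>\<in>#Z. g \<zeta>)" for Z by (induction Z) (simp_all add: g(2))
      ultimately show ?thesis using order_trans by blast
    qed
  qed
  have fB: "0 \<le> f z + B" "f z + B \<le> 2 * B" "0 \<le> B - f z" "B - f z \<le> 2 * B" for z using f(2)[of z] by linarith+
  have const: "(\<Sum>\<zeta>\<in>#proots (P n). B) = B * real (degree (P n))" for n
    unfolding size_proots_complex[symmetric] by simp
  show ?thesis
  proof (rule tendstoI)
    fix e :: real assume "0 < e"
    then have e: "0 < e / 2" by simp
    have "\<forall>\<^sub>F n in sequentially. (mean (\<lambda>z. f z + B) - e / 2) * real (degree (P n)) \<le> (\<Sum>\<zeta>\<in>#proots (P n). f \<zeta> + B)"
      by (rule lower[OF _ fB(1,2) e]) (intro continuous_on_add f(1) continuous_on_const)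
    moreover have "\<forall>\<^sub>F n in sequentially. (mean (\<lambda>z. B - f z) - e / 2) * real (degree (P n)) \<le> (\<Sum>\<zeta>\<in>#proots (P n). B - f \<zeta>)"
      by (rule lower[OF _ fB(3,4) e]) (intro continuous_on_diff f(1) continuous_on_const)
    ultimately show "\<forall>\<^sub>F n in sequentially. dist ((\<Sum>\<zeta>\<in>#proots (P n). f \<zeta>) / real (degree (P n))) (mean f) < e"
      using degree_P_pos
    proof eventually_elim
      case (elim n)
      define D where "D = real (degree (P n))"
      define S where "S = (\<Sum>\<zeta>\<in>#proots (P n). f \<zeta>)"
      have D: "0 < D" using elim(3) by (simp add: D_def)
      have split: "(\<Sum>\<zeta>\<in>#Z. f \<zeta> + B) = (\<Sum>\<zeta>\<in>#Z. f \<zeta>) + (\<Sum>\<zeta>\<in>#Z. B)" "(\<Sum>\<zeta>\<in>#Z. B - f \<zeta>) = (\<Sum>\<zeta>\<in>#Z. B) - (\<Sum>\<zeta>\<in>#Z. f \<zeta>)" for Z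
        by (induction Z) simp_all
      have "(mean f + B - e / 2) * D \<le> S + B * D" "(B - mean f - e / 2) * D \<le> B * D - S"
        using elim(1,2) unfolding split const mean_add_const[OF f(1)] mean_const_diff[OF f(1)] D_def S_def by simp_all
      then have "(mean f - e / 2) * D \<le> S" "S \<le> (mean f + e / 2) * D" by (simp_all add: algebra_simps)
      then have "mean f - e / 2 \<le> S / D" "S / D \<le> mean f + e / 2" using D by (simp_all add: pos_le_divide_eq pos_divide_le_eq)
      then show ?case using \<open>0 < e\<close> unfolding D_def S_def dist_real_def by linarith
    qed
  qed
qed

end

lemma bounded_if_vanishes_at_infinity:
  fixes f :: "complex \<Rightarrow> real"
  assumes f: "continuous_on UNIV f" "(f \<longlongrightarrow> 0) at_infinity"
  obtains B where "\<And>z. \<bar>f z\<bar> \<le> B"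
proof -
  have "eventually (\<lambda>z. dist (f z) 0 < 1) at_infinity" using f(2) by (rule tendstoD) simp
  then obtain b where b: "\<And>z. b \<le> norm z \<Longrightarrow> \<bar>f z\<bar> < 1" unfolding eventually_at_infinity by auto
  have "compact (f ` cball 0 b)" by (intro compact_continuous_image continuous_on_subset[OF f(1)]) auto
  from compact_imp_bounded[OF this] obtain B where B: "\<And>z. z \<in> cball 0 b \<Longrightarrow> \<bar>f z\<bar> \<le> B"
    unfolding bounded_iff by (metis imageI real_norm_def)
  show ?thesis
  proof (rule that[of "max B 1"])
    show "\<bar>f z\<bar> \<le> max B 1" for z
    proof (cases "b \<le> norm z")
      case True
      from b[OF this] show ?thesis by simp
    next
      case False
      then have "z \<in> cball 0 b" by simp
      from B[OF this] show ?thesis by simp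
    qed
  qed
qed

text \<open>The second conclusion is recorded because, applied to the reflected problem, it shows
  \<open>q n \<noteq> 0\<close>.\<close>

lemma weak_star_conv_zeros_P:
  fixes z :: "nat \<Rightarrow> nat \<Rightarrow> complex" and p q :: "nat \<Rightarrow> complex poly" and E :: "nat \<Rightarrow> complex \<Rightarrow> complex"
    and \<alpha> c :: real
  assumes \<gamma>: "is_gamma1 \<gamma>" and \<alpha>: "0 < \<alpha>"
    and z: "\<And>n j. 0 < n \<Longrightarrow> j \<le> 2 * n \<Longrightarrow> norm (z n j) \<le> c * real n powr (1 - \<alpha>)"
    and pq: "\<And>n. 0 < n \<Longrightarrow> p n \<noteq> 0 \<or> q n \<noteq> 0"
    and deg: "\<And>n. 0 < n \<Longrightarrow> degree (p n) \<le> n" "\<And>n. 0 < n \<Longrightarrow> degree (q n) \<le> n"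
    and E: "\<And>n. 0 < n \<Longrightarrow> E n holomorphic_on UNIV"
      "\<And>n w. 0 < n \<Longrightarrow> poly (p n) w * exp (- w / 2) + poly (q n) w * exp (w / 2) = (\<Prod>j\<le>2*n. w - z n j) * E n w"
  shows "weak_star_conv (\<lambda>n. zero_counting_measure (pcompose (p n) [:0, of_nat (2*n):])) (mu_P \<gamma>)"
    "\<And>n. 0 < n \<Longrightarrow> p n \<noteq> 0"
proof -
  define P where "P n = pcompose (p n) [:0, of_nat (2*n):]" for n
  define Q where "Q n = pcompose (q n) [:0, of_nat (2*n):]" for n
  define a where "a n j = z n j / of_nat (2 * n)" for n j
  \<comment> \<open>The power of \<open>2 * n\<close> comes from the \<open>2 * n + 1\<close>
    factors of the product, each of which is rescaled.\<close>
  define E' where "E' n w = of_nat (2 * n) ^ (2 * n + 1) * E n (of_nat (2 * n) * w)" for n w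
  define \<tau> where "\<tau> n = c / 2 * real n powr (- \<alpha>)" for n
  \<comment> \<open>Half of the exponent \<alpha> lets the radius grow, the other half makes
    \<open>\<tau> n * \<rho> n\<close> tend to 0.\<close>
  define \<rho> where "\<rho> n = real n powr (\<alpha> / 2)" for n
  have deg_lin: "degree [:0, of_nat (2*n) :: complex:] = 1" if "0 < n" for n using that by simp
  have nz: "pcompose r [:0, of_nat (2*n):] \<noteq> 0" if "0 < n" "r \<noteq> 0" for n and r :: "complex poly"
    using pcompose_eq_0[of r "[:0, of_nat (2*n):]"] deg_lin[OF that(1)] that(2) by auto
  have deg': "degree (pcompose r [:0, of_nat (2*n):]) \<le> n" if "0 < n" "degree r \<le> n" for n and r :: "complex poly"
    using degree_pcompose_le[of r "[:0, of_nat (2*n):]"] deg_lin[OF that(1)] that(2) by simp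
  have pade: "pade_pair n (a n) (P n) (Q n) (E' n) (\<tau> n)" if n: "0 < n" for n
  proof
    show "norm (a n j) \<le> \<tau> n" if "j \<le> 2 * n" for j
    proof -
      have "norm (a n j) = norm (z n j) / (2 * real n)" by (simp add: a_def norm_divide)
      also have "\<dots> \<le> c * real n powr (1 - \<alpha>) / (2 * real n)" using z[OF n that] by (intro divide_right_mono) auto
      also have "real n powr (1 - \<alpha>) = real n * real n powr (- \<alpha>)" using n by (simp add: powr_diff powr_minus divide_inverse)
      finally show ?thesis using n by (simp add: \<tau>_def)
    qed
    show "degree (P n) \<le> n" "degree (Q n) \<le> n" using deg' deg n by (simp_all add: P_def Q_def)
    show "P n \<noteq> 0 \<or> Q n \<noteq> 0" using nz[OF n] pq[OF n] by (auto simp: P_def Q_def)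
    show "E' n holomorphic_on UNIV" unfolding E'_def[abs_def]
      by (intro holomorphic_intros holomorphic_on_compose_gen[OF _ E(1)[OF n], unfolded o_def]) auto
    show "poly (P n) w * exp (- (of_nat n * w)) + poly (Q n) w * exp (of_nat n * w) = (\<Prod>j\<le>2*n. w - a n j) * E' n w" for w
    proof -
      define v where "v = of_nat (2 * n) * w"
      have "(\<Prod>j\<le>2*n. v - z n j) = (\<Prod>j\<le>2*n. of_nat (2 * n) * (w - a n j))"
        using n by (intro prod.cong refl) (simp add: v_def a_def right_diff_distrib)
      also have "\<dots> = of_nat (2 * n) ^ (2 * n + 1) * (\<Prod>j\<le>2*n. w - a n j)"
        by (simp add: prod.distrib)
      finally have pr: "(\<Prod>j\<le>2*n. v - z n j) = of_nat (2 * n) ^ (2 * n + 1) * (\<Prod>j\<le>2*n. w - a n j)" .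
      have "poly (P n) w = poly (p n) v" "poly (Q n) w = poly (q n) v"
        by (simp_all add: P_def Q_def poly_pcompose v_def mult.commute)
      moreover have "- (of_nat n * w) = - v / 2" "of_nat n * w = v / 2" by (simp_all add: v_def)
      ultimately have "poly (P n) w * exp (- (of_nat n * w)) + poly (Q n) w * exp (of_nat n * w) = (\<Prod>j\<le>2*n. v - z n j) * E n v"
        using E(2)[OF n, of v] by (simp only:)
      then show ?thesis unfolding pr E'_def v_def[symmetric] by (simp only: mult_ac)
    qed
  qed (fact n)
  interpret pade_trajectory \<gamma> a P Q E' \<tau> \<rho>
  proof (intro pade_trajectory.intro trajectory.intro pade_sequence.intro)
    show "is_gamma1 \<gamma>" by (fact \<gamma>)
    show "pade_pair n (a n) (P n) (Q n) (E' n) (\<tau> n)" if "0 < n" for n using that by (rule pade)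
    show "filterlim \<rho> at_top sequentially" unfolding \<rho>_def using \<alpha> by real_asymp
    have "\<tau> n * \<rho> n = c / 2 * real n powr (- (\<alpha> / 2))" for n
      by (simp add: \<tau>_def \<rho>_def mult.assoc flip: powr_add)
    moreover have "(\<lambda>n. c / 2 * real n powr (- (\<alpha> / 2))) \<longlonglongrightarrow> 0" using \<alpha> by real_asymp
    ultimately show "(\<lambda>n. \<tau> n * \<rho> n) \<longlonglongrightarrow> 0" by (simp only:)
  qed
  show "p n \<noteq> 0" if "0 < n" for n using P_nz[OF that] by (auto simp: P_def)
  have "weak_star_conv (\<lambda>n. zero_counting_measure (P n)) (mu_P \<gamma>)"
    unfolding weak_star_conv_def
  proof (intro allI impI)
    fix f :: "complex \<Rightarrow> real" assume f: "continuous_on UNIV f" "(f \<longlongrightarrow> 0) at_infinity"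
    obtain B where B: "\<And>z. \<bar>f z\<bar> \<le> B" by (rule bounded_if_vanishes_at_infinity[OF f]) blast
    have "\<forall>\<^sub>F n in sequentially. (\<Sum>\<zeta>\<in>#proots (P n). f \<zeta>) / real (degree (P n)) = integral\<^sup>L (zero_counting_measure (P n)) f"
      using eventually_gt_at_top[of 0]
    proof eventually_elim
      case (elim n)
      show ?case using integral_zero_counting_measure[OF P_nz[OF elim] f(1)] by simp
    qed
    from tendsto_cong[THEN iffD1, OF this mean_over_zeros_tendsto[OF f(1) B]]
    show "(\<lambda>n. integral\<^sup>L (zero_counting_measure (P n)) f) \<longlonglongrightarrow> integral\<^sup>L (mu_P \<gamma>) f"
      unfolding mu_P_integral[OF f(1) B] .
  qed
  then show "weak_star_conv (\<lambda>n. zero_counting_measure (pcompose (p n) [:0, of_nat (2*n):])) (mu_P \<gamma>)"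
    unfolding P_def .
qed

section \<open>Reflection in the origin\<close>

lemma proots_reflect:
  fixes p :: "complex poly"
  assumes p: "p \<noteq> 0"
  shows "proots (pcompose p [:0, - 1:]) = image_mset uminus (proots p)"
proof -
  have *: "pcompose (\<Prod>\<zeta>\<in>#Z. [:- \<zeta>, 1:]) [:0, - 1:] \<noteq> 0 \<and>
     proots (pcompose (\<Prod>\<zeta>\<in>#Z. [:- \<zeta>, 1:]) [:0, - 1:]) = image_mset uminus Z" for Z :: "complex multiset"
  proof (induction Z)
    case empty
    then show ?case by (simp add: pcompose_1)
  next
    case (add \<zeta> Z)
    have l: "pcompose [:- \<zeta>, 1:] [:0, - 1:] = smult (- 1) [:\<zeta>, 1:]" by (simp add: pcompose_pCons)
    have 1: "smult (- 1) [:\<zeta>, 1:] \<noteq> 0" "proots (smult (- 1) [:\<zeta>, 1:]) = {#- \<zeta>#}"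
      by (simp, subst proots_smult, simp_all only: proots_linear_factor, simp)
    have 2: "pcompose (\<Prod>\<zeta>\<in>#add_mset \<zeta> Z. [:- \<zeta>, 1:]) [:0, - 1:] = smult (- 1) [:\<zeta>, 1:] * pcompose (\<Prod>\<zeta>\<in>#Z. [:- \<zeta>, 1:]) [:0, - 1:]"
      unfolding image_mset_add_mset prod_mset.add_mset pcompose_mult l by (rule refl)
    show ?case unfolding 2 proots_mult[OF 1(1) conjunct1[OF add.IH]] 1(2) conjunct2[OF add.IH]
      using 1(1) conjunct1[OF add.IH] by (intro conjI no_zero_divisors) simp_all
  qed
  have "p = smult (lead_coeff p) (\<Prod>\<zeta>\<in>#proots p. [:- \<zeta>, 1:])" by (rule complex_poly_decompose_multiset[symmetric])
  then have "pcompose p [:0, - 1:] = smult (lead_coeff p) (pcompose (\<Prod>\<zeta>\<in>#proots p. [:- \<zeta>, 1:]) [:0, - 1:])"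
    by (metis pcompose_smult)
  then show ?thesis using p *[of "proots p"] by simp
qed

lemma integral_zero_counting_measure_reflect:
  fixes p :: "complex poly" and f :: "complex \<Rightarrow> real"
  assumes p: "p \<noteq> 0" and f: "continuous_on UNIV f"
  shows "integral\<^sup>L (zero_counting_measure (pcompose p [:0, - 1:])) (\<lambda>z. f (- z)) = integral\<^sup>L (zero_counting_measure p) f"
proof -
  have "pcompose p [:0, - 1:] \<noteq> 0" using pcompose_eq_0[of p "[:0, - 1:]"] p by auto
  moreover have "continuous_on UNIV (\<lambda>z. f (- z))" by (rule continuous_on_compose2[OF f]) (auto intro!: continuous_intros)
  moreover have "degree (pcompose p [:0, - 1:]) = degree p" by (simp add: degree_pcompose)
  ultimately show ?thesis
    unfolding integral_zero_counting_measure[OF p f] proots_reflect[OF p]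
    by (subst integral_zero_counting_measure) (simp_all add: proots_reflect[OF p] image_mset.compositionality o_def)
qed

context trajectory
begin

text \<open>The sign changes of the curve and of its derivative cancel, so both measures come from
  the same density on the parameter interval.\<close>

lemma mu_Q_eq_reflect: "mu_Q \<gamma> = distr (mu_P \<gamma>) borel uminus"
proof -
  define M where "M = restrict_space lborel {0<..<1::real}"
  have sp: "space M = {0<..<1}" by (simp add: M_def space_restrict_space)
  have sM: "sets M = sets (restrict_space borel {0<..<1})" unfolding M_def by (intro sets_restrict_space_cong) simp
  have meas: "k \<in> borel_measurable M" if "continuous_on {0<..<1} k" for k :: "real \<Rightarrow> 'b::topological_space"
    using borel_measurable_continuous_on_restrict[OF that] measurable_cong_sets[OF sM refl] by blast
  define D where "D t = ennreal (Re (1 / (\<i> * of_real pi) * (sqrt_plus \<gamma> t / \<gamma> t) * d t))" for t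
  define D2 where "D2 t = ennreal (Re (1 / (\<i> * of_real pi) * (sqrt_plus \<gamma> t / - \<gamma> t) * vector_derivative (\<lambda>t. - \<gamma> t) (at t)))" for t
  have "(\<lambda>t. Im (k0 t) / pi) \<in> borel_measurable M" by (intro meas continuous_intros cont_k0) simp
  then have m: "(\<lambda>t. ennreal (Im (k0 t) / pi)) \<in> borel_measurable M" by (rule measurable_compose) simp
  have "ennreal (Im (k0 t) / pi) = D t" if "t \<in> space M" for t
    using that density_eq unfolding sp D_def by metis
  from measurable_cong[THEN iffD1, OF this m] have Dm: "D \<in> borel_measurable M" .
  have eq: "D t = D2 t" if "t \<in> space M" for t
  proof -
    have "vector_derivative (\<lambda>t. - \<gamma> t) (at t) = - d t"
      using has_d[of t] that by (intro vector_derivative_at has_vector_derivative_minus) (simp add: sp)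
    then show ?thesis by (simp add: D_def D2_def)
  qed
  have D2m: "D2 \<in> borel_measurable M" by (rule measurable_cong[THEN iffD1, OF eq Dm])
  have dens: "density M D2 = density M D" using eq by (intro density_cong D2m Dm AE_I2) simp
  have \<gamma>m: "\<gamma> \<in> measurable (density M D) borel" using meas[OF continuous_on_subset[OF cont]] by force
  have "mu_Q \<gamma> = distr (density M D2) borel (\<lambda>t. - \<gamma> t)"
    by (simp add: mu_Q_def Let_def M_def D2_def[abs_def])
  also have "\<dots> = distr (distr (density M D) borel \<gamma>) borel uminus"
    unfolding dens by (subst distr_distr[OF _ \<gamma>m]) (simp_all add: o_def)
  also have "distr (density M D) borel \<gamma> = mu_P \<gamma>" by (simp add: mu_P_def M_def D_def[abs_def])
  finally show ?thesis .
qed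

lemma mu_Q_integral:
  fixes f :: "complex \<Rightarrow> real"
  assumes "continuous_on UNIV f"
  shows "integral\<^sup>L (mu_Q \<gamma>) f = integral\<^sup>L (mu_P \<gamma>) (\<lambda>z. f (- z))"
proof -
  have "sets (mu_P \<gamma>) = sets borel" by (simp add: mu_P_def)
  moreover have "uminus \<in> measurable borel (borel :: complex measure)"
    by (rule borel_measurable_continuous_onI) (intro continuous_intros)
  ultimately have "uminus \<in> measurable (mu_P \<gamma>) (borel :: complex measure)"
    using measurable_cong_sets by blast
  then show ?thesis unfolding mu_Q_eq_reflect
    by (intro integral_distr borel_measurable_continuous_onI assms)
qed

end

theorem theorem1p4:
  fixes z :: "nat \<Rightarrow> nat \<Rightarrow> complex"
    and p q P Q :: "nat \<Rightarrow> complex poly"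
    and \<alpha> c :: real
    and \<gamma> :: "real \<Rightarrow> complex"
  assumes "is_gamma1 \<gamma>"
    and "0 < \<alpha>" and "\<alpha> \<le> 1" and "0 < c"
    and "\<And>n. n > 0 \<Longrightarrow> (MAX j\<in>{0..2*n}. norm (z n j)) \<le> c * real n powr (1 - \<alpha>)"
    and "\<And>n. n > 0 \<Longrightarrow> p n \<noteq> 0 \<or> q n \<noteq> 0"
    and "\<And>n. n > 0 \<Longrightarrow> degree (p n) \<le> n"
    and "\<And>n. n > 0 \<Longrightarrow> degree (q n) \<le> n"
    and "\<And>n j. n > 0 \<Longrightarrow> j \<le> 2*n \<Longrightarrow>
           (\<lambda>w. poly (p n) w * exp (- w / 2) + poly (q n) w * exp (w / 2))
             \<in> O[at (z n j)](\<lambda>w. \<Prod>i=0..2*n. (w - z n i))"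
    and "\<And>n. P n = pcompose (p n) [:0, of_nat (2*n):]"
    and "\<And>n. Q n = pcompose (q n) [:0, of_nat (2*n):]"
  shows "weak_star_conv (\<lambda>n. zero_counting_measure (P n)) (mu_P \<gamma>) \<and>
         weak_star_conv (\<lambda>n. zero_counting_measure (Q n)) (mu_Q \<gamma>)"
proof
  note \<gamma> = assms(1) and \<alpha> = assms(2) and pq = assms(6) and degp = assms(7) and degq = assms(8)
  have z: "norm (z n j) \<le> c * real n powr (1 - \<alpha>)" if "0 < n" "j \<le> 2 * n" for n j
  proof -
    have "norm (z n j) \<le> (MAX j\<in>{0..2*n}. norm (z n j))" using that(2) by (intro Max_ge) auto
    then show ?thesis using assms(5)[OF that(1)] by (rule order_trans)
  qed
  \<comment> \<open>The implication stands under the quantifier so that one choice of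
    \<open>E\<close> serves all \<open>n\<close>, with an arbitrary value at
    \<open>n = 0\<close>.\<close>
  have "\<exists>E. 0 < n \<longrightarrow> E holomorphic_on UNIV \<and>
      (\<forall>w. poly (p n) w * exp (- w / 2) + poly (q n) w * exp (w / 2) = (\<Prod>j\<le>2*n. w - z n j) * E w)" for n
  proof (cases "0 < n")
    case True
    obtain E where "E holomorphic_on UNIV" "\<And>w. poly (p n) w * exp (- w / 2) + poly (q n) w * exp (w / 2) = (\<Prod>j\<in>{0..2*n}. w - z n j) * E w"
    proof (rule entire_quotient[of "\<lambda>w. poly (p n) w * exp (- w / 2) + poly (q n) w * exp (w / 2)" "{0..2*n}" "z n"])
      show "(\<lambda>w. poly (p n) w * exp (- w / 2) + poly (q n) w * exp (w / 2)) holomorphic_on UNIV"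
        by (intro holomorphic_intros) auto
      show "(\<lambda>w. poly (p n) w * exp (- w / 2) + poly (q n) w * exp (w / 2)) \<in> O[at (z n j)](\<lambda>w. \<Prod>j\<in>{0..2*n}. w - z n j)"
        if "j \<in> {0..2*n}" for j using that by (intro assms(9)[OF True]) simp
    qed auto
    then show ?thesis unfolding atLeast0AtMost by blast
  qed auto
  then obtain E where E: "\<And>n. 0 < n \<Longrightarrow> E n holomorphic_on UNIV"
    "\<And>n w. 0 < n \<Longrightarrow> poly (p n) w * exp (- w / 2) + poly (q n) w * exp (w / 2) = (\<Prod>j\<le>2*n. w - z n j) * E n w"
    by metis
  show "weak_star_conv (\<lambda>n. zero_counting_measure (P n)) (mu_P \<gamma>)"
    unfolding assms(10) by (rule weak_star_conv_zeros_P(1)[OF \<gamma> \<alpha> z pq degp degq E])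
  text \<open>The reflection \<open>w \<mapsto> - w\<close> interchanges the roles of \<open>p\<close> and \<open>q\<close>.\<close>
  define p' where "p' n = pcompose (q n) [:0, - 1:]" for n
  define q' where "q' n = pcompose (p n) [:0, - 1:]" for n
  have pq': "p' n \<noteq> 0 \<or> q' n \<noteq> 0" if "0 < n" for n
    using pq[OF that] pcompose_eq_0[of "p n" "[:0, - 1:]"] pcompose_eq_0[of "q n" "[:0, - 1:]"] by (auto simp: p'_def q'_def)
  have deg': "degree (p' n) \<le> n" "degree (q' n) \<le> n" if "0 < n" for n
    using degp[OF that] degq[OF that] by (simp_all add: p'_def q'_def degree_pcompose)
  have z': "norm (- z n j) \<le> c * real n powr (1 - \<alpha>)" if "0 < n" "j \<le> 2 * n" for n j
    using z[OF that] by simp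
  have E1: "(\<lambda>w. - E n (- w)) holomorphic_on UNIV" if "0 < n" for n
    by (intro holomorphic_intros holomorphic_on_compose_gen[OF _ E(1)[OF that], unfolded o_def]) auto
  have E2: "poly (p' n) w * exp (- w / 2) + poly (q' n) w * exp (w / 2) = (\<Prod>j\<le>2*n. w - - z n j) * - E n (- w)"
    if "0 < n" for n w
  proof -
    \<comment> \<open>The number of factors is odd, so the reflection leaves one minus sign, which
      \<open>- E n (- w)\<close> absorbs.\<close>
    have "(\<Prod>j\<le>2*n. - w - z n j) = (\<Prod>j\<le>2*n. (- 1) * (w - - z n j))" by (intro prod.cong) simp_all
    also have "\<dots> = - (\<Prod>j\<le>2*n. w - - z n j)" unfolding prod.distrib by simp
    finally show ?thesis using E(2)[OF that, of "- w"] by (simp add: p'_def q'_def poly_pcompose add.commute)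
  qed
  have conv: "weak_star_conv (\<lambda>n. zero_counting_measure (pcompose (p' n) [:0, of_nat (2*n):])) (mu_P \<gamma>)"
    by (rule weak_star_conv_zeros_P(1)[OF \<gamma> \<alpha> z' pq' deg' E1 E2])
  have p'_nz: "p' n \<noteq> 0" if "0 < n" for n
    by (rule weak_star_conv_zeros_P(2)[OF \<gamma> \<alpha> z' pq' deg' E1 E2]) (simp_all add: that)
  show "weak_star_conv (\<lambda>n. zero_counting_measure (Q n)) (mu_Q \<gamma>)"
    unfolding weak_star_conv_def
  proof (intro allI impI)
    fix f :: "complex \<Rightarrow> real" assume f: "continuous_on UNIV f" "(f \<longlongrightarrow> 0) at_infinity"
    interpret trajectory \<gamma> by (rule trajectory.intro[OF \<gamma>])
    have "continuous_on UNIV (\<lambda>z. f (- z))" by (rule continuous_on_compose2[OF f(1)]) (auto intro!: continuous_intros)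
    moreover have "filterlim uminus at_infinity (at_infinity :: complex filter)"
      by (rule filterlim_norm_at_top_imp_at_infinity) (simp add: filterlim_norm_at_top)
    then have "((\<lambda>z. f (- z)) \<longlongrightarrow> 0) at_infinity" by (rule filterlim_compose[OF f(2)])
    ultimately have lim: "(\<lambda>n. integral\<^sup>L (zero_counting_measure (pcompose (p' n) [:0, of_nat (2*n):])) (\<lambda>z. f (- z)))
        \<longlonglongrightarrow> integral\<^sup>L (mu_P \<gamma>) (\<lambda>z. f (- z))"
      using conv unfolding weak_star_conv_def by blast
    have "\<forall>\<^sub>F n in sequentially. integral\<^sup>L (zero_counting_measure (pcompose (p' n) [:0, of_nat (2*n):])) (\<lambda>z. f (- z)) =
        integral\<^sup>L (zero_counting_measure (Q n)) f"
      using eventually_gt_at_top[of 0]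
    proof eventually_elim
      case (elim n)
      have "q n \<noteq> 0" using p'_nz[OF elim] by (auto simp: p'_def)
      then have "Q n \<noteq> 0" using elim pcompose_eq_0[of "q n" "[:0, of_nat (2*n):]"] by (auto simp: assms(11))
      \<comment> \<open>Reflection and scaling by \<open>2 * n\<close> commute, so the reflected
        problem yields the reflected polynomial \<open>Q n\<close>.\<close>
      moreover have "pcompose (p' n) [:0, of_nat (2*n):] = pcompose (Q n) [:0, - 1:]"
        unfolding p'_def assms(11) pcompose_assoc[symmetric] by (simp add: pcompose_pCons)
      ultimately show ?case using integral_zero_counting_measure_reflect[OF _ f(1)] by simp
    qed
    from tendsto_cong[THEN iffD1, OF this lim]
    show "(\<lambda>n. integral\<^sup>L (zero_counting_measure (Q n)) f) \<longlonglongrightarrow> integral\<^sup>L (mu_Q \<gamma>) f"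
      unfolding mu_Q_integral[OF f(1)] .
  qed
qed

end
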